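(* Let $\nu>-1$, $\delta>0$ and $1<p\le\infty$. Then there is a constant $C$ such that $$\|\mathcal{B}^\delta f\|_{L^p((0,1),d\mu_\nu)}\le C\|f\|_{L^p((0,1),d\mu_\nu)}\quad\text{for all } f\in L^p((0,1),d\mu_\nu)$$ if and only if either ($-1<\nu\le-1/2$ or $\delta>\nu+1/2$) and $1<p\le\infty$, or ($\delta\le\nu+1/2$ and $\nu>-1/2$) and $p_0<p<p_1$, where $p_0=\frac{4(\nu+1)}{2\nu+3+2\delta}$ and $p_1=\frac{4(\nu+1)}{2\nu+1-2\delta}$.
   Context: Let $J_\nu$ be the Bessel function of order $\nu>-1$, $0<s_1<s_2<\dots$ its successive positive zeros, $d\mu_\nu(x)=x^{2\nu+1}dx$ on $(0,1)$, $\psi_j(x)=\frac{\sqrt2}{|J_{\nu+1}(s_j)|}x^{-\nu}J_\nu(s_jx)$, $a_j(f)=\int_0^1 f\psi_j\,d\mu_\nu$. For $\delta>0$, $R>0$, $\mathcal{B}_R^\delta(f,x)=\sum_{j\ge1}(1-s_j^2/R^2)_+^\delta a_j(f)\psi_j(x)$ with $(1-s^2)_+=\max\{1-s^2,0\}$, and the maximal operator is $\mathcal{B}^\delta f(x)=\sup_{R>0}|\mathcal{B}_R^\delta(f,x)|$. *)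

theory Defs
  imports "HOL-Analysis.Analysis"
begin

text \<open>Bessel function of the first kind of real order nu (used for x > 0), via its power series.\<close>
definition besselJ :: "real \<Rightarrow> real \<Rightarrow> real" where
  "besselJ nu x = (\<Sum>m. (-1) ^ m / (fact m * Gamma (real m + nu + 1)) * (x / 2) powr (2 * real m + nu))"

text \<open>Successive positive zeros s 1 < s 2 < ... of besselJ nu (s 0 = 0 is a dummy).\<close>
primrec bessel_zero :: "real \<Rightarrow> nat \<Rightarrow> real" where
  "bessel_zero nu 0 = 0"
| "bessel_zero nu (Suc j) = Inf {x. x > bessel_zero nu j \<and> besselJ nu x = 0}"

definition mu_nu :: "real \<Rightarrow> real measure" where
  "mu_nu nu = density (restrict_space lborel {0<..<1}) (\<lambda>x. ennreal (x powr (2 * nu + 1)))"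

text \<open>Normalized Fourier-Bessel functions psi_j, j >= 1.\<close>
definition psi :: "real \<Rightarrow> nat \<Rightarrow> real \<Rightarrow> real" where
  "psi nu j x = sqrt 2 / \<bar>besselJ (nu + 1) (bessel_zero nu j)\<bar> * x powr (- nu)
                 * besselJ nu (bessel_zero nu j * x)"

definition coeff_a :: "real \<Rightarrow> nat \<Rightarrow> (real \<Rightarrow> real) \<Rightarrow> real" where
  "coeff_a nu j f = integral\<^sup>L (mu_nu nu) (\<lambda>x. f x * psi nu j x)"

definition bochner_riesz :: "real \<Rightarrow> real \<Rightarrow> real \<Rightarrow> (real \<Rightarrow> real) \<Rightarrow> real \<Rightarrow> real" where
  "bochner_riesz nu delta R f x =
     (\<Sum>j. (max 0 (1 - (bessel_zero nu (Suc j))\<^sup>2 / R\<^sup>2)) powr delta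
            * coeff_a nu (Suc j) f * psi nu (Suc j) x)"

definition bochner_riesz_max :: "real \<Rightarrow> real \<Rightarrow> (real \<Rightarrow> real) \<Rightarrow> real \<Rightarrow> ennreal" where
  "bochner_riesz_max nu delta f x = (SUP R\<in>{0<..}. ennreal \<bar>bochner_riesz nu delta R f x\<bar>)"

definition Lp_norm :: "real measure \<Rightarrow> ennreal \<Rightarrow> (real \<Rightarrow> ennreal) \<Rightarrow> ennreal" where
  "Lp_norm M p g =
     (if p = \<infinity> then Inf {C. AE x in M. g x \<le> C}
      else (let N = (\<integral>\<^sup>+ x. (if g x = \<infinity> then \<infinity> else ennreal (enn2real (g x) powr enn2real p)) \<partial>M)
            in if N = \<infinity> then \<infinity> else ennreal (enn2real N powr (1 / enn2real p))))"

definition in_Lp :: "real measure \<Rightarrow> ennreal \<Rightarrow> (real \<Rightarrow> real) \<Rightarrow> bool" where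
  "in_Lp M p f \<longleftrightarrow> f \<in> borel_measurable M \<and> Lp_norm M p (\<lambda>x. ennreal \<bar>f x\<bar>) < \<infinity>"

definition p0_exp :: "real \<Rightarrow> real \<Rightarrow> ennreal" where
  "p0_exp nu delta = ennreal (4 * (nu + 1) / (2 * nu + 3 + 2 * delta))"

definition p1_exp :: "real \<Rightarrow> real \<Rightarrow> ennreal" where
  "p1_exp nu delta = (if 2 * nu + 1 - 2 * delta = 0 then \<infinity>
                       else ennreal (4 * (nu + 1) / (2 * nu + 1 - 2 * delta)))"

end

theory Submission
 imports Defs "HOL-Complex_Analysis.Complex_Analysis"
begin

text \<open>Write a = nu + 1/2 and J_nu(x) = (x/2)^nu E_nu(x) with E_nu entire and even. For fixed R
  the operator has the finite kernel \<open>Kern\<close>, and the theorem is decided by the decay of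
  this kernel off the diagonal. Multiplied by (x y)^a, its terms are residues at the zeros s_j of a
  function \<open>hk\<close>, which is built from the Green function of Bessel's equation in normal
  form and the factor (1 - z^2/R^2)^delta. That factor ends the contour at the line Re z = R, where
  it vanishes like t^delta at height t. For y <= x the rest of \<open>hk\<close> is of size
  e^{-(x-y)t} (1 + 1/t), up to weights in x and y. Integration in t gives the decay (1 + R
  |x-y|)^{-1-delta} with the weights max(x, 1/R)^{-a} and max(y, 1/R)^{-a}
  (\<open>kernel_formula\<close>, \<open>kernel_bound\<close>). The facts about Bessel functions
  come from one source: the solution f ~ e^{iw} in the right half-plane
  (\<open>jost_solution\<close>), its reflection, and the connection formula \<open>F_eq\<close>.

  Sufficiency: where x and y are comparable, the supremum over R of the majorant is controlled by
  the Hardy-Littlewood maximal function of the measure x^{2a} dx. Elsewhere it is controlled by one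
  homogeneous kernel \<open>HKer\<close> with d = min(delta, a), which Schur's test bounds on L^p
  when a - d < (2a+1)/p < a + d + 1. For delta > a this is the whole range 1 < p < infinity, and the
  case p = infinity follows from a uniform bound on the integral of the majorant. For delta <= a it
  is exactly p0 < p < p1 (\<open>maximal_majorant_bounded\<close>,
  \<open>majorant_integral_bounded\<close>, \<open>sufficiency\<close>).

  Necessity: let 0 < delta <= a. Functions living at scale 1/R are tested with R = s_{N+1} tending
  to infinity. Gaps between zeros tend to pi and the norming constants are asymptotic to a power, so
  the rescaled bilinear form converges to that of the multiplier (1 - t^2)^delta for the Hankel
  transform on the half-line (\<open>spectral_sum_tendsto\<close>, \<open>bilinear_tendsto\<close>).
  By Sonine's integral, that multiplier applied to a short bump at the origin is essentially
  E_{nu+delta+1}(x), of size x^{-(a+delta+1)}. Paired on [1, X] with \<open>dual_source\<close>,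
  which has the same oscillation and size x^{delta-a}, it grows like ln X
  (\<open>form_lower_bound\<close>). For p <= p0 or p >= p1 a norm inequality would permit only an
  arbitrarily small multiple of ln X plus a constant, a contradiction
  (\<open>necessity\<close>).\<close>

abbreviation (input) nni :: "'a measure => ('a => ennreal) => ennreal" where "nni == nn_integral"
abbreviation (input) bni :: "'a measure => ('a => real) => real" where "bni == lebesgue_integral"

section \<open>The solution of f'' = (kappa/w^2 - 1) f asymptotic to e^{iw}, by Volterra
  iteration\<close>

text \<open>Unlike the modulus, it is additive under positive real shifts, which makes the iterated Volterra integrals explicit.\<close>
definition tau :: "complex => real" where "tau w = Re w + \<bar>Im w\<bar>"

lemma tau_shift [simp]: "tau (w + of_real s) = tau w + s"
 by (simp add: tau_def)

lemma tau_pos: "Re w > 0 ==> tau w > 0"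
 by (simp add: tau_def)

lemma norm_le_tau: "Re w > 0 ==> norm w <= tau w"
 using cmod_le[of w] by (simp add: tau_def)

lemma tau_sq_le: "(tau w)\<^sup>2 <= 2*(norm w)\<^sup>2"
proof -
 have "(Re w + \<bar>Im w\<bar>)\<^sup>2 <= 2*((Re w)\<^sup>2 + (Im w)\<^sup>2)"
  using sum_squares_bound[of "Re w" "\<bar>Im w\<bar>"] by (simp add: power2_sum)
 thus ?thesis by (simp add: tau_def cmod_power2)
qed

lemma has_integral_inverse_power_shift:
 fixes B c :: real
 assumes "c + N > 0" "N <= M"
 shows "((%s. B / (c + s) ^ (n + 2)) has_integral
     (B / (real (n+1) * (c + N) ^ (n+1)) - B / (real (n+1) * (c + M) ^ (n+1)))) {N..M}"
proof -
 have "((%s. B / (c + s) ^ (n + 2)) has_integral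
     (- B / (real (n+1) * (c + M) ^ (n+1)) - (- B / (real (n+1) * (c + N) ^ (n+1))))) {N..M}"
 proof (rule fundamental_theorem_of_calculus[OF assms(2)])
  fix s assume s: "s : {N..M}"
  hence p: "c + s > 0" using assms by auto
  have "((%s. - B / (real (n+1) * (c + s) ^ (n+1))) has_real_derivative
     B / (c + s) ^ (n + 2)) (at s within {N..M})"
   using p
   by (auto intro!: derivative_eq_intros simp: field_simps power2_eq_square simp del: of_nat_Suc power_Suc)
    (simp add: field_simps)
  thus "((%s. - B / (real (n+1) * (c + s) ^ (n+1))) has_vector_derivative
     B / (c + s) ^ (n + 2)) (at s within {N..M})"
   by (simp add: has_real_derivative_iff_has_vector_derivative)
 qed
 thus ?thesis by (simp add: algebra_simps)
qed

abbreviation RHP :: "complex set" where "RHP \<equiv> {w. Re w > 0}"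

lemma open_RHP: "open RHP"
 by (rule open_halfspace_Re_gt)

lemma convex_RHP: "convex RHP"
 by (rule convex_halfspace_Re_gt)

text \<open>The hypotheses are those of one iteration. Integrating along a horizontal ray costs one
  power of \<open>tau\<close> and gains the factor 1/(n+1), while multiplication by kappa/w^2
  restores two powers, so each round improves the decay by one power and builds up the
  factorial.\<close>

locale decaying_source =
 fixes Q :: "complex => complex" and B :: real and n :: nat
 assumes hol: "Q holomorphic_on RHP"
  and bd: "!!w. Re w > 0 ==> norm (Q w) <= B / tau w ^ (n + 2)"
begin

lemma B_nonneg: "B >= 0"
proof -
 have "0 <= B / tau 1 ^ (n+2)" using order_trans[OF norm_ge_zero bd[of 1]] by simp
 thus ?thesis by (simp add: tau_def)
qed

text \<open>The Volterra integral over the ray w + [0, infinity) is handled as a limit of integrals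
  over finite segments, which are visibly holomorphic in w.\<close>

definition trunc :: "(real => complex) => real => complex => complex" where
 "trunc k N w = integral {0..N} (%s. k s * Q (w + of_real s))"

lemma cont_Q: "continuous_on RHP Q"
 using hol holomorphic_on_imp_continuous_on by blast

lemma cont_integrand:
 assumes k: "continuous_on UNIV k" and w: "Re w > 0" and "a >= 0"
 shows "continuous_on {a..b} (%s. k s * Q (w + of_real s))"
 using assms
 by (intro continuous_intros continuous_on_compose2[OF cont_Q] continuous_on_subset[OF k]) auto

lemma trunc_diff:
 assumes k: "continuous_on UNIV k" and kb: "!!s. norm (k s) <= 1" and w: "Re w > 0"
  and NM: "0 <= N" "N <= M"
 shows "norm (trunc k M w - trunc k N w) <= B / (real (n+1) * (tau w + N) ^ (n+1))"
proof -
 have i: "(%s. k s * Q (w + of_real s)) integrable_on {a..b}" if "a >= 0" for a b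
  by (rule integrable_continuous_real) (rule cont_integrand[OF k w that])
 have "trunc k M w = trunc k N w + integral {N..M} (%s. k s * Q (w + of_real s))"
  unfolding trunc_def using Henstock_Kurzweil_Integration.integral_combine[OF NM i] by simp
 hence "norm (trunc k M w - trunc k N w) = norm (integral {N..M} (%s. k s * Q (w + of_real s)))"
  by simp
 also have "... <= integral {N..M} (%s. B / (tau w + s) ^ (n + 2))"
 proof (rule integral_norm_bound_integral)
  show "(%s. B / (tau w + s) ^ (n + 2)) integrable_on {N..M}"
   using has_integral_inverse_power_shift[of "tau w" N M] tau_pos[OF w] NM
   by (meson add_pos_nonneg has_integral_integrable)
  fix s assume s: "s : {N..M}"
  have "norm (k s * Q (w + of_real s)) <= 1*(B / tau (w + of_real s) ^ (n+2))"
   unfolding norm_mult using s NM w by (intro mult_mono kb bd) auto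
  thus "norm (k s * Q (w + of_real s)) <= B / (tau w + s) ^ (n + 2)" by simp
 qed (use i NM in auto)
 also have "... = B / (real (n+1) * (tau w + N) ^ (n+1)) - B / (real (n+1) * (tau w + M) ^ (n+1))"
  using has_integral_inverse_power_shift[of "tau w" N M B n] tau_pos[OF w] NM
  by (intro integral_unique) auto
 also have "... <= B / (real (n+1) * (tau w + N) ^ (n+1))"
  using B_nonneg tau_pos[OF w] NM by simp
 finally show ?thesis .
qed

lemma trunc_zero [simp]: "trunc k 0 w = 0"
 by (simp add: trunc_def)

text \<open>Differentiation under the integral falls on Q, and integration by parts in s moves it to
  the kernel k. Hence no bound for the derivative of Q ever enters.\<close>

lemma has_derivative_trunc:
 assumes k: "!!s. (k has_vector_derivative k' s) (at s)" and k': "continuous_on UNIV k'"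
  and w: "Re w > 0" and N: "N >= 0"
 shows "(trunc k N has_field_derivative
     (k N * Q (w + of_real N) - k 0*Q w - trunc k' N w)) (at w)"
proof -
 have kc: "continuous_on UNIV k"
  using k by (meson continuous_at_imp_continuous_on has_vector_derivative_continuous)
 have dQ: "(Q has_field_derivative deriv Q w) (at w)" if "Re w > 0" for w
  using hol open_RHP that by (intro holomorphic_derivI) auto
 have dQc: "continuous_on RHP (deriv Q)"
  using hol open_RHP holomorphic_deriv holomorphic_on_imp_continuous_on by blast
 have 1: "((%w. integral (cbox 0 N) (%s. k s * Q (w + of_real s))) has_field_derivative
    integral (cbox 0 N) (%s. k s * deriv Q (w + of_real s))) (at w within RHP)"
 proof (rule leibniz_rule_field_derivative[where U=RHP])
  show "((%w. k t * Q (w + of_real t)) has_field_derivative k t * deriv Q (z + of_real t)) (at z within RHP)"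
   if "z : RHP" "t : cbox 0 N" for z t
  proof -
   have "((%w. Q (w + of_real t)) has_field_derivative deriv Q (z + of_real t) * 1) (at z within RHP)"
    using that by (intro DERIV_chain2[of Q] dQ) (auto intro!: derivative_eq_intros)
   thus ?thesis by (auto intro!: derivative_eq_intros)
  qed
  show "(%s. k s * Q (z + of_real s)) integrable_on cbox 0 N" if "z : RHP" for z
   using that by (auto intro!: integrable_continuous_real cont_integrand[OF kc])
  show "continuous_on (RHP \<times> cbox 0 N) (%(z, s). k s * deriv Q (z + of_real s))"
   unfolding split_beta
   by (intro continuous_intros continuous_on_compose2[OF kc] continuous_on_compose2[OF dQc]) auto
 qed (use w convex_RHP in auto)
 have 2: "((%s. k' s * Q (w + of_real s) + k s * deriv Q (w + of_real s)) has_integral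
     (k N * Q (w + of_real N) - k 0*Q (w + of_real 0))) {0..N}"
 proof (rule fundamental_theorem_of_calculus[OF N])
  fix s assume s: "s : {0..N}"
  have "((%z. Q (w + z)) has_field_derivative deriv Q (w + of_real s) * (0 + 1)) (at (of_real s))"
   using s w by (intro DERIV_chain2[of Q] dQ DERIV_add DERIV_const DERIV_ident) auto
  hence "((%s. Q (w + of_real s)) has_vector_derivative deriv Q (w + of_real s)) (at s within {0..N})"
   using has_vector_derivative_real_field by fastforce
  from has_vector_derivative_mult[OF has_vector_derivative_at_within[OF k, of s] this]
  show "((%s. k s * Q (w + of_real s)) has_vector_derivative
    k' s * Q (w + of_real s) + k s * deriv Q (w + of_real s)) (at s within {0..N})"
   by (simp add: algebra_simps)
 qed
 have i1: "(%s. k' s * Q (w + of_real s)) integrable_on {0..N}"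
  using w by (auto intro!: integrable_continuous_real cont_integrand[OF k'])
 have i2: "(%s. k s * deriv Q (w + of_real s)) integrable_on {0..N}"
  using w by (intro integrable_continuous_real continuous_intros continuous_on_compose2[OF dQc]
    continuous_on_subset[OF kc]) auto
 have "integral {0..N} (%s. k s * deriv Q (w + of_real s))
   = k N * Q (w + of_real N) - k 0*Q w - trunc k' N w"
  using integral_unique[OF 2] Henstock_Kurzweil_Integration.integral_add[OF i1 i2] by (simp add: trunc_def algebra_simps)
 with 1 w open_RHP show ?thesis
  by (simp add: trunc_def[abs_def] at_within_open[of w RHP] del: )
qed

lemma shifted_Q_tendsto: "Re w > 0 ==> (%N. Q (w + of_real (real N))) \<longlonglongrightarrow> 0"
proof (rule Lim_null_comparison)
 assume w: "Re w > 0"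
 show "\<forall>\<^sub>F N in sequentially. norm (Q (w + of_real (real N))) <= B / (tau w + real N) ^ (n+2)"
  using bd[of "w + of_real (real _)"] w by (intro always_eventually allI) (metis Re_complex_of_real add_pos_nonneg of_nat_0_le_iff plus_complex.sel(1) tau_shift)
 have "filterlim (%N. (tau w + real N) ^ (n+2)) at_top sequentially"
  by (intro filterlim_pow_at_top filterlim_tendsto_add_at_top[OF tendsto_const] filterlim_real_sequentially) auto
 thus "(%N. B / (tau w + real N) ^ (n+2)) \<longlonglongrightarrow> 0"
  by (intro real_tendsto_divide_at_top[OF tendsto_const])
qed

text \<open>The tail beyond N is at most B/N because tau w + N >= N, so the convergence is uniform
  on the whole half-plane.\<close>

lemma uniform_limit_trunc:
 assumes k: "continuous_on UNIV k" and kb: "!!s. norm (k s) <= 1"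
 shows "uniform_limit RHP (%N. trunc k (real N)) (%w. lim (%N. trunc k (real N) w)) sequentially"
proof -
 have "uniformly_Cauchy_on RHP (%N. trunc k (real N))"
 proof (rule uniformly_Cauchy_onI')
  fix e :: real assume e: "e > 0"
  obtain K :: nat where K: "B / e < real K" using reals_Archimedean2 by blast
  show "\<exists>M. \<forall>x\<in>RHP. \<forall>m\<ge>M. \<forall>n>m. dist (trunc k (real m) x) (trunc k (real n) x) < e"
  proof (intro exI[of _ "max 1 K"] ballI allI impI)
   fix w m M assume w: "w : RHP" and m: "max 1 K <= m" "m < (M::nat)"
   have m1: "real m >= 1" "real m >= real K" using m by auto
   have t: "tau w > 0" using w tau_pos by auto
   have "real m <= (tau w + real m) ^ 1" using t by simp
   also have "... <= (tau w + real m) ^ (n+1)" using t m1 by (intro power_increasing) auto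
   also have "... <= real (n+1) * (tau w + real m) ^ (n+1)" using t m1 by auto
   finally have le: "real m <= real (n+1) * (tau w + real m) ^ (n+1)" .
   have "dist (trunc k (real m) w) (trunc k (real M) w) <= B / (real (n+1) * (tau w + real m) ^ (n+1))"
    using trunc_diff[OF k kb, of w "real m" "real M"] w m
    by (simp add: dist_norm norm_minus_commute)
   also have "... <= B / real m" using le m1 B_nonneg by (intro divide_left_mono) auto
   also have "... < e"
   proof -
    have "B < real K * e" using K e by (simp add: pos_divide_less_eq)
    also have "... <= real m * e" using m1 e by (intro mult_right_mono) auto
    finally show ?thesis using m1 by (simp add: pos_divide_less_eq mult.commute)
   qed
   finally show "dist (trunc k (real m) w) (trunc k (real M) w) < e" .
  qed
 qed
 from Cauchy_uniformly_convergent[OF this] show ?thesis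
  by (simp add: uniformly_convergent_uniform_limit_iff)
qed

text \<open>Uniform limits of holomorphic functions may be differentiated termwise; the boundary
  term at s = N disappears because Q decays along the ray.\<close>

lemma derivative_lim:
 assumes k: "!!s. (k has_vector_derivative k' s) (at s)" and k': "continuous_on UNIV k'"
  and kb: "!!s. norm (k s) <= 1" and k0: "!!s. norm (k' s) <= 1"
  and w: "Re w > 0"
 shows "((%w. lim (%N. trunc k (real N) w)) has_field_derivative
     (- k 0*Q w - lim (%N. trunc k' (real N) w))) (at w)"
proof -
 have kc: "continuous_on UNIV k"
  using k by (meson continuous_at_imp_continuous_on has_vector_derivative_continuous)
 note ul = uniform_limit_trunc[OF kc kb]
 obtain g' where g': "!!w. w : RHP ==> ((%w. lim (%N. trunc k (real N) w)) has_field_derivative g' w) (at w)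
   & (%N. k (real N) * Q (w + of_real (real N)) - k 0*Q w - trunc k' (real N) w) \<longlonglongrightarrow> g' w"
 proof -
  have "\<exists>g'. \<forall>w\<in>RHP. ((%w. lim (%N. trunc k (real N) w)) has_field_derivative g' w) (at w)
   & (%N. k (real N) * Q (w + of_real (real N)) - k 0*Q w - trunc k' (real N) w) \<longlonglongrightarrow> g' w"
  proof (rule has_complex_derivative_uniform_sequence[OF open_RHP])
   show "(trunc k (real N) has_field_derivative
    k (real N) * Q (w + of_real (real N)) - k 0*Q w - trunc k' (real N) w) (at w)" if "w : RHP" for N w
    using has_derivative_trunc[OF k k', of w "real N"] that by simp
   show "\<exists>d>0. cball w d <= RHP & uniform_limit (cball w d) (%N. trunc k (real N)) (%w. lim (%N. trunc k (real N) w)) sequentially"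
    if "w : RHP" for w
    using that open_RHP uniform_limit_on_subset[OF ul] by (meson open_contains_cball)
  qed
  thus ?thesis using that by blast
 qed
 have "(%N. trunc k' (real N) w) \<longlonglongrightarrow> lim (%N. trunc k' (real N) w)"
  using tendsto_uniform_limitI[OF uniform_limit_trunc[OF k' k0], of w] w by simp
 moreover have "(%N. k (real N) * Q (w + of_real (real N))) \<longlonglongrightarrow> 0"
 proof (rule Lim_null_comparison)
  show "\<forall>\<^sub>F N in sequentially. norm (k (real N) * Q (w + of_real (real N))) <= norm (Q (w + of_real (real N)))"
   using kb by (intro always_eventually) (auto simp: norm_mult mult_left_le_one_le)
  show "(%N. norm (Q (w + of_real (real N)))) \<longlonglongrightarrow> 0"
   using shifted_Q_tendsto[OF w] by (rule tendsto_norm_zero)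
 qed
 ultimately have "(%N. k (real N) * Q (w + of_real (real N)) - k 0*Q w - trunc k' (real N) w)
   \<longlonglongrightarrow> 0 - k 0*Q w - lim (%N. trunc k' (real N) w)"
  by (intro tendsto_intros)
 with g'[of w] w have "g' w = 0 - k 0*Q w - lim (%N. trunc k' (real N) w)"
  using LIMSEQ_unique by blast
 with g'[of w] w show ?thesis by simp
qed

lemma lim_bound:
 assumes k: "continuous_on UNIV k" and kb: "!!s. norm (k s) <= 1" and w: "Re w > 0"
 shows "norm (lim (%N. trunc k (real N) w)) <= B / (real (n+1) * tau w ^ (n+1))"
proof (rule tendsto_upperbound)
 show "(%N. norm (trunc k (real N) w)) \<longlonglongrightarrow> norm (lim (%N. trunc k (real N) w))"
  using tendsto_norm[OF tendsto_uniform_limitI[OF uniform_limit_trunc[OF k kb], of w]] w by simp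
 show "\<forall>\<^sub>F N in sequentially. norm (trunc k (real N) w) <= B / (real (n+1) * tau w ^ (n+1))"
  using trunc_diff[OF k kb w, of 0] by (intro always_eventually) auto
qed simp

text \<open>I is the integral of ((e^{2is} - 1)/(2i)) Q(w+s) over s >= 0 and L that of e^{2is}
  Q(w+s). Since the first kernel vanishes at s = 0 and has derivative e^{2is}, I solves I'' + 2i I'
  = Q with I' = -L. This is the equation for g when f = e^{iw} g.\<close>

lemma step:
 obtains I L where
  "!!w. Re w > 0 ==> (I has_field_derivative - L w) (at w)"
  "!!w. Re w > 0 ==> (L has_field_derivative (- Q w - 2*\<i> * L w)) (at w)"
  "!!w. Re w > 0 ==> norm (I w) <= B / (real (n+1) * tau w ^ (n+1))"
  "!!w. Re w > 0 ==> norm (L w) <= B / (real (n+1) * tau w ^ (n+1))"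
proof -
 define e where "e = (%s::real. exp (2*\<i> * of_real s))"
 define e' where "e' = (%s::real. 2*\<i> * e s)"
 define k where "k = (%s::real. (e s - 1) / (2*\<i>))"
 define I where "I = (%w. lim (%N. trunc k (real N) w))"
 define L where "L = (%w. lim (%N. trunc e (real N) w))"
 have en: "norm (e s) = 1" for s by (simp add: e_def)
 have de: "(e has_vector_derivative e' s) (at s)" for s
  unfolding e_def e'_def by (auto intro!: derivative_eq_intros has_vector_derivative_real_field)
 have dk: "(k has_vector_derivative e s) (at s)" for s
  unfolding k_def using de[of s]
  by (auto intro!: derivative_eq_intros simp: e'_def has_vector_derivative_divide)
 have ce: "continuous_on UNIV e" unfolding e_def by (intro continuous_intros)
 have ce': "continuous_on UNIV e'" unfolding e'_def by (intro continuous_intros ce)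
 have ck: "continuous_on UNIV k" unfolding k_def by (intro continuous_intros ce) auto
 have nk: "norm (k s) <= 1" for s
  using norm_triangle_ineq4[of "e s" 1] by (simp add: k_def norm_divide norm_mult en)
 show ?thesis
 proof (rule that)
  show "(I has_field_derivative - L w) (at w)" if w: "Re w > 0" for w
   using derivative_lim[OF dk ce nk eq_refl[OF en] w] by (simp add: I_def L_def k_def e_def)
  show "norm (I w) <= B / (real (n+1) * tau w ^ (n+1))" if w: "Re w > 0" for w
   unfolding I_def by (rule lim_bound[OF ck nk w])
  show "norm (L w) <= B / (real (n+1) * tau w ^ (n+1))" if w: "Re w > 0" for w
   unfolding L_def by (rule lim_bound[OF ce eq_refl[OF en] w])
  show "(L has_field_derivative (- Q w - 2*\<i> * L w)) (at w)" if w: "Re w > 0" for w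
  proof -
   have tr: "trunc (%s. c * e s) N w = c * trunc e N w" for c N w
    unfolding trunc_def mult.assoc by simp
   have conv: "(%N. trunc e (real N) w) \<longlonglongrightarrow> L w" if "Re w > 0" for w
    unfolding L_def using tendsto_uniform_limitI[OF uniform_limit_trunc[OF ce eq_refl[OF en]], of w] that by simp
   have lim: "lim (%N. trunc (%s. c * e s) (real N) w) = c * L w" if "Re w > 0" for c w
    unfolding tr by (intro limI tendsto_mult_left conv that)
   \<comment> \<open>\<open>derivative_lim\<close> wants a kernel and its derivative of modulus at
     most 1, but e' has modulus 2. The kernel is therefore halved and the result doubled
     afterwards.\<close>
   have "((%w. lim (%N. trunc (%s. 1/2*e s) (real N) w)) has_field_derivative
     (- (1/2*e 0) * Q w - lim (%N. trunc (%s. \<i> * e s) (real N) w))) (at w)"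
   proof (rule derivative_lim[OF _ _ _ _ w])
    show "((%s. 1/2*e s) has_vector_derivative \<i> * e s) (at s)" for s
     using has_vector_derivative_mult_right[OF de, of "1/2" s] by (simp add: e'_def)
   qed (use en ce in "auto intro!: continuous_intros simp: norm_mult norm_divide")
   hence "((%w. lim (%N. trunc (%s. 1/2*e s) (real N) w)) has_field_derivative
     (- (1/2) * Q w - \<i> * L w)) (at w)"
    using lim[OF w, of "\<i>"] by (simp add: e_def)
   hence "((%w. 1/2*L w) has_field_derivative (- (1/2) * Q w - \<i> * L w)) (at w)"
    by (rule has_field_derivative_transform_within_open[OF _ open_RHP]) (use w lim[of _ "1/2"] in auto)
   from DERIV_cmult[OF this, of 2] show ?thesis by (simp add: algebra_simps)
  qed
 qed
qed

end

lemma summable_power_div_fact: "summable (%n. (c::real) ^ n / fact n)"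
 using summable_exp[of c] by (simp add: field_simps)

lemma suminf_power_div_fact: "(%n. (c::real) ^ n / fact n) sums exp c"
 using exp_converges[of c] by (simp add: field_simps)

text \<open>One round of Picard iteration. Passing from |w|^2 to tau^2 loses a factor 2
  (\<open>tau_sq_le\<close>), which is why A is twice |kpp|.\<close>

lemma volterra_step:
 fixes kpp A :: real and g :: "complex => complex"
 assumes A: "A = 2*\<bar>kpp\<bar>" and hol: "g holomorphic_on RHP"
  and bd: "!!w. Re w > 0 ==> norm (g w) <= (A / tau w) ^ n / fact n"
 obtains I L where
  "!!w. Re w > 0 ==> (I has_field_derivative - L w) (at w)"
  "!!w. Re w > 0 ==> (L has_field_derivative (- (of_real kpp / w\<^sup>2*g w) - 2*\<i> * L w)) (at w)"
  "!!w. Re w > 0 ==> norm (I w) <= (A / tau w) ^ Suc n / fact (Suc n)"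
  "!!w. Re w > 0 ==> norm (L w) <= (A / tau w) ^ Suc n / fact (Suc n)"
proof -
 interpret decaying_source "%w. of_real kpp / w\<^sup>2*g w" "A ^ Suc n / fact n" n
 proof
  show "(%w. of_real kpp / w\<^sup>2*g w) holomorphic_on RHP"
   by (intro holomorphic_intros hol) auto
  fix w :: complex assume w: "Re w > 0"
  have t: "tau w > 0" and nw: "norm w > 0" using tau_pos[OF w] w by auto
  have "1/(norm w)\<^sup>2 <= 2/(tau w)\<^sup>2"
   using tau_sq_le[of w] t nw by (simp add: divide_simps)
  hence "\<bar>kpp\<bar> * (1/(norm w)\<^sup>2) <= \<bar>kpp\<bar> * (2/(tau w)\<^sup>2)"
   by (rule mult_left_mono) simp
  hence "norm (of_real kpp / w\<^sup>2) <= A / (tau w)\<^sup>2"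
   unfolding A by (simp add: norm_divide norm_power algebra_simps)
  hence "norm (of_real kpp / w\<^sup>2*g w) <= A / (tau w)\<^sup>2*((A / tau w) ^ n / fact n)"
   unfolding norm_mult using bd[OF w] by (intro mult_mono) (auto simp: A)
  also have "... = A ^ Suc n / fact n / tau w ^ (n + 2)"
   using t by (simp add: power_divide power_add field_simps power2_eq_square)
  finally show "norm (of_real kpp / w\<^sup>2*g w) <= A ^ Suc n / fact n / tau w ^ (n + 2)" .
 qed
 have eq: "A ^ Suc n / fact n / (real (n+1) * tau w ^ (n+1)) = (A / tau w) ^ Suc n / fact (Suc n)" for w
  by (simp add: power_divide field_simps)
 show ?thesis
  by (rule step, rule that) (simp_all only: eq)
qed

text \<open>With f = e^{iw} G the equation becomes G'' + 2i G' = (kappa/w^2) G. The iterates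
  starting from 1 are bounded by (A/tau)^n/n!, so they sum to G, and G - 1 is bounded by the
  exponential series without its first term. Replacing tau by the smaller |w| only weakens
  this.\<close>

lemma jost_solution:
 fixes kpp :: real
 obtains f f' where
  "!!w. Re w > 0 ==> (f has_field_derivative f' w) (at w)"
  "!!w. Re w > 0 ==> (f' has_field_derivative (of_real kpp / w\<^sup>2 - 1) * f w) (at w)"
  "!!w. Re w > 0 ==> norm (exp (- \<i> * w) * f w - 1) <= exp (2*\<bar>kpp\<bar> / norm w) - 1"
  "!!w. Re w > 0 ==> norm (exp (- \<i> * w) * f' w - \<i>) <= 2*(exp (2*\<bar>kpp\<bar> / norm w) - 1)"
proof -
 define A where "A = 2*\<bar>kpp\<bar>"
 \<comment> \<open>Pairs (iterate, minus its derivative) are chosen successively: P holds the bounds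
   at stage n and the starting value, R links a stage to the next one.\<close>
 define P where "P = (%n (x :: (complex => complex) \<times> (complex => complex)).
  (n = 0 \<longrightarrow> x = (%_. 1, %_. 0)) \<and>
  (\<forall>w. Re w > 0 \<longrightarrow> (fst x has_field_derivative - snd x w) (at w) \<and>
    norm (fst x w) <= (A / tau w) ^ n / fact n & norm (snd x w) <= (A / tau w) ^ n / fact n))"
 define R where "R = (%(n::nat) (x :: (complex => complex) \<times> (complex => complex)) (y :: (complex => complex) \<times> (complex => complex)).
  \<forall>w. Re w > 0 \<longrightarrow> (snd y has_field_derivative (- (of_real kpp / w\<^sup>2*fst x w) - 2*\<i> * snd y w)) (at w))"
 have "\<exists>x. \<forall>n. P n (x n) & R n (x n) (x (Suc n))"
 proof (rule dependent_nat_choice)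
  show "\<exists>x. P 0 x"
   by (rule exI[of _ "(%_. 1, %_. 0)"]) (auto simp: P_def)
  fix x n assume x: "P n x"
  have hol: "fst x holomorphic_on RHP"
   using x open_RHP by (auto simp: P_def holomorphic_on_open)
  obtain I L where IL:
   "!!w. Re w > 0 ==> (I has_field_derivative - L w) (at w)"
   "!!w. Re w > 0 ==> (L has_field_derivative (- (of_real kpp / w\<^sup>2*fst x w) - 2*\<i> * L w)) (at w)"
   "!!w. Re w > 0 ==> norm (I w) <= (A / tau w) ^ Suc n / fact (Suc n)"
   "!!w. Re w > 0 ==> norm (L w) <= (A / tau w) ^ Suc n / fact (Suc n)"
   using volterra_step[OF A_def hol, of n] x unfolding P_def by blast
  show "\<exists>y. P (Suc n) y & R n x y"
   by (rule exI[of _ "(I, L)"]) (use IL in "simp add: P_def R_def")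
 qed
 then obtain x where x: "!!n. P n (x n)" "!!n. R n (x n) (x (Suc n))" by blast
 define g where "g = (%n. fst (x n))"
 define l where "l = (%n. snd (x n))"
 \<comment> \<open>The source of stage n comes from stage n - 1; it is 0 at stage 0, where the
   iterate is the constant 1.\<close>
 define q where "q = (%n (w::complex). case n of 0 => 0 | Suc m => of_real kpp / w\<^sup>2*g m w)"
 have g0: "g 0 = (%_. 1)" and l0: "l 0 = (%_. 0)"
  using x(1)[of 0] by (simp_all add: P_def g_def l_def)
 have gd: "(g n has_field_derivative - l n w) (at w)"
  and gb: "norm (g n w) <= (A / tau w) ^ n / fact n" and lb: "norm (l n w) <= (A / tau w) ^ n / fact n"
  if "Re w > 0" for n w
  using x(1)[of n] that by (simp_all add: P_def g_def l_def)
 have ld: "(l n has_field_derivative - q n w - 2*\<i> * l n w) (at w)" if "Re w > 0" for n w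
 proof (cases n)
  case 0 thus ?thesis by (simp add: l0 q_def)
 next
  case (Suc m) thus ?thesis using x(2)[of m] that by (simp add: q_def g_def l_def R_def)
 qed
 have loc: "\<exists>d h. 0 < d & summable h & (\<forall>\<^sub>F n in sequentially. \<forall>y\<in>ball z d \<inter> RHP. norm (u n y) <= h n)"
  if z: "z : RHP" and u: "!!n w. Re w > 0 ==> norm (u n w) <= (A / tau w) ^ n / fact n" for z and u :: "nat => complex => complex"
 proof (intro exI conjI always_eventually allI ballI)
  show "Re z / 2 > 0" using z by simp
  show "summable (%n. (A / (Re z / 2)) ^ n / fact n)" by (rule summable_power_div_fact)
  fix n w assume w: "w : ball z (Re z / 2) \<inter> RHP"
  have "\<bar>Re (z - w)\<bar> <= Re z / 2"
   using w abs_Re_le_cmod[of "z - w"] by (auto simp: dist_norm)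
  hence "Re z / 2 <= Re w" by (auto simp: abs_if split: if_splits)
  hence "A / tau w <= A / (Re z / 2)" using z w by (intro divide_left_mono) (auto simp: A_def tau_def)
  hence "(A / tau w) ^ n / fact n <= (A / (Re z / 2)) ^ n / fact n"
   using tau_pos[of w] w by (intro divide_right_mono power_mono) (auto simp: A_def intro!: divide_nonneg_nonneg)
  thus "norm (u n w) <= (A / (Re z / 2)) ^ n / fact n" using u[of w n] w by simp
 qed
 obtain G G' where G: "!!w. Re w > 0 ==> (%n. g n w) sums G w"
   "!!w. Re w > 0 ==> (%n. - l n w) sums G' w" "!!w. Re w > 0 ==> (G has_field_derivative G' w) (at w)"
  using series_and_derivative_comparison_local[OF open_RHP gd loc[OF _ gb]] by auto
 obtain L L' where L: "!!w. Re w > 0 ==> (%n. l n w) sums L w"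
   "!!w. Re w > 0 ==> (%n. - q n w - 2*\<i> * l n w) sums L' w" "!!w. Re w > 0 ==> (L has_field_derivative L' w) (at w)"
  using series_and_derivative_comparison_local[OF open_RHP ld loc[OF _ lb]] by auto
 have G': "G' w = - L w" if "Re w > 0" for w
  using sums_unique2[OF G(2)[OF that] sums_minus[OF L(1)[OF that]]] .
 have L': "L' w = - (of_real kpp / w\<^sup>2*G w) - 2*\<i> * L w" if "Re w > 0" for w
 proof -
  have "(%n. q (Suc n) w) sums (of_real kpp / w\<^sup>2*G w)"
   using sums_mult[OF G(1)[OF that], of "of_real kpp / w\<^sup>2"] by (simp add: q_def)
  hence "(%n. q n w) sums (of_real kpp / w\<^sup>2*G w)" by (subst (asm) sums_Suc_iff) (simp add: q_def)
  from sums_diff[OF sums_minus[OF this] sums_mult[OF L(1)[OF that], of "2*\<i>"]]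
  show ?thesis using sums_unique2[OF L(2)[OF that]] by blast
 qed
 have bnd: "norm (S - u 0 w) <= exp (2*\<bar>kpp\<bar> / norm w) - 1"
  if w: "Re w > 0" and u: "!!n. norm (u n w) <= (A / tau w) ^ n / fact n" and S: "(%n. u n w) sums S"
  for w S and u :: "nat => complex => complex"
 proof -
  have 1: "(%n. u (Suc n) w) sums (S - u 0 w)"
   using S by (subst sums_Suc_iff) simp
  have 2: "(%n. (A / tau w) ^ Suc n / fact (Suc n)) sums (exp (A / tau w) - 1)"
   using suminf_power_div_fact[of "A / tau w"] by (subst sums_Suc_iff) simp
  have 3: "summable (%n. norm (u (Suc n) w))"
   by (rule summable_comparison_test'[OF sums_summable[OF 2]]) (use u in "auto simp del: power_Suc fact_Suc")
  have "norm (S - u 0 w) <= (\<Sum>n. norm (u (Suc n) w))"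
   using summable_norm[OF 3] sums_unique[OF 1] by simp
  also have "... <= exp (A / tau w) - 1"
   unfolding sums_unique[OF 2] by (intro suminf_le u 3 sums_summable[OF 2])
  also have "exp (A / tau w) <= exp (A / norm w)"
  proof -
   have "norm w > 0" "tau w > 0" using w tau_pos by auto
   thus ?thesis using norm_le_tau[OF w] by (auto simp: A_def intro!: divide_left_mono mult_pos_pos)
  qed
  finally show ?thesis by (simp add: A_def)
 qed
 have Gb: "norm (G w - 1) <= exp (2*\<bar>kpp\<bar> / norm w) - 1" if "Re w > 0" for w
  using bnd[where u=g, OF that gb[OF that] G(1)[OF that]] by (simp add: g0)
 have Lb: "norm (L w) <= exp (2*\<bar>kpp\<bar> / norm w) - 1" if "Re w > 0" for w
  using bnd[where u=l, OF that lb[OF that] L(1)[OF that]] by (simp add: l0)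
 show ?thesis
 proof (rule that[of "%w. exp (\<i> * w) * G w" "%w. exp (\<i> * w) * (\<i> * G w - L w)"])
  fix w :: complex assume w: "Re w > 0"
  note [derivative_intros] = G(3)[OF w] L(3)[OF w]
  show "((%w. exp (\<i> * w) * G w) has_field_derivative exp (\<i> * w) * (\<i> * G w - L w)) (at w)"
   by (auto intro!: derivative_eq_intros simp: G'[OF w] algebra_simps)
  show "((%w. exp (\<i> * w) * (\<i> * G w - L w)) has_field_derivative (of_real kpp / w\<^sup>2 - 1) * (exp (\<i> * w) * G w)) (at w)"
   by (auto intro!: derivative_eq_intros simp: G'[OF w] L'[OF w] algebra_simps)
  have e: "exp (- \<i> * w) * (exp (\<i> * w) * u) = u" for u
   by (simp add: mult.assoc[symmetric] exp_add[symmetric])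
  show "norm (exp (- \<i> * w) * (exp (\<i> * w) * G w) - 1) <= exp (2*\<bar>kpp\<bar> / norm w) - 1"
   unfolding e by (rule Gb[OF w])
  have "norm (\<i> * G w - L w - \<i>) = norm (\<i> * (G w - 1) - L w)" by (simp add: algebra_simps)
  also have "... <= norm (G w - 1) + norm (L w)"
   using norm_triangle_ineq4[of "\<i> * (G w - 1)" "L w"] by (simp add: norm_mult)
  finally show "norm (exp (- \<i> * w) * (exp (\<i> * w) * (\<i> * G w - L w)) - \<i>) <= 2*(exp (2*\<bar>kpp\<bar> / norm w) - 1)"
   unfolding e using Gb[OF w] Lb[OF w] by simp
 qed
qed

section \<open>The entire factor of the Bessel function and the normal form of its equation\<close>

definition bcoef :: "real => nat => real" where
 "bcoef nu m = (-1) ^ m / (fact m * Gamma (real m + nu + 1))"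

text \<open>In the variable u = (w/2)^2 there is no branch to choose, and differentiation is just
  the shift nu -> nu + 1 with a sign.\<close>

definition bP :: "real => complex => complex" where
 "bP nu u = (\<Sum>m. of_real (bcoef nu m) * u ^ m)"

text \<open>The even entire function with $J_\nu(x) = (x/2)^\nu E_\nu(x)$.\<close>
definition bE :: "real => complex => complex" where
 "bE nu w = bP nu ((w / 2)\<^sup>2)"

lemma bcoef_Suc:
 assumes "nu > -1"
 shows "(real m + 1) * (real m + nu + 1) * bcoef nu (Suc m) = - bcoef nu m"
proof -
 have p: "real m + nu + 1 > 0" using assms by linarith
 hence "Gamma (real m + nu + 1 + 1) = (real m + nu + 1) * Gamma (real m + nu + 1)"
  by (intro Gamma_plus1) (auto elim!: nonpos_Ints_cases)
 hence g: "Gamma (real (Suc m) + nu + 1) = (real m + nu + 1) * Gamma (real m + nu + 1)"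
  by (simp add: algebra_simps)
 define q where "q = real m + nu + 1"
 define G where "G = Gamma q"
 have q: "q > 0" "G > 0" using p by (auto simp: q_def G_def intro: Gamma_real_pos)
 have "bcoef nu (Suc m) = (-1) ^ Suc m / (fact (Suc m) * (q * G))"
  unfolding bcoef_def g q_def G_def ..
 also have "... = - ((-1) ^ m) / ((real m + 1) * fact m * (q * G))"
  by (simp add: add_ac)
 finally show ?thesis using q unfolding bcoef_def[of nu m] q_def[symmetric] G_def[symmetric]
  by (simp add: divide_simps mult_ac)
qed

lemma bcoef_shift: "real (Suc m) * bcoef nu (Suc m) = - bcoef (nu + 1) m"
 by (simp add: bcoef_def divide_simps add_ac)

lemma summable_norm_bP:
 assumes "nu > -1"
 shows "summable (%m. norm (of_real (bcoef nu m) * u ^ m :: complex))"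
proof -
 obtain N :: nat where N: "2*norm u + 1 <= real N" using real_arch_simple by blast
 show ?thesis
 proof (rule summable_ratio_test[of "1/2" N])
  fix m assume m: "m >= N"
  have mm: "real m >= 2*norm u + 1" using m N by linarith
  have "2*norm u <= real m + 1" using mm by simp
  also have "real m + 1 <= (real m + 1) * (real m + nu + 1)"
  proof -
   have "real m >= 1" using mm norm_ge_zero[of u] by linarith
   hence "real m + nu + 1 >= 1" using assms by linarith
   thus ?thesis using mult_left_mono[of 1 "real m + nu + 1" "real m + 1"] by simp
  qed
  finally have le: "norm u <= 1/2*((real m + 1) * (real m + nu + 1))" by simp
  have "norm (of_real (bcoef nu (Suc m)) * u ^ Suc m :: complex) = (\<bar>bcoef nu (Suc m)\<bar> * norm u ^ m) * norm u"
   by (simp add: norm_mult norm_power)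
  also have "... <= (\<bar>bcoef nu (Suc m)\<bar> * norm u ^ m) * (1/2*((real m + 1) * (real m + nu + 1)))"
   by (intro mult_left_mono le) auto
  also have "... = 1/2*(\<bar>(real m + 1) * (real m + nu + 1) * bcoef nu (Suc m)\<bar> * norm u ^ m)"
   using assms by (simp add: abs_mult)
  also have "... = 1/2*norm (of_real (bcoef nu m) * u ^ m :: complex)"
   unfolding bcoef_Suc[OF assms] by (simp add: norm_mult norm_power)
  finally show "norm (norm (of_real (bcoef nu (Suc m)) * u ^ Suc m :: complex))
    <= 1/2*norm (norm (of_real (bcoef nu m) * u ^ m :: complex))" by simp
 qed simp
qed

lemma summable_bP: "nu > -1 ==> summable (%m. of_real (bcoef nu m) * u ^ m :: complex)"
 by (rule summable_norm_cancel[OF summable_norm_bP])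

lemma has_derivative_bP:
 assumes "nu > -1"
 shows "(bP nu has_field_derivative - bP (nu + 1) u) (at u)"
proof -
 have d: "diffs (%m. complex_of_real (bcoef nu m)) = (%m. - of_real (bcoef (nu + 1) m))"
 proof
  fix m
  have "complex_of_real (real (Suc m) * bcoef nu (Suc m)) = complex_of_real (- bcoef (nu + 1) m)"
   unfolding bcoef_shift ..
  thus "diffs (%m. complex_of_real (bcoef nu m)) m = - of_real (bcoef (nu + 1) m)"
   by (simp only: diffs_def of_real_mult of_real_of_nat_eq of_real_minus)
 qed
 have "((%u. \<Sum>m. complex_of_real (bcoef nu m) * u ^ m) has_field_derivative
    (\<Sum>m. diffs (%m. complex_of_real (bcoef nu m)) m * u ^ m)) (at u)"
  by (rule termdiffs_strong_converges_everywhere[of "%m. complex_of_real (bcoef nu m)" u, OF summable_bP[OF assms]])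
 thus ?thesis unfolding d bP_def[abs_def] using assms
  by (simp add: suminf_minus[OF summable_bP])
qed

text \<open>This is J_nu + J_{nu+2} = (2(nu+1)/x) J_{nu+1} without the powers of x. Every
  coefficient is expressed through the same coefficient of order nu, which reduces the claim to
  \<open>bcoef_Suc\<close>.\<close>

lemma bP_recurrence:
 assumes nu: "nu > -1"
 shows "u * bP (nu + 2) u - (nu + 1) * bP (nu + 1) u + bP nu u = 0"
proof -
 let ?c = "%nu m. complex_of_real (bcoef nu m)"
 have s: "(%m. ?c mu m * u ^ m) sums bP mu u" if "mu > -1" for mu
  unfolding bP_def using summable_bP[OF that] by (rule summable_sums)
 have b0: "?c nu 0 = (nu + 1) * ?c (nu + 1) 0"
 proof -
  have "bcoef nu 0 = (nu + 1) * bcoef (nu + 1) 0"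
   using bcoef_shift[of 0 nu] bcoef_Suc[OF nu, of 0] by simp
  thus ?thesis by simp
 qed
 have bs: "bcoef (nu + 2) m - (nu + 1) * bcoef (nu + 1) (Suc m) + bcoef nu (Suc m) = 0" for m
 proof -
  have 1: "bcoef (nu + 1) (Suc m) = - (real m + 2) * bcoef nu (Suc (Suc m))"
   using bcoef_shift[of "Suc m" nu] by (simp add: algebra_simps)
  have 2: "bcoef (nu + 2) m = (real m + 1) * (real m + 2) * bcoef nu (Suc (Suc m))"
   using bcoef_shift[of m "nu + 1"] unfolding 1 by (simp add: algebra_simps)
  show ?thesis using bcoef_Suc[OF nu, of "Suc m"] unfolding 1 2 by (simp add: algebra_simps)
 qed
 have "(%m. u * (?c (nu + 2) m * u ^ m) - (nu + 1) * (?c (nu + 1) (Suc m) * u ^ Suc m) + ?c nu (Suc m) * u ^ Suc m)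
  sums (u * bP (nu + 2) u - (nu + 1) * (bP (nu + 1) u - ?c (nu + 1) 0) + (bP nu u - ?c nu 0))"
 proof (intro sums_add sums_diff sums_mult)
  show "(%m. ?c (nu + 2) m * u ^ m) sums bP (nu + 2) u" using nu by (intro s) simp
  show "(%m. ?c (nu + 1) (Suc m) * u ^ Suc m) sums (bP (nu + 1) u - ?c (nu + 1) 0)"
   using nu s[of "nu + 1"] by (subst sums_Suc_iff) simp
  show "(%m. ?c nu (Suc m) * u ^ Suc m) sums (bP nu u - ?c nu 0)"
   using nu s[of nu] by (subst sums_Suc_iff) simp
 qed
 moreover have "u * (?c (nu + 2) m * u ^ m) - (nu + 1) * (?c (nu + 1) (Suc m) * u ^ Suc m) + ?c nu (Suc m) * u ^ Suc m = 0" for m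
 proof -
  have "u * (?c (nu + 2) m * u ^ m) - (nu + 1) * (?c (nu + 1) (Suc m) * u ^ Suc m) + ?c nu (Suc m) * u ^ Suc m
   = of_real (bcoef (nu + 2) m - (nu + 1) * bcoef (nu + 1) (Suc m) + bcoef nu (Suc m)) * u ^ Suc m"
   by (simp add: algebra_simps)
  thus ?thesis unfolding bs by simp
 qed
 ultimately have "u * bP (nu + 2) u - (nu + 1) * (bP (nu + 1) u - ?c (nu + 1) 0) + (bP nu u - ?c nu 0) = 0"
  using sums_unique2[OF _ sums_zero] by simp
 thus ?thesis using b0 by (simp add: algebra_simps)
qed

lemma has_derivative_bE [derivative_intros]:
 assumes "nu > -1"
 shows "(bE nu has_field_derivative - (w / 2) * bE (nu + 1) w) (at w)"
proof -
 have "((%w. bP nu ((w / 2)\<^sup>2)) has_field_derivative - bP (nu + 1) ((w / 2)\<^sup>2) * (w / 2)) (at w)"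
  by (rule DERIV_chain2[OF has_derivative_bP[OF assms]]) (auto intro!: derivative_eq_intros)
 thus ?thesis by (simp add: bE_def[abs_def] mult_ac)
qed

lemma bE_recurrence:
 "nu > -1 ==> (w / 2)\<^sup>2*bE (nu + 2) w = (nu + 1) * bE (nu + 1) w - bE nu w"
 using bP_recurrence[of nu "(w/2)\<^sup>2"] unfolding bE_def by (simp add: algebra_simps)

lemma holomorphic_bE: "nu > -1 ==> bE nu holomorphic_on S"
 unfolding holomorphic_on_def field_differentiable_def
 using has_field_derivative_at_within[OF has_derivative_bE] by blast

lemma continuous_on_bE [continuous_intros]:
 "nu > -1 ==> continuous_on S g ==> continuous_on S (%x. bE nu (g x))"
 by (rule continuous_on_compose2[OF holomorphic_on_imp_continuous_on[OF holomorphic_bE[of nu UNIV]]]) auto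

lemma bE_minus [simp]: "bE nu (- w) = bE nu w"
 by (simp add: bE_def)

lemma cnj_bE: "nu > -1 ==> cnj (bE nu w) = bE nu (cnj w)"
proof -
 assume nu: "nu > -1"
 have "(%m. cnj (of_real (bcoef nu m) * ((w / 2)\<^sup>2) ^ m)) sums cnj (bE nu w)"
  unfolding sums_cnj bE_def bP_def using summable_bP[OF nu] by (rule summable_sums)
 thus ?thesis unfolding bE_def[of nu "cnj w"] bP_def by (simp add: sums_iff)
qed

definition rE :: "real => real => real" where "rE nu x = Re (bE nu (of_real x))"

lemma bE_of_real: "nu > -1 ==> bE nu (of_real x) = of_real (rE nu x)"
 using cnj_bE[of nu "of_real x"] by (simp add: rE_def complex_eq_iff)

lemma rE_sums: "nu > -1 ==> (%m. bcoef nu m * (x / 2) ^ (2*m)) sums rE nu x"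
proof -
 assume nu: "nu > -1"
 have "(%m. of_real (bcoef nu m) * ((of_real x / 2)\<^sup>2) ^ m) sums bE nu (of_real x)"
  unfolding bE_def bP_def using summable_bP[OF nu] by (rule summable_sums)
 from sums_Re[OF this] show ?thesis
  by (simp add: rE_def power_mult flip: of_real_power of_real_divide of_real_mult)
qed

text \<open>On the imaginary axis (w/2)^2 is negative, its powers cancel the alternating signs of
  the coefficients, and all terms become nonnegative with a positive first one.\<close>

lemma bE_imag_axis:
 assumes nu: "nu > -1"
 obtains r where "bE nu (\<i> * of_real t) = of_real r" "r > 0"
proof -
 define a where "a = (%m. \<bar>bcoef nu m\<bar> * ((t/2)\<^sup>2) ^ m)"
 have gp: "Gamma (real m + nu + 1) > 0" for m using nu by (intro Gamma_real_pos) linarith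
 have abs: "\<bar>bcoef nu m\<bar> = (-1) ^ m * bcoef nu m" for m
 proof -
  define c where "c = 1/(fact m * Gamma (real m + nu + 1))"
  have "c > 0" using gp[of m] by (simp add: c_def)
  moreover have "bcoef nu m = (-1) ^ m * c" by (simp add: bcoef_def c_def)
  ultimately show ?thesis by (simp add: abs_mult mult.assoc[symmetric] minus_one_mult_self)
 qed
 have sq: "((\<i> * of_real t) / 2)\<^sup>2 = - of_real ((t/2)\<^sup>2)"
  by (simp add: power_divide power_mult_distrib)
 have eq: "of_real (bcoef nu m) * (((\<i> * of_real t) / 2)\<^sup>2) ^ m = complex_of_real (a m)" for m
  unfolding sq a_def abs by (subst power_minus) simp
 have "(%m. of_real (bcoef nu m) * (((\<i> * of_real t) / 2)\<^sup>2) ^ m) sums bE nu (\<i> * of_real t)"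
  unfolding bE_def bP_def using summable_bP[OF nu] by (rule summable_sums)
 hence "(%m. complex_of_real (a m)) sums bE nu (\<i> * of_real t)" unfolding eq .
 then obtain r where r: "bE nu (\<i> * of_real t) = of_real r" "a sums r"
  by (metis of_real_Re sums_Re sums_of_real sums_unique2 Re_complex_of_real sums_cong)
 have "a 0 > 0" using gp[of 0] by (simp add: a_def bcoef_def)
 hence "suminf a > 0"
  using r by (intro suminf_pos2[of _ 0]) (auto simp: sums_iff a_def)
 thus ?thesis using r that by (simp add: sums_iff)
qed

lemma rE_0: "nu > -1 ==> rE nu 0 > 0"
proof -
 assume "nu > -1"
 then obtain r where "bE nu (\<i> * of_real 0) = of_real r" "r > 0" by (rule bE_imag_axis)
 thus ?thesis by (simp add: rE_def)
qed

lemma besselJ_eq: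
 assumes nu: "nu > -1" and x: "x > 0"
 shows "besselJ nu x = (x / 2) powr nu * rE nu x"
proof -
 have "(%m. (x / 2) powr nu * (bcoef nu m * (x / 2) ^ (2*m))) sums ((x / 2) powr nu * rE nu x)"
  by (rule sums_mult[OF rE_sums[OF nu]])
 moreover have "(x / 2) powr nu * (bcoef nu m * (x / 2) ^ (2*m)) =
  (-1) ^ m / (fact m * Gamma (real m + nu + 1)) * (x / 2) powr (2*real m + nu)" for m
 proof -
  have "(x / 2) powr (2*real m + nu) = (x / 2) ^ (2*m) * (x / 2) powr nu"
   using x powr_realpow[of "x/2" "2*m"] by (simp add: powr_add)
  thus ?thesis by (simp add: bcoef_def)
 qed
 ultimately show ?thesis by (simp add: besselJ_def sums_iff)
qed

lemma has_real_derivative_rE: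
 assumes "nu > -1"
 shows "(rE nu has_real_derivative - (x / 2) * rE (nu + 1) x) (at x)"
proof -
 have "((%x. bE nu (of_real x)) has_vector_derivative - (of_real x / 2) * bE (nu + 1) (of_real x)) (at x)"
  by (rule has_vector_derivative_real_field[OF has_derivative_bE[OF assms]])
 from has_field_derivative_Re[OF this] show ?thesis
  unfolding rE_def[abs_def] by simp
qed

text \<open>The singular factor x^{-nu} cancels against the power in J_nu, and (s/2)^nu cancels
  against the normalization. From here on only the real entire function \<open>rE\<close>
  matters.\<close>

lemma psi_eq:
 assumes nu: "nu > -1" and s: "bessel_zero nu j > 0" and x: "x > 0"
 defines "s \<equiv> bessel_zero nu j"
 shows "psi nu j x = sqrt 2/\<bar>s / 2*rE (nu + 1) s\<bar> * rE nu (s * x)"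
proof -
 have s0: "s > 0" using s by (simp add: s_def)
 define P where "P = (s / 2) powr nu"
 define D where "D = s / 2*rE (nu + 1) s"
 have P: "P > 0" using s0 by (simp add: P_def)
 have J1: "besselJ (nu + 1) s = P * D"
  using nu s0 by (subst besselJ_eq) (auto simp: powr_add P_def D_def)
 have J2: "x powr (- nu) * besselJ nu (s * x) = P * rE nu (s * x)"
 proof -
  have "(s * x / 2) powr nu = (s / 2) powr nu * x powr nu"
   using powr_mult[of "s/2" x nu] s0 x by (simp add: mult_ac)
  thus ?thesis using nu s0 x by (subst besselJ_eq) (auto simp: powr_minus field_simps P_def)
 qed
 have "psi nu j x = sqrt 2/\<bar>P * D\<bar> * (P * rE nu (s * x))"
  unfolding psi_def s_def[symmetric] mult.assoc J1 J2 ..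
 also have "... = sqrt 2/\<bar>D\<bar> * rE nu (s * x)" using P by (simp add: abs_mult)
 finally show ?thesis by (simp only: D_def)
qed

text \<open>This is 2^nu sqrt(w) J_nu(w) in the principal branch; the square root removes the
  first-order term from Bessel's equation.\<close>

definition bF :: "real => complex => complex" where
 "bF nu w = w powr (of_real (nu + 1/2)) * bE nu w"

definition bF' :: "real => complex => complex" where
 "bF' nu w = w powr (of_real (nu + 1/2)) * (of_real (nu + 1/2) / w * bE nu w - w / 2*bE (nu + 1) w)"

lemma has_derivative_powr_cdiv:
 assumes "Re w > 0"
 shows "((%w. w powr a) has_field_derivative a / w * w powr a) (at w)"
proof -
 have "w \<notin> \<real>\<^sub>\<le>\<^sub>0" using assms by (auto simp: complex_nonpos_Reals_iff)
 from has_field_derivative_powr[OF this, of a] show ?thesis using assms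
  by (auto simp: powr_diff)
qed

lemma has_derivative_bF:
 assumes nu: "nu > -1" and w: "Re w > 0"
 shows "(bF nu has_field_derivative bF' nu w) (at w)"
 unfolding bF_def[abs_def] bF'_def
 by (rule DERIV_cong[OF DERIV_mult[OF has_derivative_powr_cdiv[OF w] has_derivative_bE[OF nu]]])
  (simp add: algebra_simps)

text \<open>Together with \<open>has_derivative_bF\<close> this is the normal form F'' = ((nu^2 -
  1/4)/w^2 - 1) F. The three-term recurrence eliminates the order nu + 2 created by the second
  derivative.\<close>

lemma has_derivative_bF':
 assumes nu: "nu > -1" and w: "Re w > 0"
 shows "(bF' nu has_field_derivative (of_real ((nu + 1/2) * (nu - 1/2)) / w\<^sup>2 - 1) * bF nu w) (at w)"
proof -
 have w0: "w ~= 0" using w by auto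
 let ?a = "complex_of_real (nu + 1/2)"
 let ?p = "w powr ?a"
 have "(bF' nu has_field_derivative
   ?a / w * ?p * (?a / w * bE nu w - w / 2*bE (nu + 1) w)
   + ((- ?a / w\<^sup>2) * bE nu w + (- (w / 2) * bE (nu + 1) w) * (?a / w)
    - (1/2*bE (nu + 1) w + (- (w / 2) * bE (nu + 1 + 1) w) * (w / 2))) * ?p) (at w)"
 proof -
  have "((%w. ?a / w) has_field_derivative - ?a / w\<^sup>2) (at w)"
   using w0 by (auto intro!: derivative_eq_intros simp: power2_eq_square)
  note 1 = DERIV_mult[OF this has_derivative_bE[OF nu]]
  have "((%w. w / 2) has_field_derivative 1/2) (at w)" by (auto intro!: derivative_eq_intros)
  note 2 = DERIV_mult[OF this has_derivative_bE[of "nu + 1" w]]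
  show ?thesis unfolding bF'_def[abs_def]
   by (rule DERIV_mult[OF has_derivative_powr_cdiv[OF w] DERIV_diff[OF 1 2]]) (use nu in auto)
 qed
 moreover have "?a / w * ?p * (?a / w * bE nu w - w / 2*bE (nu + 1) w)
   + ((- ?a / w\<^sup>2) * bE nu w + (- (w / 2) * bE (nu + 1) w) * (?a / w)
    - (1/2*bE (nu + 1) w + (- (w / 2) * bE (nu + 1 + 1) w) * (w / 2))) * ?p
  = ?p * ((?a * (?a - 1)) / w\<^sup>2*bE nu w - (?a + 1/2) * bE (nu + 1) w + (w / 2)\<^sup>2*bE (nu + 2) w)"
  using w0 by (simp add: field_simps power2_eq_square add_ac)
 moreover have "... = (of_real ((nu + 1/2) * (nu - 1/2)) / w\<^sup>2 - 1) * bF nu w"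
  unfolding bE_recurrence[OF nu] bF_def by (simp add: algebra_simps)
 ultimately show ?thesis by simp
qed

section \<open>Wronskians and the connection formula\<close>

locale bessel_jost =
 fixes nu :: real and f f' :: "complex => complex" and K :: real
 assumes nu: "nu > -1"
  and K: "K >= 0"
  and f_deriv: "!!w. Re w > 0 ==> (f has_field_derivative f' w) (at w)"
  and f'_deriv: "!!w. Re w > 0 ==>
   (f' has_field_derivative (of_real ((nu + 1/2) * (nu - 1/2)) / w\<^sup>2 - 1) * f w) (at w)"
  and f_bound: "!!w. Re w > 0 ==> norm (exp (- \<i> * w) * f w - 1) <= exp (K / norm w) - 1"
  and f'_bound: "!!w. Re w > 0 ==> norm (exp (- \<i> * w) * f' w - \<i>) <= 2*(exp (K / norm w) - 1)"

text \<open>The Jost pair enters as locale parameters, so that its equation and its two asymptotic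
  bounds are all that is ever used; here K is 2 |nu^2 - 1/4|.\<close>

lemma bessel_jost_exists:
 assumes "nu > -1"
 obtains f f' K where "bessel_jost nu f f' K"
proof -
 obtain f f' where *:
  "!!w. Re w > 0 ==> (f has_field_derivative f' w) (at w)"
  "!!w. Re w > 0 ==> (f' has_field_derivative (of_real ((nu + 1/2) * (nu - 1/2)) / w\<^sup>2 - 1) * f w) (at w)"
  "!!w. Re w > 0 ==> norm (exp (- \<i> * w) * f w - 1) <= exp (2*\<bar>(nu + 1/2) * (nu - 1/2)\<bar> / norm w) - 1"
  "!!w. Re w > 0 ==> norm (exp (- \<i> * w) * f' w - \<i>) <= 2*(exp (2*\<bar>(nu + 1/2) * (nu - 1/2)\<bar> / norm w) - 1)"
  using jost_solution[of "(nu + 1/2) * (nu - 1/2)"] by metis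
 show ?thesis
  by (rule that[OF bessel_jost.intro[OF assms _ *]]) simp_all
qed

text \<open>Without a first-order term the derivative u v'' - u'' v cancels, and the half-plane is
  convex.\<close>

lemma wronskian_constant:
 fixes q :: "complex => complex"
 assumes u: "!!w. Re w > 0 ==> (u has_field_derivative u' w) (at w)"
   "!!w. Re w > 0 ==> (u' has_field_derivative q w * u w) (at w)"
  and v: "!!w. Re w > 0 ==> (v has_field_derivative v' w) (at w)"
   "!!w. Re w > 0 ==> (v' has_field_derivative q w * v w) (at w)"
  and w: "Re w > 0" and z: "Re z > 0"
 shows "u w * v' w - u' w * v w = u z * v' z - u' z * v z"
proof -
 have "\<exists>c. \<forall>w\<in>RHP. u w * v' w - u' w * v w = c"
 proof (rule has_field_derivative_zero_constant[OF convex_RHP])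
  fix w assume "w : RHP"
  hence w: "Re w > 0" by simp
  have "((%w. u w * v' w - u' w * v w) has_field_derivative
    ((u' w * v' w + q w * v w * u w) - (q w * u w * v w + v' w * u' w))) (at w)"
   by (rule DERIV_diff[OF DERIV_mult[OF u(1)[OF w] v(2)[OF w]] DERIV_mult[OF u(2)[OF w] v(1)[OF w]]])
  hence "((%w. u w * v' w - u' w * v w) has_field_derivative 0) (at w)"
   by (simp add: algebra_simps)
  thus "((%w. u w * v' w - u' w * v w) has_field_derivative 0) (at w within RHP)"
   by (rule has_field_derivative_at_within)
 qed
 thus ?thesis using w z by auto
qed

lemma has_field_derivative_reflect:
 assumes "(g has_field_derivative D) (at (cnj w))"
 shows "((%w. cnj (g (cnj w))) has_field_derivative cnj D) (at w)"
 using has_field_derivative_cnj_cnj[OF assms] by (simp add: o_def)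

context bessel_jost
begin

abbreviation "F \<equiv> bF nu"
abbreviation "F' \<equiv> bF' nu"
abbreviation "q \<equiv> %w::complex. of_real ((nu + 1/2) * (nu - 1/2)) / w\<^sup>2 - 1"

lemmas F_deriv = has_derivative_bF[OF nu] and F'_deriv = has_derivative_bF'[OF nu]

text \<open>The reflected solution, asymptotic to e^{-iw}. It solves the same equation because the
  potential has real coefficients.\<close>

definition fc :: "complex => complex" where "fc w = cnj (f (cnj w))"
definition fc' :: "complex => complex" where "fc' w = cnj (f' (cnj w))"

lemma fc_deriv: "Re w > 0 ==> (fc has_field_derivative fc' w) (at w)"
 using has_field_derivative_reflect[OF f_deriv[of "cnj w"]] by (simp add: fc_def[abs_def] fc'_def)

lemma fc'_deriv: "Re w > 0 ==> (fc' has_field_derivative q w * fc w) (at w)"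
 using has_field_derivative_reflect[OF f'_deriv[of "cnj w"]] by (simp add: fc_def fc'_def[abs_def])

lemma f_eq: "f w = exp (\<i> * w) * (exp (- \<i> * w) * f w)"
 by (simp add: mult.assoc[symmetric] exp_add[symmetric])

lemma norm_f_factor: "norm (f w) = exp (- Im w) * norm (exp (- \<i> * w) * f w)"
 by (subst f_eq) (simp only: norm_mult norm_exp_eq_Re, simp)

lemma norm_f_le:
 assumes w: "Re w > 0" shows "norm (f w) <= exp (K / norm w) * exp (- Im w)"
proof -
 have "norm (exp (- \<i> * w) * f w) <= exp (K / norm w)"
  using norm_triangle_ineq2[of "exp (- \<i> * w) * f w" 1] f_bound[OF w] by simp
 thus ?thesis unfolding norm_f_factor by (simp add: mult.commute)
qed

lemma norm_f_ge:
 assumes w: "Re w > 0" shows "norm (f w) >= (2 - exp (K / norm w)) * exp (- Im w)"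
proof -
 have "norm (exp (- \<i> * w) * f w) >= 2 - exp (K / norm w)"
  using norm_triangle_ineq2[of 1 "exp (- \<i> * w) * f w"] f_bound[OF w]
  by (simp add: norm_minus_commute)
 thus ?thesis unfolding norm_f_factor by (simp add: mult.commute)
qed

lemma norm_fc_le: "Re w > 0 ==> norm (fc w) <= exp (K / norm w) * exp (Im w)"
 using norm_f_le[of "cnj w"] by (simp add: fc_def)

lemma norm_fc_ge: "Re w > 0 ==> norm (fc w) >= (2 - exp (K / norm w)) * exp (Im w)"
 using norm_f_ge[of "cnj w"] by (simp add: fc_def)

text \<open>The Wronskian is constant, so it may be read off at infinity along the positive
  integers, where e^{-iw} f and e^{-iw} f' tend to 1 and i.\<close>

lemma wronskian_f_fc:
 assumes w: "Re w > 0" shows "f w * fc' w - f' w * fc w = - 2*\<i>"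
proof -
 let ?n = "%n. complex_of_real (real (Suc n))"
 define A where "A = (%n. exp (- \<i> * ?n n) * f (?n n))"
 define B where "B = (%n. exp (- \<i> * ?n n) * f' (?n n))"
 have e: "(%n. exp (K / real (Suc n)) - 1) \<longlonglongrightarrow> 0"
 proof -
  have "(%n. K / real (Suc n)) \<longlonglongrightarrow> 0"
   using LIMSEQ_Suc[OF lim_const_over_n[of K]] by simp
  from tendsto_exp[OF this] show ?thesis by (intro LIM_zero) simp
 qed
 have A: "A \<longlonglongrightarrow> 1"
 proof (rule LIM_zero_cancel, rule Lim_null_comparison[OF always_eventually e], intro allI)
  show "norm (A n - 1) <= exp (K / real (Suc n)) - 1" for n
   using f_bound[of "?n n"] unfolding A_def by (simp del: of_nat_Suc add: norm_of_real)
 qed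
 have B: "B \<longlonglongrightarrow> \<i>"
 proof (rule LIM_zero_cancel, rule Lim_null_comparison[OF always_eventually], intro allI)
  show "norm (B n - \<i>) <= 2*(exp (K / real (Suc n)) - 1)" for n
   using f'_bound[of "?n n"] unfolding B_def by (simp del: of_nat_Suc add: norm_of_real)
  show "(%n. 2*(exp (K / real (Suc n)) - 1)) \<longlonglongrightarrow> 0"
   using tendsto_mult_right_zero[OF e, of 2] by simp
 qed
 have eq: "A n * cnj (B n) - B n * cnj (A n) = f w * fc' w - f' w * fc w" for n
 proof -
  let ?e = "exp (- \<i> * ?n n)"
  have en: "?e * cnj ?e = 1" using complex_norm_square[of ?e] by (simp add: norm_exp_eq_Re del: of_nat_Suc)
  have "A n * cnj (B n) - B n * cnj (A n) = (?e * cnj ?e) * (f (?n n) * fc' (?n n) - f' (?n n) * fc (?n n))"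
   unfolding A_def B_def fc_def fc'_def by (simp add: algebra_simps del: of_nat_Suc)
  also have "... = f w * fc' w - f' w * fc w"
   unfolding en using wronskian_constant[where q=q, OF f_deriv f'_deriv fc_deriv fc'_deriv, of "?n n" w] w by simp
  finally show ?thesis .
 qed
 have "(%n. A n * cnj (B n) - B n * cnj (A n)) \<longlonglongrightarrow> 1*cnj \<i> - \<i> * cnj 1"
  by (intro tendsto_intros A B)
 hence "(%n::nat. f w * fc' w - f' w * fc w) \<longlonglongrightarrow> - 2*\<i>" unfolding eq by simp
 thus ?thesis by (simp add: LIMSEQ_const_iff)
qed

text \<open>The connection coefficient of F, normalized by the Wronskian at the point 1; its value
  in terms of nu is never computed.\<close>

definition beta :: complex where "beta = (F 1*f' 1 - F' 1*f 1) / (2*\<i>)"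

lemma wronskian_F_f: "Re w > 0 ==> F w * f' w - F' w * f w = 2*\<i> * beta"
 using wronskian_constant[where q=q, OF F_deriv F'_deriv f_deriv f'_deriv, of w 1] by (simp add: beta_def)

lemma F_of_real: "x > 0 ==> F (of_real x) = of_real (x powr (nu + 1/2) * rE nu x)"
 using nu by (simp add: bF_def bE_of_real powr_of_real del: of_real_add)

lemma F'_of_real: "x > 0 ==> F' (of_real x) =
  of_real (x powr (nu + 1/2) * ((nu + 1/2) / x * rE nu x - x / 2*rE (nu + 1) x))"
proof -
 assume "x > 0"
 hence "complex_of_real x powr of_real (nu + 1/2) = of_real (x powr (nu + 1/2))"
  by (intro powr_of_real) simp
 thus ?thesis using nu unfolding bF'_def by (simp add: bE_of_real)
qed

lemma wronskian_F_fc: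
 assumes "Re w > 0" shows "F w * fc' w - F' w * fc w = - 2*\<i> * cnj beta"
proof -
 have r: "cnj (F 1) = F 1" "cnj (F' 1) = F' 1"
  using F_of_real[of 1] F'_of_real[of 1] by simp_all
 have "F w * fc' w - F' w * fc w = F 1*fc' 1 - F' 1*fc 1"
  using wronskian_constant[where q=q, OF F_deriv F'_deriv fc_deriv fc'_deriv, of w 1] assms by simp
 also have "... = cnj (F 1*f' 1 - F' 1*f 1)" by (simp add: fc_def fc'_def r)
 also have "... = cnj (2*\<i> * beta)" by (simp add: beta_def)
 finally show ?thesis by simp
qed

text \<open>Cramer's rule from the three constant Wronskians. The two coefficients are conjugate
  because F is real on the positive axis.\<close>

lemma F_eq:
 assumes w: "Re w > 0" shows "F w = cnj beta * f w + beta * fc w"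
proof -
 have "F w * (f w * fc' w - f' w * fc w) = f w * (F w * fc' w - F' w * fc w) - fc w * (F w * f' w - F' w * f w)"
  by (simp add: algebra_simps)
 hence "F w * (- 2*\<i>) = f w * (- 2*\<i> * cnj beta) - fc w * (2*\<i> * beta)"
  unfolding wronskian_f_fc[OF w] wronskian_F_fc[OF w] wronskian_F_f[OF w] .
 hence "(- 2*\<i>) * F w = (- 2*\<i>) * (cnj beta * f w + beta * fc w)" by (simp add: algebra_simps)
 thus ?thesis by (subst (asm) mult_left_cancel) auto
qed

lemma rE_pos_near_0: obtains c where "0 < c" "c <= 1" "!!x. 0 <= x ==> x <= c ==> rE nu x >= rE nu 0/2"
proof -
 have "isCont (rE nu) 0" using has_real_derivative_rE[OF nu] by (rule DERIV_isCont)
 hence "\<forall>\<^sub>F x in nhds 0. rE nu x > rE nu 0/2"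
  using rE_0[OF nu] by (intro order_tendstoD(1)[of _ "rE nu 0"]) (auto simp: isCont_def tendsto_nhds_iff)
 then obtain d where d: "d > 0" "!!x. dist x 0 < d ==> rE nu x > rE nu 0/2"
  unfolding eventually_nhds_metric by blast
 show ?thesis
  by (rule that[of "min 1 (d/2)"]) (use d in "auto intro: less_imp_le")
qed

text \<open>Otherwise the connection formula would make F vanish identically, although E_nu is
  positive near 0.\<close>

lemma beta_nonzero: "beta ~= 0"
proof
 assume "beta = 0"
 obtain c where c: "0 < c" "rE nu c >= rE nu 0/2"
  using rE_pos_near_0 by (metis less_imp_le order_refl)
 hence "rE nu c > 0" using rE_0[OF nu] by linarith
 hence "F (of_real c) ~= 0" using c by (subst F_of_real) auto
 thus False using F_eq[of "of_real c"] c \<open>beta = 0\<close> by simp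
qed

end

section \<open>Upper and lower bounds for F in the right half-plane\<close>

context bessel_jost
begin

lemma beta_pos: "norm beta > 0" using beta_nonzero by simp

text \<open>The value 13/12 is chosen so that three times the excess over 1 is 1/4, the Lipschitz
  constant used in \<open>f_le_fc\<close>.\<close>

lemma small_exp_bound:
 obtains M where "M >= 1" "!!r. r >= M ==> exp (K / r) <= 13/12"
proof (rule that[of "max 1 (K / ln (13/12))"])
 fix r assume r: "r >= max 1 (K / ln (13/12))"
 have l: "ln (13/12 :: real) > 0" by simp
 have "K <= r * ln (13/12)" using r l by (simp add: pos_divide_le_eq)
 hence "K / r <= ln (13/12)" using r by (simp add: pos_divide_le_eq mult.commute)
 hence "exp (K / r) <= exp (ln (13/12))" by (rule exp_le_cancel_iff[THEN iffD2])
 thus "exp (K / r) <= 13/12" by simp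
qed simp

text \<open>Near the real axis f and fc have almost equal modulus, so a bound with a multiplicative
  constant would not separate them. With g = e^{-iw} f, which has derivative at most 1/4, the mean
  value inequality between z and its conjugate gives |g(z)| <= (1 + t) |g(cnj z)| <= e^t |g(cnj z)|
  with t = Im z. Undoing the exponential factors leaves the constant 1.\<close>

lemma f_le_fc:
 assumes M: "M >= 1" "!!r. r >= M ==> exp (K / r) <= 13/12" and z: "Re z >= M" "Im z >= 0"
 shows "norm (f z) <= exp (- Im z) * norm (fc z)"
proof -
 define g where "g = (%w. exp (- \<i> * w) * f w)"
 define g' where "g' = (%w. (exp (- \<i> * w) * f' w - \<i>) - \<i> * (g w - 1))"
 define t where "t = Im z"
 have Re0: "Re w > 0" and nw: "norm w >= M" if "w : {w. Re w >= M}" for w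
  using that M(1) complex_Re_le_cmod[of w] by auto
 have "norm (g z - g (cnj z)) <= 1/4*norm (z - cnj z)"
 proof (rule field_differentiable_bound[where S="{w. Re w >= M}"])
  show "convex {w. Re w >= M}" by (rule convex_halfspace_Re_ge)
  fix w assume w: "w : {w. Re w >= M}"
  have "((%w. exp (- \<i> * w)) has_field_derivative (- \<i>) * exp (- \<i> * w)) (at w)"
   by (auto intro!: derivative_eq_intros)
  from DERIV_mult[OF this f_deriv[OF Re0[OF w]]]
  have "(g has_field_derivative g' w) (at w)"
   unfolding g_def g'_def by (simp add: algebra_simps)
  thus "(g has_field_derivative g' w) (at w within {w. Re w >= M})"
   by (rule has_field_derivative_at_within)
  have "norm (g' w) <= norm (exp (- \<i> * w) * f' w - \<i>) + norm (\<i> * (g w - 1))"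
   unfolding g'_def by (rule norm_triangle_ineq4)
  also have "... <= 2*(exp (K / norm w) - 1) + (exp (K / norm w) - 1)"
   using f_bound[OF Re0[OF w]] f'_bound[OF Re0[OF w]] by (simp add: g_def norm_mult)
  also have "... <= 1/4" using M(2)[OF nw[OF w]] by simp
  finally show "norm (g' w) <= 1/4" .
 qed (use z in auto)
 also have "norm (z - cnj z) = 2*t" using z by (simp add: t_def complex_diff_cnj norm_mult)
 finally have 1: "norm (g z) <= norm (g (cnj z)) + t / 2"
  using norm_triangle_ineq2[of "g z" "g (cnj z)"] by simp
 have "norm (g (cnj z)) >= 11/12"
  using norm_triangle_ineq2[of 1 "g (cnj z)"] f_bound[of "cnj z"] M(2)[OF nw[of "cnj z"]] z Re0[of z]
  by (simp add: g_def norm_minus_commute)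
 hence "t / 2 <= t * norm (g (cnj z))" using z mult_left_mono[of "1/2" "norm (g (cnj z))" t] by (simp add: t_def)
 hence "norm (g z) <= (1 + t) * norm (g (cnj z))" using 1 by (simp add: algebra_simps)
 also have "... <= exp t * norm (g (cnj z))" by (intro mult_right_mono exp_ge_add_one_self) auto
 finally have gg: "norm (g z) <= exp t * norm (g (cnj z))" .
 have "norm (f z) = exp (- t) * norm (g z)" using norm_f_factor[of z] by (simp add: g_def t_def)
 also have "... <= exp (- t) * (exp t * norm (g (cnj z)))" by (intro mult_left_mono gg) auto
 also have "exp t * norm (g (cnj z)) = norm (fc z)" using norm_f_factor[of "cnj z"] by (simp add: g_def t_def fc_def)
 finally show ?thesis by (simp add: t_def)
qed

text \<open>In F = cnj beta f + beta fc the second term dominates in the upper half-plane. The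
  factor 1 - e^{-t} accounts for the zeros on the real axis. Where Re z < M the height is at least
  1, and crude bounds for f and fc suffice.\<close>

lemma F_lower_bound:
 obtains M where "M >= 1"
  "!!z. Re z > 0 ==> Im z >= 0 ==> Re z >= M \<or> Im z >= M ==>
   norm (F z) >= norm beta / 4*exp (Im z) * (1 - exp (- Im z))"
proof -
 obtain M where M: "M >= 1" "!!r. r >= M ==> exp (K / r) <= 13/12" using small_exp_bound by blast
 show ?thesis
 proof (rule that[OF M(1)])
  fix z assume z: "Re z > 0" "Im z >= 0" and or: "Re z >= M \<or> Im z >= M"
  define t where "t = Im z"
  have t: "t >= 0" using z by (simp add: t_def)
  have "norm z >= M" using or complex_Re_le_cmod[of z] abs_Im_le_cmod[of z] by auto
  hence e: "exp (K / norm z) <= 13/12" by (rule M(2))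
  have "norm (fc z) >= (2 - exp (K / norm z)) * exp t" using norm_fc_ge[OF z(1)] by (simp add: t_def)
  moreover have "(2 - exp (K / norm z)) * exp t >= 11/12*exp t" using e by (intro mult_right_mono) auto
  ultimately have fc: "norm (fc z) >= 11/12*exp t" by linarith
  have diff: "norm (fc z) - norm (f z) >= 1/4*exp t * (1 - exp (- t))"
  proof (cases "Re z >= M")
   case True
   have "norm (f z) <= exp (- t) * norm (fc z)" using f_le_fc[OF M True] z by (simp add: t_def)
   hence "norm (fc z) - norm (f z) >= norm (fc z) * (1 - exp (- t))" by (simp add: algebra_simps)
   moreover have "norm (fc z) * (1 - exp (- t)) >= (1/4*exp t) * (1 - exp (- t))"
    using fc t exp_gt_zero[of t] by (intro mult_right_mono) (linarith, auto)
   ultimately show ?thesis by linarith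
  next
   case False
   hence tM: "t >= 1" using or M(1) by (simp add: t_def)
   have "norm (f z) <= exp (K / norm z) * exp (- t)" using norm_f_le[OF z(1)] by (simp add: t_def)
   also have "... <= 13/12*exp (- t)" using e by (intro mult_right_mono) auto
   also have "exp (- t) <= exp t / 2"
   proof -
    have "2 <= exp (2*t)" using exp_ge_add_one_self[of "2*t"] tM by linarith
    hence "2*exp (- t) <= exp (2*t) * exp (- t)" by (intro mult_right_mono) auto
    thus ?thesis by (simp add: exp_add[symmetric])
   qed
   finally have "norm (f z) <= 13/24*exp t" by simp
   hence "norm (fc z) - norm (f z) >= 1/4*exp t" using fc exp_gt_zero[of t] by linarith
   moreover have "1/4*exp t * (1 - exp (- t)) <= 1/4*exp t * 1" by (intro mult_left_mono) auto
   ultimately show ?thesis by linarith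
  qed
  have "norm (F z) >= norm (beta * fc z) - norm (cnj beta * f z)"
   unfolding F_eq[OF z(1)] using norm_triangle_ineq2[of "beta * fc z" "- (cnj beta * f z)"] by (simp add: add.commute)
  also have "norm (beta * fc z) - norm (cnj beta * f z) = norm beta * (norm (fc z) - norm (f z))"
   by (simp add: norm_mult algebra_simps)
  finally have "norm beta * (norm (fc z) - norm (f z)) <= norm (F z)" .
  moreover have "norm beta * (1/4*exp t * (1 - exp (- t))) <= norm beta * (norm (fc z) - norm (f z))"
   by (intro mult_left_mono diff) simp
  ultimately show "norm (F z) >= norm beta / 4*exp (Im z) * (1 - exp (- Im z))"
   by (simp add: t_def)
 qed
qed

text \<open>For |w| <= 1 the entire factor is bounded by compactness; for |w| > 1 both Jost
  solutions are O(e^{Im w}).\<close>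

lemma F_upper_bound:
 obtains C where "C > 0"
  "!!w. Re w > 0 ==> Im w >= 0 ==> norm (F w) <= C * min 1 (norm w) powr (nu + 1/2) * exp (Im w)"
proof -
 have "compact (bE nu ` cball 0 1)"
  by (intro compact_continuous_image continuous_on_bE nu continuous_on_id compact_cball)
 from compact_imp_bounded[OF this] obtain B where B0: "\<forall>y\<in>bE nu ` cball 0 1. norm y <= B"
  unfolding bounded_iff by (rule exE)
 have B: "norm (bE nu w) <= B" if "norm w <= 1" for w
  using B0 that by simp
 define C where "C = max 1 (max B (2*norm beta * exp K))"
 show ?thesis
 proof (rule that[of C])
  show "C > 0" by (simp add: C_def)
  fix w assume w: "Re w > 0" "Im w >= 0"
  show "norm (F w) <= C * min 1 (norm w) powr (nu + 1/2) * exp (Im w)"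
  proof (cases "norm w <= 1")
   case True
   have "norm (F w) = norm w powr (nu + 1/2) * norm (bE nu w)"
    unfolding bF_def norm_mult by (subst norm_powr_real_powr') auto
   also have "... <= norm w powr (nu + 1/2) * C"
    using B[OF True] by (intro mult_left_mono) (auto simp: C_def)
   also have "... <= (norm w powr (nu + 1/2) * C) * exp (Im w)"
    using mult_left_mono[of 1 "exp (Im w)" "norm w powr (nu + 1/2) * C"] w by (simp add: C_def)
   finally show ?thesis using True by (simp add: mult_ac)
  next
   case False
   have "K / norm w <= K" using divide_left_mono[of 1 "norm w" K] False K by (cases "w = 0") auto
   hence e: "exp (K / norm w) <= exp K" by simp
   have "norm (f w) <= exp K * exp (Im w)"
    using order_trans[OF norm_f_le[OF w(1)], of "exp K * exp (Im w)"] e w by (simp add: mult_mono)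
   moreover have "norm (fc w) <= exp K * exp (Im w)"
    using order_trans[OF norm_fc_le[OF w(1)], of "exp K * exp (Im w)"] e w by (simp add: mult_mono)
   ultimately have "norm beta * (norm (f w) + norm (fc w)) <= norm beta * (2*(exp K * exp (Im w)))"
    by (intro mult_left_mono) auto
   moreover have "norm (F w) <= norm beta * (norm (f w) + norm (fc w))"
    unfolding F_eq[OF w(1)] using norm_triangle_ineq[of "cnj beta * f w" "beta * fc w"]
    by (simp add: norm_mult algebra_simps)
   ultimately have "norm (F w) <= (2*norm beta * exp K) * exp (Im w)" by simp
   also have "... <= C * exp (Im w)" by (intro mult_right_mono) (auto simp: C_def)
   finally show ?thesis using False by simp
  qed
 qed
qed

text \<open>As a function of x this is the solution of the equation rescaled by z that vanishes at x
  = 1. Up to sign and the factor 2iz, D(z,x) F(zy) / F(z) is the Green function on (0,1) for y <=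
  x.\<close>

definition D :: "complex => real => complex" where
 "D z x = f (z * of_real x) * fc z - fc (z * of_real x) * f z"

lemma D_bound:
 assumes c: "c > 0" and z: "Re z > 0" "Im z >= 0" and x: "0 < x" "x <= 1" "c <= norm z * x"
 shows "norm (D z x) <= 2*exp (K / c) ^ 2*exp ((1 - x) * Im z)"
proof -
 define t where "t = Im z"
 have nz: "norm z >= c" using x mult_left_mono[of x 1 "norm z"] by simp
 have e: "exp (K / r) <= exp (K / c)" if "r >= c" for r
  using that c K by (simp add: frac_le)
 let ?E = "exp (K / c)"
 have zx: "Re (z * of_real x) > 0" "Im (z * of_real x) = t * x" "norm (z * of_real x) = norm z * x"
  using z x by (auto simp: t_def norm_mult)
 have 1: "norm (f (z * of_real x)) <= ?E * exp (- t * x)" "norm (fc (z * of_real x)) <= ?E * exp (t * x)"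
  using norm_f_le[OF zx(1)] norm_fc_le[OF zx(1)] e[OF x(3)] unfolding zx(2,3)
  by (auto elim!: order_trans)
 have 2: "norm (f z) <= ?E * exp (- t)" "norm (fc z) <= ?E * exp t"
  using norm_f_le[OF z(1)] norm_fc_le[OF z(1)] e[OF nz] unfolding t_def
  by (auto elim!: order_trans)
 have "norm (D z x) <= norm (f (z * of_real x)) * norm (fc z) + norm (fc (z * of_real x)) * norm (f z)"
  unfolding D_def by (rule order_trans[OF norm_triangle_ineq4]) (simp add: norm_mult)
 also have "... <= (?E * exp (- t * x)) * (?E * exp t) + (?E * exp (t * x)) * (?E * exp (- t))"
  by (intro add_mono mult_mono 1 2) auto
 also have "... = ?E^2*(exp ((1 - x) * t) + exp (- ((1 - x) * t)))"
  by (simp add: algebra_simps power2_eq_square exp_add exp_diff exp_minus divide_inverse)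
 also have "... <= ?E^2*(exp ((1 - x) * t) + exp ((1 - x) * t))"
  using z x by (intro mult_left_mono add_mono) (auto simp: t_def)
 finally show ?thesis by (simp add: t_def)
qed

end

section \<open>The zeros: real, simple, unbounded, and enumerated by
  \<open>bessel_zero\<close>\<close>

text \<open>Lommel's argument: u(x) = E_nu(zx) satisfies a self-adjoint equation on (0,1) with
  eigenvalue z^2. A zero at z would make u an eigenfunction, which a non-real z^2 forbids.\<close>

lemma bE_nonzero_upper:
 assumes nu: "nu > -1" and z: "Re z > 0" "Im z > 0"
 shows "bE nu z ~= 0"
proof
 assume zero: "bE nu z = 0"
 define a where "a = 2*nu + 2"
 have a: "a > 0" using nu by (simp add: a_def)
 define u where "u = (%x. bE nu (z * of_real x))"
 define v where "v = (%x. bE (nu + 1) (z * of_real x))"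
 define w where "w = (%x. bE (nu + 2) (z * of_real x))"
 \<comment> \<open>H is x^{2nu+1} Im(cnj(u) u'), since u' = -(z^2 x/2) v. Its derivative has the
   fixed sign of -Im(z^2), and it vanishes at both ends: at 0 because a > 0, at 1 because of the
   supposed zero.\<close>
 define H where "H = (%x. x powr a * Im (cnj (u x) * (- (z\<^sup>2/2) * v x)))"
 have chain: "((%x. bE mu (z * of_real x)) has_vector_derivative
    (- (z\<^sup>2 * of_real x / 2) * bE (mu + 1) (z * of_real x))) (at x)" if "mu > -1" for mu x
 proof -
  have "((%y. bE mu (z * y)) has_field_derivative - (z * of_real x / 2) * bE (mu + 1) (z * of_real x) * z) (at (of_real x))"
   by (rule DERIV_chain2[OF has_derivative_bE[OF that]]) (auto intro!: derivative_eq_intros)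
  from has_vector_derivative_real_field[OF this] show ?thesis by (simp add: power2_eq_square mult_ac)
 qed
 have du: "(u has_vector_derivative - (z\<^sup>2 * of_real x / 2) * v x) (at x)" for x
  unfolding u_def v_def by (rule chain[OF nu])
 have dv: "(v has_vector_derivative - (z\<^sup>2 * of_real x / 2) * w x) (at x)" for x
  unfolding v_def w_def using chain[of "nu + 1" x] nu by (simp add: add.assoc)
 have dH: "(H has_real_derivative - (x powr (a - 1) * Im (z\<^sup>2) * (norm (u x))\<^sup>2)) (at x)" if x: "x > 0" for x
 proof -
  have "((%x. - (z\<^sup>2/2) * v x) has_vector_derivative - (z\<^sup>2/2) * (- (z\<^sup>2 * of_real x / 2) * w x)) (at x)"
   by (intro has_vector_derivative_mult_right dv)
  from has_vector_derivative_mult[OF has_vector_derivative_cnj[OF du] this]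
  have "((%x. cnj (u x) * (- (z\<^sup>2/2) * v x)) has_vector_derivative
   cnj (u x) * (- (z\<^sup>2/2) * (- (z\<^sup>2 * of_real x / 2) * w x)) +
   cnj (- (z\<^sup>2 * of_real x / 2) * v x) * (- (z\<^sup>2/2) * v x)) (at x)" .
  note d1 = has_field_derivative_Im[OF this]
  have d2: "((%x. x powr a) has_real_derivative a * x powr (a - 1)) (at x)"
   using x by (auto intro!: derivative_eq_intros)
  have Im0: "Im (cnj (- (z\<^sup>2 * of_real x / 2) * v x) * (- (z\<^sup>2/2) * v x)) = 0"
  proof -
   have "cnj (- (z\<^sup>2 * of_real x / 2) * v x) * (- (z\<^sup>2/2) * v x)
     = of_real x * ((- (z\<^sup>2/2) * v x) * cnj (- (z\<^sup>2/2) * v x))" by simp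
   also have "... = of_real (x * (norm (- (z\<^sup>2/2) * v x))\<^sup>2)"
    by (simp only: complex_norm_square[symmetric] of_real_mult)
   finally show ?thesis by (simp only: Im_complex_of_real)
  qed
  have xp: "x powr a = x powr (a - 1) * x" using x by (simp add: powr_diff)
  have rec: "of_real x * (z\<^sup>2 * of_real x / 2) * w x = of_real a * v x - 2*u x"
  proof -
   have "(z * of_real x / 2)\<^sup>2*w x = (nu + 1) * v x - u x"
    using bE_recurrence[OF nu, of "z * of_real x"] by (simp add: u_def v_def w_def)
   moreover have "of_real x * (z\<^sup>2 * of_real x / 2) * w x = 2*((z * of_real x / 2)\<^sup>2*w x)"
    by (simp add: power2_eq_square)
   ultimately have "of_real x * (z\<^sup>2 * of_real x / 2) * w x = 2*((nu + 1) * v x - u x)"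
    by (simp only:)
   thus ?thesis by (simp add: a_def algebra_simps)
  qed
  have gen: "a * x powr (a - 1) * Im P + Im Q * (x powr (a - 1) * x)
    = x powr (a - 1) * Im (of_real a * P + of_real x * Q)" for P Q :: complex
   by (simp add: algebra_simps)
  have "a * x powr (a - 1) * Im (cnj (u x) * (- (z\<^sup>2/2) * v x)) +
     Im (cnj (u x) * (- (z\<^sup>2/2) * (- (z\<^sup>2 * of_real x / 2) * w x))) * x powr a
    = x powr (a - 1) * Im (of_real a * (cnj (u x) * (- (z\<^sup>2/2) * v x)) +
     of_real x * (cnj (u x) * (- (z\<^sup>2/2) * (- (z\<^sup>2 * of_real x / 2) * w x))))"
   unfolding xp by (rule gen)
  also have "of_real a * (cnj (u x) * (- (z\<^sup>2/2) * v x)) +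
     of_real x * (cnj (u x) * (- (z\<^sup>2/2) * (- (z\<^sup>2 * of_real x / 2) * w x)))
    = cnj (u x) * (- (z\<^sup>2/2)) * (of_real a * v x - of_real x * (z\<^sup>2 * of_real x / 2) * w x)"
   by (simp add: algebra_simps)
  also have "... = - (z\<^sup>2*(u x * cnj (u x)))" unfolding rec by (simp add: algebra_simps)
  also have "... = - (z\<^sup>2 * of_real ((norm (u x))\<^sup>2))" by (simp only: complex_norm_square)
  finally have eq: "a * x powr (a - 1) * Im (cnj (u x) * (- (z\<^sup>2/2) * v x)) +
     Im (cnj (u x) * (- (z\<^sup>2/2) * (- (z\<^sup>2 * of_real x / 2) * w x))) * x powr a
    = - (x powr (a - 1) * Im (z\<^sup>2) * (norm (u x))\<^sup>2)" by simp
  show ?thesis unfolding H_def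
   by (rule DERIV_cong[OF DERIV_mult[OF d2 d1]]) (use eq Im0 in simp)
 qed
 have z2: "Im (z\<^sup>2) > 0" using z by (simp add: power2_eq_square)
 have contu: "continuous_on {0..1} u" unfolding u_def by (intro continuous_intros nu)
 have contH: "continuous_on {0..1} H"
  unfolding H_def v_def using a nu by (auto intro!: continuous_intros contu continuous_on_powr')
 have H0: "H 0 = 0" by (simp add: H_def)
 have H1: "H 1 = 0" by (simp add: H_def u_def zero)
 have dec: "H x >= H y" if "0 <= x" "x <= y" "y <= 1" for x y
 proof (rule DERIV_nonpos_imp_decreasing_open[OF that(2)])
  show "continuous_on {x..y} H" by (rule continuous_on_subset[OF contH]) (use that in auto)
  fix s assume s: "x < s" "s < y"
  thus "\<exists>d. DERIV H s :> d & d <= 0" using dH[of s] z2 that by (intro exI[of _ "- (s powr (a - 1) * Im (z\<^sup>2) * (norm (u s))\<^sup>2)"]) auto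
 qed
 have Hz: "H x = 0" if "x : {0..1}" for x
  using dec[of 0 x] dec[of x 1] H0 H1 that by simp
 have uz: "u x = 0" if x: "x : {0<..<1}" for x
 proof -
  have "(H has_real_derivative 0) (at x)"
   by (rule has_field_derivative_transform_within_open[of "%_. 0" _ _ "{0<..<1}"]) (use Hz x in auto)
  from DERIV_unique[OF this dH[of x]] x z2 show ?thesis by simp
 qed
 have "u 0 = 0"
 proof (rule tendsto_unique)
  show "(u \<longlongrightarrow> u 0) (at_right 0)"
   using contu by (simp add: continuous_on_Icc_at_rightD)
  show "(u \<longlongrightarrow> 0) (at_right 0)"
   by (rule tendsto_eventually) (use uz in "auto simp: eventually_at_right_field intro!: exI[of _ 1]")
 qed simp
 moreover have "u 0 = of_real (rE nu 0)" using bE_of_real[OF nu, of 0] by (simp add: u_def)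
 ultimately show False using rE_0[OF nu] by simp
qed

lemma bE_nonzero_nonreal:
 assumes nu: "nu > -1" and z: "Re z > 0" "Im z ~= 0"
 shows "bE nu z ~= 0"
proof (cases "Im z > 0")
 case False
 hence "bE nu (cnj z) ~= 0" using z by (intro bE_nonzero_upper[OF nu]) auto
 thus ?thesis using cnj_bE[OF nu, of "cnj z"] by auto
qed (use bE_nonzero_upper[OF nu z(1)] in blast)

context bessel_jost
begin

text \<open>If E_{nu+1} vanished as well, F and F' would vanish together and so would the Wronskian
  2i beta.\<close>

lemma simple_zero:
 assumes x: "x > 0" and z: "rE nu x = 0"
 shows "rE (nu + 1) x ~= 0"
proof
 assume "rE (nu + 1) x = 0"
 hence "F (of_real x) = 0" "F' (of_real x) = 0"
  using x z by (simp_all only: F_of_real F'_of_real) auto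
 thus False using wronskian_F_f[of "of_real x"] x beta_nonzero by simp
qed

text \<open>On the real axis F is twice the real part of cnj beta f, and f is close to e^{ix}. At
  the points x = arg beta + n pi this has sign (-1)^n, so the intermediate value theorem yields
  zeros arbitrarily far out.\<close>

lemma zeros_unbounded: "\<exists>x>B. rE nu x = 0"
proof -
 obtain M where M: "M >= 1" "!!r. r >= M ==> exp (K / r) <= 13/12" using small_exp_bound by blast
 define th where "th = Arg beta"
 define X where "X = (%n::nat. th + pi * real n)"
 have beta: "beta = of_real (norm beta) * cis th"
  unfolding th_def using rcis_cmod_Arg[of beta] by (simp add: rcis_def)
 have sgn: "(-1) ^ n * rE nu (X n) > 0" if n: "X n >= M" for n
 proof -
  let ?x = "X n"
  have x0: "?x > 0" using n M by linarith
  define g where "g = exp (- \<i> * of_real ?x) * f (of_real ?x)"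
  have "norm (g - 1) <= exp (K / ?x) - 1" using f_bound[of "of_real ?x"] x0 by (simp add: g_def)
  also have "... < 1" using M(2)[OF n] by simp
  finally have "\<bar>Re (g - 1)\<bar> < 1" using abs_Re_le_cmod[of "g - 1"] by linarith
  hence g: "Re g > 0" by (simp add: abs_less_iff)
  have fx: "f (of_real ?x) = cis ?x * g"
   using f_eq[of "of_real ?x"] by (simp add: g_def cis_conv_exp)
  have "cnj beta * f (of_real ?x) = of_real (norm beta) * (cis (- th) * cis ?x) * g"
   unfolding fx by (subst beta) (simp add: cis_cnj)
  also have "cis (- th) * cis ?x = cis (pi * real n)" by (simp add: cis_mult X_def)
  also have "... = of_real ((-1) ^ n)"
   by (simp add: complex_eq_iff cos_int_times_real sin_npi2 cos_npi2)
  finally have "Re (cnj beta * f (of_real ?x)) = norm beta * (-1) ^ n * Re g"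
   by (simp flip: of_real_mult)
  moreover have "Re (F (of_real ?x)) = 2*Re (cnj beta * f (of_real ?x))"
   using x0 by (subst F_eq) (auto simp: fc_def)
  ultimately have "?x powr (nu + 1/2) * rE nu ?x = 2*norm beta * (-1) ^ n * Re g"
   using F_of_real[OF x0] by simp
  hence "(-1) ^ n * (?x powr (nu + 1/2) * rE nu ?x) = (-1) ^ n * (2*norm beta * (-1) ^ n * Re g)"
   by simp
  hence "?x powr (nu + 1/2) * ((-1) ^ n * rE nu ?x) = 2*norm beta * ((-1) ^ n * (-1) ^ n) * Re g"
   by (simp only: mult_ac)
  also have "... = 2*norm beta * Re g" by (simp add: minus_one_mult_self)
  also have "... > 0" using g beta_pos by simp
  finally show ?thesis using x0 by (simp add: zero_less_mult_iff)
 qed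
 obtain m :: nat where m: "max M (B + 1) - th <= real m" using real_arch_simple by blast
 have big: "X n >= max M (B + 1)" if "n >= m" for n
 proof -
  have "real m <= real n" using that by simp
  also have "real n <= pi * real n" using pi_ge_two mult_right_mono[of 1 pi "real n"] by simp
  finally have "real m <= pi * real n" .
  moreover have "max M (B + 1) <= th + real m" using m by linarith
  ultimately show ?thesis unfolding X_def by linarith
 qed
 define k where "k = 2*m"
 have k: "k >= m" "Suc k >= m" by (auto simp: k_def)
 have s1: "rE nu (X k) > 0" using sgn[of k] big[OF k(1)] by (simp add: k_def)
 have s2: "rE nu (X (Suc k)) < 0" using sgn[of "Suc k"] big[OF k(2)] by (simp add: k_def)
 have le: "X k <= X (Suc k)" by (simp add: X_def)
 have "\<exists>x\<ge>X k. x <= X (Suc k) & rE nu x = 0"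
  by (rule IVT2) (use s1 s2 le has_real_derivative_rE[OF nu] in "auto intro: DERIV_isCont")
 then obtain x where "x >= X k" "rE nu x = 0" by blast
 thus ?thesis using big[OF k(1)] by (intro exI[of _ x]) auto
qed

lemma zeros_isolated:
 assumes s: "s >= 0" shows "\<forall>\<^sub>F x in at s. rE nu x ~= 0"
proof (cases "rE nu s = 0")
 case False
 have "isCont (rE nu) s" using has_real_derivative_rE[OF nu] by (rule DERIV_isCont)
 thus ?thesis using False by (intro tendsto_imp_eventually_ne[of _ "rE nu s"]) (auto simp: isCont_def)
next
 case True
 hence s0: "s > 0" using s rE_0[OF nu] by (cases "s = 0") auto
 have "((%x. (rE nu x - rE nu s) / (x - s)) \<longlongrightarrow> - (s / 2) * rE (nu + 1) s) (at s)"
  using has_real_derivative_rE[OF nu, of s] by (simp add: has_field_derivative_iff)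
 moreover have "- (s / 2) * rE (nu + 1) s ~= 0" using s0 simple_zero[OF s0 True] by simp
 ultimately have "\<forall>\<^sub>F x in at s. (rE nu x - rE nu s) / (x - s) ~= 0"
  by (rule tendsto_imp_eventually_ne)
 thus ?thesis by eventually_elim (use True in auto)
qed

abbreviation "bz \<equiv> bessel_zero nu"

text \<open>By isolation the zeros beyond s stay a distance e away from s, hence form a nonempty
  closed set bounded below. The infimum is attained and is the next zero. The dummy start s = 0
  fits, because isolation is proved for s >= 0.\<close>

lemma bessel_zero_step:
 assumes s: "s >= 0"
 defines "t \<equiv> Inf {x. x > s & besselJ nu x = 0}"
 shows "t > s" "rE nu t = 0" "!!x. s < x ==> x < t ==> rE nu x ~= 0"
proof -
 have J: "besselJ nu x = 0 \<longleftrightarrow> rE nu x = 0" if "x > s" for x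
  using that s by (subst besselJ_eq[OF nu]) auto
 define S where "S = {x. x > s & rE nu x = 0}"
 have S: "{x. x > s & besselJ nu x = 0} = S" using J by (auto simp: S_def)
 obtain e where e: "e > 0" "!!x. x ~= s ==> dist x s < e ==> rE nu x ~= 0"
  using zeros_isolated[OF s] unfolding eventually_at by auto
 have gap: "s + e <= x" if "x > s" "rE nu x = 0" for x
  using e(2)[of x] that by (force simp: dist_real_def)
 have S': "S = {s + e..} \<inter> (rE nu -` {0})"
  using e(1) gap by (auto simp: S_def)
 have cont: "continuous_on UNIV (rE nu)"
  using has_real_derivative_rE[OF nu] by (auto intro!: continuous_at_imp_continuous_on DERIV_isCont)
 have clS: "closed S" unfolding S' by (intro closed_Int closed_vimage cont) auto
 have bb: "bdd_below S" by (rule bdd_belowI[of _ s]) (auto simp: S_def)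
 have "S ~= {}" using zeros_unbounded[of s] by (auto simp: S_def)
 from closed_contains_Inf[OF this bb clS] have "t : S" unfolding t_def S .
 thus "t > s" "rE nu t = 0" by (auto simp: S_def)
 fix x assume x: "s < x" "x < t"
 show "rE nu x ~= 0"
 proof
  assume "rE nu x = 0"
  hence "t <= x" unfolding t_def S using x bb by (intro cInf_lower) (auto simp: S_def)
  thus False using x by simp
 qed
qed

lemma bz_nonneg: "bz j >= 0"
proof (induction j)
 case (Suc j) thus ?case using bessel_zero_step(1)[OF Suc] by simp
qed simp

lemma bz_Suc: "bz (Suc j) > bz j" "rE nu (bz (Suc j)) = 0"
  "!!x. bz j < x ==> x < bz (Suc j) ==> rE nu x ~= 0"
 using bessel_zero_step[OF bz_nonneg[of j]] by auto

lemma strict_mono_bz: "strict_mono bz"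
 by (rule strict_monoI_Suc) (rule bz_Suc(1))

lemma bz_pos: "bz (Suc j) > 0"
 using bz_Suc(1)[of j] bz_nonneg[of j] by linarith

text \<open>A bounded increasing sequence of zeros would converge to a point at which zeros are not
  isolated.\<close>

lemma bz_unbounded: "\<exists>j. bz j > B"
proof (rule ccontr)
 assume "\<not> ?thesis"
 hence B: "!!j. bz j <= B" by (auto simp: not_less)
 have "incseq bz" using strict_mono_bz by (simp add: strict_mono_mono)
 then obtain L where L: "bz \<longlonglongrightarrow> L" "\<forall>i. bz i <= L"
 proof -
  have "\<forall>i. bz i <= B" using B by blast
  from incseq_convergent[OF \<open>incseq bz\<close> this] that show ?thesis by blast
 qed
 have less: "bz i < L" for i using L(2) bz_Suc(1)[of i] by (meson less_le_trans)
 have "L >= 0" using L(2) bz_nonneg[of 0] by (meson order_trans)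
 from zeros_isolated[OF this] obtain e where e: "e > 0" "!!x. x ~= L ==> dist x L < e ==> rE nu x ~= 0"
  unfolding eventually_at by auto
 have "\<forall>\<^sub>F i in sequentially. dist (bz (Suc i)) L < e"
  using LIMSEQ_Suc[OF L(1)] e(1) by (rule tendstoD)
 then obtain i where "dist (bz (Suc i)) L < e" by (auto simp: eventually_sequentially)
 thus False using e(2)[of "bz (Suc i)"] bz_Suc(2)[of i] less[of "Suc i"] by auto
qed

lemma zero_imp_bz:
 assumes x: "x > 0" "rE nu x = 0" shows "\<exists>j. x = bz (Suc j)"
proof -
 have ex: "\<exists>j. x <= bz j" using bz_unbounded[of x] less_imp_le by blast
 define j where "j = (LEAST j. x <= bz j)"
 have j: "x <= bz j" unfolding j_def using ex by (rule LeastI_ex)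
 have "j ~= 0" using j x by (cases "j = 0") auto
 then obtain i where i: "j = Suc i" by (cases j) auto
 have "\<not> x <= bz i" using not_less_Least[of i "%j. x <= bz j"] i by (simp add: j_def)
 hence "x = bz (Suc i)" using j i bz_Suc(3)[of i x] x by force
 thus ?thesis by blast
qed

lemma finite_bz_below: "finite {j. bz (Suc j) < R}"
proof -
 obtain m where m: "bz m > R" using bz_unbounded by blast
 have "j < m" if "bz (Suc j) < R" for j
 proof (rule ccontr)
  assume "\<not> j < m"
  hence "bz m <= bz (Suc j)" using strict_mono_less_eq[OF strict_mono_bz, of m "Suc j"] by simp
  thus False using m that by simp
 qed
 hence "{j. bz (Suc j) < R} <= {..<m}" by auto
 thus ?thesis by (rule finite_subset) simp
qed

end

section \<open>The kernel as a contour integral\<close>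

lemma contour_integral_linepath_same_Im:
 assumes "a < b"
 shows "contour_integral (linepath (Complex a c) (Complex b c)) f = integral {a..b} (%x. f (Complex x c))"
proof -
 let ?p = "Complex a c" and ?q = "Complex b c" and ?p' = "Complex (-c) a" and ?q' = "Complex (-c) b"
 \<comment> \<open>Multiplication by i turns the horizontal segment into a vertical one.\<close>
 have rot: "- \<i> * linepath ?p' ?q' t = linepath ?p ?q t" for t
  by (simp add: linepath_def Complex_eq scaleR_conv_of_real algebra_simps)
 have "\<i> * contour_integral (linepath ?p ?q) f = \<i> * ((?q - ?p) * integral {0..1} (%t. f (linepath ?p ?q t)))"
  by (simp add: contour_integral_integral)
 also have "... = (?q' - ?p') * integral {0..1} (%t. f (- \<i> * linepath ?p' ?q' t))"
  unfolding rot by (simp add: Complex_eq algebra_simps)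
 also have "... = contour_integral (linepath ?p' ?q') (%w. f (- \<i> * w))"
  by (simp add: contour_integral_integral)
 also have "... = \<i> * integral {a..b} (%x. f (- \<i> * Complex (-c) x))"
  using assms by (intro contour_integral_linepath_same_Re) auto
 also have "(%x. f (- \<i> * Complex (-c) x)) = (%x. f (Complex x c))"
  by (simp add: Complex_eq algebra_simps)
 finally show ?thesis by simp
qed

lemma rectangle_residue:
 assumes a: "0 < a" "a < b" "b < R" and T: "T > 0"
  and pts: "finite pts" "pts <= of_real ` {a<..<b}"
  and hol: "h holomorphic_on {z. 0 < Re z & Re z < R} - pts"
 shows "integral {a..b} (%r. h (Complex r (-T))) + \<i> * integral {-T..T} (%t. h (Complex b t))
   - integral {a..b} (%r. h (Complex r T)) - \<i> * integral {-T..T} (%t. h (Complex a t))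
   = 2*pi * \<i> * (\<Sum>p\<in>pts. residue h p)"
proof -
 define S where "S = {z. 0 < Re z & Re z < R}"
 define g where "g = rectpath (Complex a (-T)) (Complex b T)"
 have opS: "open S" and cvS: "convex S"
  unfolding S_def using open_Int[OF open_halfspace_Re_gt open_halfspace_Re_lt, of 0 R]
   convex_Int[OF convex_halfspace_Re_gt convex_halfspace_Re_lt, of 0 R] by (simp_all add: Collect_conj_eq)
 have ptsbox: "p : box (Complex a (-T)) (Complex b T)" if "p : pts" for p
  using that pts(2) T by (auto simp: in_box_complex_iff)
 have cbS: "cbox (Complex a (-T)) (Complex b T) <= S"
  using a by (auto simp: S_def in_cbox_complex_iff)
 have img: "path_image g <= S - pts"
  unfolding g_def using cbS ptsbox a T
  by (subst path_image_rectpath_cbox_minus_box) auto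
 have "contour_integral g h = 2*pi * \<i> * (\<Sum>p\<in>pts. winding_number g p * residue h p)"
 proof (rule Residue_theorem[OF opS convex_connected[OF cvS] pts(1) _ _ _ img])
  show "\<forall>z. z \<notin> S \<longrightarrow> winding_number g z = 0"
   unfolding g_def using cbS a T by (auto intro!: winding_number_rectpath_outside)
 qed (use hol in "auto simp: g_def S_def")
 also have "(\<Sum>p\<in>pts. winding_number g p * residue h p) = (\<Sum>p\<in>pts. residue h p)"
  unfolding g_def by (intro sum.cong refl) (simp add: winding_number_rectpath ptsbox)
 finally have 1: "contour_integral g h = 2*pi * \<i> * (\<Sum>p\<in>pts. residue h p)" .
 have cont: "continuous_on (path_image g) h"
  using hol img unfolding S_def by (meson holomorphic_on_imp_continuous_on continuous_on_subset)
 have im: "path_image g = closed_segment (Complex a (-T)) (Complex b (-T)) \<union> closed_segment (Complex b (-T)) (Complex b T)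
   \<union> closed_segment (Complex b T) (Complex a T) \<union> closed_segment (Complex a T) (Complex a (-T))"
  unfolding g_def rectpath_def Let_def by (simp add: path_image_join Un_assoc)
 have ci: "h contour_integrable_on linepath p q" if "closed_segment p q <= path_image g" for p q
  by (intro contour_integrable_continuous_linepath continuous_on_subset[OF cont that])
 have i1: "h contour_integrable_on linepath (Complex a (-T)) (Complex b (-T))"
  and i2: "h contour_integrable_on linepath (Complex b (-T)) (Complex b T)"
  and i3: "h contour_integrable_on linepath (Complex b T) (Complex a T)"
  and i4: "h contour_integrable_on linepath (Complex a T) (Complex a (-T))"
  by (rule ci, unfold im, blast)+
 have rev: "contour_integral (linepath p q) h = - contour_integral (linepath q p) h" for p q
  using contour_integral_reversepath[OF valid_path_linepath, of q p h] by simp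
 have "contour_integral g h = contour_integral (linepath (Complex a (-T)) (Complex b (-T))) h
   + (contour_integral (linepath (Complex b (-T)) (Complex b T)) h
   + (contour_integral (linepath (Complex b T) (Complex a T)) h
   + contour_integral (linepath (Complex a T) (Complex a (-T))) h))"
  unfolding g_def rectpath_def Let_def using i1 i2 i3 i4
  by (simp add: contour_integrable_joinI)
 also have "... = integral {a..b} (%r. h (Complex r (-T))) + (\<i> * integral {-T..T} (%t. h (Complex b t))
   + (- integral {a..b} (%r. h (Complex r T)) + - (\<i> * integral {-T..T} (%t. h (Complex a t)))))"
  unfolding rev[of "Complex b T" "Complex a T"] rev[of "Complex a T" "Complex a (-T)"] using a T
  by (simp add: contour_integral_linepath_same_Re contour_integral_linepath_same_Im)
 finally show ?thesis unfolding 1 by simp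
qed

text \<open>h is holomorphic only inside the strip, so the residue theorem is applied to rectangles
  whose vertical sides lie inside, and these sides move to Re z = 0 and Re z = R by continuity.
  Oddness kills the left side. Conjugation symmetry makes the bottom side the conjugate of the top
  one and folds the right side onto its upper half.\<close>

lemma rectangle_residue_symmetric:
 assumes e0: "0 < e0" "e0 < R0" "R0 < R" and T: "T > 0"
  and pts: "finite pts" "pts <= of_real ` {e0<..<R0}"
  and hol: "h holomorphic_on {z. 0 < Re z & Re z < R} - pts"
  and c1: "continuous_on {0..R} (%r. h (Complex r T))"
  and c2: "continuous_on ({0..e0} \<times> {-T..T}) (%(r, t). h (Complex r t))"
  and c3: "continuous_on ({R0..R} \<times> {-T..T}) (%(r, t). h (Complex r t))"
  and odd: "!!t. h (Complex 0 (-t)) = - h (Complex 0 t)"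
  and sym: "!!z. 0 <= Re z ==> Re z <= R ==> h (cnj z) = cnj (h z)"
 shows "of_real pi * (\<Sum>p\<in>pts. residue h p) =
  complex_of_real (Re (integral {0..T} (%t. h (Complex R t))) - Im (integral {0..R} (%r. h (Complex r T))))"
proof -
 define G where "G = (%u. integral {0..u} (%r. h (Complex r T)))"
 define V where "V = (%b. integral {-T..T} (%t. h (Complex b t)))"
 define Sg where "Sg = 2*pi * \<i> * (\<Sum>p\<in>pts. residue h p)"
 define al where "al = (%s. s * e0)"
 define be where "be = (%s. R - s * (R - R0))"
 have int1: "(%r. h (Complex r T)) integrable_on {0..R}" using c1 by (rule integrable_continuous_real)
 have contG: "continuous_on {0..R} G" unfolding G_def by (rule indefinite_integral_continuous_1[OF int1])
 have contV: "continuous_on {0..e0} V" "continuous_on {R0..R} V"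
  using integral_continuous_on_param[of "{0..e0}" "-T" T "%r t. h (Complex r t)"] c2
   integral_continuous_on_param[of "{R0..R}" "-T" T "%r t. h (Complex r t)"] c3
  by (simp_all add: V_def[abs_def])
 have ab: "0 <= al s" "al s <= e0" "R0 <= be s" "be s <= R" if "s : {0..1}" for s
 proof -
  show "0 <= al s" "be s <= R" using that e0 by (auto simp: al_def be_def)
  show "al s <= e0" using that e0 by (simp add: al_def mult_left_le_one_le)
  have "s * (R - R0) <= 1*(R - R0)" using that e0 by (intro mult_right_mono) auto
  thus "R0 <= be s" by (simp add: be_def)
 qed
 have ab': "0 <= be s" "al s <= R" if "s : {0..1}" for s
  using ab[OF that] e0 by linarith+
 \<comment> \<open>The boundary integral of the rectangle between \<open>al s\<close> and
   \<open>be s\<close>. It equals the residue sum for s > 0, and its continuity carries the identity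
   to s = 0.\<close>
 define X where "X = (%s. cnj (G (be s) - G (al s)) + \<i> * V (be s) - (G (be s) - G (al s)) - \<i> * V (al s))"
 have contX: "continuous_on {0..1} X"
 proof -
  have ca: "continuous_on {0..1} al" "continuous_on {0..1} be"
   unfolding al_def be_def by (intro continuous_intros)+
  have "continuous_on {0..1} (%s. G (be s))" "continuous_on {0..1} (%s. G (al s))"
   using ab ab' by (auto intro!: continuous_on_compose2[OF contG] ca)
  moreover have "continuous_on {0..1} (%s. V (be s))" "continuous_on {0..1} (%s. V (al s))"
   by (rule continuous_on_compose2[OF contV(2) ca(2)], use ab in force)
    (rule continuous_on_compose2[OF contV(1) ca(1)], use ab in force)
  ultimately show ?thesis unfolding X_def by (intro continuous_intros)
 qed
 have X1: "X s = Sg" if s: "s : {0<..1}" for s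
 proof -
  have st: "0 < al s" "al s < be s" "be s < R" "al s <= e0" "R0 <= be s"
  proof -
   show "0 < al s" "be s < R" using s e0 by (auto simp: al_def be_def)
   show le: "al s <= e0" "R0 <= be s" using s ab[of s] by auto
   thus "al s < be s" using e0 by linarith
  qed
  have Gd: "G (be s) - G (al s) = integral {al s..be s} (%r. h (Complex r T))"
  proof -
   have "(%r. h (Complex r T)) integrable_on {0..be s}"
    using int1 by (rule integrable_on_subinterval) (use st in auto)
   from Henstock_Kurzweil_Integration.integral_combine[of 0 "al s" "be s", OF _ _ this] st
   show ?thesis by (simp add: G_def algebra_simps)
  qed
  have cn: "cnj (integral {al s..be s} (%r. h (Complex r T))) = integral {al s..be s} (%r. h (Complex r (-T)))"
  proof -
   have "cnj (h (Complex r T)) = h (Complex r (-T))" if "r : {al s..be s}" for r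
    using sym[of "Complex r T"] that st by (simp add: complex_cnj)
   thus ?thesis unfolding integral_cnj by (rule integral_cong)
  qed
  show ?thesis unfolding X_def Gd cn V_def Sg_def
   by (rule rectangle_residue[OF st(1-3) T pts(1) _ hol])
    (use pts(2) st in "auto simp: image_iff subset_iff")
 qed
 have X0: "X 0 = Sg"
 proof (rule tendsto_unique)
  show "(X \<longlongrightarrow> X 0) (at_right 0)"
   using contX by (simp add: continuous_on_Icc_at_rightD)
  show "(X \<longlongrightarrow> Sg) (at_right 0)"
   by (rule tendsto_eventually) (use X1 in "auto simp: eventually_at_right_field intro!: exI[of _ 1]")
 qed simp
 \<comment> \<open>The integral of an odd function over a symmetric interval equals its own
   negative.\<close>
 have V0: "V 0 = 0"
 proof -
  have "integral {- T..- (- T)} (%t. h (Complex 0 (-t))) = V 0"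
   unfolding V_def by (subst Henstock_Kurzweil_Integration.integral_reflect_real) simp
  thus ?thesis unfolding odd by (simp add: V_def)
 qed
 have VR: "V R = integral {0..T} (%t. h (Complex R t)) + cnj (integral {0..T} (%t. h (Complex R t)))"
 proof -
  have cR: "continuous_on {-T..T} (%t. h (Complex R t))"
  proof -
   have "continuous_on {-T..T} (%t. (%(r, t). h (Complex r t)) (R, t))"
    by (rule continuous_on_compose2[OF c3]) (use e0 in "auto intro!: continuous_intros")
   thus ?thesis by simp
  qed
  have "V R = integral {-T..0} (%t. h (Complex R t)) + integral {0..T} (%t. h (Complex R t))"
   unfolding V_def using T Henstock_Kurzweil_Integration.integral_combine[of "-T" 0 T, OF _ _ integrable_continuous_real[OF cR]] by simp
  also have "integral {-T..0} (%t. h (Complex R t)) = integral {-T..-0} (%t. cnj (h (Complex R (-t))))"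
   using sym[of "Complex R _"] e0 by (simp add: complex_cnj)
  also have "... = integral {0..T} (%t. cnj (h (Complex R t)))"
   by (rule Henstock_Kurzweil_Integration.integral_reflect_real[of T 0 "%t. cnj (h (Complex R t))"])
  finally show ?thesis by (simp add: integral_cnj)
 qed
 have G0: "G 0 = 0" by (simp add: G_def)
 have "X 0 = cnj (G R) - G R + \<i> * V R"
  unfolding X_def al_def be_def by (simp add: V0 G0)
 hence "Sg = cnj (G R) - G R + \<i> * (integral {0..T} (%t. h (Complex R t)) + cnj (integral {0..T} (%t. h (Complex R t))))"
  unfolding X0 VR .
 also have "... = 2*\<i> * of_real (Re (integral {0..T} (%t. h (Complex R t))) - Im (G R))"
  by (simp add: complex_eq_iff)
 finally have "2*\<i> * (of_real pi * (\<Sum>p\<in>pts. residue h p)) = 2*\<i> * of_real (Re (integral {0..T} (%t. h (Complex R t))) - Im (G R))"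
  by (simp add: Sg_def mult_ac)
 thus ?thesis by (simp add: G_def)
qed

context bessel_jost
begin

lemma F_scale:
 assumes z: "Re z > 0" and u: "u > 0"
 shows "F (z * of_real u) = z powr of_real (nu + 1/2) * of_real (u powr (nu + 1/2)) * bE nu (z * of_real u)"
proof -
 have z0: "z ~= 0" using z by auto
 have "(z * of_real u) powr of_real (nu + 1/2) = exp (of_real (nu + 1/2) * (of_real (ln u) + Ln z))"
  using Ln_times_of_real[OF u z0] z0 u by (simp add: powr_def mult.commute Ln_of_real)
 also have "... = z powr of_real (nu + 1/2) * of_real (u powr (nu + 1/2))"
  using z0 u by (simp add: powr_def exp_add algebra_simps flip: exp_of_real)
 finally show ?thesis by (simp add: bF_def)
qed

text \<open>The quotient of the solutions D(z,x) and F(zx) has derivative Wronskian/F^2 in x and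
  vanishes at x = 1. The resulting integral formula makes sense on the imaginary axis once the
  powers of z cancel.\<close>

lemma D_over_F:
 assumes z: "Re z > 0" and x: "0 < x" "x <= 1"
  and nz: "!!u. x <= u ==> u <= 1 ==> bE nu (z * of_real u) ~= 0"
 shows "D z x = - 2*\<i> * z * F z * F (z * of_real x) * integral {x..1} (%u. 1/(F (z * of_real u))\<^sup>2)"
proof -
 have Fnz: "F (z * of_real u) ~= 0" if "x <= u" "u <= 1" for u
  using F_scale[OF z, of u] nz[OF that] that x z by auto
 define n where "n = (%u. D z u / F (z * of_real u))"
 have "((%u. 2*\<i> * z * F z * (1/(F (z * of_real u))\<^sup>2)) has_integral (n 1 - n x)) {x..1}"
 proof (rule fundamental_theorem_of_calculus[OF x(2)])
  fix u assume u: "u : {x..1}"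
  hence u0: "u > 0" and Fu: "F (z * of_real u) ~= 0" using x Fnz by auto
  have Rzu: "Re (z * of_real u) > 0" using z u0 by simp
  let ?w = "z * of_real u"
  have num: "((f' ?w * fc z - fc' ?w * f z) * F ?w - (f ?w * fc z - fc ?w * f z) * F' ?w) * z = 2*\<i> * z * F z"
  proof -
   have "((f' ?w * fc z - fc' ?w * f z) * F ?w - (f ?w * fc z - fc ?w * f z) * F' ?w) * z
    = z * (fc z * (F ?w * f' ?w - F' ?w * f ?w) - f z * (F ?w * fc' ?w - F' ?w * fc ?w))"
    by (simp add: algebra_simps)
   also have "... = z * (2*\<i> * (cnj beta * f z + beta * fc z))"
    unfolding wronskian_F_f[OF Rzu] wronskian_F_fc[OF Rzu] by (simp add: algebra_simps)
   also have "... = 2*\<i> * z * F z" unfolding F_eq[OF z] by simp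
   finally show ?thesis .
  qed
  have d: "((%w. (f w * fc z - fc w * f z) / F w) has_field_derivative
   ((f' ?w * fc z - fc' ?w * f z) * F ?w - (f ?w * fc z - fc ?w * f z) * F' ?w) / (F ?w * F ?w)) (at ?w)"
   by (rule DERIV_divide[OF DERIV_diff[OF DERIV_cmult_right[OF f_deriv[OF Rzu]] DERIV_cmult_right[OF fc_deriv[OF Rzu]]] F_deriv[OF Rzu] Fu])
  have "((%y. z * y) has_field_derivative z) (at (of_real u))" by (auto intro!: derivative_eq_intros)
  from has_vector_derivative_real_field[OF DERIV_chain2[OF d this]]
  show "(n has_vector_derivative 2*\<i> * z * F z * (1/(F ?w)\<^sup>2)) (at u within {x..1})"
   unfolding n_def D_def using num by (simp add: power2_eq_square)
 qed
 from integral_unique[OF this] have "integral {x..1} (%u. 2*\<i> * z * F z * (1/(F (z * of_real u))\<^sup>2)) = - n x"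
  by (simp add: n_def D_def)
 hence "- n x = 2*\<i> * z * F z * integral {x..1} (%u. 1/(F (z * of_real u))\<^sup>2)"
  by (simp only: integral_mult_right)
 hence "n x * F (z * of_real x) = - (2*\<i> * z * F z * integral {x..1} (%u. 1/(F (z * of_real u))\<^sup>2)) * F (z * of_real x)"
  by (metis add.inverse_inverse)
 thus ?thesis using Fnz[of x] x by (simp add: n_def mult_ac)
qed

definition Qint :: "real => complex => complex" where
 "Qint x z = integral {x..1} (%u. of_real (u powr (- (2*nu + 1))) / (bE nu (z * of_real u))\<^sup>2)"

text \<open>For Re z > 0 this is the Green function form, whose poles are the zeros of F. The other
  branch is the continuous extension to the imaginary axis supplied by \<open>D_over_F\<close>;
  there all factors except z are even, which makes the oddness visible.\<close>

definition hk :: "real => real => real => real => complex => complex" where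
 "hk delta R x y z = (if Re z > 0
  then - \<i> * (1 - z\<^sup>2/R\<^sup>2) powr of_real delta * (D z x * F (z * of_real y) / F z)
  else - 2*z * (1 - z\<^sup>2/R\<^sup>2) powr of_real delta * of_real ((x * y) powr (nu + 1/2))
     * bE nu (z * of_real x) * bE nu (z * of_real y) * Qint x z)"

lemma hk_alt:
 assumes z: "Re z >= 0" and x: "0 < x" "x <= 1" and y: "0 < y"
  and nz: "!!u. x <= u ==> u <= 1 ==> bE nu (z * of_real u) ~= 0"
 shows "hk delta R x y z = - 2*z * (1 - z\<^sup>2/R\<^sup>2) powr of_real delta * of_real ((x * y) powr (nu + 1/2))
     * bE nu (z * of_real x) * bE nu (z * of_real y) * Qint x z"
proof (cases "Re z > 0")
 case True
 let ?p = "z powr of_real (nu + 1/2) :: complex"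
 have p0: "?p ~= 0" using True by auto
 have F1: "F z = ?p * bE nu z" using F_scale[OF True, of 1] by simp
 have Fz0: "F z ~= 0" using F1 p0 nz[of 1] x by simp
 have "integral {x..1} (%u. 1/(F (z * of_real u))\<^sup>2) = integral {x..1} (%u. 1/?p\<^sup>2*(of_real (u powr (- (2*nu + 1))) / (bE nu (z * of_real u))\<^sup>2))"
 proof (rule integral_cong)
  fix u assume "u : {x..1}"
  hence u: "u > 0" using x by auto
  define A where "A = complex_of_real (u powr (nu + 1/2))"
  define E where "E = bE nu (z * of_real u)"
  have AA: "A * A = of_real (u powr (2*nu + 1))"
   unfolding A_def by (simp flip: of_real_mult powr_add)
  have "(F (z * of_real u))\<^sup>2 = ?p\<^sup>2*(A * A) * E\<^sup>2"
   unfolding F_scale[OF True u] A_def[symmetric] E_def[symmetric] by (simp add: power2_eq_square)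
  moreover have "complex_of_real (u powr (- (2*nu + 1))) = 1/(A * A)"
   unfolding AA by (simp only: powr_minus_divide of_real_divide of_real_1)
  ultimately show "1/(F (z * of_real u))\<^sup>2 = 1/?p\<^sup>2*(of_real (u powr (- (2*nu + 1))) / (bE nu (z * of_real u))\<^sup>2)"
   unfolding E_def[symmetric] by simp
 qed
 also have "... = 1/?p\<^sup>2*Qint x z" unfolding Qint_def by (rule integral_mult_right)
 finally have "D z x * F (z * of_real y) / F z = - 2*\<i> * z * F (z * of_real x) * F (z * of_real y) * (1/?p\<^sup>2*Qint x z)"
  using D_over_F[OF True x nz] Fz0 by simp
 also have "... = - 2*\<i> * z * (of_real (x powr (nu + 1/2)) * of_real (y powr (nu + 1/2))) * bE nu (z * of_real x) * bE nu (z * of_real y) * Qint x z"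
  unfolding F_scale[OF True x(1)] F_scale[OF True y] using p0 by (simp add: field_simps power2_eq_square)
 also have "complex_of_real (x powr (nu + 1/2)) * of_real (y powr (nu + 1/2)) = of_real ((x * y) powr (nu + 1/2))"
  using x y by (simp add: powr_mult)
 finally show ?thesis using True by (simp add: hk_def mult_ac)
qed (simp add: hk_def)

lemma bE_strip_nonzero:
 assumes z: "0 <= Re z" "Re z < bz 1"
 shows "bE nu z ~= 0"
proof -
 consider "Re z = 0" | "Re z > 0" "Im z ~= 0" | "Re z > 0" "Im z = 0" using z by linarith
 thus ?thesis
 proof cases
  case 1
  obtain r where "bE nu (\<i> * of_real (Im z)) = of_real r" "r > 0" by (rule bE_imag_axis[OF nu])
  moreover have "z = \<i> * of_real (Im z)" using 1 by (simp add: complex_eq_iff)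
  ultimately show ?thesis by auto
 next
  case 2 thus ?thesis by (rule bE_nonzero_nonreal[OF nu])
 next
  case 3
  hence "rE nu (Re z) ~= 0" using z bz_Suc(3)[of 0 "Re z"] by simp
  moreover have "z = of_real (Re z)" using 3 by (simp add: complex_eq_iff)
  ultimately show ?thesis using bE_of_real[OF nu, of "Re z"] by (metis of_real_eq_0_iff)
 qed
qed

lemma F_eq_0_iff:
 assumes z: "Re z > 0" shows "F z = 0 \<longleftrightarrow> (\<exists>j. z = of_real (bz (Suc j)))"
proof -
 have "F z = 0 \<longleftrightarrow> bE nu z = 0" using z by (auto simp: bF_def)
 also have "... \<longleftrightarrow> (\<exists>j. z = of_real (bz (Suc j)))"
 proof
  assume E: "bE nu z = 0"
  hence "Im z = 0" using bE_nonzero_nonreal[OF nu z] by blast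
  hence zr: "z = of_real (Re z)" by (simp add: complex_eq_iff)
  hence "rE nu (Re z) = 0" using E bE_of_real[OF nu, of "Re z"] by (metis of_real_eq_0_iff)
  thus "\<exists>j. z = of_real (bz (Suc j))" using zero_imp_bz[OF z] zr by metis
 next
  assume "\<exists>j. z = of_real (bz (Suc j))"
  thus "bE nu z = 0" using bE_of_real[OF nu] bz_Suc(2) by auto
 qed
 finally show ?thesis .
qed

lemma cnj_hk_aux:
 assumes "Re z > 0" shows "F (cnj z) = cnj (F z)" "D (cnj z) x = - cnj (D z x)"
proof -
 have "cnj (z powr of_real (nu + 1/2)) = cnj z powr of_real (nu + 1/2)"
  using assms by (subst cnj_powr) auto
 thus "F (cnj z) = cnj (F z)" using cnj_bE[OF nu, of z] by (simp add: bF_def)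
 show "D (cnj z) x = - cnj (D z x)" by (simp add: D_def fc_def)
qed

lemma cnj_hk:
 assumes R: "R > 0" "Re z <= R" "Re z >= 0" and y: "y > 0"
 shows "hk delta R x y (cnj z) = cnj (hk delta R x y z)"
proof -
 define w where "w = 1 - z\<^sup>2/(of_real R)\<^sup>2"
 \<comment> \<open>In the closed strip the base of the power meets the cut (-infinity, 0] only at
   the value 0, so the principal power commutes with conjugation.\<close>
 have w: "w \<notin> \<real>\<^sub>\<le>\<^sub>0 \<or> w = 0"
 proof (rule ccontr)
  assume "\<not> ?thesis"
  hence w1: "Re w <= 0" "Im w = 0" "w ~= 0" by (auto simp: complex_nonpos_Reals_iff)
  have Rew: "Re w = 1 - ((Re z)\<^sup>2 - (Im z)\<^sup>2) / R\<^sup>2" and Imw: "Im w = - (2*Re z * Im z) / R\<^sup>2"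
   by (simp_all add: w_def power2_eq_square flip: of_real_mult)
  have "(Re z)\<^sup>2 <= R\<^sup>2" using R by (intro power_mono) auto
  hence "(Im z)\<^sup>2/R\<^sup>2 <= Re w" unfolding Rew using R by (simp add: field_simps)
  hence I: "Im z = 0" using w1(1) R by (smt (verit) divide_pos_pos zero_less_power2)
  hence "1 <= (Re z)\<^sup>2/R\<^sup>2" using w1(1) Rew by simp
  hence "(Re z)\<^sup>2 = R\<^sup>2" using \<open>(Re z)\<^sup>2 <= R\<^sup>2\<close> R by (simp add: field_simps)
  hence "w = 0" using I R Rew Imw by (simp add: complex_eq_iff)
  thus False using w1 by simp
 qed
 have wc: "1 - (cnj z)\<^sup>2/(of_real R)\<^sup>2 = cnj w" by (simp add: w_def)
 have pc: "cnj w powr of_real delta = cnj (w powr of_real delta)"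
  using w by (subst cnj_powr) (auto simp: complex_nonpos_Reals_iff)
 show ?thesis
 proof (cases "Re z > 0")
  case True
  have "F (cnj (z * of_real y)) = cnj (F (z * of_real y))" using True y by (intro cnj_hk_aux) auto
  thus ?thesis using True cnj_hk_aux[OF True] unfolding hk_def of_real_power wc w_def[symmetric] pc
   by simp
 next
  case False
  have Q: "Qint x (cnj z) = cnj (Qint x z)"
   unfolding Qint_def integral_cnj by (intro integral_cong) (simp add: cnj_bE[OF nu])
  show ?thesis using False Q unfolding hk_def of_real_power wc w_def[symmetric] pc
   by (simp add: cnj_bE[OF nu])
 qed
qed

end

declare bessel_zero.simps(2) [simp del]

lemma residue_simple_quotient:
 assumes s: "open s" "z : s" and N: "N holomorphic_on s" and G: "G holomorphic_on s"
  and nz: "!!w. w : s ==> w ~= z ==> G w ~= 0" and G0: "G z = 0"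
  and G': "(G has_field_derivative G') (at z)" "G' ~= 0"
 shows "residue (%w. N w / G w) z = N z / G'"
proof (rule residue_simple'[OF s])
 show "(%w. N w / G w) holomorphic_on s - {z}"
  by (intro holomorphic_intros holomorphic_on_subset[OF N] holomorphic_on_subset[OF G]) (use nz in auto)
 have "((%w. (G w - G z) / (w - z)) \<longlongrightarrow> G') (at z)"
  using G'(1) by (simp add: has_field_derivative_iff)
 moreover have "(N \<longlongrightarrow> N z) (at z)"
  using N s by (meson continuous_on_eq_continuous_at holomorphic_on_imp_continuous_on isCont_def)
 ultimately have lim: "((%w. N w / ((G w - G z) / (w - z))) \<longlongrightarrow> N z / G') (at z)"
  using G'(2) by (intro tendsto_divide)
 have eq: "N w / ((G w - G z) / (w - z)) = N w / G w * (w - z)" for w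
  by (simp add: G0)
 show "((%w. N w / G w * (w - z)) \<longlongrightarrow> N z / G') (at z)" using lim unfolding eq .
qed

context bessel_jost
begin

lemma Re_one_minus_sq:
 fixes z :: complex
 assumes "R > 0"
 shows "Re (1 - z\<^sup>2 / of_real (R\<^sup>2)) = 1 - ((Re z)\<^sup>2 - (Im z)\<^sup>2) / R\<^sup>2"
 using assms by (simp add: power2_eq_square flip: of_real_mult)

lemma Re_one_minus_sq_nonneg:
 fixes z :: complex
 assumes "R > 0" "0 <= Re z" "Re z <= R"
 shows "Re (1 - z\<^sup>2 / of_real (R\<^sup>2)) >= 0"
proof -
 have "(Re z)\<^sup>2 <= R\<^sup>2" using assms by (intro power_mono) auto
 hence "(Re z)\<^sup>2 - (Im z)\<^sup>2 <= R\<^sup>2" using zero_le_power2[of "Im z"] by linarith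
 hence "((Re z)\<^sup>2 - (Im z)\<^sup>2) / R\<^sup>2 <= 1" using assms(1) by (subst divide_le_eq_1_pos) auto
 thus ?thesis unfolding Re_one_minus_sq[OF assms(1)] by linarith
qed

lemma Re_one_minus_sq_pos:
 fixes z :: complex
 assumes "R > 0" "0 <= Re z" "Re z < R"
 shows "Re (1 - z\<^sup>2 / of_real (R\<^sup>2)) > 0"
proof -
 have "(Re z)\<^sup>2 < R\<^sup>2" using assms by (intro power_strict_mono) auto
 hence "(Re z)\<^sup>2 - (Im z)\<^sup>2 < R\<^sup>2" using zero_le_power2[of "Im z"] by linarith
 hence "((Re z)\<^sup>2 - (Im z)\<^sup>2) / R\<^sup>2 < 1" using assms(1) by (subst divide_less_eq_1_pos) auto
 thus ?thesis unfolding Re_one_minus_sq[OF assms(1)] by linarith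
qed

lemma holomorphic_scaled:
 assumes "!!w. Re w > 0 ==> (g has_field_derivative g' w) (at w)" "x > 0" "S <= RHP"
 shows "(%z. g (z * of_real x)) holomorphic_on S"
proof -
 have "g holomorphic_on RHP" using assms(1) open_RHP by (auto simp: holomorphic_on_open)
 hence "(g \<circ> (%z. z * of_real x)) holomorphic_on S"
  by (rule holomorphic_on_compose_gen[rotated]) (use assms in "auto intro!: holomorphic_intros")
 thus ?thesis by (simp add: o_def)
qed

lemma holomorphic_F: "S <= RHP ==> F holomorphic_on S"
 using holomorphic_scaled[OF F_deriv, of 1] by simp

lemma holomorphic_D:
 assumes "x > 0" "S <= RHP" shows "(%z. D z x) holomorphic_on S"
proof -
 have "f holomorphic_on S" "fc holomorphic_on S"
  using holomorphic_scaled[OF f_deriv, of 1 S] holomorphic_scaled[OF fc_deriv, of 1 S] assms by simp_all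
 thus ?thesis unfolding D_def using assms
  by (intro holomorphic_intros holomorphic_scaled[OF f_deriv] holomorphic_scaled[OF fc_deriv])
qed

definition hkN :: "real => real => real => real => complex => complex" where
 "hkN delta R x y z = - \<i> * (1 - z\<^sup>2/R\<^sup>2) powr of_real delta * (D z x * F (z * of_real y))"

lemma hk_eq_quotient: "Re z > 0 ==> hk delta R x y z = hkN delta R x y z / F z"
 by (simp add: hk_def hkN_def)

lemma holomorphic_hkN:
 assumes R: "R > 0" and xy: "x > 0" "y > 0"
 shows "hkN delta R x y holomorphic_on {z. 0 < Re z & Re z < R}"
 unfolding hkN_def[abs_def]
proof (intro holomorphic_intros)
 fix z assume z: "z : {z. 0 < Re z & Re z < R}"
 have "Re (1 - z\<^sup>2 / of_real (R\<^sup>2)) > 0" by (rule Re_one_minus_sq_pos) (use R z in auto)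
 thus "1 - z\<^sup>2 / of_real (R\<^sup>2) \<notin> \<real>\<^sub>\<le>\<^sub>0" by (auto simp: complex_nonpos_Reals_iff simp del: minus_complex.sel)
qed (use R xy in "auto intro!: holomorphic_D holomorphic_scaled[OF F_deriv]")

lemma continuous_hk_right:
 assumes R: "R > 0" and xy: "x > 0" "y > 0" and delta: "delta > 0"
  and S: "!!z. z : S ==> 0 < Re z & Re z <= R & F z ~= 0"
 shows "continuous_on S (hk delta R x y)"
proof -
 have SR: "S <= RHP" using S by auto
 have "continuous_on S (%z. - \<i> * (1 - z\<^sup>2/R\<^sup>2) powr of_real delta * (D z x * F (z * of_real y) / F z))"
 proof (intro continuous_intros)
  show "S <= {z. 0 <= Re (1 - z\<^sup>2 / of_real (R\<^sup>2)) \<or> Im (1 - z\<^sup>2 / of_real (R\<^sup>2)) ~= 0}"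
   by (intro subsetI CollectI disjI1 Re_one_minus_sq_nonneg R) (auto dest: S)
  show "continuous_on S (%z. D z x)" "continuous_on S (%z. F (z * of_real y))"
   by (intro holomorphic_on_imp_continuous_on holomorphic_D holomorphic_scaled[OF F_deriv] xy SR; assumption)+
  show "continuous_on S F" by (rule holomorphic_on_imp_continuous_on[OF holomorphic_F[OF SR]])
 qed (use R delta S in auto)
 thus ?thesis by (rule continuous_on_eq) (use S in "auto simp: hk_def")
qed

lemma continuous_hk_left:
 assumes R: "R > 0" and x: "0 < x" "x <= 1" and y: "y > 0" and delta: "delta > 0"
  and e0: "e0 < bz 1" "e0 <= R"
 shows "continuous_on {z. 0 <= Re z & Re z <= e0} (hk delta R x y)"
proof -
 define A where "A = {z. 0 <= Re z & Re z <= e0}"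
 have nz: "bE nu (z * of_real u) ~= 0" if "z : A" "x <= u" "u <= 1" for z u
 proof (rule bE_strip_nonzero)
  show "0 <= Re (z * of_real u)" using that x by (simp add: A_def)
  have "Re z * u <= Re z" using that by (intro mult_right_le_one_le) (use x in "auto simp: A_def")
  thus "Re (z * of_real u) < bz 1" using that e0 by (auto simp: A_def)
 qed
 have "continuous_on A (%z. integral (cbox x 1) (%u. of_real (u powr (- (2*nu + 1))) / (bE nu (z * of_real u))\<^sup>2))"
 proof (rule integral_continuous_on_param)
  show "continuous_on (A \<times> cbox x 1) (%(z, u). complex_of_real (u powr (- (2*nu + 1))) / (bE nu (z * of_real u))\<^sup>2)"
   unfolding split_beta using nz x
   by (intro continuous_intros nu continuous_on_powr') auto
 qed
 hence Q: "continuous_on A (Qint x)" by (simp add: Qint_def[abs_def])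
 have "continuous_on A (%z. - 2*z * (1 - z\<^sup>2/R\<^sup>2) powr of_real delta * of_real ((x * y) powr (nu + 1/2))
     * bE nu (z * of_real x) * bE nu (z * of_real y) * Qint x z)"
 proof (intro continuous_intros Q nu)
  show "A <= {z. 0 <= Re (1 - z\<^sup>2 / of_real (R\<^sup>2)) \<or> Im (1 - z\<^sup>2 / of_real (R\<^sup>2)) ~= 0}"
   by (intro subsetI CollectI disjI1 Re_one_minus_sq_nonneg R) (use e0 in "auto simp: A_def")
 qed (use R delta in auto)
 hence "continuous_on A (hk delta R x y)"
 proof (rule continuous_on_eq)
  fix z assume "z : A"
  thus "- 2*z * (1 - z\<^sup>2/R\<^sup>2) powr of_real delta * of_real ((x * y) powr (nu + 1/2))
     * bE nu (z * of_real x) * bE nu (z * of_real y) * Qint x z = hk delta R x y z"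
   by (intro hk_alt[symmetric] x y nz) (simp_all add: A_def)
 qed
 thus ?thesis by (simp add: A_def)
qed

lemma hk_odd: "hk delta R x y (Complex 0 (-t)) = - hk delta R x y (Complex 0 t)"
proof -
 have e: "Complex 0 (-t) = - Complex 0 t" by (simp add: complex_eq_iff)
 have b: "bE nu (- w * u) = bE nu (w * u)" for w u using bE_minus[of nu "w * u"] by simp
 have q: "Qint x (- w) = Qint x w" for w unfolding Qint_def b ..
 show ?thesis by (simp add: hk_def e q)
qed

definition Kern :: "real => real => real => real => real" where
 "Kern delta R x y = (\<Sum>j | bz (Suc j) < R. (1 - (bz (Suc j))\<^sup>2/R\<^sup>2) powr delta * psi nu (Suc j) x * psi nu (Suc j) y)"

lemma psi_mult:
 assumes "x > 0" "y > 0"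
 shows "psi nu (Suc j) x * psi nu (Suc j) y =
  2*rE nu (bz (Suc j) * x) * rE nu (bz (Suc j) * y) / (bz (Suc j) / 2*rE (nu + 1) (bz (Suc j)))\<^sup>2"
proof -
 define d where "d = bz (Suc j) / 2*rE (nu + 1) (bz (Suc j))"
 have "psi nu (Suc j) x * psi nu (Suc j) y = (sqrt 2 * sqrt 2) * rE nu (bz (Suc j) * x) * rE nu (bz (Suc j) * y) / (\<bar>d\<bar> * \<bar>d\<bar>)"
  using psi_eq[OF nu bz_pos assms(1)] psi_eq[OF nu bz_pos assms(2)] by (simp only: d_def) simp
 thus ?thesis unfolding d_def[symmetric] by (simp add: power2_eq_square)
qed

text \<open>At a zero s of F the solution D(s, x) is proportional to F(sx): F'(s) D(s,x) = 2i F(sx).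
  The residue of the quotient becomes 2 F(sx) F(sy) / F'(s)^2 times the multiplier, which is the
  product of the two normalized eigenfunctions times (xy)^{nu+1/2}.\<close>

lemma residue_hk:
 assumes R: "bz (Suc j) < R" and xy: "x > 0" "y > 0" and delta: "delta > 0"
 shows "residue (hk delta R x y) (of_real (bz (Suc j))) =
  of_real ((1 - (bz (Suc j))\<^sup>2/R\<^sup>2) powr delta * (psi nu (Suc j) x * psi nu (Suc j) y) * (x * y) powr (nu + 1/2))"
proof -
 define s where "s = bz (Suc j)"
 have s: "s > 0" "s < R" using bz_pos R by (auto simp: s_def)
 have R0: "R > 0" using s by linarith
 have rs: "rE nu s = 0" using bz_Suc(2) by (simp add: s_def)
 let ?S = "{z. 0 < Re z & Re z < R}"
 define P where "P = (%j. complex_of_real (bz (Suc j))) ` {j. bz (Suc j) < R}"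
 define U where "U = ?S - (P - {of_real s})"
 have fP: "finite P" unfolding P_def using finite_bz_below by auto
 have "?S = {z. 0 < Re z} \<inter> {z. Re z < R}" by auto
 hence "open ?S" using open_Int[OF open_halfspace_Re_gt open_halfspace_Re_lt] by metis
 hence opU: "open U" unfolding U_def using fP by (intro open_Diff finite_imp_closed finite_Diff)
 have sU: "of_real s : U" using s by (auto simp: U_def)
 have US: "U <= ?S" "U <= RHP" by (auto simp: U_def)
 have Fs: "F (of_real s) = 0" using F_of_real[OF s(1)] rs by simp
 have F's: "F' (of_real s) = of_real (s powr (nu + 1/2) * (- (s / 2*rE (nu + 1) s)))"
  using F'_of_real[OF s(1)] rs by simp
 have d0: "s / 2*rE (nu + 1) s ~= 0" using simple_zero[OF s(1) rs] s by simp
 have F's0: "F' (of_real s) ~= 0" unfolding F's using d0 s by simp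
 have Fnz: "F w ~= 0" if "w : U" "w ~= of_real s" for w
 proof
  assume "F w = 0"
  moreover have "Re w > 0" "Re w < R" using that US by auto
  ultimately obtain i where "w = of_real (bz (Suc i))" using F_eq_0_iff[of w] by blast
  hence "w : P - {of_real s}" using that \<open>Re w < R\<close> by (auto simp: P_def)
  thus False using that by (auto simp: U_def)
 qed
 have "residue (hk delta R x y) (of_real s) = residue (%w. hkN delta R x y w / F w) (of_real s)"
 proof (rule residue_cong)
  show "\<forall>\<^sub>F w in at (of_real s). hk delta R x y w = hkN delta R x y w / F w"
   using eventually_at_in_open'[OF opU sU] by eventually_elim (use US hk_eq_quotient in auto)
 qed simp
 also have "... = hkN delta R x y (of_real s) / F' (of_real s)"
  by (rule residue_simple_quotient[OF opU sU _ _ Fnz Fs F_deriv F's0])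
   (use s R0 xy US in "auto intro!: holomorphic_on_subset[OF holomorphic_hkN] holomorphic_F")
 also have "... = of_real ((1 - s\<^sup>2/R\<^sup>2) powr delta * (psi nu (Suc j) x * psi nu (Suc j) y) * (x * y) powr (nu + 1/2))"
 proof -
  define q where "q = (1 - s\<^sup>2/R\<^sup>2) powr delta"
  define A where "A = s powr (nu + 1/2)"
  define d where "d = s / 2*rE (nu + 1) s"
  have A0: "A > 0" using s by (simp add: A_def)
  have "s\<^sup>2 <= R\<^sup>2" using s by (intro power_mono) auto
  hence "1 - s\<^sup>2/R\<^sup>2 >= 0" using R0 by simp
  hence pw: "(1 - (complex_of_real s)\<^sup>2 / of_real (R\<^sup>2)) powr of_real delta = of_real q"
   unfolding q_def by (subst powr_of_real[symmetric]) auto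
  have wr: "- (F' (of_real s) * f (of_real s)) = 2*\<i> * beta"
   using wronskian_F_f[of "of_real s"] s Fs by simp
  \<comment> \<open>The connection formula at a zero: the two terms of F cancel.\<close>
  have fcs: "beta * fc (of_real s) = - (cnj beta * f (of_real s))"
   using F_eq[of "of_real s"] s Fs by (simp add: eq_neg_iff_add_eq_0 add.commute)
  have sx: "Re (of_real s * of_real x) > 0" using s xy by simp
  have "beta * D (of_real s) x = f (of_real s * of_real x) * (beta * fc (of_real s)) - (beta * fc (of_real s * of_real x)) * f (of_real s)"
   by (simp add: D_def algebra_simps)
  also have "... = - (f (of_real s) * F (of_real s * of_real x))"
   unfolding fcs F_eq[OF sx] by (simp add: algebra_simps)
  finally have bD: "beta * D (of_real s) x = - (f (of_real s) * F (of_real s * of_real x))" .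
  have "(2*\<i> * beta) * D (of_real s) x = - (2*\<i>) * (f (of_real s) * F (of_real s * of_real x))"
   using bD by (simp add: mult.assoc)
  hence "f (of_real s) * (F' (of_real s) * D (of_real s) x) = f (of_real s) * (2*\<i> * F (of_real s * of_real x))"
   unfolding wr[symmetric] by (simp add: algebra_simps)
  moreover have "f (of_real s) ~= 0" using wr beta_nonzero by auto
  ultimately have FD: "F' (of_real s) * D (of_real s) x = 2*\<i> * F (of_real s * of_real x)" by simp
  have F'd: "F' (of_real s) = of_real (- (A * d))" unfolding F's A_def d_def by simp
  have Fu: "F (of_real s * of_real u) = of_real (A * u powr (nu + 1/2) * rE nu (s * u))" if "u > 0" for u
   using F_of_real[of "s * u"] s that by (simp add: A_def powr_mult)
  have "hkN delta R x y (of_real s) / F' (of_real s) = - \<i> * of_real q * (F' (of_real s) * D (of_real s) x) * F (of_real s * of_real y) / (F' (of_real s))\<^sup>2"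
   unfolding hkN_def pw using F's0 by (simp add: power2_eq_square)
  also have "... = 2 * of_real q * F (of_real s * of_real x) * F (of_real s * of_real y) / (F' (of_real s))\<^sup>2"
  proof -
   have "- \<i> * Q * (2*\<i> * X) = 2*Q * X" for Q X :: complex by (simp add: algebra_simps)
   thus ?thesis unfolding FD by (simp only:)
  qed
  also have "... = of_real (2*q * (A * x powr (nu + 1/2) * rE nu (s * x)) * (A * y powr (nu + 1/2) * rE nu (s * y)) / (A * d)\<^sup>2)"
   unfolding Fu[OF xy(1)] Fu[OF xy(2)] F'd by simp
  also have "2*q * (A * x powr (nu + 1/2) * rE nu (s * x)) * (A * y powr (nu + 1/2) * rE nu (s * y)) / (A * d)\<^sup>2
   = q * (2*rE nu (s * x) * rE nu (s * y) / d\<^sup>2) * (x * y) powr (nu + 1/2)"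
   using A0 xy by (simp add: power2_eq_square powr_mult)
  also have "2*rE nu (s * x) * rE nu (s * y) / d\<^sup>2 = psi nu (Suc j) x * psi nu (Suc j) y"
   using psi_mult[OF xy, of j] by (simp add: s_def d_def)
  finally show ?thesis by (simp add: q_def)
 qed
 finally show ?thesis by (simp add: s_def)
qed

text \<open>The residues at the zeros below R are the terms of the kernel. The height T of the
  rectangle stays free: it is sent to infinity when x > y and taken equal to R near the
  diagonal.\<close>

theorem kernel_formula:
 assumes R: "R > 0" "rE nu R ~= 0" and delta: "delta > 0" and T: "T > 0"
  and x: "0 < x" "x <= 1" and y: "y > 0"
 shows "pi * (Kern delta R x y * (x * y) powr (nu + 1/2)) =
  Re (integral {0..T} (%t. hk delta R x y (Complex R t))) - Im (integral {0..R} (%r. hk delta R x y (Complex r T)))"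
proof -
 define I where "I = {j. bz (Suc j) < R}"
 define P where "P = (%j. complex_of_real (bz (Suc j))) ` I"
 have fI: "finite I" unfolding I_def by (rule finite_bz_below)
 define e0 where "e0 = min (bz 1) R / 2"
 have b1: "bz 1 > 0" using bz_pos[of 0] by simp
 have e0: "0 < e0" "e0 < bz 1" "e0 < R" using b1 R by (auto simp: e0_def min_def)
 define m where "m = Max (insert e0 ((%j. bz (Suc j)) ` I))"
 have mlt: "m < R" unfolding m_def using fI e0 by (subst Max_less_iff) (auto simp: I_def)
 have mge: "e0 <= m" "!!j. j : I ==> bz (Suc j) <= m" unfolding m_def using fI by (auto intro!: Max_ge)
 \<comment> \<open>The midpoint between R and the larger of e0 and the last zero below R. All poles
   lie between e0 and R0, and F has no zero with real part in [R0, R].\<close>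
 define R0 where "R0 = (m + R) / 2"
 have R0: "e0 < R0" "R0 < R" "m < R0" using mlt mge by (auto simp: R0_def)
 have bz1: "bz 1 <= bz (Suc j)" for j using strict_mono_less_eq[OF strict_mono_bz, of 1 "Suc j"] by simp
 have bzI: "bz (Suc j) : {e0<..<R0}" if "j : I" for j
  using mge(2)[OF that] R0 e0 bz1[of j] by auto
 have Fnz: "F z ~= 0" if z: "Re z > 0" "!!j. j : I ==> z ~= of_real (bz (Suc j))" "Re z <= R" for z
 proof
  assume "F z = 0"
  then obtain j where j: "z = of_real (bz (Suc j))" using F_eq_0_iff[OF z(1)] by blast
  have "bz (Suc j) ~= R" using bz_Suc(2)[of j] R by auto
  hence "j : I" using j z(3) by (auto simp: I_def)
  thus False using z(2) j by blast
 qed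
 have contR: "continuous_on {z. 0 < Re z & Re z <= R & F z ~= 0} (hk delta R x y)"
  by (rule continuous_hk_right) (use R x y delta in auto)
 have contL: "continuous_on {z. 0 <= Re z & Re z <= e0} (hk delta R x y)"
  by (rule continuous_hk_left) (use R x y delta e0 in auto)
 have "of_real pi * (\<Sum>p\<in>P. residue (hk delta R x y) p) =
  complex_of_real (Re (integral {0..T} (%t. hk delta R x y (Complex R t))) - Im (integral {0..R} (%r. hk delta R x y (Complex r T))))"
 proof (rule rectangle_residue_symmetric[OF e0(1) R0(1,2) T])
  show "finite P" unfolding P_def using fI by simp
  show "P <= of_real ` {e0<..<R0}" unfolding P_def using bzI by auto
  show "hk delta R x y holomorphic_on {z. 0 < Re z & Re z < R} - P"
  proof (rule holomorphic_transform)
   show "(%z. hkN delta R x y z / F z) holomorphic_on {z. 0 < Re z & Re z < R} - P"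
   proof (intro holomorphic_intros)
    show "hkN delta R x y holomorphic_on {z. 0 < Re z & Re z < R} - P"
     by (rule holomorphic_on_subset[OF holomorphic_hkN]) (use R x y in auto)
    show "F holomorphic_on {z. 0 < Re z & Re z < R} - P" by (rule holomorphic_F) auto
    fix z assume z: "z : {z. 0 < Re z & Re z < R} - P"
    show "F z ~= 0" by (rule Fnz) (use z in "auto simp: P_def")
   qed
  qed (auto simp: hk_eq_quotient)
  have c1a: "continuous_on {0..e0} (%r. hk delta R x y (Complex r T))"
   by (rule continuous_on_compose2[OF contL]) (auto intro!: continuous_intros)
  have c1b: "continuous_on {e0..R} (%r. hk delta R x y (Complex r T))"
  proof (rule continuous_on_compose2[OF contR])
   show "(%r. Complex r T) ` {e0..R} <= {z. 0 < Re z & Re z <= R & F z ~= 0}"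
   proof (intro image_subsetI CollectI conjI)
    fix r assume r: "r : {e0..R}"
    show "F (Complex r T) ~= 0" by (rule Fnz) (use r e0 T in "auto simp: complex_eq_iff")
   qed (use e0 in auto)
  qed (intro continuous_intros)
  have "{0..R} = {0..e0} \<union> {e0..R}" using e0 by auto
  thus "continuous_on {0..R} (%r. hk delta R x y (Complex r T))"
   using continuous_on_closed_Un[OF closed_atLeastAtMost closed_atLeastAtMost c1a c1b] by metis
  show "continuous_on ({0..e0} \<times> {- T..T}) (%(r, t). hk delta R x y (Complex r t))"
   unfolding split_beta by (rule continuous_on_compose2[OF contL]) (auto intro!: continuous_intros)
  show "continuous_on ({R0..R} \<times> {- T..T}) (%(r, t). hk delta R x y (Complex r t))"
   unfolding split_beta
  proof (rule continuous_on_compose2[OF contR])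
   show "(%x. Complex (fst x) (snd x)) ` ({R0..R} \<times> {- T..T}) <= {z. 0 < Re z & Re z <= R & F z ~= 0}"
   proof (intro image_subsetI CollectI conjI)
    fix p assume p: "p : {R0..R} \<times> {- T..T}"
    have Fp: "bz (Suc j) ~= fst p" if "j : I" for j using bzI[OF that] p by auto
    show "F (Complex (fst p) (snd p)) ~= 0"
    proof (rule Fnz)
     fix j assume "j : I"
     from Fp[OF this] show "Complex (fst p) (snd p) ~= of_real (bz (Suc j))" by (simp add: complex_eq_iff)
    qed (use p R0 e0 in auto)
   qed (use R0 e0 in auto)
  qed (auto intro!: continuous_intros)
  show "hk delta R x y (cnj z) = cnj (hk delta R x y z)" if "0 <= Re z" "Re z <= R" for z
   by (rule cnj_hk) (use that R y in auto)
 qed (rule hk_odd)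
 moreover have "(\<Sum>p\<in>P. residue (hk delta R x y) p) = of_real (Kern delta R x y * (x * y) powr (nu + 1/2))"
 proof -
  have inj: "inj_on (%j. complex_of_real (bz (Suc j))) I"
   using strict_mono_eq[OF strict_mono_bz] by (auto simp: inj_on_def)
  have "(\<Sum>p\<in>P. residue (hk delta R x y) p) = (\<Sum>j\<in>I. residue (hk delta R x y) (of_real (bz (Suc j))))"
   unfolding P_def by (rule sum.reindex_cong[OF inj]) auto
  also have "... = (\<Sum>j\<in>I. of_real ((1 - (bz (Suc j))\<^sup>2/R\<^sup>2) powr delta * (psi nu (Suc j) x * psi nu (Suc j) y) * (x * y) powr (nu + 1/2)))"
   by (intro sum.cong refl residue_hk) (use x y delta in "auto simp: I_def")
  also have "... = of_real (Kern delta R x y * (x * y) powr (nu + 1/2))"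
   unfolding Kern_def I_def[symmetric] sum_distrib_right of_real_sum by (simp add: mult.assoc)
  finally show ?thesis .
 qed
 ultimately have "complex_of_real (pi * (Kern delta R x y * (x * y) powr (nu + 1/2))) =
  complex_of_real (Re (integral {0..T} (%t. hk delta R x y (Complex R t))) - Im (integral {0..R} (%r. hk delta R x y (Complex r T))))"
  by simp
 thus ?thesis by (simp only: of_real_eq_iff)
qed

end

section \<open>Pointwise bounds for the kernel\<close>

lemma one_minus_exp_ge:
 assumes "t > 0" shows "1/(1 - exp (- t)) <= 1 + 1/(t::real)"
proof -
 have "1 + t <= exp t" by (rule exp_ge_add_one_self)
 hence "exp (- t) <= 1/(1 + t)" using assms by (simp add: exp_minus field_simps)
 hence "t / (1 + t) <= 1 - exp (- t)" using assms by (simp add: field_simps)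
 hence "1/(1 - exp (- t)) <= 1/(t / (1 + t))" using assms by (intro divide_left_mono) auto
 thus ?thesis using assms by (simp add: field_simps)
qed

text \<open>The exponent may be negative, as nu can be close to -1. For either sign, replacing R by
  a larger n costs at most (n/R)^|a|.\<close>

lemma min_powr_le:
 fixes a R n y :: real
 assumes "0 < R" "R <= n" "0 < y"
 shows "min 1 (n * y) powr a <= (n / R) powr \<bar>a\<bar> * min 1 (R * y) powr a"
proof (cases "a >= 0")
 case True
 have n1: "n / R >= 1" using assms by simp
 have "min 1 (n * y) <= n / R * min 1 (R * y)"
 proof (cases "R * y >= 1")
  case True thus ?thesis using n1 by simp
 next
  case False
  hence "n / R * min 1 (R * y) = n * y" using assms by simp
  thus ?thesis by simp
 qed
 hence "min 1 (n * y) powr a <= (n / R * min 1 (R * y)) powr a"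
  using assms True by (intro powr_mono2) auto
 also have "(n / R * min 1 (R * y)) powr a = (n / R) powr a * min 1 (R * y) powr a"
  using assms by (subst powr_mult) auto
 finally show ?thesis using True by simp
next
 case False
 have "min 1 (R * y) <= min 1 (n * y)" using assms by (auto simp: min_def mult_right_mono intro: order_trans)
 hence "min 1 (n * y) powr a <= min 1 (R * y) powr a"
  using assms False by (intro powr_mono2') auto
 also have "... <= (n / R) powr \<bar>a\<bar> * min 1 (R * y) powr a"
  using ge_one_powr_ge_zero[of "n / R" "\<bar>a\<bar>"] assms by (simp add: mult_le_cancel_right1)
 finally show ?thesis .
qed

lemma poly_exp_bound:
 fixes N :: real
 obtains C where "C > 0" "!!s. s >= 0 ==> (2 + s) powr N * exp (- s) <= C"
proof
 define m where "m = nat \<lceil>N\<rceil>"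
 show "fact m * exp 2 > (0::real)" by simp
 fix s :: real assume s: "s >= 0"
 have "(2 + s) powr N <= (2 + s) powr real m" using s real_nat_ceiling_ge[of N] by (intro powr_mono) (auto simp: m_def)
 also have "... = (2 + s) ^ m" using s by (simp add: powr_realpow)
 also have "... <= fact m * exp (2 + s)"
 proof -
  have "(\<Sum>n\<in>{m}. (2 + s) ^ n / fact n) <= (\<Sum>n. (2 + s) ^ n / fact n)"
   by (rule sum_le_suminf[OF summable_power_div_fact]) (use s in auto)
  hence "(2 + s) ^ m / fact m <= exp (2 + s)"
   using sums_unique[OF suminf_power_div_fact[of "2 + s"]] by simp
  thus ?thesis by (simp add: pos_divide_le_eq mult.commute)
 qed
 finally have "(2 + s) powr N * exp (- s) <= fact m * exp (2 + s) * exp (- s)"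
  by (intro mult_right_mono) auto
 also have "... = fact m * exp 2" by (simp add: mult.assoc exp_add[symmetric])
 finally show "(2 + s) powr N * exp (- s) <= fact m * exp 2" .
qed

context bessel_jost
begin

abbreviation "a \<equiv> nu + 1/2"

text \<open>The exponentials combine to e^{(1-x)t} e^{yt} / e^t = e^{-(x-y)t}. The lower bound for F
  contributes 1/(1 - e^{-t}) <= 1 + 1/t, the only singularity at the real axis.\<close>

lemma hk_quotient_bound:
 assumes c: "c > 0"
 obtains C M where "C > 0" "M >= 1"
  "!!z x y. Re z > 0 ==> Im z > 0 ==> Re z >= M \<or> Im z >= M ==> 0 < y ==> y <= x ==> x <= 1 ==> c <= norm z * x ==>
   norm (D z x * F (z * of_real y) / F z) <= C * min 1 (norm z * y) powr a * exp (- ((x - y) * Im z)) * (1 + 1/Im z)"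
proof -
 obtain M where M: "M >= 1"
  "!!z. Re z > 0 ==> Im z >= 0 ==> Re z >= M \<or> Im z >= M ==> norm (F z) >= norm beta / 4*exp (Im z) * (1 - exp (- Im z))"
  using F_lower_bound by blast
 obtain CF where CF: "CF > 0" "!!w. Re w > 0 ==> Im w >= 0 ==> norm (F w) <= CF * min 1 (norm w) powr a * exp (Im w)"
  using F_upper_bound by blast
 define A where "A = 2*exp (K / c) ^ 2"
 define b where "b = norm beta / 4"
 have pos: "A > 0" "b > 0" using beta_pos by (auto simp: A_def b_def)
 show ?thesis
 proof (rule that[of "A * CF / b" M])
  fix z :: complex and x y :: real
  assume z: "Re z > 0" "Im z > 0" "Re z >= M \<or> Im z >= M" and xy: "0 < y" "y <= x" "x <= 1" "c <= norm z * x"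
  define t where "t = Im z"
  define m where "m = min 1 (norm z * y) powr a"
  have t: "t > 0" using z by (simp add: t_def)
  have 1: "norm (D z x) <= A * exp ((1 - x) * t)"
   using D_bound[OF c z(1), of x] z xy by (simp add: A_def t_def)
  have 2: "norm (F (z * of_real y)) <= CF * m * exp (t * y)"
   using CF(2)[of "z * of_real y"] z xy by (simp add: m_def t_def norm_mult)
  have 3: "norm (F z) >= b * exp t * (1 - exp (- t))"
   using M(2)[of z] z by (simp add: b_def t_def)
  have et: "1 - exp (- t) > 0" using t by simp
  have "norm (D z x * F (z * of_real y) / F z) = norm (D z x) * norm (F (z * of_real y)) / norm (F z)"
   by (simp add: norm_mult norm_divide)
  also have "... <= (A * exp ((1 - x) * t)) * (CF * m * exp (t * y)) / (b * exp t * (1 - exp (- t)))"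
   using pos et CF by (intro frac_le mult_mono 1 2 3) (auto simp: m_def)
  also have "... = A * CF / b * m * (exp ((1 - x) * t) * exp (t * y) / exp t) * (1/(1 - exp (- t)))"
   by simp
  also have "exp ((1 - x) * t) * exp (t * y) / exp t = exp (- ((x - y) * t))"
   by (simp add: exp_add[symmetric] exp_diff[symmetric] algebra_simps)
  also have "A * CF / b * m * exp (- ((x - y) * t)) * (1/(1 - exp (- t))) <= A * CF / b * m * exp (- ((x - y) * t)) * (1 + 1/t)"
   using pos CF by (intro mult_left_mono one_minus_exp_ge t) (auto simp: m_def)
  finally show "norm (D z x * F (z * of_real y) / F z) <= A * CF / b * min 1 (norm z * y) powr a * exp (- ((x - y) * Im z)) * (1 + 1/Im z)"
   by (simp add: m_def t_def)
 qed (use pos CF M in auto)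
qed

lemma norm_hk_eq:
 assumes "Re z > 0"
 shows "norm (hk delta R x y z) = norm (1 - z\<^sup>2/R\<^sup>2) powr delta * norm (D z x * F (z * of_real y) / F z)"
proof -
 have "norm ((1 - z\<^sup>2/R\<^sup>2) powr of_real delta) = norm (1 - z\<^sup>2/R\<^sup>2) powr delta"
  by (subst norm_powr_real_powr') auto
 moreover have "hk delta R x y z = - \<i> * (1 - z\<^sup>2/R\<^sup>2) powr of_real delta * (D z x * F (z * of_real y) / F z)"
  using assms by (simp only: hk_def if_True)
 ultimately show ?thesis by (simp only: norm_mult norm_minus_cancel norm_ii mult_1)
qed

text \<open>On Re z = R one has 1 - z^2/R^2 = -(t/R)(2i - t/R). The factor (t/R)^delta makes the
  singularity 1/t integrable, and here delta > 0 enters. On the upper side only polynomial growth in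
  T/R occurs.\<close>

lemma hk_line_bounds:
 assumes c: "c > 0" "c <= 1" and delta: "delta > 0"
 obtains C M where "C > 0" "M >= 1"
  "!!R x y t. R >= M ==> 0 < y ==> y <= x ==> x <= 1 ==> c / R <= x ==> t > 0 ==>
   norm (hk delta R x y (Complex R t)) <= C * min 1 (R * y) powr a * ((t / R) powr delta * (1 + 1/t))
    * ((2 + t / R) powr (delta + \<bar>a\<bar>) * exp (- ((x - y) * t)))"
  "!!R x y r T. R >= M ==> 0 < y ==> y <= x ==> x <= 1 ==> c / R <= x ==> 0 < r ==> r <= R ==> R <= T ==>
   norm (hk delta R x y (Complex r T)) <= C * min 1 (R * y) powr a * (5*(T / R)\<^sup>2) powr (delta + \<bar>a\<bar>) * exp (- ((x - y) * T))"
proof -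
 obtain C M where CM: "C > 0" "M >= 1"
  "!!z x y. Re z > 0 ==> Im z > 0 ==> Re z >= M \<or> Im z >= M ==> 0 < y ==> y <= x ==> x <= 1 ==> c <= norm z * x ==>
   norm (D z x * F (z * of_real y) / F z) <= C * min 1 (norm z * y) powr a * exp (- ((x - y) * Im z)) * (1 + 1/Im z)"
  using hk_quotient_bound[OF c(1)] by metis
 have main: "norm (hk delta R x y z) <= C * min 1 (R * y) powr a *
   (norm (1 - z\<^sup>2/R\<^sup>2) powr delta * (norm z / R) powr \<bar>a\<bar> * (1 + 1/Im z)) * exp (- ((x - y) * Im z))"
  if h: "R >= M" "0 < y" "y <= x" "x <= 1" "c / R <= x" "Re z > 0" "Im z > 0" "Re z >= M \<or> Im z >= M" "norm z >= R" for R x y z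
 proof -
  have R0: "R > 0" using h CM by linarith
  have "c <= R * x" using h R0 by (simp add: pos_divide_le_eq mult.commute)
  also have "... <= norm z * x" using h by (intro mult_right_mono) auto
  finally have cz: "c <= norm z * x" .
  have "norm (hk delta R x y z) = norm (1 - z\<^sup>2/R\<^sup>2) powr delta * norm (D z x * F (z * of_real y) / F z)"
   by (rule norm_hk_eq[OF h(6)])
  also have "... <= norm (1 - z\<^sup>2/R\<^sup>2) powr delta * (C * min 1 (norm z * y) powr a * exp (- ((x - y) * Im z)) * (1 + 1/Im z))"
   using CM(3)[of z y x] h cz by (intro mult_left_mono) auto
  also have "... = (norm (1 - z\<^sup>2/R\<^sup>2) powr delta * C * exp (- ((x - y) * Im z)) * (1 + 1/Im z)) * min 1 (norm z * y) powr a"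
   by (simp only: mult_ac)
  also have "... <= (norm (1 - z\<^sup>2/R\<^sup>2) powr delta * C * exp (- ((x - y) * Im z)) * (1 + 1/Im z)) * ((norm z / R) powr \<bar>a\<bar> * min 1 (R * y) powr a)"
   using CM(1) h R0 by (intro mult_left_mono min_powr_le) auto
  finally show ?thesis by (simp only: mult_ac)
 qed
 define C' where "C' = 2*C"
 show ?thesis
 proof (rule that[of C' M])
  fix R x y t :: real
  assume h: "R >= M" "0 < y" "y <= x" "x <= 1" "c / R <= x" and t: "t > 0"
  have R0: "R > 0" using h CM by linarith
  let ?z = "Complex R t"
  have nz: "norm ?z >= R" using complex_Re_le_cmod[of ?z] by simp
  have nz2: "norm ?z <= R + t" using cmod_le[of ?z] R0 t by simp
  have "1 - ?z\<^sup>2/R\<^sup>2 = - of_real (t / R) * Complex (- (t / R)) 2"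
   using R0 by (simp add: complex_eq_iff power2_eq_square field_simps)
  hence "norm (1 - ?z\<^sup>2/R\<^sup>2) = norm (- complex_of_real (t / R)) * norm (Complex (- (t / R)) 2)"
   by (simp only: norm_mult)
  also have "norm (- complex_of_real (t / R)) = t / R" using R0 t by (simp only: norm_minus_cancel norm_of_real) simp
  also have "(t / R) * norm (Complex (- (t / R)) 2) <= (t / R) * (2 + t / R)"
   using cmod_le[of "Complex (- (t / R)) 2"] R0 t by (intro mult_left_mono) auto
  finally have "norm (1 - ?z\<^sup>2/R\<^sup>2) powr delta <= ((t / R) * (2 + t / R)) powr delta"
   using delta by (intro powr_mono2) auto
  also have "... = (t / R) powr delta * (2 + t / R) powr delta" by (rule powr_mult)
  finally have 1: "norm (1 - ?z\<^sup>2/R\<^sup>2) powr delta <= (t / R) powr delta * (2 + t / R) powr delta" .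
  have "norm ?z / R <= 2 + t / R" using nz2 R0 by (simp add: field_simps)
  hence 2: "(norm ?z / R) powr \<bar>a\<bar> <= (2 + t / R) powr \<bar>a\<bar>" using R0 by (intro powr_mono2) auto
  have "norm (hk delta R x y ?z) <= C * min 1 (R * y) powr a *
   (norm (1 - ?z\<^sup>2/R\<^sup>2) powr delta * (norm ?z / R) powr \<bar>a\<bar> * (1 + 1/t)) * exp (- ((x - y) * t))"
   using main[OF h, of ?z] h R0 t nz by simp
  also have "... <= C * min 1 (R * y) powr a *
   (((t / R) powr delta * (2 + t / R) powr delta) * (2 + t / R) powr \<bar>a\<bar> * (1 + 1/t)) * exp (- ((x - y) * t))"
   using CM(1) t by (intro mult_right_mono mult_left_mono mult_mono 1 2) auto
  also have "... = C * (min 1 (R * y) powr a * ((t / R) powr delta * (1 + 1/t))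
    * ((2 + t / R) powr (delta + \<bar>a\<bar>) * exp (- ((x - y) * t))))"
   by (simp add: powr_add mult_ac)
  also have "... <= C' * (min 1 (R * y) powr a * ((t / R) powr delta * (1 + 1/t))
    * ((2 + t / R) powr (delta + \<bar>a\<bar>) * exp (- ((x - y) * t))))"
   using CM(1) t by (intro mult_right_mono) (auto simp: C'_def intro!: mult_nonneg_nonneg)
  finally show "norm (hk delta R x y ?z) <= C' * min 1 (R * y) powr a * ((t / R) powr delta * (1 + 1/t))
    * ((2 + t / R) powr (delta + \<bar>a\<bar>) * exp (- ((x - y) * t)))" by (simp add: mult_ac)
 next
  fix R x y r T :: real
  assume h: "R >= M" "0 < y" "y <= x" "x <= 1" "c / R <= x" and r: "0 < r" "r <= R" and T: "R <= T"
  have R0: "R > 0" using h CM by linarith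
  have T1: "T >= 1" "T >= M" "T > 0" using h CM T by linarith+
  let ?z = "Complex r T"
  have nz: "norm ?z >= R" using abs_Im_le_cmod[of ?z] T by simp
  have nz2: "norm ?z <= 2*T" using cmod_le[of ?z] r T by simp
  have TR: "T / R >= 1" using T R0 by simp
  have TR2: "(T / R)\<^sup>2 >= T / R" using TR self_le_power[of "T / R" 2] by simp
  have "norm (1 - ?z\<^sup>2/R\<^sup>2) <= 1 + norm (?z\<^sup>2/R\<^sup>2)" using norm_triangle_ineq4[of 1 "?z\<^sup>2/R\<^sup>2"] by simp
  also have "norm (?z\<^sup>2/R\<^sup>2) = (norm ?z / R)\<^sup>2" using R0 by (simp add: norm_divide norm_power power_divide)
  also have "... <= (2*(T / R))\<^sup>2" using nz2 R0 by (intro power_mono) (auto simp: field_simps)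
  also have "1 + (2*(T / R))\<^sup>2 <= 5*(T / R)\<^sup>2"
  proof -
   have "(2*(T / R))\<^sup>2 = 4*(T / R)\<^sup>2" by (simp add: power2_eq_square)
   thus ?thesis using TR TR2 by linarith
  qed
  finally have "norm (1 - ?z\<^sup>2/R\<^sup>2) <= 5*(T / R)\<^sup>2" by simp
  hence 1: "norm (1 - ?z\<^sup>2/R\<^sup>2) powr delta <= (5*(T / R)\<^sup>2) powr delta"
   using delta by (intro powr_mono2) auto
  have "norm ?z / R <= 2*(T / R)" using nz2 R0 by (simp add: field_simps)
  also have "... <= 5*(T / R)\<^sup>2" using TR TR2 by linarith
  finally have 2: "(norm ?z / R) powr \<bar>a\<bar> <= (5*(T / R)\<^sup>2) powr \<bar>a\<bar>" using R0 by (intro powr_mono2) auto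
  have 3: "1 + 1/T <= 2" using T1 by simp
  have "norm (hk delta R x y ?z) <= C * min 1 (R * y) powr a *
   (norm (1 - ?z\<^sup>2/R\<^sup>2) powr delta * (norm ?z / R) powr \<bar>a\<bar> * (1 + 1/T)) * exp (- ((x - y) * T))"
   using main[OF h, of ?z] r T1 nz by simp
  also have "... <= C * min 1 (R * y) powr a *
   ((5*(T / R)\<^sup>2) powr delta * (5*(T / R)\<^sup>2) powr \<bar>a\<bar> * 2) * exp (- ((x - y) * T))"
   using CM(1) T1 by (intro mult_right_mono mult_left_mono mult_mono 1 2 3) auto
  also have "... = C' * min 1 (R * y) powr a * (5*(T / R)\<^sup>2) powr (delta + \<bar>a\<bar>) * exp (- ((x - y) * T))"
   by (simp add: powr_add C'_def mult_ac)
  finally show "norm (hk delta R x y ?z) <= C' * min 1 (R * y) powr a * (5*(T / R)\<^sup>2) powr (delta + \<bar>a\<bar>) * exp (- ((x - y) * T))" .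
 qed (use CM in "auto simp: C'_def")
qed

end

lemma powr_one_div: "(d::real) > 0 ==> (1/d) powr r = d powr (- r)"
 by (simp add: powr_divide powr_minus_divide)

lemma powr_div_eq: "(t::real) > 0 ==> R > 0 ==> (t / R) powr r = R powr (- r) * t powr r"
 by (simp add: powr_divide powr_minus_divide)

lemma integral_norm_le:
 fixes f :: "real => complex"
 assumes "f integrable_on S" "(g has_integral I) S" "!!x. x : S ==> norm (f x) <= g x"
 shows "norm (integral S f) <= I"
 using integral_norm_bound_integral[OF assms(1) has_integral_integrable[OF assms(2)] assms(3)] integral_unique[OF assms(2)]
 by simp

context bessel_jost
begin

lemma hk_vertical_integrable:
 assumes "R > 0" "rE nu R ~= 0" "x > 0" "y > 0" "delta > 0"
 shows "(%t. hk delta R x y (Complex R t)) integrable_on {0..T}"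
proof (rule integrable_continuous_real)
 have nz: "F (Complex R t) ~= 0" for t
 proof
  assume "F (Complex R t) = 0"
  then obtain j where "Complex R t = of_real (bz (Suc j))" using F_eq_0_iff[of "Complex R t"] assms by auto
  hence "R = bz (Suc j)" by (simp add: complex_eq_iff)
  thus False using bz_Suc(2)[of j] assms by simp
 qed
 have "continuous_on (range (Complex R)) (hk delta R x y)"
  by (rule continuous_hk_right) (use assms nz in auto)
 thus "continuous_on {0..T} (%t. hk delta R x y (Complex R t))"
  by (rule continuous_on_compose2) (auto intro!: continuous_intros)
qed

lemma hk_horizontal_integrable:
 assumes "R > 0" "0 < x" "x <= 1" "y > 0" "delta > 0" "T > 0"
 shows "(%r. hk delta R x y (Complex r T)) integrable_on {0..R}"
proof (rule integrable_continuous_real)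
 define e0 where "e0 = min (bz 1) R / 2"
 have b1: "bz 1 > 0" using bz_pos[of 0] by simp
 have e0: "0 < e0" "e0 < bz 1" "e0 < R" using b1 assms by (auto simp: e0_def min_def)
 have nz: "F (Complex r T) ~= 0" if r: "r > 0" for r
 proof
  assume "F (Complex r T) = 0"
  then obtain j where "Complex r T = of_real (bz (Suc j))" using F_eq_0_iff[of "Complex r T"] r by auto
  thus False using assms by (simp add: complex_eq_iff)
 qed
 have "continuous_on ((%r. Complex r T) ` {e0..R}) (hk delta R x y)"
  by (rule continuous_hk_right) (use assms nz e0 in auto)
 hence 1: "continuous_on {e0..R} (%r. hk delta R x y (Complex r T))"
  by (rule continuous_on_compose2) (auto intro!: continuous_intros)
 have "continuous_on {z. 0 <= Re z & Re z <= e0} (hk delta R x y)"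
  by (rule continuous_hk_left) (use assms e0 in auto)
 hence 2: "continuous_on {0..e0} (%r. hk delta R x y (Complex r T))"
  by (rule continuous_on_compose2) (auto intro!: continuous_intros)
 have "{0..R} = {0..e0} \<union> {e0..R}" using e0 by auto
 thus "continuous_on {0..R} (%r. hk delta R x y (Complex r T))"
  using continuous_on_closed_Un[OF closed_atLeastAtMost closed_atLeastAtMost 2 1] by metis
qed

lemma hk_at_R: "R > 0 ==> hk delta R x y (Complex R 0) = 0"
 by (simp add: hk_def complex_of_real_def[symmetric])

text \<open>Let d = x - y. If R d < 1, the height T = R bounds both sides of the contour by O(R).
  Otherwise T tends to infinity, the horizontal side vanishes, and the vertical integral of
  t^{delta-1} + t^delta against e^{-dt} is of order d^{-1-delta}. With the factor R^{-delta} this is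
  R (R d)^{-1-delta}.\<close>

lemma kernel_bound_large:
 assumes c: "c > 0" "c <= 1" and delta: "delta > 0"
 obtains C M where "C > 0" "M >= 1"
  "!!R x y. R >= M ==> rE nu R ~= 0 ==> 0 < y ==> y <= x ==> x <= 1 ==> c / R <= x ==>
   \<bar>Kern delta R x y\<bar> * (x * y) powr a <= C * R * min 1 (R * y) powr a * (1 + R * (x - y)) powr (- 1 - delta)"
proof (rule hk_line_bounds[OF c delta])
 fix C0 M assume CM: "C0 > 0" "M >= 1"
  "!!R x y t. R >= M ==> 0 < y ==> y <= x ==> x <= 1 ==> c / R <= x ==> t > 0 ==>
   norm (hk delta R x y (Complex R t)) <= C0*min 1 (R * y) powr a * ((t / R) powr delta * (1 + 1/t))
    * ((2 + t / R) powr (delta + \<bar>a\<bar>) * exp (- ((x - y) * t)))"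
  "!!R x y r T. R >= M ==> 0 < y ==> y <= x ==> x <= 1 ==> c / R <= x ==> 0 < r ==> r <= R ==> R <= T ==>
   norm (hk delta R x y (Complex r T)) <= C0*min 1 (R * y) powr a * (5*(T / R)\<^sup>2) powr (delta + \<bar>a\<bar>) * exp (- ((x - y) * T))"

 define N where "N = delta + \<bar>a\<bar>"
 have N: "N > 0" using delta by (simp add: N_def)
 obtain P where P: "P > 0" "!!s. s >= 0 ==> (2 + s) powr (N + delta + 2) * exp (- s) <= P"
  using poly_exp_bound[of "N + delta + 2"] by blast
 obtain P' where P': "P' > 0" "!!s. s >= 0 ==> (2 + s) powr (2*N + 1) * exp (- s) <= P'"
  using poly_exp_bound[of "2*N + 1"] by blast
 define A where "A = 3 powr N * (1 + 1/delta)"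
 have A: "A > 0" using delta by (auto simp: A_def intro!: mult_pos_pos add_pos_pos)
 define C where "C = C0*(A + 5 powr N + 2*P) * 2 powr (1 + delta)"
 have C: "C > 0" using CM A P by (auto simp: C_def intro!: mult_pos_pos add_pos_pos)
 show ?thesis
 proof (rule that[OF C CM(2)])
  fix R x y :: real
  assume h: "R >= M" and rR: "rE nu R ~= 0" and xy: "0 < y" "y <= x" "x <= 1" "c / R <= x"
  define m where "m = min 1 (R * y) powr a"
  define d where "d = x - y"
  have R0: "R > 0" "R >= 1" using h CM by linarith+
  have d: "d >= 0" "d <= 1" using xy by (auto simp: d_def)
  have m: "m > 0" using R0 xy by (simp add: m_def min_def)
  have low: "norm (integral {0..L} (%t. hk delta R x y (Complex R t))) <=
    C0*m * 3 powr N * R powr (- delta) * (L powr (delta + 1) / (delta + 1) + L powr delta / delta)"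
   if L: "0 <= L" "L <= R" for L
  proof (rule integral_norm_le)
   show "(%t. hk delta R x y (Complex R t)) integrable_on {0..L}"
    by (rule hk_vertical_integrable) (use R0 rR xy delta in auto)
   have 1: "((%t. t powr delta) has_integral (L powr (delta + 1) / (delta + 1))) {0..L}"
    using has_integral_powr_from_0[of delta L] delta L by simp
   have 2: "((%t. t powr (delta - 1)) has_integral (L powr delta / delta)) {0..L}"
    using has_integral_powr_from_0[of "delta - 1" L] delta L by simp
   show "((%t. C0*m * 3 powr N * R powr (- delta) * (t powr delta + t powr (delta - 1))) has_integral
    C0*m * 3 powr N * R powr (- delta) * (L powr (delta + 1) / (delta + 1) + L powr delta / delta)) {0..L}"
    by (intro has_integral_mult_right has_integral_add 1 2)
   fix t assume t: "t : {0..L}"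
   show "norm (hk delta R x y (Complex R t)) <= C0*m * 3 powr N * R powr (- delta) * (t powr delta + t powr (delta - 1))"
   proof (cases "t = 0")
    case True
    thus ?thesis using hk_at_R[OF R0(1)] CM m by simp
   next
    case False
    hence t0: "t > 0" using t by simp
    have e: "(t / R) powr delta * (1 + 1/t) = R powr (- delta) * (t powr delta + t powr (delta - 1))"
     using t0 R0 by (simp add: powr_divide powr_minus powr_diff field_simps)
    have "t / R <= 1" using t L R0 by simp
    hence "(2 + t / R) powr N <= 3 powr N" using N t0 R0 by (intro powr_mono2) auto
    moreover have "exp (- ((x - y) * t)) <= 1" using d t0 by (simp add: d_def)
    ultimately have f: "(2 + t / R) powr N * exp (- ((x - y) * t)) <= 3 powr N * 1"
     by (intro mult_mono) auto
    have "norm (hk delta R x y (Complex R t)) <= C0*m * ((t / R) powr delta * (1 + 1/t))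
    * ((2 + t / R) powr N * exp (- ((x - y) * t)))"
     using CM(3)[OF h xy t0] by (simp add: m_def N_def)
    also have "... <= C0*m * ((t / R) powr delta * (1 + 1/t)) * (3 powr N * 1)"
     using CM m t0 by (intro mult_left_mono f) auto
    finally show ?thesis unfolding e by (simp add: mult_ac)
   qed
  qed
  have low': "norm (integral {0..L} (%t. hk delta R x y (Complex R t))) <= C0*m * A * R powr (- delta) * L powr (delta + 1)"
   if L: "1 <= L" "L <= R" for L
  proof -
   have "L powr (delta + 1) / (delta + 1) <= L powr (delta + 1)" using delta L by (simp add: divide_le_eq mult_le_cancel_left1)
   moreover have "L powr delta / delta <= L powr (delta + 1) / delta"
    using delta L by (intro divide_right_mono powr_mono) auto
   ultimately have "L powr (delta + 1) / (delta + 1) + L powr delta / delta <= (1 + 1/delta) * L powr (delta + 1)"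
    by (simp add: algebra_simps)
   hence "C0*m * 3 powr N * R powr (- delta) * (L powr (delta + 1) / (delta + 1) + L powr delta / delta)
     <= C0*m * 3 powr N * R powr (- delta) * ((1 + 1/delta) * L powr (delta + 1))"
    using CM m by (intro mult_left_mono) auto
   also have "... = C0*m * A * R powr (- delta) * L powr (delta + 1)" by (simp add: A_def mult_ac)
   finally show ?thesis using low[of L] L by linarith
  qed
  have hor: "norm (integral {0..R} (%r. hk delta R x y (Complex r T))) <= R * (C0*m * (5*(T / R)\<^sup>2) powr N * exp (- (d * T)))"
   if T: "R <= T" for T
  proof -
   let ?B = "C0*m * (5*(T / R)\<^sup>2) powr N * exp (- (d * T))"
   have "(%r. hk delta R x y (Complex r T)) integrable_on {0..R}"
    by (rule hk_horizontal_integrable) (use R0 xy delta T in auto)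
   hence i: "(%r. hk delta R x y (Complex r T)) integrable_on {0<..<R}"
    by (simp add: integrable_on_Icc_iff_Ioo)
   have "norm (integral {0<..<R} (%r. hk delta R x y (Complex r T))) <= R * ?B"
   proof (rule integral_norm_le[OF i])
    have "((%_. ?B) has_integral (R * ?B)) {0..R}"
     using has_integral_const_real[of ?B 0 R] R0 by simp
    thus "((%_. ?B) has_integral (R * ?B)) {0<..<R}" by (simp add: has_integral_Icc_iff_Ioo)
    show "norm (hk delta R x y (Complex r T)) <= ?B" if "r : {0<..<R}" for r
     using CM(4)[OF h xy, of r T] that T by (simp add: m_def N_def d_def)
   qed
   thus ?thesis by (simp add: integral_open_interval_real)
  qed
  have form: "pi * (\<bar>Kern delta R x y\<bar> * (x * y) powr a) <=
    norm (integral {0..T} (%t. hk delta R x y (Complex R t))) + norm (integral {0..R} (%r. hk delta R x y (Complex r T)))"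
   if T: "T > 0" for T
  proof -
   have "pi * (\<bar>Kern delta R x y\<bar> * (x * y) powr a) = \<bar>pi * (Kern delta R x y * (x * y) powr a)\<bar>"
    by (simp add: abs_mult)
   also have "... = \<bar>Re (integral {0..T} (%t. hk delta R x y (Complex R t))) - Im (integral {0..R} (%r. hk delta R x y (Complex r T)))\<bar>"
    by (subst kernel_formula[OF R0(1) rR delta T]) (use xy in auto)
   also have "... <= norm (integral {0..T} (%t. hk delta R x y (Complex R t))) + norm (integral {0..R} (%r. hk delta R x y (Complex r T)))"
    by (rule order_trans[OF abs_triangle_ineq4]) (intro add_mono abs_Re_le_cmod abs_Im_le_cmod)
   finally show ?thesis .
  qed
  have final: "\<bar>Kern delta R x y\<bar> * (x * y) powr a <= C * R * m * (1 + R * d) powr (- 1 - delta)"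
  proof (cases "R * d < 1")
   case True
   have "pi * (\<bar>Kern delta R x y\<bar> * (x * y) powr a) <= C0*m * A * R powr (- delta) * R powr (delta + 1)
     + R * (C0*m * (5*(R / R)\<^sup>2) powr N * exp (- (d * R)))"
    using form[of R] low'[of R] hor[of R] R0 by simp
   also have "C0*m * A * R powr (- delta) * R powr (delta + 1) = C0*m * A * R"
    using R0 by (simp add: powr_add[symmetric] mult.assoc)
   also have "R * (C0*m * (5*(R / R)\<^sup>2) powr N * exp (- (d * R))) <= R * (C0*m * 5 powr N * 1)"
    using R0 CM m d by (intro mult_left_mono) auto
   also have "C0*m * A * R + R * (C0*m * 5 powr N * 1) <= (C0*(A + 5 powr N + 2*P)) * R * m"
    using CM m R0 P by (simp add: algebra_simps)
   finally have 1: "pi * (\<bar>Kern delta R x y\<bar> * (x * y) powr a) <= (C0*(A + 5 powr N + 2*P)) * R * m" by simp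
   have "\<bar>Kern delta R x y\<bar> * (x * y) powr a <= pi * (\<bar>Kern delta R x y\<bar> * (x * y) powr a)"
    using pi_ge_two mult_right_mono[of 1 pi "\<bar>Kern delta R x y\<bar> * (x * y) powr a"] by simp
   also note 1
   also have "(C0*(A + 5 powr N + 2*P)) * R * m <= (C0*(A + 5 powr N + 2*P)) * R * m * (2 powr (1 + delta) * (1 + R * d) powr (- 1 - delta))"
   proof -
    have "2 powr (- 1 - delta) <= (1 + R * d) powr (- 1 - delta)"
     using True R0 d delta by (intro powr_mono2') (auto intro!: add_pos_nonneg)
    hence "2 powr (1 + delta) * 2 powr (- 1 - delta) <= 2 powr (1 + delta) * (1 + R * d) powr (- 1 - delta)"
     by (intro mult_left_mono) auto
    hence "1 <= 2 powr (1 + delta) * (1 + R * d) powr (- 1 - delta)" by (simp add: powr_add[symmetric])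
    moreover have "0 <= C0*(A + 5 powr N + 2*P) * R * m"
     using CM A P R0 m by (intro mult_nonneg_nonneg add_nonneg_nonneg) auto
    ultimately show ?thesis
     using mult_left_mono[of 1 "2 powr (1 + delta) * (1 + R * d) powr (- 1 - delta)" "C0*(A + 5 powr N + 2*P) * R * m"] by simp
   qed
   finally show ?thesis by (simp add: C_def mult_ac)
  next
   case False
   hence Rd: "R * d >= 1" by simp
   have d0: "d > 0" using Rd R0 d by (cases "d = 0") auto
   \<comment> \<open>Below height 1/d the exponential is of order one and the power of t is
     integrated directly; above it the exponential beats every power.\<close>
   define L where "L = 1/d"
   have L: "1 <= L" "L <= R" "L > 0" using d0 d Rd R0 by (auto simp: L_def field_simps)
   have high: "norm (integral {L..T} (%t. hk delta R x y (Complex R t))) <= C0*m * (2*P) * R powr (- delta) * L powr (delta + 1)"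
    if T: "L <= T" for T
   proof -
    let ?B = "C0*m * (2*P) * R powr (- delta) * d powr (- delta - 2)"
    have "norm (integral {L..T} (%t. hk delta R x y (Complex R t))) <= ?B / (real (0+1) * (0 + L) ^ (0+1)) - ?B / (real (0+1) * (0 + T) ^ (0+1))"
    proof (rule integral_norm_le)
     show "(%t. hk delta R x y (Complex R t)) integrable_on {L..T}"
      by (rule integrable_on_subinterval[OF hk_vertical_integrable[of R x y delta T]]) (use R0 rR xy delta L in auto)
     show "((%t. ?B / (0 + t) ^ (0 + 2)) has_integral
       ?B / (real (0+1) * (0 + L) ^ (0+1)) - ?B / (real (0+1) * (0 + T) ^ (0+1))) {L..T}"
      by (rule has_integral_inverse_power_shift) (use L T in auto)
     fix t assume t: "t : {L..T}"
     have t0: "t > 0" "t >= 1" using t L by auto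
     define s where "s = d * t"
     have s: "s >= 1" using t d0 by (simp add: s_def L_def field_simps)
     have "1/R <= d" using Rd R0 by (simp add: divide_le_eq mult.commute)
     hence ts: "t / R <= s" using t0 mult_right_mono[of "1/R" d t] by (simp add: s_def)
     have e: "(t / R) powr delta * (1 + 1/t) <= 2*(R powr (- delta) * t powr delta)"
     proof -
      have "1 + 1/t <= 2" using t0 by simp
      hence "(t / R) powr delta * (1 + 1/t) <= (t / R) powr delta * 2" by (intro mult_left_mono) auto
      thus ?thesis unfolding powr_div_eq[OF t0(1) R0(1)] by (simp only: mult_ac)
     qed
     have f: "(2 + t / R) powr N * exp (- s) <= P * s powr (- delta - 2)"
     proof -
      have "(2 + t / R) powr N <= (2 + s) powr N" using ts t0 R0 N by (intro powr_mono2) auto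
      hence "(2 + t / R) powr N * exp (- s) <= (2 + s) powr N * exp (- s)" by (intro mult_right_mono) auto
      also have "(2 + s) powr N = (2 + s) powr (N + delta + 2) * (2 + s) powr (- delta - 2)"
       by (simp add: powr_add[symmetric])
      also have "(2 + s) powr (N + delta + 2) * (2 + s) powr (- delta - 2) * exp (- s) = ((2 + s) powr (N + delta + 2) * exp (- s)) * (2 + s) powr (- delta - 2)"
       by (simp only: mult_ac)
      also have "... <= P * s powr (- delta - 2)"
       using s P delta by (intro mult_mono P powr_mono2') auto
      finally show ?thesis .
     qed
     have "norm (hk delta R x y (Complex R t)) <= C0*m * ((t / R) powr delta * (1 + 1/t)) * ((2 + t / R) powr N * exp (- s))"
      using CM(3)[OF h xy t0(1)] by (simp add: m_def N_def s_def d_def)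
     also have "... <= C0*m * (2*(R powr (- delta) * t powr delta)) * (P * s powr (- delta - 2))"
      using CM m t0 by (intro mult_mono mult_left_mono e f) (auto intro!: mult_nonneg_nonneg)
     also have "... = ?B / t\<^sup>2"
     proof -
      have "t powr delta * s powr (- delta - 2) = d powr (- delta - 2) / t\<^sup>2"
      proof -
       have s1: "s powr (- delta - 2) = d powr (- delta - 2) * t powr (- delta - 2)" by (simp add: s_def powr_mult)
       have s2: "t powr delta * t powr (- delta - 2) = 1/t\<^sup>2"
        using t0 by (simp add: powr_add[symmetric] powr_minus divide_inverse)
       have "t powr delta * s powr (- delta - 2) = d powr (- delta - 2) * (t powr delta * t powr (- delta - 2))"
        unfolding s1 by (rule mult.left_commute)
       thus ?thesis unfolding s2 by simp
      qed
      hence "C0*m * (2*P) * R powr (- delta) * (t powr delta * s powr (- delta - 2)) = C0*m * (2*P) * R powr (- delta) * (d powr (- delta - 2) / t\<^sup>2)"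
       by simp
      thus ?thesis by (simp add: mult_ac)
     qed
     finally show "norm (hk delta R x y (Complex R t)) <= ?B / (0 + t) ^ (0 + 2)" by (simp add: power2_eq_square)
    qed
    also have "... <= ?B / L" using CM m P L T by simp
    also have "?B / L = C0*m * (2*P) * R powr (- delta) * L powr (delta + 1)"
    proof -
     have "d powr (- delta - 2) / L = d powr (- delta - 2) * d powr 1" using d0 by (simp add: L_def)
     also have "... = d powr (- delta - 2 + 1)" by (rule powr_add[symmetric])
     also have "- delta - 2 + 1 = - (delta + 1)" by simp
     also have "d powr (- (delta + 1)) = L powr (delta + 1)" unfolding L_def by (rule powr_one_div[OF d0, symmetric])
     finally have e: "d powr (- delta - 2) / L = L powr (delta + 1)" .
     have "?B / L = C0*m * (2*P) * R powr (- delta) * (d powr (- delta - 2) / L)" by simp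
     thus ?thesis unfolding e .
    qed
    finally show ?thesis .
   qed
   have main: "pi * (\<bar>Kern delta R x y\<bar> * (x * y) powr a) <= C0*m * (A + 2*P) * R powr (- delta) * L powr (delta + 1) + e"
    if e: "e > 0" for e
   proof -
    define E where "E = R * (C0*m * 5 powr N * P')"
    have E: "E > 0" using R0 CM m P' by (simp add: E_def)
    \<comment> \<open>The horizontal side is at most E / (2 + d T), so this height makes it at most
      e.\<close>
    define T where "T = max R (E / (e * d))"
    have T: "T >= R" "T >= L" "T > 0" "T >= E / (e * d)" using L R0 by (auto simp: T_def)
    define s where "s = d * T"
    have s0: "s > 0" using d0 T by (simp add: s_def)
    have "E / e <= s" using T(4) d0 e by (simp add: s_def field_simps)
    hence Ee: "E / (2 + s) <= e" using e s0 E by (simp add: field_simps)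
    have "1/R <= d" using Rd R0 by (simp add: divide_le_eq mult.commute)
    hence "T / R <= 2 + s" using T mult_right_mono[of "1/R" d T] by (simp add: s_def)
    hence "(T / R)\<^sup>2 <= (2 + s)\<^sup>2" using R0 T by (intro power_mono) auto
    hence "(5*(T / R)\<^sup>2) powr N <= (5*(2 + s)\<^sup>2) powr N" using N by (intro powr_mono2) auto
    also have "... = 5 powr N * (2 + s) powr (2*N)"
     using s0 by (simp add: powr_mult powr_powr flip: powr_numeral)
    also have "(2 + s) powr (2*N) = (2 + s) powr (2*N + 1) / (2 + s)" using s0 by (simp add: powr_add)
    finally have "(5*(T / R)\<^sup>2) powr N * exp (- s) <= 5 powr N * ((2 + s) powr (2*N + 1) / (2 + s)) * exp (- s)"
     by (intro mult_right_mono) auto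
    also have "... = 5 powr N * ((2 + s) powr (2*N + 1) * exp (- s)) / (2 + s)" by simp
    also have "... <= 5 powr N * P' / (2 + s)"
     using P'(2)[of s] s0 by (intro divide_right_mono mult_left_mono) auto
    finally have "R * (C0*m) * ((5*(T / R)\<^sup>2) powr N * exp (- s)) <= R * (C0*m) * (5 powr N * P' / (2 + s))"
     using R0 CM m by (intro mult_left_mono) auto
    also have "... = E / (2 + s)" by (simp add: E_def)
    finally have hh: "norm (integral {0..R} (%r. hk delta R x y (Complex r T))) <= e"
     using hor[OF T(1)] Ee by (simp add: s_def mult_ac)
    have i: "(%t. hk delta R x y (Complex R t)) integrable_on {0..T}"
     by (rule hk_vertical_integrable) (use R0 rR xy delta in auto)
    have "norm (integral {0..T} (%t. hk delta R x y (Complex R t))) <=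
     norm (integral {0..L} (%t. hk delta R x y (Complex R t))) + norm (integral {L..T} (%t. hk delta R x y (Complex R t)))"
     using Henstock_Kurzweil_Integration.integral_combine[OF _ T(2) i] L norm_triangle_ineq by (metis less_imp_le)
    also have "... <= C0*m * A * R powr (- delta) * L powr (delta + 1) + C0*m * (2*P) * R powr (- delta) * L powr (delta + 1)"
     by (intro add_mono low' high L T)
    also have "... = C0*m * (A + 2*P) * R powr (- delta) * L powr (delta + 1)" by (simp add: algebra_simps)
    finally show ?thesis using form[OF T(3)] hh by linarith
   qed
   have 1: "pi * (\<bar>Kern delta R x y\<bar> * (x * y) powr a) <= C0*m * (A + 2*P) * R powr (- delta) * L powr (delta + 1)"
    by (rule field_le_epsilon) (rule main)
   have "\<bar>Kern delta R x y\<bar> * (x * y) powr a <= pi * (\<bar>Kern delta R x y\<bar> * (x * y) powr a)"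
    using pi_ge_two mult_right_mono[of 1 pi "\<bar>Kern delta R x y\<bar> * (x * y) powr a"] by simp
   also note 1
   also have "C0*m * (A + 2*P) * R powr (- delta) * L powr (delta + 1) = C0*m * (A + 2*P) * R * (R * d) powr (- (delta + 1))"
   proof -
    have "L powr (delta + 1) = d powr (- (delta + 1))" unfolding L_def by (rule powr_one_div[OF d0])
    moreover have "R powr (- delta) = R * R powr (- (delta + 1))"
     using R0 powr_add[of R 1 "- (delta + 1)"] by simp
    ultimately have "R powr (- delta) * L powr (delta + 1) = R * (R * d) powr (- (delta + 1))"
     by (simp only: powr_mult mult.assoc)
    thus ?thesis by (simp only: mult.assoc)
   qed
   also have "C0*m * (A + 2*P) * R * (R * d) powr (- (delta + 1))
    <= C0*m * (A + 2*P) * R * (2 powr (1 + delta) * (1 + R * d) powr (- 1 - delta))"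
   proof (rule mult_left_mono)
    have "(1 + R * d) / 2 <= R * d" using Rd by simp
    hence "(R * d) powr (- (delta + 1)) <= ((1 + R * d) / 2) powr (- (delta + 1))"
     using Rd delta by (intro powr_mono2') auto
    also have "... = 2 powr (- (- (delta + 1))) * (1 + R * d) powr (- (delta + 1))"
     using Rd by (intro powr_div_eq) auto
    also have "... = 2 powr (1 + delta) * (1 + R * d) powr (- 1 - delta)"
    proof -
     have "- (- (delta + 1)) = 1 + delta" "- (delta + 1) = - 1 - delta" by simp_all
     thus ?thesis by (simp only:)
    qed
    finally show "(R * d) powr (- (delta + 1)) <= 2 powr (1 + delta) * (1 + R * d) powr (- 1 - delta)" .
    show "0 <= C0*m * (A + 2*P) * R"
     using CM A P R0 m by (intro mult_nonneg_nonneg add_nonneg_nonneg) auto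
   qed
   also have "C0*m * (A + 2*P) * R * (2 powr (1 + delta) * (1 + R * d) powr (- 1 - delta)) <= C * R * m * (1 + R * d) powr (- 1 - delta)"
   proof -
    have "C0*(A + 2*P) <= C0*(A + 5 powr N + 2*P)" using CM by (intro mult_left_mono) auto
    hence "C0*(A + 2*P) * (m * R * 2 powr (1 + delta) * (1 + R * d) powr (- 1 - delta))
     <= C0*(A + 5 powr N + 2*P) * (m * R * 2 powr (1 + delta) * (1 + R * d) powr (- 1 - delta))"
     using m R0 by (intro mult_right_mono) auto
    thus ?thesis by (simp add: C_def mult_ac)
   qed
   finally show ?thesis .
  qed
  show "\<bar>Kern delta R x y\<bar> * (x * y) powr a <= C * R * min 1 (R * y) powr a * (1 + R * (x - y)) powr (- 1 - delta)"
   using final by (simp add: m_def d_def)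
 qed
qed

end

context bessel_jost
begin

lemma Kern_sym: "Kern delta R x y = Kern delta R y x"
 by (simp add: Kern_def mult_ac)

definition dj :: "nat => real" where "dj j = bz (Suc j) / 2*rE (nu + 1) (bz (Suc j))"

lemma dj_nonzero: "dj j ~= 0"
 using simple_zero[OF bz_pos bz_Suc(2), of j] bz_pos[of j] by (simp add: dj_def)

lemma psi_mult': "x > 0 ==> y > 0 ==>
  psi nu (Suc j) x * psi nu (Suc j) y = 2*rE nu (bz (Suc j) * x) * rE nu (bz (Suc j) * y) / (dj j)\<^sup>2"
 unfolding dj_def by (rule psi_mult)

lemma Kern_eq:
 assumes delta: "delta > 0" and J: "finite J" "{j. bz (Suc j) < R} <= J" and R: "R > 0"
 shows "Kern delta R x y = (\<Sum>j\<in>J. max 0 (1 - (bz (Suc j))\<^sup>2/R\<^sup>2) powr delta * (psi nu (Suc j) x * psi nu (Suc j) y))"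
 unfolding Kern_def
proof (rule sum.mono_neutral_cong_left[OF J(1) J(2)])
 have iff: "bz (Suc j) < R \<longleftrightarrow> 1 - (bz (Suc j))\<^sup>2/R\<^sup>2 > 0" for j
 proof -
  have "bz (Suc j) < R \<longleftrightarrow> (bz (Suc j))\<^sup>2 < R\<^sup>2"
   using power2_less_imp_less[of "bz (Suc j)" R] power_strict_mono[of "bz (Suc j)" R 2] bz_pos[of j] R by auto
  also have "... \<longleftrightarrow> (bz (Suc j))\<^sup>2/R\<^sup>2 < 1" using R by (subst divide_less_eq_1_pos) auto
  finally show ?thesis by simp
 qed
 show "\<forall>j\<in>J - {j. bz (Suc j) < R}. max 0 (1 - (bz (Suc j))\<^sup>2/R\<^sup>2) powr delta * (psi nu (Suc j) x * psi nu (Suc j) y) = 0"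
  using iff by (auto simp: max_def not_less)
 fix j assume "j : {j. bz (Suc j) < R}"
 thus "(1 - (bz (Suc j))\<^sup>2/R\<^sup>2) powr delta * psi nu (Suc j) x * psi nu (Suc j) y =
   max 0 (1 - (bz (Suc j))\<^sup>2/R\<^sup>2) powr delta * (psi nu (Suc j) x * psi nu (Suc j) y)"
  using iff[of j] by (simp add: max_def)
qed

text \<open>Each truncated weight is continuous in R because delta > 0. This later admits values of
  R that are themselves zeros.\<close>

lemma Kern_tendsto:
 assumes delta: "delta > 0" and R: "R > 0"
 shows "((%r. Kern delta r x y) \<longlongrightarrow> Kern delta R x y) (at_right R)"
proof -
 define J where "J = {j. bz (Suc j) < R + 1}"
 have J: "finite J" unfolding J_def by (rule finite_bz_below)
 let ?G = "%r. \<Sum>j\<in>J. max 0 (1 - (bz (Suc j))\<^sup>2/r\<^sup>2) powr delta * (psi nu (Suc j) x * psi nu (Suc j) y)"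
 have eq: "Kern delta r x y = ?G r" if "0 < r" "r <= R + 1" for r
  by (rule Kern_eq[OF delta J]) (use that in "auto simp: J_def")
 have "(?G \<longlongrightarrow> ?G R) (at_right R)"
  using R delta by (intro tendsto_intros tendsto_powr') auto
 moreover have "\<forall>\<^sub>F r in at_right R. ?G r = Kern delta r x y"
  unfolding eventually_at_right_field by (rule exI[of _ "R + 1"]) (use R eq in auto)
 ultimately have "((%r. Kern delta r x y) \<longlongrightarrow> ?G R) (at_right R)"
  by (rule Lim_transform_eventually)
 thus ?thesis using eq[of R] R by simp
qed

lemma rE_bounded: "\<exists>B\<ge>0. \<forall>x\<in>{0..M}. \<bar>rE nu x\<bar> <= B"
proof -
 have "continuous_on {0..M} (rE nu)"
  using has_real_derivative_rE[OF nu] by (intro continuous_at_imp_continuous_on ballI DERIV_isCont)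
 hence "compact (rE nu ` {0..M})" by (intro compact_continuous_image) auto
 from compact_imp_bounded[OF this] obtain B where "\<forall>y\<in>rE nu ` {0..M}. norm y <= B"
  unfolding bounded_iff by (rule exE)
 thus ?thesis by (intro exI[of _ "max 0 B"]) (auto intro: le_max_iff_disj[THEN iffD2])
qed

abbreviation wt :: "real => real => real" where "wt R x \<equiv> max x (1/R)"

text \<open>Since min(1, R y) = y / max(y, 1/R), the factor y^{-a} min(1, R y)^a is max(y,
  1/R)^{-a}. The same weight in x is comparable to x^{-a} when x >= c/R, so the bound can be written
  symmetrically.\<close>

definition Maj :: "real => real => real => real => real" where
 "Maj delta R x y = R * wt R x powr (- a) * wt R y powr (- a) * (1 + R * \<bar>x - y\<bar>) powr (- 1 - delta)"

lemma Maj_sym: "Maj delta R x y = Maj delta R y x"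
 by (simp add: Maj_def mult_ac abs_minus_commute)

lemma Maj_nonneg: "R > 0 ==> Maj delta R x y >= 0"
 by (simp add: Maj_def)

text \<open>The estimate is rewritten with symmetric weights, the comparison of x with max(x, 1/R)
  costing c^{-|a|}. If R is a zero, it is approached from the right by values that are not.\<close>

lemma kernel_bound_large':
 assumes c: "c > 0" "c <= 1" and delta: "delta > 0"
 obtains C M where "C > 0" "M >= 1"
  "!!R x y. R >= M ==> 0 < y ==> y <= x ==> x <= 1 ==> c / R <= x ==> \<bar>Kern delta R x y\<bar> <= C * Maj delta R x y"
proof (rule kernel_bound_large[OF c delta])
 fix C M assume CM: "C > 0" "M >= 1"
  "!!R x y. R >= M ==> rE nu R ~= 0 ==> 0 < y ==> y <= x ==> x <= 1 ==> c / R <= x ==>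
   \<bar>Kern delta R x y\<bar> * (x * y) powr a <= C * R * min 1 (R * y) powr a * (1 + R * (x - y)) powr (- 1 - delta)"
 define C' where "C' = C * c powr (- \<bar>a\<bar>)"
 have C': "C' > 0" using CM c by (simp add: C'_def)
 have gen: "\<bar>Kern delta R x y\<bar> <= C' * Maj delta R x y"
  if h: "R >= M" "rE nu R ~= 0" "0 < y" "y <= x" "x <= 1" "c / R <= x" for R x y
 proof -
  have R0: "R > 0" using h CM by linarith
  have x0: "x > 0" using h by linarith
  have wy: "wt R y > 0" and wx: "wt R x > 0" using h(3) x0 by (simp_all add: less_max_iff_disj)
  have my: "min 1 (R * y) = y / wt R y"
   using R0 h by (auto simp: min_def max_def field_simps)
  have xy: "(x * y) powr a = x powr a * y powr a" by (rule powr_mult)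
  have pos: "x powr a > 0" "y powr a > 0" using x0 h by auto
  have yy: "min 1 (R * y) powr a / y powr a = wt R y powr (- a)"
  proof -
   have "(y / W) powr a / y powr a = W powr (- a)" for W
    unfolding powr_divide powr_minus_divide using pos by simp
   thus ?thesis unfolding my .
  qed
  have xx0: "x powr (- a) <= c powr (- \<bar>a\<bar>) * wt R x powr (- a)"
  proof (cases "a >= 0")
   case True
   have "c * wt R x <= x" using c h x0 R0 by (auto simp: max_def mult_left_le_one_le)
   hence "x powr (- a) <= (c * wt R x) powr (- a)" using True c wx by (intro powr_mono2') auto
   also have "... = c powr (- a) * wt R x powr (- a)" by (rule powr_mult)
   finally show ?thesis using True by (simp only: abs_of_nonneg)
  next
   case False
   have "x powr (- a) <= wt R x powr (- a)" using False x0 by (intro powr_mono2) auto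
   also have "... <= c powr (- \<bar>a\<bar>) * wt R x powr (- a)"
   proof -
    have "1 powr (- \<bar>a\<bar>) <= c powr (- \<bar>a\<bar>)" using c by (intro powr_mono2') auto
    thus ?thesis by (simp add: mult_le_cancel_right1)
   qed
   finally show ?thesis .
  qed
  have xx: "1/x powr a <= c powr (- \<bar>a\<bar>) * wt R x powr (- a)"
   using xx0 by (simp only: powr_minus_divide[of x])
  have alg: "(C * R * m * e) / (X * Y) = C * R * e * (m / Y) * (1/X)" for m e X Y :: real by (simp add: mult_ac)
  have "\<bar>Kern delta R x y\<bar> = (\<bar>Kern delta R x y\<bar> * (x * y) powr a) / (x powr a * y powr a)"
   unfolding xy using pos by simp
  also have "... <= (C * R * min 1 (R * y) powr a * (1 + R * (x - y)) powr (- 1 - delta)) / (x powr a * y powr a)"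
   using CM(3)[OF h] pos by (intro divide_right_mono) auto
  also have "... = C * R * (1 + R * (x - y)) powr (- 1 - delta) * (min 1 (R * y) powr a / y powr a) * (1/x powr a)"
   by (rule alg)
  also have "... <= C * R * (1 + R * (x - y)) powr (- 1 - delta) * (min 1 (R * y) powr a / y powr a) * (c powr (- \<bar>a\<bar>) * wt R x powr (- a))"
   using CM R0 by (intro mult_left_mono xx) auto
  also have "... = C' * Maj delta R x y"
   unfolding yy Maj_def C'_def using h by (simp add: mult_ac)
  finally show ?thesis .
 qed
 show thesis
 proof (rule that[OF C' CM(2)])
  fix R x y assume h: "R >= M" "0 < y" "y <= x" "x <= 1" "c / R <= x"
  have R0: "R > 0" using h CM by linarith
  show "\<bar>Kern delta R x y\<bar> <= C' * Maj delta R x y"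
  proof (rule tendsto_le[of "at_right R"])
   show "((%r. \<bar>Kern delta r x y\<bar>) \<longlongrightarrow> \<bar>Kern delta R x y\<bar>) (at_right R)"
    by (intro tendsto_rabs Kern_tendsto delta R0)
   have "(1 + R * \<bar>x - y\<bar>) > 0" using R0 by (intro add_pos_nonneg) auto
   moreover have "wt R x > 0" "wt R y > 0" using h R0 by (auto simp: max_def)
   ultimately show "((%r. C' * Maj delta r x y) \<longlongrightarrow> C' * Maj delta R x y) (at_right R)"
    unfolding Maj_def using R0 by (intro tendsto_intros) auto
   have "\<forall>\<^sub>F r in at_right R. rE nu r ~= 0"
    using zeros_isolated[of R] R0 by (auto simp: eventually_at_split)
   moreover have "\<forall>\<^sub>F r in at_right R. r > R" by (simp add: eventually_at_right_less)
   ultimately show "\<forall>\<^sub>F r in at_right R. \<bar>Kern delta r x y\<bar> <= C' * Maj delta r x y"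
   proof eventually_elim
    case (elim r)
    have "c / r <= c / R" using elim R0 c by (intro divide_left_mono) auto
    thus ?case using elim h by (intro gen) auto
   qed
  qed simp
 qed
qed

text \<open>Three regimes remain to be joined. For large R with the larger variable at least c/R the
  contour estimate applies. With both variables below c/R, each term is dominated by the diagonal
  term at c/R, where E_nu is still bounded below. For R < M there are finitely many bounded terms,
  and none at all for R up to the first zero.\<close>

theorem kernel_bound:
 assumes delta: "delta > 0"
 obtains C where "C > 0"
  "!!R x y. R > 0 ==> 0 < x ==> x < 1 ==> 0 < y ==> y < 1 ==> \<bar>Kern delta R x y\<bar> <= C * Maj delta R x y"
proof -
 obtain c where c: "0 < c" "c <= 1" "!!x. 0 <= x ==> x <= c ==> rE nu x >= rE nu 0/2"
  using rE_pos_near_0 by blast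
 obtain C1 M where C1: "C1 > 0" "M >= 1"
  "!!R x y. R >= M ==> 0 < y ==> y <= x ==> x <= 1 ==> c / R <= x ==> \<bar>Kern delta R x y\<bar> <= C1*Maj delta R x y"
  using kernel_bound_large'[OF c(1,2) delta] by blast
 obtain B where B: "B >= 0" "!!x. 0 <= x ==> x <= max 1 M ==> \<bar>rE nu x\<bar> <= B"
  using rE_bounded[of "max 1 M"] by auto
 define e where "e = rE nu 0/2"
 have e: "e > 0" using rE_0[OF nu] by (simp add: e_def)
 text \<open>Near the origin the kernel is controlled by its value on the diagonal.\<close>
 define C2 where "C2 = B\<^sup>2/e\<^sup>2*C1*2 powr (1 + delta)"
 have small: "\<bar>Kern delta R x y\<bar> <= C2*Maj delta R x y"
  if h: "R >= M" "0 < y" "y <= x" "x < c / R" for R x y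
 proof -
  have R0: "R > 0" using h C1 by linarith
  define x0 where "x0 = c / R"
  have x0: "x0 > 0" "x0 <= 1" "x0 <= 1/R" using c C1(2) h R0 by (auto simp: x0_def field_simps)
  have le: "\<bar>psi nu (Suc j) x * psi nu (Suc j) y\<bar> <= B\<^sup>2/e\<^sup>2*(psi nu (Suc j) x0*psi nu (Suc j) x0)"
   if j: "bz (Suc j) < R" for j
  proof -
   define s where "s = bz (Suc j)"
   have s: "s > 0" "s < R" using j bz_pos by (auto simp: s_def)
   have rng: "0 <= s * u" "s * u <= c" if "0 < u" "u <= x0" for u
   proof -
    show "0 <= s * u" using s that by simp
    have "s * u <= R * x0" using s that by (intro mult_mono) auto
    thus "s * u <= c" using R0 by (simp add: x0_def)
   qed
   have b: "\<bar>rE nu (s * u)\<bar> <= B" if "0 < u" "u <= x0" for u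
    using rng[OF that] c(2) by (intro B) auto
   have bx: "\<bar>rE nu (s * x)\<bar> <= B" "\<bar>rE nu (s * y)\<bar> <= B" using h x0 by (auto intro!: b simp: x0_def)
   have ex: "e <= rE nu (s * x0)" unfolding e_def using rng[of x0] x0 by (intro c(3)) auto
   have "\<bar>rE nu (s * x)\<bar> * \<bar>rE nu (s * y)\<bar> <= B\<^sup>2" unfolding power2_eq_square using bx B by (intro mult_mono) auto
   also have "B\<^sup>2 = B\<^sup>2/e\<^sup>2*e\<^sup>2" using e by simp
   also have "... <= B\<^sup>2/e\<^sup>2*(rE nu (s * x0) * rE nu (s * x0))"
    unfolding power2_eq_square[of e] using ex e by (intro mult_left_mono mult_mono) auto
   finally have 1: "\<bar>rE nu (s * x)\<bar> * \<bar>rE nu (s * y)\<bar> <= B\<^sup>2/e\<^sup>2*(rE nu (s * x0) * rE nu (s * x0))" .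
   have "\<bar>psi nu (Suc j) x * psi nu (Suc j) y\<bar> = 2/(dj j)\<^sup>2*(\<bar>rE nu (s * x)\<bar> * \<bar>rE nu (s * y)\<bar>)"
    using h by (subst psi_mult') (auto simp: s_def abs_mult)
   also have "... <= 2/(dj j)\<^sup>2*(B\<^sup>2/e\<^sup>2*(rE nu (s * x0) * rE nu (s * x0)))"
    by (intro mult_left_mono 1) auto
   also have "... = B\<^sup>2/e\<^sup>2*(psi nu (Suc j) x0*psi nu (Suc j) x0)"
    unfolding psi_mult'[OF x0(1) x0(1)] s_def by (simp add: mult_ac)
   finally show ?thesis .
  qed
  have "\<bar>Kern delta R x y\<bar> <= (\<Sum>j | bz (Suc j) < R. (1 - (bz (Suc j))\<^sup>2/R\<^sup>2) powr delta * \<bar>psi nu (Suc j) x * psi nu (Suc j) y\<bar>)"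
   unfolding Kern_def by (rule order_trans[OF sum_abs]) (simp add: abs_mult mult.assoc)
  also have "... <= (\<Sum>j | bz (Suc j) < R. (1 - (bz (Suc j))\<^sup>2/R\<^sup>2) powr delta * (B\<^sup>2/e\<^sup>2*(psi nu (Suc j) x0*psi nu (Suc j) x0)))"
   by (intro sum_mono mult_left_mono le) auto
  also have "... = B\<^sup>2/e\<^sup>2*Kern delta R x0 x0"
   unfolding Kern_def sum_distrib_left by (simp add: mult_ac)
  also have "... <= B\<^sup>2/e\<^sup>2*(C1*Maj delta R x0 x0)"
   using C1(3)[of R x0 x0] h x0 by (intro mult_left_mono) (auto simp: x0_def)
  also have "Maj delta R x0 x0 <= 2 powr (1 + delta) * Maj delta R x y"
  proof -
   have w: "wt R x0 = 1/R" "wt R x = 1/R" "wt R y = 1/R" using x0 h by (auto simp: max_def x0_def)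
   have "R * \<bar>x - y\<bar> <= R * x0" using h R0 by (intro mult_left_mono) (auto simp: x0_def)
   hence "1 + R * \<bar>x - y\<bar> <= 2" using R0 c by (simp add: x0_def)
   hence "2 powr (- 1 - delta) <= (1 + R * \<bar>x - y\<bar>) powr (- 1 - delta)"
    using R0 delta by (intro powr_mono2') (auto intro!: add_pos_nonneg)
   hence "2 powr (1 + delta) * 2 powr (- 1 - delta) <= 2 powr (1 + delta) * (1 + R * \<bar>x - y\<bar>) powr (- 1 - delta)"
    by (intro mult_left_mono) auto
   hence g: "1 <= 2 powr (1 + delta) * (1 + R * \<bar>x - y\<bar>) powr (- 1 - delta)" by (simp add: powr_add[symmetric])
   have "Maj delta R x0 x0 = R * (1/R) powr (- a) * (1/R) powr (- a) * 1" by (simp add: Maj_def w)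
   also have "... <= R * (1/R) powr (- a) * (1/R) powr (- a) * (2 powr (1 + delta) * (1 + R * \<bar>x - y\<bar>) powr (- 1 - delta))"
    using R0 by (intro mult_left_mono g) auto
   finally show ?thesis by (simp add: Maj_def w mult_ac)
  qed
  hence "B\<^sup>2/e\<^sup>2*(C1*Maj delta R x0 x0) <= B\<^sup>2/e\<^sup>2*(C1*(2 powr (1 + delta) * Maj delta R x y))"
   using C1 by (intro mult_left_mono) auto
  finally show ?thesis by (simp add: C2_def mult_ac)
 qed
 define b where "b = bz 1"
 have b: "b > 0" using bz_pos[of 0] by (simp add: b_def)
 define J where "J = {j. bz (Suc j) < M}"
 have J: "finite J" unfolding J_def by (rule finite_bz_below)
 define C4 where "C4 = (\<Sum>j\<in>J. 2/(dj j)\<^sup>2*B\<^sup>2)"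
 define kpp where "kpp = min ((1/M) powr (- a)) (max 1 (1/b) powr (- a))"
 have kap: "kpp > 0" using C1(2) by (auto simp: kpp_def)
 \<comment> \<open>A positive lower bound for \<open>Maj\<close> when b < R < M; \<open>kpp\<close>
   bounds the weight from below for either sign of a.\<close>
 define L where "L = b * kpp * kpp * (1 + M) powr (- 1 - delta)"
 have L: "L > 0" using b kap C1(2) by (simp add: L_def)
 have C40: "C4 >= 0" unfolding C4_def by (intro sum_nonneg) auto
 have bounded: "\<bar>Kern delta R x y\<bar> <= C4/L * Maj delta R x y"
  if h: "0 < R" "R < M" "0 < y" "y < 1" "0 < x" "x < 1" for R x y
 proof (cases "R <= b")
  case True
  have "b <= bz (Suc j)" for j using strict_mono_less_eq[OF strict_mono_bz, of 1 "Suc j"] by (simp add: b_def)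
  hence "{j. bz (Suc j) < R} = {}" using True by (auto simp: not_less intro: order_trans)
  hence "Kern delta R x y = 0" by (simp add: Kern_def)
  thus ?thesis using Maj_nonneg[OF h(1)] L C40 by simp
 next
  case False
  have Rb: "R > b" using False by simp
  have "\<bar>Kern delta R x y\<bar> <= (\<Sum>j | bz (Suc j) < R. \<bar>(1 - (bz (Suc j))\<^sup>2/R\<^sup>2) powr delta * (psi nu (Suc j) x * psi nu (Suc j) y)\<bar>)"
   unfolding Kern_def mult.assoc by (rule sum_abs)
  also have "... <= (\<Sum>j | bz (Suc j) < R. 2/(dj j)\<^sup>2*B\<^sup>2)"
  proof (rule sum_mono)
   fix j assume "j : {j. bz (Suc j) < R}"
   hence s: "0 < bz (Suc j)" "bz (Suc j) < R" using bz_pos by auto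
   have "(bz (Suc j))\<^sup>2 <= R\<^sup>2" using s by (intro power_mono) auto
   hence "(1 - (bz (Suc j))\<^sup>2/R\<^sup>2) powr delta <= 1 powr delta" using delta h by (intro powr_mono2) auto
   hence p: "(1 - (bz (Suc j))\<^sup>2/R\<^sup>2) powr delta <= 1" by simp
   have r: "\<bar>rE nu (bz (Suc j) * u)\<bar> <= B" if "0 < u" "u < 1" for u
   proof (rule B(2))
    have "bz (Suc j) * u <= bz (Suc j) * 1" using that s by (intro mult_left_mono) auto
    hence "bz (Suc j) * u <= M" using s h by linarith
    thus "bz (Suc j) * u <= max 1 M" by simp
   qed (use that s in auto)
   have q: "\<bar>psi nu (Suc j) x * psi nu (Suc j) y\<bar> <= 2/(dj j)\<^sup>2*B\<^sup>2"
   proof -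
    have "\<bar>psi nu (Suc j) x * psi nu (Suc j) y\<bar> = 2/(dj j)\<^sup>2*(\<bar>rE nu (bz (Suc j) * x)\<bar> * \<bar>rE nu (bz (Suc j) * y)\<bar>)"
     using h by (subst psi_mult') (auto simp: abs_mult)
    also have "... <= 2/(dj j)\<^sup>2*B\<^sup>2" unfolding power2_eq_square[of B]
     using h B by (intro mult_left_mono mult_mono r) auto
    finally show ?thesis .
   qed
   have "\<bar>(1 - (bz (Suc j))\<^sup>2/R\<^sup>2) powr delta * (psi nu (Suc j) x * psi nu (Suc j) y)\<bar>
    = (1 - (bz (Suc j))\<^sup>2/R\<^sup>2) powr delta * \<bar>psi nu (Suc j) x * psi nu (Suc j) y\<bar>" by (simp add: abs_mult)
   also have "... <= 1*(2/(dj j)\<^sup>2*B\<^sup>2)" by (intro mult_mono p q) auto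
   finally show "\<bar>(1 - (bz (Suc j))\<^sup>2/R\<^sup>2) powr delta * (psi nu (Suc j) x * psi nu (Suc j) y)\<bar> <= 2/(dj j)\<^sup>2*B\<^sup>2" by simp
  qed
  also have "... <= C4" unfolding C4_def using J h by (intro sum_mono2) (auto simp: J_def)
  finally have 1: "\<bar>Kern delta R x y\<bar> <= C4" .
  have w: "kpp <= wt R u powr (- a)" if u: "0 < u" "u < 1" for u
  proof -
   have "1/M <= 1/R" using h by (intro divide_left_mono) auto
   hence lo: "1/M <= wt R u" by simp
   have "1/R <= 1/b" using Rb b by (intro divide_left_mono) auto
   hence hi: "wt R u <= max 1 (1/b)" using u by auto
   have wp: "wt R u > 0" using u by simp
   show ?thesis
   proof (cases "a >= 0")
    case True
    have "max 1 (1/b) powr (- a) <= wt R u powr (- a)" using True hi wp by (intro powr_mono2') auto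
    thus ?thesis by (simp add: kpp_def)
   next
    case False
    have "(1/M) powr (- a) <= wt R u powr (- a)" using False lo C1(2) by (intro powr_mono2) auto
    thus ?thesis by (simp add: kpp_def)
   qed
  qed
  have "R * \<bar>x - y\<bar> <= M * 1" using h by (intro mult_mono) auto
  hence "(1 + M) powr (- 1 - delta) <= (1 + R * \<bar>x - y\<bar>) powr (- 1 - delta)"
   using delta h by (intro powr_mono2') (auto intro!: add_pos_nonneg)
  hence "L <= Maj delta R x y"
   unfolding L_def Maj_def using Rb b kap h by (intro mult_mono w) auto
  hence "C4 <= C4/L * Maj delta R x y" using L C40 by (simp add: field_simps mult_left_mono)
  with 1 show ?thesis by linarith
 qed
 define C where "C = max C1 (max C2 (C4/L))"
 have ordered: "\<bar>Kern delta R x y\<bar> <= C * Maj delta R x y"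
  if h: "0 < R" "0 < y" "y <= x" "x < 1" for R x y
 proof -
  have up: "q * Maj delta R x y <= C * Maj delta R x y" if "q <= C" for q
   using that Maj_nonneg[OF h(1)] by (intro mult_right_mono) auto
  consider "R < M" | "R >= M" "x < c / R" | "R >= M" "c / R <= x" by linarith
  thus ?thesis
  proof cases
   case 1 thus ?thesis using bounded[of R y x] h up[of "C4/L"] by (force simp: C_def)
  next
   case 2 thus ?thesis using small[of R y x] h up[of C2] by (force simp: C_def)
  next
   case 3 thus ?thesis using C1(3)[of R y x] h up[of C1] by (force simp: C_def)
  qed
 qed
 show ?thesis
 proof (rule that[of C])
  show "C > 0" using C1 by (simp add: C_def)
  fix R x y :: real assume h: "R > 0" "0 < x" "x < 1" "0 < y" "y < 1"
  show "\<bar>Kern delta R x y\<bar> <= C * Maj delta R x y"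
  proof (cases "y <= x")
   case True thus ?thesis using ordered[of R y x] h by simp
  next
   case False thus ?thesis using ordered[of R x y] h Kern_sym[of delta R x y] Maj_sym[of delta R x y] by simp
  qed
 qed
qed

end

section \<open>Powers of extended reals and the Hardy-Littlewood maximal inequality\<close>

text \<open>The power with infinity sent to infinity, which is the integrand and the outer root in
  \<open>Lp_norm\<close>.\<close>

definition epow :: "ennreal => real => ennreal" where
 "epow v r = (if v = \<infinity> then \<infinity> else ennreal (enn2real v powr r))"

lemma epow_ennreal: "c >= 0 ==> epow (ennreal c) r = ennreal (c powr r)"
 by (simp add: epow_def)

lemma epow_mono:
 assumes "u <= v" "r >= 0" shows "epow u r <= epow v r"
proof (cases "v = \<infinity>")
 case False
 hence "u ~= \<infinity>" using assms(1) by (auto simp: top_unique)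
 moreover have "enn2real u <= enn2real v" using assms(1) False by (intro enn2real_mono) (auto simp: less_top)
 ultimately show ?thesis using False assms(2) by (auto simp: epow_def intro!: ennreal_leI powr_mono2)
qed (simp add: epow_def)

lemma borel_measurable_epow [measurable]:
 assumes [measurable]: "f : borel_measurable M"
 shows "(%x. epow (f x) r) : borel_measurable M"
 unfolding epow_def by measurable

lemma nn_integral_powr_0:
 assumes r: "r > 0" and c: "c >= 0"
 shows "(nni lborel (%t. ennreal (r * t powr (r - 1)) * indicator {0<..<c} t)) = ennreal (c powr r)"
proof -
 have "((%t. t powr (r - 1)) has_integral (c powr (r - 1 + 1) / (r - 1 + 1))) {0..c}"
  using r c by (intro has_integral_powr_from_0) auto
 hence "((%t. r * t powr (r - 1)) has_integral (r * (c powr r / r))) {0<..<c}"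
  by (subst (asm) has_integral_Icc_iff_Ioo) (intro has_integral_mult_right, simp)
 from nn_integral_has_integral_lebesgue[OF _ this]
 have "integral\<^sup>N lborel (%t. ennreal (indicator {0<..<c} t * (r * t powr (r - 1)))) = ennreal (c powr r)"
  using r by simp
 moreover have "(%t. ennreal (indicator {0<..<c} t * (r * t powr (r - 1))))
   = (%t. ennreal (r * t powr (r - 1)) * indicator {0<..<c} t)"
  by (auto simp: indicator_def fun_eq_iff)
 ultimately show ?thesis by simp
qed

lemma epow_layer_cake:
 assumes r: "r > 0"
 shows "(nni lborel (%t. ennreal (r * t powr (r - 1)) * indicator {t. 0 < t & ennreal t < v} t)) = epow v r"
proof (cases v)
 case (real c)
 have "{t. 0 < t & ennreal t < v} = {0<..<c}"
  using real by (auto simp: ennreal_less_iff)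
 thus ?thesis using real nn_integral_powr_0[OF r, of c] by (simp add: epow_ennreal)
next
 case top
 have "of_nat N <= (nni lborel (%t. ennreal (r * t powr (r - 1)) * indicator {t. 0 < t & ennreal t < v} t))" for N
 proof -
  let ?c = "real N powr (1/r)"
  have "of_nat N = ennreal (?c powr r)"
   using r by (simp add: powr_powr ennreal_of_nat_eq_real_of_nat)
  also have "... = (nni lborel (%t. ennreal (r * t powr (r - 1)) * indicator {0<..<?c} t))"
   by (rule nn_integral_powr_0[OF r, symmetric]) simp
  also have "... <= (nni lborel (%t. ennreal (r * t powr (r - 1)) * indicator {t. 0 < t & ennreal t < v} t))"
   by (intro nn_integral_mono mult_left_mono) (auto simp: indicator_def top)
  finally show ?thesis .
 qed
 hence "(nni lborel (%t. ennreal (r * t powr (r - 1)) * indicator {t. 0 < t & ennreal t < v} t)) = \<infinity>"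
  using ennreal_Ex_less_of_nat by (metis infinity_ennreal_def less_top not_le)
 thus ?thesis using top by (simp add: epow_def)
qed

text \<open>Layer-cake formula: the power is written as an integral over levels, and Tonelli
  exchanges the integrals.\<close>

lemma nn_integral_epow:
 assumes "sigma_finite_measure M" and h[measurable]: "h : borel_measurable M" and r: "r > 0"
 shows "(nni M (%x. epow (h x) r)) =
  (nni lborel (%t. ennreal (r * t powr (r - 1)) * indicator {0<..} t * emeasure M {x\<in>space M. ennreal t < h x}))"
proof -
 interpret M: sigma_finite_measure M by fact
 interpret P: pair_sigma_finite M lborel ..
 have "(nni M (%x. epow (h x) r)) =
  (nni M (%x. (nni lborel (%t. ennreal (r * t powr (r - 1)) * (indicator {0<..} t * indicator {t. ennreal t < h x} t)))))"
  by (subst epow_layer_cake[OF r, symmetric])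
   (auto intro!: nn_integral_cong simp: indicator_def)
 also have "... = (nni lborel (%t. (nni M (%x. ennreal (r * t powr (r - 1)) * (indicator {0<..} t * indicator {t. ennreal t < h x} t)))))"
  by (rule P.Fubini'[symmetric]) measurable
 also have "... = (nni lborel (%t. ennreal (r * t powr (r - 1)) * indicator {0<..} t * emeasure M {x\<in>space M. ennreal t < h x}))"
 proof (rule nn_integral_cong)
  fix t :: real
  have "(nni M (%x. ennreal (r * t powr (r - 1)) * (indicator {0<..} t * indicator {t. ennreal t < h x} t)))
   = (nni M (%x. (ennreal (r * t powr (r - 1)) * indicator {0<..} t) * indicator {x\<in>space M. ennreal t < h x} x))"
   by (intro nn_integral_cong) (auto simp: indicator_def)
  also have "... = ennreal (r * t powr (r - 1)) * indicator {0<..} t * emeasure M {x\<in>space M. ennreal t < h x}"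
   by (subst nn_integral_cmult_indicator) auto
  finally show "(nni M (%x. ennreal (r * t powr (r - 1)) * (indicator {0<..} t * indicator {t. ennreal t < h x} t)))
   = ennreal (r * t powr (r - 1)) * indicator {0<..} t * emeasure M {x\<in>space M. ennreal t < h x}" .
 qed
 finally show ?thesis .
qed

abbreviation oivl :: "real \<times> real => real set" where "oivl i \<equiv> {fst i<..<snd i}"

text \<open>Among three intervals through a common point, the one that is neither leftmost nor
 rightmost is redundant.\<close>
lemma interval_subcover_overlap:
 fixes T :: "(real \<times> real) set"
 assumes "finite T"
 obtains T' where "T' <= T" "(\<Union>i\<in>T'. oivl i) = (\<Union>i\<in>T. oivl i)" "!!x. card {i\<in>T'. x : oivl i} <= 2"
proof -
 have "\<exists>T'\<subseteq>T. (\<Union>i\<in>T'. oivl i) = (\<Union>i\<in>T. oivl i) & (\<forall>x. card {i\<in>T'. x : oivl i} <= 2)"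
  using assms
 proof (induction T rule: finite_psubset_induct)
  case (psubset T)
  show ?case
  proof (cases "\<forall>x. card {i\<in>T. x : oivl i} <= 2")
   case False
   then obtain x where x: "card {i\<in>T. x : oivl i} > 2" by (auto simp: not_le)
   define S where "S = {i\<in>T. x : oivl i}"
   have fS: "finite S" "card S > 2" "S <= T" using psubset.hyps x by (auto simp: S_def)
   have Sne: "S ~= {}" using fS by auto
   have "Min (fst ` S) : fst ` S" "Max (snd ` S) : snd ` S"
    using fS(1) Sne by auto
   then obtain l u where lu: "l : S" "Min (fst ` S) = fst l" "u : S" "Max (snd ` S) = snd u"
    by (elim imageE) simp
   have l: "l : S" "!!i. i : S ==> fst l <= fst i"
    using lu fS(1) unfolding lu(2)[symmetric] by (auto intro!: Min_le)
   have u: "u : S" "!!i. i : S ==> snd i <= snd u"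
    using lu fS(1) unfolding lu(4)[symmetric] by (auto intro!: Max_ge)
   have "card {l, u} < card S" using fS by (cases "l = u") auto
   hence "\<not> S <= {l, u}" using card_mono[of "{l, u}" S] by auto
   then obtain r where r: "r : S" "r ~= l" "r ~= u" by auto
   have sub: "oivl r <= oivl l \<union> oivl u"
    using l(2)[OF r(1)] u(2)[OF r(1)] r(1) l(1) u(1) unfolding S_def by force
   have "T - {r} \<subset> T" using r fS by auto
   from psubset.IH[OF this] obtain T' where T': "T' <= T - {r}"
    "(\<Union>i\<in>T'. oivl i) = (\<Union>i\<in>T - {r}. oivl i)" "\<forall>x. card {i\<in>T'. x : oivl i} <= 2" by blast
   have "(\<Union>i\<in>T - {r}. oivl i) = (\<Union>i\<in>T. oivl i)"
   proof
    show "(\<Union>i\<in>T. oivl i) <= (\<Union>i\<in>T - {r}. oivl i)"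
    proof
     fix y assume "y : (\<Union>i\<in>T. oivl i)"
     then obtain i where i: "i : T" "y : oivl i" by blast
     have "l : T - {r}" "u : T - {r}" using r l u fS by auto
     thus "y : (\<Union>i\<in>T - {r}. oivl i)" using i sub by (cases "i = r") blast+
    qed
   qed blast
   moreover have "T' <= T" using T'(1) by blast
   ultimately show ?thesis using T'(2,3) by (intro exI[of _ T'] conjI) simp_all
  qed blast
 qed
 thus ?thesis using that by blast
qed

definition avg :: "real measure => (real => ennreal) => real \<times> real => ennreal" where
 "avg M f i = (nni M (%y. f y * indicator (oivl i) y)) / emeasure M (oivl i)"

text \<open>Restricting to intervals with rational end points makes the maximal function measurable.\<close>
definition HLmax :: "real measure => (real => ennreal) => real => ennreal" where
 "HLmax M f x = (SUP i\<in>\<rat> \<times> \<rat>. avg M f i * indicator (oivl i) x)"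

lemma HLmax_ge: "i : \<rat> \<times> \<rat> ==> x : oivl i ==> avg M f i <= HLmax M f x"
 unfolding HLmax_def by (rule SUP_upper2[of i]) auto

lemma countable_RatRat: "countable (\<rat> \<times> \<rat> :: (real \<times> real) set)"
 by (intro countable_SIGMA countable_rat)

locale line_measure = finite_measure M for M :: "real measure" +
 assumes sets_M [measurable_cong, simp]: "sets M = sets borel"
begin

lemma space_M [simp]: "space M = UNIV"
 using sets_eq_imp_space_eq[OF sets_M] by simp

lemma HLmax_measurable [measurable]: "HLmax M f : borel_measurable M"
 unfolding HLmax_def by (intro borel_measurable_SUP countable_RatRat) measurable

lemma avg_less_imp:
 assumes f: "f : borel_measurable M" and "l < avg M f i"
 shows "l * emeasure M (oivl i) <= (nni M (%y. f y * indicator (oivl i) y))"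
proof (cases "emeasure M (oivl i) = 0")
 case False
 have fin: "emeasure M (oivl i) ~= \<infinity>" using emeasure_finite by simp
 have "l * emeasure M (oivl i) <= avg M f i * emeasure M (oivl i)"
  using assms by (intro mult_right_mono) auto
 also have "... = (nni M (%y. f y * indicator (oivl i) y))"
 proof -
  have "emeasure M (oivl i) / emeasure M (oivl i) = 1"
   by (rule ennreal_divide_self) (use False fin in "simp_all add: less_top[symmetric]")
  thus ?thesis unfolding avg_def by (simp add: ennreal_divide_times)
 qed
 finally show ?thesis .
qed simp

text \<open>A finite family of intervals has a subfamily with the same union covering each point at
  most twice. This gives the constant 2 for an arbitrary finite Borel measure on the line.\<close>

lemma HLmax_weak_type:
 assumes f: "f : borel_measurable M"
 shows "l * emeasure M {x. l < HLmax M f x} <= 2*(nni M (%y. f y))"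
proof -
 define J where "J = {i\<in>\<rat> \<times> \<rat>. l < avg M f i}"
 have cJ: "countable J" unfolding J_def by (rule countable_subset[OF _ countable_RatRat]) auto
 have E: "{x. l < HLmax M f x} = (\<Union>i\<in>J. oivl i)"
 proof safe
  fix x assume "l < HLmax M f x"
  then obtain i where i: "i : \<rat> \<times> \<rat>" "l < avg M f i * indicator (oivl i) x"
   unfolding HLmax_def less_SUP_iff by blast
  hence "x : oivl i" by (cases "x : oivl i") auto
  moreover have "i : J" using i \<open>x : oivl i\<close> by (auto simp: J_def)
  ultimately show "x : (\<Union>i\<in>J. oivl i)" by blast
 next
  fix x a b assume "(a, b) : J" "x : oivl (a, b)"
  thus "l < HLmax M f x" using HLmax_ge[of "(a,b)" x M f] by (auto simp: J_def elim: less_le_trans)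
 qed
 have fin: "l * emeasure M (\<Union>i\<in>T. oivl i) <= 2*(nni M (%y. f y))" if T: "T <= J" "finite T" for T
 proof -
  obtain T' where T': "T' <= T" "(\<Union>i\<in>T'. oivl i) = (\<Union>i\<in>T. oivl i)" "!!x. card {i\<in>T'. x : oivl i} <= 2"
   using interval_subcover_overlap[OF T(2)] by blast
  have fT': "finite T'" using T T' finite_subset by blast
  have "l * emeasure M (\<Union>i\<in>T. oivl i) <= l * (\<Sum>i\<in>T'. emeasure M (oivl i))"
   unfolding T'(2)[symmetric] by (intro mult_left_mono emeasure_subadditive_finite fT') auto
  also have "... = (\<Sum>i\<in>T'. l * emeasure M (oivl i))" by (rule sum_distrib_left)
  also have "... <= (\<Sum>i\<in>T'. \<integral>\<^sup>+y. f y * indicator (oivl i) y \<partial>M)"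
   using T T' by (intro sum_mono avg_less_imp f) (auto simp: J_def)
  also have "... = (nni M (%y. (\<Sum>i\<in>T'. f y * indicator (oivl i) y)))"
   using f by (intro nn_integral_sum[symmetric]) auto
  also have "... <= (nni M (%y. 2*f y))"
  proof (rule nn_integral_mono)
   fix y
   have "(\<Sum>i\<in>T'. indicator (oivl i) y :: ennreal) = (\<Sum>i\<in>{i\<in>T'. y : oivl i}. 1)"
    using fT' by (intro sum.mono_neutral_cong_right) (auto simp: indicator_def)
   also have "... = of_nat (card {i\<in>T'. y : oivl i})" by simp
   also have "... <= of_nat 2" by (rule of_nat_mono[OF T'(3)])
   finally have "(\<Sum>i\<in>T'. indicator (oivl i) y :: ennreal) <= 2" by simp
   from mult_left_mono[OF this, of "f y"]
   show "(\<Sum>i\<in>T'. f y * indicator (oivl i) y) <= 2*f y"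
    by (simp add: sum_distrib_left mult.commute)
  qed
  also have "... = 2*(nni M (%y. f y))" using f by (rule nn_integral_cmult)
  finally show ?thesis .
 qed
 show ?thesis
 proof (cases "J = {}")
  case False
  \<comment> \<open>Finite unions along an enumeration of the countable family of intervals; they
    increase to the superlevel set.\<close>
  define A where "A = (%n. \<Union>i\<in>from_nat_into J ` {..n}. oivl i)"
  have "(\<Union>i\<in>J. oivl i) = (\<Union>n. A n)"
  proof -
   have "J <= (\<Union>n. from_nat_into J ` {..n})"
   proof
    fix x assume "x : J"
    from from_nat_into_surj[OF cJ this] obtain n where "from_nat_into J n = x" by (rule exE)
    thus "x : (\<Union>n. from_nat_into J ` {..n})" by (intro UN_I[of n]) auto
   qed
   moreover have "from_nat_into J ` {..n} <= J" for n using from_nat_into[OF False] by auto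
   ultimately have "J = (\<Union>n. from_nat_into J ` {..n})" by (intro equalityI UN_least)
   hence "(\<Union>i\<in>J. oivl i) = (\<Union>i\<in>(\<Union>n. from_nat_into J ` {..n}). oivl i)" by (rule arg_cong)
   thus ?thesis unfolding A_def by (simp only: UN_UN_flatten)
  qed
  moreover have "incseq A" unfolding A_def incseq_def by (intro allI impI UN_mono image_mono) auto
  ultimately have eq: "emeasure M (\<Union>i\<in>J. oivl i) = (SUP n. emeasure M (A n))"
  proof -
   have "open (A n)" for n unfolding A_def by (intro open_UN) auto
   hence "range A <= sets M" by auto
   from SUP_emeasure_incseq[OF this \<open>incseq A\<close>] \<open>(\<Union>i\<in>J. oivl i) = (\<Union>n. A n)\<close>
   show ?thesis by simp
  qed
  have "l * emeasure M (A n) <= 2*(nni M (%y. f y))" for n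
   unfolding A_def using from_nat_into[OF False] by (intro fin) auto
  thus ?thesis unfolding E eq by (subst SUP_mult_left_ennreal) (auto intro!: SUP_least)
 qed (simp add: E)
qed

text \<open>The part of f below the level l contributes at most l to any average. This is the
  truncation used for interpolation.\<close>

lemma HLmax_split:
 assumes f: "f : borel_measurable M"
 shows "HLmax M f x <= HLmax M (%y. f y * indicator {y. l < f y} y) x + l"
 unfolding HLmax_def[of M f]
proof (rule SUP_least)
 fix i :: "real \<times> real" assume i: "i : \<rat> \<times> \<rat>"
 let ?g = "%y. f y * indicator {y. l < f y} y"
 show "avg M f i * indicator (oivl i) x <= HLmax M ?g x + l"
 proof (cases "x : oivl i")
  case True
  have "(nni M (%y. f y * indicator (oivl i) y)) <= (nni M (%y. ?g y * indicator (oivl i) y + l * indicator (oivl i) y))"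
   by (intro nn_integral_mono) (auto simp: indicator_def not_less)
  also have "... = (nni M (%y. ?g y * indicator (oivl i) y)) + l * emeasure M (oivl i)"
   using f by (subst nn_integral_add) (auto simp: nn_integral_cmult_indicator)
  finally have "avg M f i <= ((nni M (%y. ?g y * indicator (oivl i) y)) + l * emeasure M (oivl i)) / emeasure M (oivl i)"
   unfolding avg_def by (rule divide_right_mono_ennreal)
  also have "... <= avg M ?g i + l"
  proof (cases "emeasure M (oivl i) = 0")
   case True
   hence "(nni M (%y. ?g y * indicator (oivl i) y)) = 0"
   proof -
    have "AE y in M. y \<notin> oivl i" using True by (intro AE_not_in null_setsI) auto
    hence "AE y in M. ?g y * indicator (oivl i) y = 0" by eventually_elim simp
    thus ?thesis using f by (subst nn_integral_0_iff_AE) auto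
   qed
   thus ?thesis using True by simp
  next
   case False
   thus ?thesis unfolding avg_def
    by (simp add: add_divide_distrib_ennreal ennreal_mult_divide_eq emeasure_finite)
  qed
  also have "... <= HLmax M ?g x + l" by (intro add_mono HLmax_ge i True) auto
  finally show ?thesis using True by simp
 qed simp
qed

text \<open>Marcinkiewicz interpolation: at level t only the part of g above t/2 counts, by
  truncation and the weak-type bound. Integrating p t^{p-1} over levels and exchanging the order
  gives 4p times the integral of t^{p-2} up to 2g, which converges because p > 1.\<close>

lemma HLmax_strong_type:
 assumes p: "p > 1" and g[measurable]: "g : borel_measurable M" and g0: "!!x. g x >= 0"
 shows "(nni M (%x. epow (HLmax M (%x. ennreal (g x)) x) p)) <=
  ennreal (4*p * 2 powr (p - 1) / (p - 1)) * (nni M (%x. ennreal (g x powr p)))"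
proof -
 let ?f = "%x. ennreal (g x)"
 have sf: "sigma_finite_measure M" by unfold_locales
 interpret P: pair_sigma_finite M lborel using sf by (intro pair_sigma_finite.intro lborel.sigma_finite_measure_axioms)
 have wk: "ennreal (p * t powr (p - 1)) * indicator {0<..} t * emeasure M {x\<in>space M. ennreal t < HLmax M ?f x}
  <= (nni M (%x. ennreal (4*p * t powr (p - 2)) * indicator {0<..} t * (?f x * indicator {x. t / 2 < g x} x)))" for t
 proof (cases "t > 0")
  case True
  let ?h = "%y. ?f y * indicator {y. ennreal (t/2) < ?f y} y"
  have "{x\<in>space M. ennreal t < HLmax M ?f x} <= {x. ennreal (t/2) < HLmax M ?h x}"
  proof safe
   fix x assume "ennreal t < HLmax M ?f x"
   also have "... <= HLmax M ?h x + ennreal (t/2)" by (rule HLmax_split) measurable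
   finally have "ennreal (t/2) + ennreal (t/2) < HLmax M ?h x + ennreal (t/2)"
    using True by (subst ennreal_plus[symmetric]) auto
   thus "ennreal (t/2) < HLmax M ?h x" by (simp add: ennreal_add_left_cancel_less add.commute)
  qed
  hence "emeasure M {x\<in>space M. ennreal t < HLmax M ?f x} <= emeasure M {x. ennreal (t/2) < HLmax M ?h x}"
   by (intro emeasure_mono) auto
  hence "ennreal (t/2) * emeasure M {x\<in>space M. ennreal t < HLmax M ?f x} <= ennreal (t/2) * emeasure M {x. ennreal (t/2) < HLmax M ?h x}"
   by (rule mult_left_mono) simp
  also have "... <= 2*(nni M (%y. ?h y))" by (rule HLmax_weak_type) measurable
  finally have w: "ennreal (t/2) * emeasure M {x\<in>space M. ennreal t < HLmax M ?f x} <= 2*(nni M (%y. ?h y))" .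
  have eq: "ennreal (p * t powr (p - 1)) = ennreal (2*p * t powr (p - 2)) * ennreal (t / 2)"
   using True p by (subst ennreal_mult[symmetric]) (auto simp: powr_diff field_simps power2_eq_square)
  have "ennreal (p * t powr (p - 1)) * emeasure M {x\<in>space M. ennreal t < HLmax M ?f x}
    <= ennreal (2*p * t powr (p - 2)) * (2*(nni M (%y. ?h y)))"
   unfolding eq mult.assoc using w by (intro mult_left_mono) auto
  also have "... = ennreal (4*p * t powr (p - 2)) * (nni M (%y. ?h y))"
  proof -
   have "ennreal (2*p * t powr (p - 2)) * 2 = ennreal (4*p * t powr (p - 2))"
    using p by (subst ennreal_numeral[symmetric], subst ennreal_mult[symmetric]) auto
   thus ?thesis by (simp add: mult.assoc[symmetric])
  qed
  also have "... = (nni M (%x. ennreal (4*p * t powr (p - 2)) * (?f x * indicator {x. t / 2 < g x} x)))"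
   using g0 True by (subst nn_integral_cmult[symmetric]) (auto intro!: nn_integral_cong simp: indicator_def ennreal_less_iff)
  finally show ?thesis using True by simp
 qed simp
 have "(nni M (%x. epow (HLmax M ?f x) p)) =
  (nni lborel (%t. ennreal (p * t powr (p - 1)) * indicator {0<..} t * emeasure M {x\<in>space M. ennreal t < HLmax M ?f x}))"
  using p by (intro nn_integral_epow sf) auto
 also have "... <= (nni lborel (%t. (nni M (%x. ennreal (4*p * t powr (p - 2)) * indicator {0<..} t * (?f x * indicator {x. t / 2 < g x} x)))))"
  by (intro nn_integral_mono wk)
 also have "... = (nni M (%x. (nni lborel (%t. ennreal (4*p * t powr (p - 2)) * indicator {0<..} t * (?f x * indicator {x. t / 2 < g x} x)))))"
  by (rule P.Fubini') measurable
 also have "... = (nni M (%x. ennreal (4*p * 2 powr (p - 1) / (p - 1)) * ennreal (g x powr p)))"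
 proof (rule nn_integral_cong)
  fix x
  have c: "4*p / (p - 1) >= 0" using p by simp
  have "(nni lborel (%t. ennreal (4*p * t powr (p - 2)) * indicator {0<..} t * (?f x * indicator {x. t / 2 < g x} x)))
   = (nni lborel (%t. (ennreal (4*p / (p - 1)) * ?f x) * (ennreal ((p - 1) * t powr (p - 1 - 1)) * indicator {0<..<2*g x} t)))"
  proof (rule nn_integral_cong)
   fix t
   have "ennreal (4*p * t powr (p - 2)) = ennreal (4*p / (p - 1)) * ennreal ((p - 1) * t powr (p - 1 - 1))"
    using p by (subst ennreal_mult[symmetric]) (auto simp: diff_diff_eq)
   thus "ennreal (4*p * t powr (p - 2)) * indicator {0<..} t * (?f x * indicator {x. t / 2 < g x} x)
    = (ennreal (4*p / (p - 1)) * ?f x) * (ennreal ((p - 1) * t powr (p - 1 - 1)) * indicator {0<..<2*g x} t)"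
    by (auto simp: indicator_def mult_ac)
  qed
  also have "... = (ennreal (4*p / (p - 1)) * ?f x) * ennreal ((2*g x) powr (p - 1))"
  proof -
   have i: "(nni lborel (%t. ennreal ((p - 1) * t powr (p - 1 - 1)) * indicator {0<..<2*g x} t))
     = ennreal ((2*g x) powr (p - 1))"
    by (rule nn_integral_powr_0) (use p g0[of x] in auto)
   show ?thesis by (subst nn_integral_cmult) (measurable, simp only: i)
  qed
  also have "... = ennreal (4*p / (p - 1) * g x * (2*g x) powr (p - 1))"
  proof -
   let ?A = "4*p / (p - 1)"
   have "ennreal (?A * g x * (2*g x) powr (p - 1)) = ennreal (?A * g x) * ennreal ((2*g x) powr (p - 1))"
    by (rule ennreal_mult) (use mult_nonneg_nonneg[OF c g0[of x]] in simp_all)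
   also have "ennreal (?A * g x) = ennreal ?A * ennreal (g x)"
    by (rule ennreal_mult) (use c g0[of x] in auto)
   finally show ?thesis ..
  qed
  also have "4*p / (p - 1) * g x * (2*g x) powr (p - 1) = 4*p * 2 powr (p - 1) / (p - 1) * g x powr p"
   using g0[of x] p by (cases "g x = 0") (auto simp: powr_mult powr_diff field_simps)
  also have "ennreal (4*p * 2 powr (p - 1) / (p - 1) * g x powr p) = ennreal (4*p * 2 powr (p - 1) / (p - 1)) * ennreal (g x powr p)"
   using p by (intro ennreal_mult) auto
  finally show "(nni lborel (%t. ennreal (4*p * t powr (p - 2)) * indicator {0<..} t * (?f x * indicator {x. t / 2 < g x} x)))
   = ennreal (4*p * 2 powr (p - 1) / (p - 1)) * ennreal (g x powr p)" .
 qed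
 also have "... = ennreal (4*p * 2 powr (p - 1) / (p - 1)) * (nni M (%x. ennreal (g x powr p)))"
  by (rule nn_integral_cmult) measurable
 finally show ?thesis .
qed

end

section \<open>Power weights and a Schur test for a homogeneous kernel\<close>

text \<open>The weight on (0,1) extended by zero to the line, so that \<open>mu_nu\<close>, which
  lives on a restricted space, can be compared with a Borel measure to which the maximal inequality
  applies.\<close>

definition pmeas :: "real => real measure" where
 "pmeas b = density lborel (%x. ennreal (x powr b) * indicator {0<..<1} x)"

lemma sets_pmeas [measurable_cong, simp]: "sets (pmeas b) = sets borel"
 by (simp add: pmeas_def)

lemma space_pmeas [simp]: "space (pmeas b) = UNIV"
 by (simp add: pmeas_def)

lemma nn_integral_pmeas:
 assumes [measurable]: "g : borel_measurable borel"
 shows "(nni (pmeas b) (%y. g y)) = (nni lborel (%y. ennreal (y powr b) * indicator {0<..<1} y * g y))"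
 unfolding pmeas_def by (rule nn_integral_density) measurable

lemma AE_pmeas: "AE y in pmeas b. 0 < y & y < 1"
 unfolding pmeas_def by (subst AE_density) (auto simp: indicator_def)

lemma pmeas_low:
 assumes "e + b > -1" "x >= 0"
 shows "(nni (pmeas b) (%y. ennreal (y powr e) * indicator {0<..<x} y)) <= ennreal (x powr (e + b + 1) / (e + b + 1))"
proof -
 define r where "r = e + b + 1"
 have r: "r > 0" using assms by (simp add: r_def)
 have "(nni (pmeas b) (%y. ennreal (y powr e) * indicator {0<..<x} y))
  <= (nni lborel (%y. ennreal (1/r) * (ennreal (r * y powr (r - 1)) * indicator {0<..<x} y)))"
 proof (subst nn_integral_pmeas, measurable, rule nn_integral_mono)
  fix y
  have "ennreal (1/r) * ennreal (r * y powr (r - 1)) = ennreal (y powr b) * ennreal (y powr e)"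
   using r by (simp add: ennreal_mult[symmetric] powr_add[symmetric] r_def add.commute)
  thus "ennreal (y powr b) * indicator {0<..<1} y * (ennreal (y powr e) * indicator {0<..<x} y)
    <= ennreal (1/r) * (ennreal (r * y powr (r - 1)) * indicator {0<..<x} y)"
   by (auto simp: indicator_def mult.assoc[symmetric])
 qed
 also have "... = ennreal (1/r) * ennreal (x powr r)"
  by (subst nn_integral_cmult) (measurable, simp only: nn_integral_powr_0[OF r assms(2)])
 also have "... = ennreal (x powr r / r)" using r by (simp add: ennreal_mult[symmetric])
 finally show ?thesis by (simp add: r_def)
qed

lemma pmeas_high:
 assumes "e + b < -1" "x > 0"
 shows "(nni (pmeas b) (%y. ennreal (y powr e) * indicator {x..} y)) <= ennreal (x powr (e + b + 1) / (- (e + b + 1)))"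
proof -
 have "((%y. y powr (b + e)) has_integral - (x powr (b + e + 1)) / (b + e + 1)) {x..}"
  using assms by (intro has_integral_powr_to_inf) auto
 from nn_integral_has_integral_lebesgue[OF _ this]
 have 1: "integral\<^sup>N lborel (%y. ennreal (indicator {x..} y * y powr (b + e))) = ennreal (- (x powr (b + e + 1)) / (b + e + 1))"
  by simp
 have "(nni (pmeas b) (%y. ennreal (y powr e) * indicator {x..} y)) <= integral\<^sup>N lborel (%y. ennreal (indicator {x..} y * y powr (b + e)))"
 proof (subst nn_integral_pmeas, measurable, rule nn_integral_mono)
  fix y
  show "ennreal (y powr b) * indicator {0<..<1} y * (ennreal (y powr e) * indicator {x..} y)
    <= ennreal (indicator {x..} y * y powr (b + e))"
   by (auto simp: indicator_def ennreal_mult[symmetric] powr_add)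
 qed
 moreover have alg: "- X / t = X / (- t)" for X t :: real by simp
 have "- (x powr (b + e + 1)) / (b + e + 1) = x powr (e + b + 1) / (- (e + b + 1))"
  unfolding add.commute[of b e] by (rule alg)
 ultimately show ?thesis unfolding 1 by (simp only:)
qed

lemma line_measure_pmeas:
 assumes "b > -1" shows "line_measure (pmeas b)"
proof (intro line_measure.intro line_measure_axioms.intro finite_measureI)
 have "emeasure (pmeas b) (space (pmeas b)) = (nni (pmeas b) (%y. 1))" by simp
 also have "... <= (nni (pmeas b) (%y. ennreal (y powr 0) * indicator {0<..<1} y))"
  by (intro nn_integral_mono_AE) (use AE_pmeas[of b] in eventually_elim, auto)
 also have "... <= ennreal (1 powr (0 + b + 1) / (0 + b + 1))" by (rule pmeas_low) (use assms in auto)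
 finally show "emeasure (pmeas b) (space (pmeas b)) ~= \<infinity>" by (auto simp: top_unique)
qed simp

text \<open>Holder's inequality for the measure k dM and the splitting g = (w g)(1/w), obtained from
  Young's inequality with a scaling parameter.\<close>

lemma nn_integral_Holder:
 fixes k w g :: "'a => real"
 assumes p: "p > 1" and q: "q = p / (p - 1)"
  and meas [measurable]: "k : borel_measurable M" "w : borel_measurable M" "g : borel_measurable M"
  and pos: "AE y in M. k y >= 0 & w y > 0 & g y >= 0"
  and A0: "A0 > 0" "(nni M (%y. ennreal (k y * w y powr (- q)))) <= ennreal A0"
 shows "epow (nni M (%y. ennreal (k y * g y))) p <= ennreal (A0 powr (p - 1)) * (nni M (%y. ennreal (k y * (w y powr p * g y powr p))))"
proof (cases "(nni M (%y. ennreal (k y * (w y powr p * g y powr p))))")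
 case top
 thus ?thesis using A0 by (simp add: ennreal_mult_top)
next
 case (real B)
 have q1: "q > 1" and pq: "1/p + 1/q = 1" and sum: "p + q = p * q"
  using p by (auto simp: q field_simps)
 have ppos: "p > 0" "q > 0" using p q1 by auto
 \<comment> \<open>Working with B' strictly above B keeps the scaling parameter positive even when B
   = 0; the slack is removed at the end.\<close>
 have main: "epow (nni M (%y. ennreal (k y * g y))) p <= ennreal (A0 powr (p - 1) * B')" if B': "B' > B" for B'
 proof -
  have B'0: "B' > 0" using B' real by linarith
  \<comment> \<open>The value balancing the two terms: t^q A0 and t^{-p} B' both equal V, and 1/p +
    1/q = 1 adds them up.\<close>
  define t where "t = (B' / A0) powr (1/(p * q))"
  have t: "t > 0" using B'0 A0 by (simp add: t_def)
  define V where "V = A0 powr (1/q) * B' powr (1/p)"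
  have tq: "t powr q * A0 = V"
  proof -
   have "t powr q = (B' / A0) powr (1/p)" using ppos by (simp add: t_def powr_powr)
   also have "... = B' powr (1/p) / A0 powr (1/p)" by (rule powr_divide)
   finally have "t powr q * A0 = B' powr (1/p) * (A0 powr 1/A0 powr (1/p))" using A0 by simp
   also have "A0 powr 1/A0 powr (1/p) = A0 powr (1 - 1/p)" by (rule powr_diff[symmetric])
   also have "1 - 1/p = 1/q" using pq by simp
   finally show ?thesis by (simp add: V_def mult.commute)
  qed
  have tp: "t powr (- p) * B' = V"
  proof -
   have "t powr (- p) = (B' / A0) powr (- (1/q))" using ppos by (simp add: t_def powr_powr)
   also have "... = B' powr (- (1/q)) / A0 powr (- (1/q))" by (rule powr_divide)
   also have "... = B' powr (- (1/q)) * A0 powr (1/q)" by (simp add: powr_minus_divide)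
   finally have eq: "t powr (- p) = B' powr (- (1/q)) * A0 powr (1/q)" .
   have one: "B' powr 1 = B'" using B'0 by simp
   have "t powr (- p) * B' = A0 powr (1/q) * (B' powr 1*B' powr (- (1/q)))"
    unfolding eq one by (simp only: mult_ac)
   also have "B' powr 1*B' powr (- (1/q)) = B' powr (1 + - (1/q))" by (rule powr_add[symmetric])
   also have "1 + - (1/q) = 1/p" using pq by simp
   finally show ?thesis by (simp add: V_def)
  qed
  have "(nni M (%y. ennreal (k y * g y))) <=
   (nni M (%y. ennreal (t powr q / q) * ennreal (k y * w y powr (- q)) + ennreal (t powr (- p) / p) * ennreal (k y * (w y powr p * g y powr p))))"
  proof (rule nn_integral_mono_AE, use pos in eventually_elim)
   fix y assume y: "k y >= 0 & w y > 0 & g y >= 0"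
   have "g y = (w y * g y / t) * (t / w y)" using y t by simp
   also have "... <= (w y * g y / t) powr p / p + (t / w y) powr q / q"
    by (rule Youngs_inequality) (use p q1 pq y t in auto)
   also have "(w y * g y / t) powr p = t powr (- p) * (w y powr p * g y powr p)"
    using y t by (simp add: powr_divide powr_mult powr_minus_divide)
   also have "(t / w y) powr q = t powr q * w y powr (- q)"
    using y t by (simp add: powr_divide powr_minus_divide)
   finally have "k y * g y <= k y * (t powr (- p) * (w y powr p * g y powr p) / p + t powr q * w y powr (- q) / q)"
    using y by (intro mult_left_mono) auto
   also have "... = (t powr q / q) * (k y * w y powr (- q)) + (t powr (- p) / p) * (k y * (w y powr p * g y powr p))"
    by (simp add: algebra_simps)
   finally have le: "ennreal (k y * g y) <= ennreal ((t powr q / q) * (k y * w y powr (- q)) + (t powr (- p) / p) * (k y * (w y powr p * g y powr p)))"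
    by (rule ennreal_leI)
   thus "ennreal (k y * g y) <= ennreal (t powr q / q) * ennreal (k y * w y powr (- q)) + ennreal (t powr (- p) / p) * ennreal (k y * (w y powr p * g y powr p))"
   proof -
    have "ennreal (c1*Q1 + c2*Q2) = ennreal c1*ennreal Q1 + ennreal c2*ennreal Q2"
     if "c1 >= 0" "Q1 >= 0" "c2 >= 0" "Q2 >= 0" for c1 Q1 c2 Q2 :: real
     using that by (simp add: ennreal_mult ennreal_plus)
    from this[of "t powr q / q" "k y * w y powr (- q)" "t powr (- p) / p" "k y * (w y powr p * g y powr p)"]
    have "ennreal ((t powr q / q) * (k y * w y powr (- q)) + (t powr (- p) / p) * (k y * (w y powr p * g y powr p)))
     = ennreal (t powr q / q) * ennreal (k y * w y powr (- q)) + ennreal (t powr (- p) / p) * ennreal (k y * (w y powr p * g y powr p))"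
     using y ppos by (simp del: ennreal_plus)
    thus ?thesis using le by (simp only:)
   qed
  qed
  also have "... = ennreal (t powr q / q) * (nni M (%y. ennreal (k y * w y powr (- q)))) + ennreal (t powr (- p) / p) * ennreal B"
   using real by (simp add: nn_integral_add nn_integral_cmult)
  also have "... <= ennreal (t powr q / q) * ennreal A0 + ennreal (t powr (- p) / p) * ennreal B'"
   using B' by (intro add_mono mult_left_mono A0 ennreal_leI) auto
  also have "... = ennreal (t powr q * A0/q + t powr (- p) * B' / p)"
   using ppos A0 B'0 by (simp add: ennreal_mult[symmetric] ennreal_plus[symmetric] del: ennreal_plus)
  also have "t powr q * A0/q + t powr (- p) * B' / p = V"
  proof -
   have "V / q + V / p = V * (1/p + 1/q)" by (simp add: algebra_simps)
   thus ?thesis unfolding tq tp pq by simp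
  qed
  finally have "epow (nni M (%y. ennreal (k y * g y))) p <= epow (ennreal V) p"
   using p by (intro epow_mono) auto
  also have "... = ennreal (V powr p)" using A0 B'0 by (intro epow_ennreal) (auto simp: V_def)
  also have "V powr p = A0 powr (p - 1) * B'"
  proof -
   have "1/q * p = p - 1" using p by (simp add: q)
   thus ?thesis using B'0 ppos by (simp add: V_def powr_mult powr_powr)
  qed
  finally show ?thesis .
 qed
 have "epow (nni M (%y. ennreal (k y * g y))) p <= ennreal (A0 powr (p - 1) * B)"
 proof (rule ennreal_le_epsilon)
  fix e :: real assume e: "e > 0"
  have "epow (nni M (%y. ennreal (k y * g y))) p <= ennreal (A0 powr (p - 1) * (B + e / A0 powr (p - 1)))"
   by (rule main) (use e A0 in simp)
  also have "A0 powr (p - 1) * (B + e / A0 powr (p - 1)) = A0 powr (p - 1) * B + e"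
   using A0 by (simp add: field_simps)
  finally show "epow (nni M (%y. ennreal (k y * g y))) p <= ennreal (A0 powr (p - 1) * B) + ennreal e"
   using e real by (simp add: ennreal_plus)
 qed
 thus ?thesis using real by (simp add: ennreal_mult)
qed

lemma nn_integral_linear:
 assumes [measurable]: "u : borel_measurable M" "v : borel_measurable M"
 shows "(nni M (%y. A * u y + B * v y)) = A * (nni M (%y. u y)) + B * (nni M (%y. v y))"
 by (simp add: nn_integral_add nn_integral_cmult)

lemma nn_integral_cmult2:
 assumes [measurable]: "u : borel_measurable M"
 shows "(nni M (%y. A * (B * u y))) = A * (B * (nni M (%y. u y)))"
 by (simp add: nn_integral_cmult)

text \<open>Homogeneous of degree -(2a+1), which matches the scaling of the measure x^{2a} dx, so
  powers of y behave as approximate eigenfunctions.\<close>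

definition HKer :: "real => real => real => real => real" where
 "HKer a d x y = max x y powr (- a - 1 - d) * min x y powr (d - a)"

lemma HKer_sym: "HKer a d x y = HKer a d y x"
 by (simp add: HKer_def max.commute min.commute)

lemma HKer_nonneg: "HKer a d x y >= 0"
 by (simp add: HKer_def)

lemma HKer_measurable [measurable]:
 assumes [measurable]: "f : borel_measurable M" "g : borel_measurable M"
 shows "(%z. HKer a d (f z) (g z)) : borel_measurable M"
 unfolding HKer_def by measurable

lemma HKer_integral:
 assumes e: "a - d < e" "e < a + d + 1" and x: "x > 0"
 shows "(nni (pmeas (2*a)) (%y. ennreal (HKer a d x y * y powr (- e))))
  <= ennreal ((1/(a + d + 1 - e) + 1/(e - a + d)) * x powr (- e))"
proof -
 have "(nni (pmeas (2*a)) (%y. ennreal (HKer a d x y * y powr (- e))))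
  <= (nni (pmeas (2*a)) (%y. ennreal (x powr (- a - 1 - d)) * (ennreal (y powr (d - a - e)) * indicator {0<..<x} y)
    + ennreal (x powr (d - a)) * (ennreal (y powr (- a - 1 - d - e)) * indicator {x..} y)))"
 proof (rule nn_integral_mono_AE, use AE_pmeas[of "2*a"] in eventually_elim)
  fix y :: real assume y: "0 < y & y < 1"
  show "ennreal (HKer a d x y * y powr (- e)) <= ennreal (x powr (- a - 1 - d)) * (ennreal (y powr (d - a - e)) * indicator {0<..<x} y)
    + ennreal (x powr (d - a)) * (ennreal (y powr (- a - 1 - d - e)) * indicator {x..} y)"
  proof (cases "y < x")
   case True
   have "HKer a d x y * y powr (- e) = x powr (- a - 1 - d) * (y powr (d - a) * y powr (- e))"
    using True by (simp add: HKer_def)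
   also have "y powr (d - a) * y powr (- e) = y powr (d - a - e)" by (simp add: powr_add[symmetric])
   finally show ?thesis using True y by (simp add: ennreal_mult)
  next
   case False
   have "HKer a d x y * y powr (- e) = x powr (d - a) * (y powr (- a - 1 - d) * y powr (- e))"
    using False by (simp add: HKer_def max_def min_def)
   also have "y powr (- a - 1 - d) * y powr (- e) = y powr (- a - 1 - d - e)" by (simp add: powr_add[symmetric])
   finally show ?thesis using False y by (simp add: ennreal_mult)
  qed
 qed
 also have "... = ennreal (x powr (- a - 1 - d)) * (nni (pmeas (2*a)) (%y. ennreal (y powr (d - a - e)) * indicator {0<..<x} y))
    + ennreal (x powr (d - a)) * (nni (pmeas (2*a)) (%y. ennreal (y powr (- a - 1 - d - e)) * indicator {x..} y))"
  by (rule nn_integral_linear) measurable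
 also have "... <= ennreal (x powr (- a - 1 - d)) * ennreal (x powr (d - a - e + 2*a + 1) / (d - a - e + 2*a + 1))
    + ennreal (x powr (d - a)) * ennreal (x powr (- a - 1 - d - e + 2*a + 1) / (- (- a - 1 - d - e + 2*a + 1)))"
  using e x by (intro add_mono mult_left_mono pmeas_low pmeas_high) auto
 also have "... = ennreal (x powr (- a - 1 - d) * (x powr (d - a - e + 2*a + 1) / (d - a - e + 2*a + 1))
    + x powr (d - a) * (x powr (- a - 1 - d - e + 2*a + 1) / (- (- a - 1 - d - e + 2*a + 1))))"
 proof -
  have "ennreal A * ennreal B + ennreal A' * ennreal B' = ennreal (A * B + A' * B')"
   if "A >= 0" "B >= 0" "A' >= 0" "B' >= 0" for A B A' B' :: real
   using that by (simp add: ennreal_mult ennreal_plus)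
  thus ?thesis by this (use e in "auto intro!: divide_nonneg_nonneg")
 qed
 also have "x powr (- a - 1 - d) * (x powr (d - a - e + 2*a + 1) / (d - a - e + 2*a + 1)) = 1/(a + d + 1 - e) * x powr (- e)"
 proof -
  have "x powr (- a - 1 - d) * x powr (d - a - e + 2*a + 1) = x powr (- e)"
   by (simp only: powr_add[symmetric]) (simp add: algebra_simps)
  moreover have "d - a - e + 2*a + 1 = a + d + 1 - e" by simp
  ultimately show ?thesis by (metis mult.commute mult_1 times_divide_eq_left times_divide_eq_right)
 qed
 also have "x powr (d - a) * (x powr (- a - 1 - d - e + 2*a + 1) / (- (- a - 1 - d - e + 2*a + 1))) = 1/(e - a + d) * x powr (- e)"
 proof -
  have "x powr (d - a) * x powr (- a - 1 - d - e + 2*a + 1) = x powr (- e)"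
   by (simp only: powr_add[symmetric]) (simp add: algebra_simps)
  moreover have "- (- a - 1 - d - e + 2*a + 1) = e - a + d" by simp
  ultimately show ?thesis by (metis mult.commute mult_1 times_divide_eq_left times_divide_eq_right)
 qed
 finally show ?thesis by (simp add: algebra_simps)
qed

text \<open>Schur's test with a power as test function. The two inequalities on (2a+1)/p express
  convergence of the power integrals at 0 and at infinity.\<close>

theorem HKer_bounded:
 assumes p: "p > 1" and a: "2*a > -1" and cond: "a - d < (2*a + 1) / p" "(2*a + 1) / p < a + d + 1"
 obtains C where "C >= 0"
  "!!g. g : borel_measurable borel ==> (!!y. g y >= 0) ==>
   (nni (pmeas (2*a)) (%x. epow (nni (pmeas (2*a)) (%y. ennreal (HKer a d x y * g y))) p))
    <= ennreal C * (nni (pmeas (2*a)) (%y. ennreal (g y powr p)))"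
proof -
 let ?M = "pmeas (2*a)"
 interpret line_measure ?M by (rule line_measure_pmeas[OF a])
 interpret P: pair_sigma_finite ?M ?M by unfold_locales
 define q where "q = p / (p - 1)"
 \<comment> \<open>With e1 = (2a+1)/p and e2 = (2a+1)/q the sum is 2a+1, and the admissible window
   is symmetric under e -> 2a+1-e. Both integrals in the test therefore converge under one
   condition.\<close>
 define e1 where "e1 = (2*a + 1) / p"
 define e2 where "e2 = e1*(p - 1)"
 define K1 where "K1 = 1/(a + d + 1 - e1) + 1/(e1 - a + d)"
 define K2 where "K2 = 1/(a + d + 1 - e2) + 1/(e2 - a + d)"
 have e2: "e2 = 2*a + 1 - e1" using p by (simp add: e2_def e1_def field_simps)
 have c1: "a - d < e1" "e1 < a + d + 1" and c2: "a - d < e2" "e2 < a + d + 1"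
  using cond by (auto simp: e2 e1_def)
 have K: "K1 > 0" "K2 > 0" using c1 c2 by (auto simp: K1_def K2_def intro!: add_pos_pos)
 define w where "w = (%y::real. y powr (e1/q))"
 have q: "q > 0" using p by (simp add: q_def)
 have wq: "w y powr (- q) = y powr (- e1)" for y using q by (simp add: w_def powr_powr)
 have wp: "w y powr p = y powr e2" for y
 proof -
  have "e1/q * p = e2" using p by (simp add: q_def e2_def)
  thus ?thesis by (simp add: w_def powr_powr)
 qed
 show ?thesis
 proof (rule that[of "K1 powr (p - 1) * K2"])
  show "K1 powr (p - 1) * K2 >= 0" using K by simp
  fix g :: "real => real" assume g[measurable]: "g : borel_measurable borel" and g0: "!!y. g y >= 0"
  have pt: "epow (nni ?M (%y. ennreal (HKer a d x y * g y))) p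
    <= (nni ?M (%y. ennreal (K1 powr (p - 1)) * (ennreal (y powr e2*g y powr p) * ennreal (HKer a d y x * x powr (- e2)))))"
   if x: "x > 0" for x
  proof -
   have "epow (nni ?M (%y. ennreal (HKer a d x y * g y))) p
    <= ennreal ((K1*x powr (- e1)) powr (p - 1)) * (nni ?M (%y. ennreal (HKer a d x y * (w y powr p * g y powr p))))"
   proof (rule nn_integral_Holder[OF p q_def])
    show "w : borel_measurable ?M" unfolding w_def by measurable
    show "AE y in ?M. HKer a d x y >= 0 & w y > 0 & g y >= 0"
     using AE_pmeas[of "2*a"] by eventually_elim (auto simp: HKer_nonneg g0 w_def)
    show "K1*x powr (- e1) > 0" using K x by simp
    show "(nni ?M (%y. ennreal (HKer a d x y * w y powr (- q)))) <= ennreal (K1*x powr (- e1))"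
     unfolding wq K1_def by (rule HKer_integral[OF c1 x])
   qed measurable
   also have "(K1*x powr (- e1)) powr (p - 1) = K1 powr (p - 1) * x powr (- e2)"
    by (simp add: powr_mult powr_powr e2_def)
   also have "ennreal (K1 powr (p - 1) * x powr (- e2)) * (nni ?M (%y. ennreal (HKer a d x y * (w y powr p * g y powr p))))
    = (nni ?M (%y. ennreal (K1 powr (p - 1)) * (ennreal (y powr e2*g y powr p) * ennreal (HKer a d y x * x powr (- e2)))))"
    unfolding wp by (subst nn_integral_cmult[symmetric], measurable)
     (auto intro!: nn_integral_cong simp: ennreal_mult[symmetric] HKer_nonneg HKer_sym[of a d x] mult_ac)
   finally show ?thesis .
  qed
  have "(nni ?M (%x. epow (nni ?M (%y. ennreal (HKer a d x y * g y))) p))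
   <= (nni ?M (%x. (nni ?M (%y. ennreal (K1 powr (p - 1)) * (ennreal (y powr e2*g y powr p) * ennreal (HKer a d y x * x powr (- e2)))))))"
   by (rule nn_integral_mono_AE) (use AE_pmeas[of "2*a"] pt in "auto elim!: eventually_mono")
  also have "... = (nni ?M (%y. (nni ?M (%x. ennreal (K1 powr (p - 1)) * (ennreal (y powr e2*g y powr p) * ennreal (HKer a d y x * x powr (- e2)))))))"
   by (rule P.Fubini') measurable
  also have "... = (nni ?M (%y. ennreal (K1 powr (p - 1)) * (ennreal (y powr e2*g y powr p) * (nni ?M (%x. ennreal (HKer a d y x * x powr (- e2)))))))"
   by (intro nn_integral_cong nn_integral_cmult2) measurable
  also have "... <= (nni ?M (%y. ennreal (K1 powr (p - 1) * K2) * ennreal (g y powr p)))"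
  proof (rule nn_integral_mono_AE, use AE_pmeas[of "2*a"] in eventually_elim)
   fix y :: real assume y: "0 < y & y < 1"
   have "ennreal (K1 powr (p - 1)) * (ennreal (y powr e2*g y powr p) * (nni ?M (%x. ennreal (HKer a d y x * x powr (- e2)))))
    <= ennreal (K1 powr (p - 1)) * (ennreal (y powr e2*g y powr p) * ennreal (K2*y powr (- e2)))"
    unfolding K2_def by (intro mult_left_mono HKer_integral[OF c2]) (use y in auto)
   also have "... = ennreal (K1 powr (p - 1) * ((y powr e2*g y powr p) * (K2*y powr (- e2))))"
    using K by (simp add: ennreal_mult)
   also have "K1 powr (p - 1) * ((y powr e2*g y powr p) * (K2*y powr (- e2))) = (K1 powr (p - 1) * K2) * g y powr p"
    using y by (simp add: powr_minus field_simps)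
   finally show "ennreal (K1 powr (p - 1)) * (ennreal (y powr e2*g y powr p) * (nni ?M (%x. ennreal (HKer a d y x * x powr (- e2)))))
    <= ennreal (K1 powr (p - 1) * K2) * ennreal (g y powr p)"
    using K by (simp add: ennreal_mult)
  qed
  also have "... = ennreal (K1 powr (p - 1) * K2) * (nni ?M (%y. ennreal (g y powr p)))"
   by (rule nn_integral_cmult) measurable
  finally show "(nni ?M (%x. epow (nni ?M (%y. ennreal (HKer a d x y * g y))) p))
    <= ennreal (K1 powr (p - 1) * K2) * (nni ?M (%y. ennreal (g y powr p)))" .
 qed
qed

section \<open>The maximal function of the majorant\<close>

definition majorant :: "real => real => real => real => real => real" where
 "majorant a dl R x y =
  R * max x (1/R) powr (- a) * max y (1/R) powr (- a) * (1 + R * \<bar>x - y\<bar>) powr (- 1 - dl)"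

lemma majorant_measurable [measurable]:
 assumes [measurable]: "f : borel_measurable M"
 shows "(%y. majorant a dl R x (f y)) : borel_measurable M"
 unfolding majorant_def by measurable

lemma majorant_nonneg: "R > 0 ==> majorant a dl R x y >= 0"
 by (simp add: majorant_def)

lemma majorant_sym: "majorant a dl R x y = majorant a dl R y x"
 by (simp add: majorant_def mult_ac abs_minus_commute)

lemma powr_comparable:
 fixes x y K b :: real
 assumes "x > 0" "K >= 1" "x / K <= y" "y <= K * x"
 shows "y powr b <= K powr \<bar>b\<bar> * x powr b"
proof -
 have y: "y > 0" using assms by (meson divide_pos_pos less_le_trans zero_less_one)
 have "(y / x) powr b <= K powr \<bar>b\<bar>"
 proof (cases "b >= 0")
  case True
  have "y / x <= K" using assms by (simp add: field_simps)
  thus ?thesis using True y assms by (simp add: powr_mono2)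
 next
  case False
  have "x / y <= K" using assms y by (simp add: field_simps)
  hence "(x / y) powr (- b) <= K powr (- b)" using False y assms by (intro powr_mono2) auto
  moreover have "(x / y) powr (- b) = (y / x) powr b"
   using y assms by (simp add: powr_divide powr_minus_divide)
  ultimately show ?thesis using False by simp
 qed
 hence "(y / x) powr b * x powr b <= K powr \<bar>b\<bar> * x powr b" by (intro mult_right_mono) auto
 moreover have "(y / x) powr b * x powr b = y powr b" using assms y by (simp add: powr_divide)
 ultimately show ?thesis by simp
qed

context line_measure
begin

lemma integral_le_avg:
 "(nni M (%y. f y * indicator (oivl i) y)) <= avg M f i * emeasure M (oivl i)"
proof (cases "emeasure M (oivl i) = 0")
 case True
 hence "oivl i : null_sets M" by (intro null_setsI) auto
 thus ?thesis by (simp add: nn_integral_null_set)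
next
 case False
 have "emeasure M (oivl i) / emeasure M (oivl i) = 1"
  by (rule ennreal_divide_self) (use False emeasure_finite in "simp_all add: less_top[symmetric]")
 thus ?thesis unfolding avg_def by (simp add: ennreal_divide_times)
qed

lemma HLmax_const_le: "HLmax M (%_. 1) x <= 1"
 unfolding HLmax_def
proof (rule SUP_least)
 fix i :: "real \<times> real"
 have "avg M (%_. 1) i <= 1"
 proof (cases "emeasure M (oivl i) = 0")
  case False
  have "emeasure M (oivl i) / emeasure M (oivl i) = 1"
   by (rule ennreal_divide_self) (use False emeasure_finite in "simp_all add: less_top[symmetric]")
  thus ?thesis by (simp add: avg_def)
 qed (simp add: avg_def)
 thus "avg M (%_. 1) i * indicator (oivl i) x <= 1" by (simp add: indicator_def)
qed

end

text \<open>The set lies in an interval (p, q) with rational end points, length at most 4s, and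
  contained in (x/4, 3x), where y^b is comparable to x^b. Its measure is thus of order s
  x^b.\<close>

lemma near_average:
 assumes b: "b > -1" and x: "0 < x" and s: "0 < s" "s <= x"
  and [measurable]: "g : borel_measurable borel"
 shows "(nni (pmeas b) (%y. g y * indicator {y. x / 2 <= y & \<bar>y - x\<bar> <= s} y))
  <= ennreal (4*4 powr \<bar>b\<bar> * s * x powr b) * HLmax (pmeas b) g x"
proof -
 interpret line_measure "pmeas b" by (rule line_measure_pmeas[OF b])
 define L where "L = max (x / 2) (x - s)"
 have "L - min s (x / 4) < L" using s x by simp
 then obtain p where p: "p : \<rat>" "L - min s (x / 4) < p" "p < L" using Rats_dense_in_real by blast
 have "x + s < x + 2 * s" using s by simp
 then obtain q where q: "q : \<rat>" "x + s < q" "q < x + 2 * s" using Rats_dense_in_real by blast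
 have L: "L <= x" "x / 2 <= L" "x - s <= L" using s x by (auto simp: L_def)
 have p4: "x / 4 < p" "x - 2 * s < p" using p L by auto
 have px: "p < x" using p L by simp
 let ?I = "oivl (p, q)"
 have "emeasure (pmeas b) ?I = (nni (pmeas b) (%y. indicator ?I y))" by simp
 also have "... <= (nni lborel (%y. ennreal (4 powr \<bar>b\<bar> * x powr b) * indicator ?I y))"
 proof (subst nn_integral_pmeas, measurable, rule nn_integral_mono)
  fix y
  have "y powr b <= 4 powr \<bar>b\<bar> * x powr b" if "p < y" "y < q"
   by (rule powr_comparable) (use that p4 q s x in auto)
  thus "ennreal (y powr b) * indicator {0<..<1} y * indicator ?I y <= ennreal (4 powr \<bar>b\<bar> * x powr b) * indicator ?I y"
   by (auto simp: indicator_def intro!: ennreal_leI)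
 qed
 also have "... = ennreal (4 powr \<bar>b\<bar> * x powr b) * ennreal (q - p)"
  using px q s by (subst nn_integral_cmult_indicator) auto
 also have "... <= ennreal (4 powr \<bar>b\<bar> * x powr b) * ennreal (4 * s)"
  using p4 q by (intro mult_left_mono ennreal_leI) auto
 also have "... = ennreal (4*4 powr \<bar>b\<bar> * s * x powr b)" using s by (simp add: ennreal_mult[symmetric] mult_ac)
 finally have em: "emeasure (pmeas b) ?I <= ennreal (4*4 powr \<bar>b\<bar> * s * x powr b)" .
 have "(nni (pmeas b) (%y. g y * indicator {y. x / 2 <= y & \<bar>y - x\<bar> <= s} y))
   <= (nni (pmeas b) (%y. g y * indicator ?I y))"
 proof (rule nn_integral_mono)
  fix y
  have "p < y & y < q" if "x / 2 <= y" "\<bar>y - x\<bar> <= s"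
  proof -
   have "L <= y" using that by (auto simp: L_def)
   thus ?thesis using that p q by linarith
  qed
  thus "g y * indicator {y. x / 2 <= y & \<bar>y - x\<bar> <= s} y <= g y * indicator ?I y"
   by (auto simp: indicator_def)
 qed
 also have "... <= avg (pmeas b) g (p, q) * emeasure (pmeas b) ?I" by (rule integral_le_avg)
 also have "... <= HLmax (pmeas b) g x * ennreal (4*4 powr \<bar>b\<bar> * s * x powr b)"
  using p q px s by (intro mult_mono HLmax_ge em) auto
 finally show ?thesis by (simp add: mult.commute)
qed

definition near_const :: "real => real => real" where
 "near_const a dl = 2 powr \<bar>a\<bar> * 2 powr (1 + dl) * (4*4 powr \<bar>2*a\<bar>) / (1 - 2 powr (- dl))"

lemma near_const_nonneg: "dl > 0 ==> near_const a dl >= 0"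
proof -
 assume "dl > 0"
 hence "2 powr (- dl) <= (1::real)" by (auto simp: powr_minus inverse_le_1_iff ge_one_powr_ge_zero)
 thus ?thesis by (simp add: near_const_def)
qed

abbreviation near :: "real => real set" where "near x \<equiv> {x / 2..2*x}"

lemma majorant_near_le:
 assumes R: "R > 0" and x: "x > 0" and y: "y : near x" and dl: "dl > 0"
 shows "R * x < 1 ==> 2*a > -1 ==> majorant a dl R x y <= 2 powr \<bar>a\<bar> * x powr (- (2*a) - 1)"
  and "R * x >= 1 ==> majorant a dl R x y <= 2 powr \<bar>a\<bar> * x powr (- (2*a)) * (R * (1 + R * \<bar>x - y\<bar>) powr (- 1 - dl))"
proof -
 define w where "w = max x (1/R)"
 have w: "w > 0" "w >= x" using x by (auto simp: w_def)
 have "max y u <= 2*max x u" "max x u / 2 <= max y u" if "u > 0" for u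
  using y x that by (auto simp: max_def)
 from this[of "1/R"] have "max y (1/R) <= 2*w" "w / 2 <= max y (1/R)"
  using R by (simp_all add: w_def)
 hence my: "max y (1/R) powr (- a) <= 2 powr \<bar>a\<bar> * w powr (- a)"
  using powr_comparable[of w 2 "max y (1/R)" "- a"] w by simp
 have "majorant a dl R x y = R * w powr (- a) * (1 + R * \<bar>x - y\<bar>) powr (- 1 - dl) * max y (1/R) powr (- a)"
  by (simp add: majorant_def w_def)
 also have "... <= R * w powr (- a) * (1 + R * \<bar>x - y\<bar>) powr (- 1 - dl) * (2 powr \<bar>a\<bar> * w powr (- a))"
  using R by (intro mult_left_mono my) auto
 also have "... = 2 powr \<bar>a\<bar> * (w powr (- a) * w powr (- a)) * (R * (1 + R * \<bar>x - y\<bar>) powr (- 1 - dl))" by simp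
 also have "w powr (- a) * w powr (- a) = w powr (- (2*a))" by (simp add: powr_add[symmetric])
 finally have main: "majorant a dl R x y <= 2 powr \<bar>a\<bar> * w powr (- (2*a)) * (R * (1 + R * \<bar>x - y\<bar>) powr (- 1 - dl))" .
 {
  assume "R * x >= 1"
  hence "w = x" using R by (simp add: w_def max_def field_simps)
  thus "majorant a dl R x y <= 2 powr \<bar>a\<bar> * x powr (- (2*a)) * (R * (1 + R * \<bar>x - y\<bar>) powr (- 1 - dl))"
   using main by simp
 next
  assume Rx: "R * x < 1" and a: "2*a > -1"
  hence wR: "w = 1/R" using R by (simp add: w_def max_def field_simps)
  have "(1 + R * \<bar>x - y\<bar>) powr (- 1 - dl) <= 1 powr (- 1 - dl)" using R dl by (intro powr_mono2') auto
  hence "R * (1 + R * \<bar>x - y\<bar>) powr (- 1 - dl) <= R * 1" using R by (intro mult_left_mono) auto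
  hence "majorant a dl R x y <= 2 powr \<bar>a\<bar> * w powr (- (2*a)) * R"
   by (intro order_trans[OF main] mult_left_mono) auto
  also have "2 powr \<bar>a\<bar> * w powr (- (2*a)) * R = 2 powr \<bar>a\<bar> * w powr (- (2*a) - 1)"
   using w wR by (simp add: powr_diff)
  also have "... <= 2 powr \<bar>a\<bar> * x powr (- (2*a) - 1)"
   using w x a by (intro mult_left_mono powr_mono2') auto
  finally show "majorant a dl R x y <= 2 powr \<bar>a\<bar> * x powr (- (2*a) - 1)" .
 }
qed

text \<open>The least k with t <= 2^k also satisfies 2^k/2 <= 1 + t, so the decaying factor is
  comparable to its value on the dyadic shell.\<close>

lemma dyadic_majorant:
 fixes t dl :: real
 assumes "t >= 0" "dl > 0"
 obtains k :: nat where "t <= 2 ^ k" "(1 + t) powr (- 1 - dl) <= 2 powr (1 + dl) * (2 powr (- 1 - dl)) ^ k"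
proof -
 define k where "k = (LEAST k::nat. t <= 2 ^ k)"
 obtain k0 :: nat where "t < 2 ^ k0" using real_arch_pow[of 2 t] by auto
 hence k: "t <= 2 ^ k" unfolding k_def by (intro LeastI[of "%k. t <= 2 ^ k" k0]) simp
 have "2 ^ k / 2 <= 1 + t"
 proof (cases k)
  case (Suc j)
  have "\<not> t <= 2 ^ j" using Suc not_less_Least[of j "%k. t <= 2 ^ k"] by (simp add: k_def)
  thus ?thesis using Suc by simp
 qed (use assms in simp)
 hence "(1 + t) powr (- 1 - dl) <= (2 ^ k / 2) powr (- 1 - dl)" using assms by (intro powr_mono2') auto
 also have "... = (2 ^ k) powr (- 1 - dl) / 2 powr (- 1 - dl)" by (simp add: powr_divide)
 also have "(2 ^ k) powr (- 1 - dl) = (2 powr (- 1 - dl)) ^ k"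
  by (simp add: powr_realpow[symmetric] powr_powr mult.commute)
 also have "(2 powr (- 1 - dl)) ^ k / 2 powr (- 1 - dl) = 2 powr (1 + dl) * (2 powr (- 1 - dl)) ^ k"
  using powr_minus_divide[of 2 "- 1 - dl"] by (simp add: add.commute)
 finally show thesis using k by (rule that[rotated])
qed

text \<open>The shell |y - x| <= 2^k/R has measure of order 2^k x^{2a}/R and carries the weight
  2^{-(1+dl)k}. The contributions to the maximal function form a geometric series with ratio
  2^{-dl}. For R x < 1 one shell suffices.\<close>

lemma near_bound:
 assumes a: "2*a > -1" and x: "0 < x" and R: "R > 0" and dl: "dl > 0"
  and g[measurable]: "g : borel_measurable borel"
 shows "(nni (pmeas (2*a)) (%y. ennreal (majorant a dl R x y) * g y * indicator (near x) y))
  <= ennreal (near_const a dl) * HLmax (pmeas (2*a)) g x"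
proof -
 let ?M = "pmeas (2*a)"
 define K where "K = 4*4 powr \<bar>2*a\<bar>"
 define c2 where "c2 = 2 powr \<bar>a\<bar>"
 define r where "r = 2 powr (- dl)"
 have r: "0 < r" "r < 1" using dl by (auto simp: r_def powr_minus inverse_less_1_iff gr_one_powr)
 have K: "K > 0" and c2: "c2 > 0" by (auto simp: K_def c2_def)
 have nc: "near_const a dl = c2*2 powr (1 + dl) * K / (1 - r)" by (simp add: near_const_def K_def c2_def r_def)
 show ?thesis
 proof (cases "R * x < 1")
  case True
  have "(nni ?M (%y. ennreal (majorant a dl R x y) * g y * indicator (near x) y))
   <= (nni ?M (%y. ennreal (c2*x powr (- (2*a) - 1)) * (g y * indicator {y. x / 2 <= y & \<bar>y - x\<bar> <= x} y)))"
  proof (rule nn_integral_mono)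
   fix y
   show "ennreal (majorant a dl R x y) * g y * indicator (near x) y
    <= ennreal (c2*x powr (- (2*a) - 1)) * (g y * indicator {y. x / 2 <= y & \<bar>y - x\<bar> <= x} y)"
   proof (cases "y : near x")
    case y: True
    have "ennreal (majorant a dl R x y) <= ennreal (c2*x powr (- (2*a) - 1))"
     unfolding c2_def by (intro ennreal_leI majorant_near_le(1)) (use assms True y in auto)
    thus ?thesis using y x by (simp add: mult_right_mono abs_le_iff)
   qed simp
  qed
  also have "... = ennreal (c2*x powr (- (2*a) - 1)) * (nni ?M (%y. g y * indicator {y. x / 2 <= y & \<bar>y - x\<bar> <= x} y))"
   by (rule nn_integral_cmult) measurable
  also have "... <= ennreal (c2*x powr (- (2*a) - 1)) * (ennreal (K * x * x powr (2*a)) * HLmax ?M g x)"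
   unfolding K_def by (intro mult_left_mono near_average a x order_refl g) auto
  also have "... = ennreal ((c2*x powr (- (2*a) - 1)) * (K * x * x powr (2*a))) * HLmax ?M g x"
   using K c2 x by (simp add: ennreal_mult mult.assoc)
  also have "(c2*x powr (- (2*a) - 1)) * (K * x * x powr (2*a)) = c2*K"
   using x by (simp add: powr_diff powr_minus_divide)
  also have "ennreal (c2*K) * HLmax ?M g x <= ennreal (near_const a dl) * HLmax ?M g x"
  proof (intro mult_right_mono ennreal_leI)
   have "c2*K * (1 - r) <= c2*K * 2 powr (1 + dl)"
    using r K c2 dl ge_one_powr_ge_zero[of 2 "1 + dl"] by (intro mult_left_mono) auto
   thus "c2*K <= near_const a dl" unfolding nc using r by (simp add: pos_le_divide_eq mult_ac)
  qed simp
  finally show ?thesis .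
 next
  case False
  hence Rx: "R * x >= 1" by simp
  define A where "A = c2*x powr (- (2*a)) * R * 2 powr (1 + dl)"
  have A: "A > 0" using c2 x R by (simp add: A_def)
  define q where "q = (2::real) powr (- 1 - dl)"
  define S where "S = (%k::nat. {y. x / 2 <= y & \<bar>y - x\<bar> <= min x (2 ^ k / R)})"
  have q0: "q > 0" by (simp add: q_def)
  have Sm[measurable]: "S k : sets borel" for k unfolding S_def by measurable
  have "(nni ?M (%y. ennreal (majorant a dl R x y) * g y * indicator (near x) y))
   <= (nni ?M (%y. (\<Sum>k. ennreal (A * q ^ k) * (g y * indicator (S k) y))))"
  proof (rule nn_integral_mono)
   fix y
   show "ennreal (majorant a dl R x y) * g y * indicator (near x) y
    <= (\<Sum>k. ennreal (A * q ^ k) * (g y * indicator (S k) y))"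
   proof (cases "y : near x")
    case y: True
    obtain k where k: "R * \<bar>x - y\<bar> <= 2 ^ k" "(1 + R * \<bar>x - y\<bar>) powr (- 1 - dl) <= 2 powr (1 + dl) * q ^ k"
     using dyadic_majorant[of "R * \<bar>x - y\<bar>" dl] R dl unfolding q_def by auto
    have "majorant a dl R x y <= c2*x powr (- (2*a)) * (R * (1 + R * \<bar>x - y\<bar>) powr (- 1 - dl))"
     unfolding c2_def by (intro majorant_near_le(2)) (use assms Rx y in auto)
    also have "... <= c2*x powr (- (2*a)) * (R * (2 powr (1 + dl) * q ^ k))"
     using k c2 R by (intro mult_left_mono) auto
    also have "... = A * q ^ k" by (simp add: A_def mult_ac)
    finally have "ennreal (majorant a dl R x y) <= ennreal (A * q ^ k)" by (rule ennreal_leI)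
    moreover have "\<bar>y - x\<bar> <= 2 ^ k / R"
     using k(1) R by (simp add: pos_le_divide_eq mult.commute abs_minus_commute)
    hence "y : S k" using y x by (auto simp: S_def abs_le_iff)
    ultimately have "ennreal (majorant a dl R x y) * g y * indicator (near x) y <= ennreal (A * q ^ k) * (g y * indicator (S k) y)"
     using y by (simp add: mult_right_mono)
    also have "... = (\<Sum>k\<in>{k}. ennreal (A * q ^ k) * (g y * indicator (S k) y))" by simp
    also have "... <= (\<Sum>k. ennreal (A * q ^ k) * (g y * indicator (S k) y))"
     by (rule sum_le_suminf) auto
    finally show ?thesis .
   qed simp
  qed
  also have "... = (\<Sum>k. (nni ?M (%y. ennreal (A * q ^ k) * (g y * indicator (S k) y))))"
   by (rule nn_integral_suminf) measurable
  also have "... = (\<Sum>k. ennreal (A * q ^ k) * (nni ?M (%y. g y * indicator (S k) y)))"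
   by (intro suminf_cong nn_integral_cmult) measurable
  also have "... <= (\<Sum>k. ennreal (c2*2 powr (1 + dl) * K * r ^ k) * HLmax ?M g x)"
  proof (intro suminf_le allI summableI)
   fix k
   have mpos: "min x (2 ^ k / R) > 0" using x R by simp
   have "(nni ?M (%y. g y * indicator (S k) y)) <= ennreal (K * min x (2 ^ k / R) * x powr (2*a)) * HLmax ?M g x"
    unfolding S_def K_def by (intro near_average a x g mpos) auto
   also have "... <= ennreal (K * (2 ^ k / R) * x powr (2*a)) * HLmax ?M g x"
    using K x by (intro mult_right_mono ennreal_leI mult_left_mono) auto
   finally have "ennreal (A * q ^ k) * (nni ?M (%y. g y * indicator (S k) y))
    <= ennreal (A * q ^ k) * (ennreal (K * (2 ^ k / R) * x powr (2*a)) * HLmax ?M g x)"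
    by (rule mult_left_mono) simp
   also have "... = ennreal ((A * q ^ k) * (K * (2 ^ k / R) * x powr (2*a))) * HLmax ?M g x"
    using A q0 K R by (subst ennreal_mult) (simp_all add: mult.assoc)
   also have "(A * q ^ k) * (K * (2 ^ k / R) * x powr (2*a)) = c2*2 powr (1 + dl) * K * (2*q) ^ k"
    using x R unfolding A_def by (simp add: powr_minus_divide power_mult_distrib)
   also have "2*q = r" by (simp add: q_def r_def powr_diff powr_minus_divide)
   finally show "ennreal (A * q ^ k) * (nni ?M (%y. g y * indicator (S k) y))
    <= ennreal (c2*2 powr (1 + dl) * K * r ^ k) * HLmax ?M g x" .
  qed
  also have "... = (\<Sum>k. ennreal (c2*2 powr (1 + dl) * K * r ^ k)) * HLmax ?M g x"
   by (rule ennreal_suminf_multc)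
  also have "(\<Sum>k. ennreal (c2*2 powr (1 + dl) * K * r ^ k)) = ennreal (c2*2 powr (1 + dl) * K * (1/(1 - r)))"
  proof (rule suminf_ennreal_eq)
   show "0 <= c2*2 powr (1 + dl) * K * r ^ k" for k using c2 K r by simp
   show "(%k. c2*2 powr (1 + dl) * K * r ^ k) sums (c2*2 powr (1 + dl) * K * (1/(1 - r)))"
    using r by (intro sums_mult geometric_sums) auto
  qed
  finally show ?thesis unfolding nc by simp
 qed
qed

text \<open>The worst R is 1/m when dl <= a and 1/M when dl > a, which explains d = min(dl, a). In
  terms of the logarithms of R, M and m each position of 1/R leads to a linear inequality between
  exponents.\<close>

lemma majorant_far_le:
 assumes xy: "0 < m" "2*m <= M" and R: "R > 0" and dl: "dl > 0" and d: "d = min dl a" and a: "2*a > -1"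
 shows "majorant a dl R M m <= 2 powr (1 + dl) * HKer a d M m"
proof -
 have M: "M > 0" "m <= M" using xy by auto
 define l where "l = ln R"
 define u where "u = ln M"
 define v where "v = ln m"
 have eR: "R = exp l" and eM: "M = exp u" and em: "m = exp v" using R M xy by (auto simp: l_def u_def v_def)
 have uv: "v <= u" using M(2) by (simp add: eM em)
 have pw: "exp s powr t = exp (t * s)" for s t :: real by (simp add: powr_def)
 have inv: "1/R = exp (- l)" by (simp add: eR exp_minus divide_inverse)
 have H: "HKer a d M m = exp ((- a - 1 - d) * u + (d - a) * v)"
  using M by (simp add: HKer_def max_def min_def eM em pw exp_add)
 have t2: "2 powr (1 + dl) = exp ((1 + dl) * ln 2)" by (simp add: powr_def)
 have dist: "\<bar>M - m\<bar> >= M / 2" using xy by auto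
 have low: "(1 + R * \<bar>M - m\<bar>) powr (- 1 - dl) <= exp ((- 1 - dl) * (l + u - ln 2))"
 proof -
  have "R * (M / 2) <= R * \<bar>M - m\<bar>" using R by (intro mult_left_mono dist) auto
  hence "R * M / 2 <= 1 + R * \<bar>M - m\<bar>" by simp
  hence "(1 + R * \<bar>M - m\<bar>) powr (- 1 - dl) <= (R * M / 2) powr (- 1 - dl)" using dl R M by (intro powr_mono2') auto
  moreover have "R * M / 2 = exp (l + u - ln 2)" by (simp add: eR eM exp_add exp_diff)
  ultimately show ?thesis by (simp add: pw)
 qed
 have d1: "d <= a" "d <= dl" and d2: "d >= 0 \<or> d = a" using d dl by (auto simp: min_def)
 consider "M < 1/R" | "m < 1/R" "1/R <= M" | "1/R <= m" using M by linarith
 thus ?thesis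
 proof cases
  case 1
  have lu: "l + u <= 0" using 1 by (simp add: inv eM)
  have "(1 + R * \<bar>M - m\<bar>) powr (- 1 - dl) <= 1 powr (- 1 - dl)" using R dl by (intro powr_mono2') auto
  hence "majorant a dl R M m <= R * max M (1/R) powr (- a) * max m (1/R) powr (- a) * 1"
   unfolding majorant_def using R by (intro mult_left_mono) auto
  also have "... = exp (l + a * l + a * l)"
  proof -
   have mx: "max M (1/R) = exp (- l)" "max m (1/R) = exp (- l)" using 1 M by (auto simp: inv)
   show ?thesis unfolding mx by (simp only: eR pw exp_add mult_1_right minus_mult_minus)
  qed
  also have "... <= exp ((1 + dl) * ln 2 + ((- a - 1 - d) * u + (d - a) * v))"
  proof (subst exp_le_cancel_iff)
   have "(2*a + 1) * (l + u) <= 0" using a lu by (intro mult_nonneg_nonpos) auto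
   moreover have "(a - d) * v <= (a - d) * u" using d1 uv by (intro mult_left_mono) auto
   moreover have "(1 + dl) * ln 2 >= 0" using dl by simp
   ultimately show "l + a * l + a * l <= (1 + dl) * ln 2 + ((- a - 1 - d) * u + (d - a) * v)"
    by (simp add: algebra_simps)
  qed
  finally show ?thesis by (simp add: H t2 exp_add)
 next
  case 2
  have lu: "l + u >= 0" "l + v <= 0" using 2 by (simp_all add: inv eM em)
  have "majorant a dl R M m <= R * max M (1/R) powr (- a) * max m (1/R) powr (- a) * exp ((- 1 - dl) * (l + u - ln 2))"
   unfolding majorant_def using R by (intro mult_left_mono low) auto
  also have "... = exp (l + (- a) * u + a * l + (- 1 - dl) * (l + u - ln 2))"
  proof -
   have mx: "max M (1/R) = M" "max m (1/R) = exp (- l)" using 2 by (auto simp: inv)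
   show ?thesis unfolding mx by (simp only: eR eM pw exp_add minus_mult_minus)
  qed
  also have "... <= exp ((1 + dl) * ln 2 + ((- a - 1 - d) * u + (d - a) * v))"
  proof (subst exp_le_cancel_iff)
   have "(dl - d) * (l + u) >= 0" using d1 lu by (intro mult_nonneg_nonneg) auto
   moreover have "(a - d) * (l + v) <= 0" using d1 lu by (intro mult_nonneg_nonpos) auto
   ultimately show "l + (- a) * u + a * l + (- 1 - dl) * (l + u - ln 2) <= (1 + dl) * ln 2 + ((- a - 1 - d) * u + (d - a) * v)"
    by (simp add: algebra_simps)
  qed
  finally show ?thesis by (simp add: H t2 exp_add)
 next
  case 3
  have lu: "l + v >= 0" "l + u >= 0" using 3 M(2) uv by (simp_all add: inv em)
  have M3: "max M (1/R) = M" "max m (1/R) = m" using 3 M by auto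
  have "majorant a dl R M m <= R * M powr (- a) * m powr (- a) * exp ((- 1 - dl) * (l + u - ln 2))"
   unfolding majorant_def M3 using R by (intro mult_left_mono low) auto
  also have "... = exp (l + (- a) * u + (- a) * v + (- 1 - dl) * (l + u - ln 2))"
   by (simp only: eR eM em pw exp_add)
  also have "... <= exp ((1 + dl) * ln 2 + ((- a - 1 - d) * u + (d - a) * v))"
  proof (subst exp_le_cancel_iff)
   have main: "(dl - d) * u + dl * l + d * v >= 0"
   proof (cases "d >= 0")
    case True
    have "(dl - d) * (l + u) >= 0" "d * (l + v) >= 0" using d1 lu True by auto
    thus ?thesis by (simp add: algebra_simps)
   next
    case False
    have "dl * (l + u) >= 0" "(- d) * (u - v) >= 0"
     by (rule mult_nonneg_nonneg; use dl lu uv False in simp)+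
    thus ?thesis by (simp add: algebra_simps)
   qed
   show "l + (- a) * u + (- a) * v + (- 1 - dl) * (l + u - ln 2) <= (1 + dl) * ln 2 + ((- a - 1 - d) * u + (d - a) * v)"
    using main by (simp add: algebra_simps)
  qed
  finally show ?thesis by (simp add: H t2 exp_add)
 qed
qed

lemma majorant_far:
 assumes "0 < x" "0 < y" "y \<notin> near x" "R > 0" "dl > 0" "2*a > -1"
 shows "majorant a dl R x y <= 2 powr (1 + dl) * HKer a (min dl a) x y"
proof (cases "2*y <= x")
 case True
 thus ?thesis using assms by (intro majorant_far_le) auto
next
 case False
 hence "2*x <= y" using assms by auto
 hence "majorant a dl R y x <= 2 powr (1 + dl) * HKer a (min dl a) y x" using assms by (intro majorant_far_le) auto
 thus ?thesis by (simp add: majorant_sym HKer_sym)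
qed

lemma majorant_pointwise:
 assumes a: "2*a > -1" and x: "0 < x" and R: "R > 0" and dl: "dl > 0"
  and g[measurable]: "g : borel_measurable borel"
 shows "(nni (pmeas (2*a)) (%y. ennreal (majorant a dl R x y) * g y))
  <= ennreal (near_const a dl) * HLmax (pmeas (2*a)) g x
   + ennreal (2 powr (1 + dl)) * (nni (pmeas (2*a)) (%y. ennreal (HKer a (min dl a) x y) * g y))"
proof -
 let ?M = "pmeas (2*a)"
 have "(nni ?M (%y. ennreal (majorant a dl R x y) * g y))
  <= (nni ?M (%y. 1*(ennreal (majorant a dl R x y) * g y * indicator (near x) y)
    + ennreal (2 powr (1 + dl)) * (ennreal (HKer a (min dl a) x y) * g y)))"
 proof (rule nn_integral_mono_AE, use AE_pmeas[of "2*a"] in eventually_elim)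
  fix y :: real assume y: "0 < y & y < 1"
  show "ennreal (majorant a dl R x y) * g y <= 1*(ennreal (majorant a dl R x y) * g y * indicator (near x) y)
    + ennreal (2 powr (1 + dl)) * (ennreal (HKer a (min dl a) x y) * g y)"
  proof (cases "y : near x")
   case False
   have "ennreal (majorant a dl R x y) <= ennreal (2 powr (1 + dl) * HKer a (min dl a) x y)"
    using assms y False by (intro ennreal_leI majorant_far) auto
   hence "ennreal (majorant a dl R x y) * g y <= ennreal (2 powr (1 + dl)) * ennreal (HKer a (min dl a) x y) * g y"
    by (intro mult_right_mono) (auto simp: ennreal_mult HKer_nonneg)
   thus ?thesis using False by (simp add: mult.assoc)
  qed simp
 qed
 also have "... = 1*(nni ?M (%y. ennreal (majorant a dl R x y) * g y * indicator (near x) y))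
  + ennreal (2 powr (1 + dl)) * (nni ?M (%y. ennreal (HKer a (min dl a) x y) * g y))"
  by (rule nn_integral_linear) measurable
 also have "... <= ennreal (near_const a dl) * HLmax ?M g x
  + ennreal (2 powr (1 + dl)) * (nni ?M (%y. ennreal (HKer a (min dl a) x y) * g y))"
  using near_bound[OF a x R dl g] by (intro add_right_mono) simp
 finally show ?thesis .
qed

lemma epow_cmult:
 assumes "c > 0" "r > 0" shows "epow (ennreal c * v) r = ennreal (c powr r) * epow v r"
proof (cases v)
 case (real t)
 have "ennreal c * v = ennreal (c * t)" using real assms by (simp add: ennreal_mult)
 hence "epow (ennreal c * v) r = ennreal ((c * t) powr r)" using real assms by (simp only:) (rule epow_ennreal, simp)
 also have "(c * t) powr r = c powr r * t powr r" by (rule powr_mult)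
 finally show ?thesis using real by (simp add: epow_ennreal ennreal_mult)
qed (use assms in "simp add: epow_def ennreal_mult_top")

lemma epow_add_le:
 assumes "r > 0" shows "epow (u + v) r <= ennreal (2 powr r) * (epow u r + epow v r)"
proof -
 have "u + v <= max u v + max u v" by (intro add_mono) auto
 also have "... = ennreal 2*max u v" by (simp add: mult_2)
 finally have "epow (u + v) r <= ennreal (2 powr r) * epow (max u v) r"
  using epow_mono[of "u + v" "ennreal 2*max u v" r] epow_cmult[of 2 r "max u v"] assms by simp
 also have "epow (max u v) r <= epow u r + epow v r" by (simp add: max_def)
 finally show ?thesis by (simp add: mult_left_mono)
qed

text \<open>The near part is below the maximal function and the far part below one fixed kernel,
  both independent of R, so the supremum costs nothing. Here h is any function below that supremum,
  measurable or not.\<close>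

theorem maximal_majorant_bounded:
 assumes p: "p > 1" and a: "2*a > -1" and dl: "dl > 0"
  and cond: "a - min dl a < (2*a + 1) / p" "(2*a + 1) / p < a + min dl a + 1"
 obtains C where "C >= 0"
  "!!g h. g : borel_measurable borel ==> (!!y. g y >= 0) ==>
   (!!x. 0 < x ==> x < 1 ==> h x <= (SUP R\<in>{0<..}. \<integral>\<^sup>+y. ennreal (majorant a dl R x y) * ennreal (g y) \<partial>pmeas (2*a))) ==>
   (nni (pmeas (2*a)) (%x. epow (h x) p)) <= ennreal C * (nni (pmeas (2*a)) (%y. ennreal (g y powr p)))"
proof (rule HKer_bounded[OF p a cond])
 fix C1 assume C1: "C1 >= 0" "!!g. g : borel_measurable borel ==> (!!y. g y >= 0) ==>
   (nni (pmeas (2*a)) (%x. epow (nni (pmeas (2*a)) (%y. ennreal (HKer a (min dl a) x y * g y))) p))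
    <= ennreal C1*(nni (pmeas (2*a)) (%y. ennreal (g y powr p)))"
 let ?M = "pmeas (2*a)"
 interpret line_measure ?M by (rule line_measure_pmeas[OF a])
 define c where "c = near_const a dl + 1"
 have c: "c > 0" "near_const a dl <= c" using near_const_nonneg[OF dl, of a] by (auto simp: c_def)
 define C0 where "C0 = 4*p * 2 powr (p - 1) / (p - 1)"
 have C0: "C0 >= 0" using p by (simp add: C0_def)
 define k where "k = (2::real) powr (1 + dl)"
 have k: "k > 0" by (simp add: k_def)
 define A where "A = 2 powr p * c powr p"
 define B where "B = 2 powr p * k powr p"
 show thesis
 proof (rule that[of "A * C0 + B * C1"])
  show "A * C0 + B * C1 >= 0" using C0 C1 by (simp add: A_def B_def)
  fix g :: "real => real" and h :: "real => ennreal"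
  assume g[measurable]: "g : borel_measurable borel" and g0: "!!y. g y >= 0"
   and h: "!!x. 0 < x ==> x < 1 ==> h x <= (SUP R\<in>{0<..}. \<integral>\<^sup>+y. ennreal (majorant a dl R x y) * ennreal (g y) \<partial>?M)"
  let ?H = "HLmax ?M (%y. ennreal (g y))"
  let ?T = "%x. \<integral>\<^sup>+y. ennreal (HKer a (min dl a) x y * g y) \<partial>?M"
  have "(nni ?M (%x. epow (h x) p)) <= (nni ?M (%x. ennreal A * epow (?H x) p + ennreal B * epow (?T x) p))"
  proof (rule nn_integral_mono_AE, use AE_pmeas[of "2*a"] in eventually_elim)
   fix x :: real assume x: "0 < x & x < 1"
   have T: "(nni ?M (%y. ennreal (HKer a (min dl a) x y) * ennreal (g y))) = ?T x"
    by (intro nn_integral_cong) (simp add: ennreal_mult HKer_nonneg g0)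
   have "h x <= (SUP R\<in>{0<..}. \<integral>\<^sup>+y. ennreal (majorant a dl R x y) * ennreal (g y) \<partial>?M)" using h x by blast
   also have "... <= ennreal c * ?H x + ennreal k * ?T x"
   proof (rule SUP_least)
    fix R :: real assume R: "R : {0<..}"
    have "(nni ?M (%y. ennreal (majorant a dl R x y) * ennreal (g y))) <= ennreal (near_const a dl) * ?H x + ennreal k * ?T x"
     unfolding k_def T[symmetric] by (rule majorant_pointwise) (use a x R dl in auto)
    also have "... <= ennreal c * ?H x + ennreal k * ?T x"
     using c by (intro add_right_mono mult_right_mono ennreal_leI) auto
    finally show "(nni ?M (%y. ennreal (majorant a dl R x y) * ennreal (g y))) <= ennreal c * ?H x + ennreal k * ?T x" .
   qed
   finally have "epow (h x) p <= epow (ennreal c * ?H x + ennreal k * ?T x) p" using p by (intro epow_mono) auto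
   also have "... <= ennreal (2 powr p) * (epow (ennreal c * ?H x) p + epow (ennreal k * ?T x) p)"
    using p by (intro epow_add_le) auto
   also have "... = ennreal (2 powr p) * (ennreal (c powr p) * epow (?H x) p + ennreal (k powr p) * epow (?T x) p)"
    using p c k by (subst (1 2) epow_cmult) auto
   also have "... = ennreal A * epow (?H x) p + ennreal B * epow (?T x) p"
    by (simp add: A_def B_def ennreal_mult distrib_left mult.assoc)
   finally show "epow (h x) p <= ennreal A * epow (?H x) p + ennreal B * epow (?T x) p" .
  qed
  also have "... = ennreal A * (nni ?M (%x. epow (?H x) p)) + ennreal B * (nni ?M (%x. epow (?T x) p))"
  proof (rule nn_integral_linear)
   have sf: "sigma_finite_measure ?M" by unfold_locales
   have "?T : borel_measurable borel"
    by (rule sigma_finite_measure.borel_measurable_nn_integral[OF sf]) measurable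
   thus "(%x. epow (?T x) p) : borel_measurable ?M" by measurable
  qed measurable
  also have "... <= ennreal A * (ennreal C0*(nni ?M (%y. ennreal (g y powr p)))) + ennreal B * (ennreal C1*(nni ?M (%y. ennreal (g y powr p))))"
   unfolding C0_def by (intro add_mono mult_left_mono HLmax_strong_type C1 p g0 g) auto
  also have "... = ennreal (A * C0 + B * C1) * (nni ?M (%y. ennreal (g y powr p)))"
   using C0 C1(1) by (simp add: A_def B_def ennreal_mult ennreal_plus distrib_right mult.assoc)
  finally show "(nni ?M (%x. epow (h x) p)) <= ennreal (A * C0 + B * C1) * (nni ?M (%y. ennreal (g y powr p)))" .
 qed
qed

text \<open>The tail y^{-a-1-dl} against y^{2a} is integrable at infinity precisely because dl > a;
  the other regions are scale invariant.\<close>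

theorem majorant_integral_bounded:
 assumes a: "2*a > -1" and dl: "dl > 0" "dl > a"
 obtains C where "C >= 0"
  "!!x R. 0 < x ==> R > 0 ==> (nni (pmeas (2*a)) (%y. ennreal (majorant a dl R x y))) <= ennreal C"
proof -
 let ?M = "pmeas (2*a)"
 interpret line_measure ?M by (rule line_measure_pmeas[OF a])
 define k where "k = (2::real) powr (1 + dl)"
 have k: "k > 0" by (simp add: k_def)
 define C where "C = near_const a dl + k / (2*a + 1) + k / (dl - a) + 1/(2*a + 1)"
 show ?thesis
 proof (rule that[of C])
  show "C >= 0" using near_const_nonneg[OF dl(1), of a] k a dl by (simp add: C_def)
  fix x R :: real assume x: "0 < x" and R: "R > 0"
  define W where "W = max x (1/R)"
  have W: "W > 0" "x <= W" "1/R <= W" using x by (auto simp: W_def)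
  have low: "majorant a dl R x y <= k * x powr (- (2*a) - 1)" if "0 < y" "2*y <= x" for y
  proof -
   have "majorant a dl R x y <= k * HKer a a x y"
    unfolding k_def by (rule majorant_far_le) (use that R a dl in auto)
   thus ?thesis using that by (simp add: HKer_def max_def)
  qed
  have small: "majorant a dl R x y <= W powr (- (2*a) - 1)" if y: "0 < y" "x <= y" "y < W" for y
  proof -
   have WR: "W = 1/R" "max x (1/R) = W" "max y (1/R) = W" using y by (auto simp: W_def max_def split: if_splits)
   have "(1 + R * \<bar>x - y\<bar>) powr (- 1 - dl) <= 1 powr (- 1 - dl)" using R dl by (intro powr_mono2') auto
   hence "majorant a dl R x y <= R * W powr (- a) * W powr (- a) * 1"
    unfolding majorant_def WR(2,3) using R by (intro mult_left_mono) auto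
   also have "... = W powr (- (2*a) - 1)"
   proof -
    have "R = W powr (- 1)" using R WR(1) by (simp add: powr_minus_divide)
    hence "R * W powr (- a) * W powr (- a) * 1 = W powr (- 1) * W powr (- a) * W powr (- a)" by simp
    also have "... = W powr (- 1 + - a + - a)" by (simp only: powr_add)
    also have "- 1 + - a + - a = - (2*a) - 1" by simp
    finally show ?thesis .
   qed
   finally show ?thesis .
  qed
  have high: "majorant a dl R x y <= k * W powr (dl - a) * y powr (- a - 1 - dl)" if y: "2*x <= y" "W <= y" for y
  proof -
   have y0: "y > 0" and my: "max y (1/R) = y" using y W by auto
   have "R * (y / 2) <= R * \<bar>x - y\<bar>" using y R x by (intro mult_left_mono) auto
   hence "R * y / 2 <= 1 + R * \<bar>x - y\<bar>" by simp
   hence "(1 + R * \<bar>x - y\<bar>) powr (- 1 - dl) <= (R * y / 2) powr (- 1 - dl)" using dl R y0 by (intro powr_mono2') auto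
   hence "majorant a dl R x y <= R * W powr (- a) * y powr (- a) * (R * y / 2) powr (- 1 - dl)"
    unfolding majorant_def my W_def[symmetric] using R by (intro mult_left_mono) auto
   also have "... = k * R powr (- dl) * W powr (- a) * y powr (- a - 1 - dl)"
   proof -
    have s: "s powr (- 1 - dl) = s powr (- dl) / s" if "s > 0" for s :: real
    proof -
     have "s powr (- dl - 1) = s powr (- dl) / s powr 1" by (rule powr_diff)
     moreover have "- dl - 1 = - 1 - dl" by simp
     ultimately show ?thesis using that by simp
    qed
    have "(R * y / 2) powr (- 1 - dl) = R powr (- 1 - dl) * y powr (- 1 - dl) / 2 powr (- 1 - dl)"
     by (simp only: powr_divide powr_mult)
    also have "R powr (- 1 - dl) = R powr (- dl) / R" by (rule s[OF R])
    also have "2 powr (- 1 - dl) = 1/k" using powr_minus_divide[of 2 "1 + dl"] by (simp add: k_def)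
    finally have e: "(R * y / 2) powr (- 1 - dl) = R powr (- dl) / R * y powr (- 1 - dl) / (1/k)" .
    have ex: "- a - 1 - dl = - a + (- 1 - dl)" by simp
    have "y powr (- a - 1 - dl) = y powr (- a) * y powr (- 1 - dl)" unfolding ex by (rule powr_add)
    thus ?thesis unfolding e using R k by simp
   qed
   also have "... <= k * W powr dl * W powr (- a) * y powr (- a - 1 - dl)"
   proof -
    have "R powr (- dl) = (1/R) powr dl" using R by (simp add: powr_divide powr_minus_divide)
    also have "... <= W powr dl" using W R dl by (intro powr_mono2) auto
    finally show ?thesis using k by (intro mult_right_mono mult_left_mono) auto
   qed
   also have "k * W powr dl * W powr (- a) = k * W powr (dl - a)" by (simp add: powr_diff powr_minus_divide)
   finally show ?thesis .
  qed
  let ?f1 = "%y. ennreal (majorant a dl R x y) * 1*indicator (near x) y"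
  let ?f2 = "%y. ennreal (y powr 0) * indicator {0<..<x} y"
  let ?f3 = "%y. ennreal (y powr (- a - 1 - dl)) * indicator {W..} y"
  let ?f4 = "%y. ennreal (y powr 0) * indicator {0<..<W} y"
  let ?c2 = "ennreal (k * x powr (- (2*a) - 1))"
  let ?c3 = "ennreal (k * W powr (dl - a))"
  let ?c4 = "ennreal (W powr (- (2*a) - 1))"
  have "(nni ?M (%y. ennreal (majorant a dl R x y)))
   <= (nni ?M (%y. 1*(1*?f1 y + ?c2*?f2 y) + 1*(?c3*?f3 y + ?c4*?f4 y)))"
  proof (rule nn_integral_mono_AE, use AE_pmeas[of "2*a"] in eventually_elim)
   fix y :: real assume y: "0 < y & y < 1"
   \<comment> \<open>Besides the near zone and y <= x/2, the zone y >= 2x is cut at W = max(x, 1/R),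
     below which the decaying factor is replaced by 1.\<close>
   consider "y : near x" | "2*y <= x" | "2*x <= y" "W <= y" | "2*x <= y" "y < W"
    by fastforce
   thus "ennreal (majorant a dl R x y) <= 1*(1*?f1 y + ?c2*?f2 y) + 1*(?c3*?f3 y + ?c4*?f4 y)"
   proof cases
    case 1
    hence "ennreal (majorant a dl R x y) <= ?f1 y" by simp
    thus ?thesis by (simp add: add_increasing2 add.assoc)
   next
    case 2
    have "ennreal (majorant a dl R x y) <= ?c2" using low[of y] 2 y by (intro ennreal_leI) auto
    also have "?c2 = ?c2*?f2 y" using 2 y x by simp
    finally show ?thesis by (simp add: add_increasing2 add_increasing)
   next
    case 3
    have "ennreal (majorant a dl R x y) <= ennreal (k * W powr (dl - a) * y powr (- a - 1 - dl))"
     using high[of y] 3 by (intro ennreal_leI) auto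
    also have "... = ?c3*?f3 y" using 3 k by (simp add: ennreal_mult)
    finally show ?thesis by (simp add: add_increasing2 add_increasing)
   next
    case 4
    have "ennreal (majorant a dl R x y) <= ?c4" using small[of y] 4 y x by (intro ennreal_leI) auto
    also have "?c4 = ?c4*?f4 y" using 4 y by simp
    finally show ?thesis by (simp add: add_increasing2 add_increasing)
   qed
  qed
  also have "... = 1*(nni ?M (%y. 1*?f1 y + ?c2*?f2 y)) + 1*(nni ?M (%y. ?c3*?f3 y + ?c4*?f4 y))"
   by (rule nn_integral_linear) measurable
  also have "(nni ?M (%y. 1*?f1 y + ?c2*?f2 y)) = 1*(nni ?M (%y. ?f1 y)) + ?c2*(nni ?M (%y. ?f2 y))"
   by (rule nn_integral_linear) measurable
  also have "(nni ?M (%y. ?c3*?f3 y + ?c4*?f4 y)) = ?c3*(nni ?M (%y. ?f3 y)) + ?c4*(nni ?M (%y. ?f4 y))"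
   by (rule nn_integral_linear) measurable
  also have "1*(1*(nni ?M (%y. ?f1 y)) + ?c2*(nni ?M (%y. ?f2 y))) + 1*(?c3*(nni ?M (%y. ?f3 y)) + ?c4*(nni ?M (%y. ?f4 y)))
   <= 1*(1*ennreal (near_const a dl) + ?c2*ennreal (x powr (0 + 2*a + 1) / (0 + 2*a + 1)))
    + 1*(?c3*ennreal (W powr ((- a - 1 - dl) + 2*a + 1) / (- ((- a - 1 - dl) + 2*a + 1))) + ?c4*ennreal (W powr (0 + 2*a + 1) / (0 + 2*a + 1)))"
  proof (intro add_mono mult_left_mono pmeas_low pmeas_high)
   have "(nni ?M (%y. ?f1 y)) <= ennreal (near_const a dl) * HLmax ?M (%_. 1) x"
    by (rule near_bound[OF a x R dl(1)]) measurable
   also have "... <= ennreal (near_const a dl) * 1" by (intro mult_left_mono HLmax_const_le) simp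
   finally show "(nni ?M (%y. ?f1 y)) <= ennreal (near_const a dl)" by simp
  qed (use a dl x W in auto)
  also have "... = ennreal C"
  proof -
   have e1: "s powr (- (2*a) - 1) * (s powr (0 + 2*a + 1) / (0 + 2*a + 1)) = 1/(2*a + 1)" if "s > 0" for s :: real
   proof -
    have "s powr (- (2*a) - 1) * s powr (0 + 2*a + 1) = s powr (- (2*a) - 1 + (0 + 2*a + 1))" by (simp only: powr_add)
    thus ?thesis using that by simp
   qed
   have e2: "W powr (dl - a) * (W powr ((- a - 1 - dl) + 2*a + 1) / (- ((- a - 1 - dl) + 2*a + 1))) = 1/(dl - a)"
   proof -
    have "W powr (dl - a) * W powr ((- a - 1 - dl) + 2*a + 1) = W powr (dl - a + ((- a - 1 - dl) + 2*a + 1))" by (simp only: powr_add)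
    moreover have "dl - a + ((- a - 1 - dl) + 2*a + 1) = 0" "- ((- a - 1 - dl) + 2*a + 1) = dl - a" by simp_all
    ultimately show ?thesis using W by simp
   qed
   have c2: "?c2*ennreal (x powr (0 + 2*a + 1) / (0 + 2*a + 1)) = ennreal (k / (2*a + 1))"
    using e1[OF x] k a by (subst ennreal_mult[symmetric]) (auto simp: mult.assoc)
   have c3: "?c3*ennreal (W powr ((- a - 1 - dl) + 2*a + 1) / (- ((- a - 1 - dl) + 2*a + 1))) = ennreal (k / (dl - a))"
   proof -
    have nn: "W powr ((- a - 1 - dl) + 2*a + 1) / (- ((- a - 1 - dl) + 2*a + 1)) >= 0"
     using dl by (intro divide_nonneg_nonneg) auto
    have eq: "k * W powr (dl - a) * (W powr ((- a - 1 - dl) + 2*a + 1) / (- ((- a - 1 - dl) + 2*a + 1))) = k / (dl - a)"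
     unfolding mult.assoc e2 by simp
    have "k * W powr (dl - a) >= 0" using k by simp
    from ennreal_mult[OF this nn] show ?thesis unfolding eq by (rule sym)
   qed
   have c4: "?c4*ennreal (W powr (0 + 2*a + 1) / (0 + 2*a + 1)) = ennreal (1/(2*a + 1))"
    using e1[OF W(1)] a by (subst ennreal_mult[symmetric]) auto
   have "1*(1*ennreal A + ennreal B) + 1*(ennreal D + ennreal E) = ennreal (A + B + D + E)"
    if "A >= 0" "B >= 0" "D >= 0" "E >= 0" for A B D E :: real
    using that by (simp add: ennreal_plus add.assoc)
   thus ?thesis unfolding c2 c3 c4 C_def
    by this (use near_const_nonneg[OF dl(1), of a] k a dl in auto)
  qed
  finally show "(nni ?M (%y. ennreal (majorant a dl R x y))) <= ennreal C" .
 qed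
qed

section \<open>Transfer to \<open>mu_nu\<close> and the sufficiency of the conditions\<close>

lemma sets_mu_nu: "sets (mu_nu nu) = sets (restrict_space lborel {0<..<1})"
 and space_mu_nu: "space (mu_nu nu) = {0<..<1}"
 by (simp_all add: mu_nu_def space_restrict_space)

lemma borel_measurable_mu_nu_iff:
 fixes f :: "real => real"
 shows "f : borel_measurable (mu_nu nu) \<longleftrightarrow> (%x. indicator {0<..<1} x * f x) : borel_measurable borel"
proof -
 have "f : borel_measurable (mu_nu nu) \<longleftrightarrow> f : borel_measurable (restrict_space lborel {0<..<1})"
  using sets_mu_nu by (intro iffI; subst (asm) measurable_cong_sets) auto
 also have "... \<longleftrightarrow> (%x. indicator {0<..<1} x *\<^sub>R f x) : borel_measurable lborel"
  by (rule borel_measurable_restrict_space_iff) simp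
 finally show ?thesis by simp
qed

lemma nn_integral_mu_nu:
 assumes u: "u : borel_measurable (mu_nu nu)"
 shows "(%x. u x * indicator {0<..<1} x) : borel_measurable borel"
  "(nni (mu_nu nu) (%x. u x)) = (nni (pmeas (2*nu + 1)) (%x. u x * indicator {0<..<1} x))"
proof -
 have u': "u : borel_measurable (restrict_space lborel {0<..<1})"
  using u by (subst (asm) measurable_cong_sets[OF sets_mu_nu refl])
 have eq: "(%x. indicator {0<..<1} x * u x) = (%x. u x * indicator {0<..<1} x)" by (simp add: mult.commute)
 show m[measurable]: "(%x. u x * indicator {0<..<1} x) : borel_measurable borel"
  using u' by (subst (asm) borel_measurable_restrict_space_iff_ennreal) (auto simp: eq mult.commute)
 have w: "(%x. ennreal (x powr (2*nu + 1))) : borel_measurable (restrict_space lborel {0<..<1::real})"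
  by (rule measurable_restrict_space1) simp
 have "(nni (mu_nu nu) (%x. u x)) = (nni (restrict_space lborel {0<..<1}) (%x. ennreal (x powr (2*nu + 1)) * u x))"
  unfolding mu_nu_def by (rule nn_integral_density[OF w u'])
 also have "... = (nni lborel (%x. ennreal (x powr (2*nu + 1)) * u x * indicator {0<..<1} x))"
  by (rule nn_integral_restrict_space) simp
 also have "... = (nni lborel (%x. ennreal (x powr (2*nu + 1)) * indicator {0<..<1} x * (u x * indicator {0<..<1} x)))"
  by (intro nn_integral_cong) (simp add: indicator_def)
 also have "... = (nni (pmeas (2*nu + 1)) (%x. u x * indicator {0<..<1} x))"
  by (rule nn_integral_pmeas[OF m, symmetric])
 finally show "(nni (mu_nu nu) (%x. u x)) = (nni (pmeas (2*nu + 1)) (%x. u x * indicator {0<..<1} x))" .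
qed

text \<open>No measurability of the integrand is needed here: it is applied to a supremum over
 uncountably many functions.\<close>
lemma nn_integral_mu_nu_le: "(nni (mu_nu nu) (%x. h x)) <= (nni (pmeas (2*nu + 1)) (%x. h x))"
 unfolding nn_integral_def[of "mu_nu nu"]
proof (rule SUP_least)
 fix g assume "g : {g. simple_function (mu_nu nu) g & g <= h}"
 hence g: "simple_function (mu_nu nu) g" "g <= h" by auto
 have "integral\<^sup>S (mu_nu nu) g = (nni (mu_nu nu) (%x. g x))" by (rule nn_integral_eq_simple_integral[OF g(1), symmetric])
 also have "... = (nni (pmeas (2*nu + 1)) (%x. g x * indicator {0<..<1} x))"
  by (rule nn_integral_mu_nu(2)) (rule borel_measurable_simple_function[OF g(1)])
 also have "... <= (nni (pmeas (2*nu + 1)) (%x. h x))"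
  using g(2) by (intro nn_integral_mono) (auto simp: indicator_def le_fun_def)
 finally show "integral\<^sup>S (mu_nu nu) g <= (nni (pmeas (2*nu + 1)) (%x. h x))" .
qed

lemma finite_measure_mu_nu: "nu > -1 ==> finite_measure (mu_nu nu)"
proof -
 assume "nu > -1"
 then interpret line_measure "pmeas (2*nu + 1)" by (intro line_measure_pmeas) simp
 have "(nni (mu_nu nu) (%x. 1)) <= (nni (pmeas (2*nu + 1)) (%x. 1))" by (rule nn_integral_mu_nu_le)
 also have "... < \<infinity>" using emeasure_finite[of UNIV] by (simp add: less_top[symmetric])
 finally show "finite_measure (mu_nu nu)" by (intro finite_measureI) (auto simp: less_top[symmetric])
qed

lemma Lp_norm_finite: "p ~= \<infinity> ==> Lp_norm M p g = epow (nni M (%x. epow (g x) (enn2real p))) (1/enn2real p)"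
 by (simp add: Lp_norm_def epow_def Let_def cong: if_cong)

lemma Lp_norm_infinity_AE:
 assumes "Lp_norm M \<infinity> g < t" shows "AE x in M. g x <= t"
proof -
 have "Inf {C. AE x in M. g x <= C} < t" using assms by (simp add: Lp_norm_def)
 then obtain C where "AE x in M. g x <= C" "C < t" by (auto simp: Inf_less_iff)
 thus ?thesis by (auto elim!: eventually_mono)
qed

lemma Lp_norm_infinity_le:
 assumes "!!x. x : space M ==> g x <= C" shows "Lp_norm M \<infinity> g <= C"
 unfolding Lp_norm_def using assms by (auto intro!: Inf_lower AE_I2)

lemma enn2real_gt_1: "1 < p ==> p ~= \<infinity> ==> enn2real p > 1"
 by (cases p) (auto simp: ennreal_1[symmetric] ennreal_less_iff simp del: ennreal_1)

text \<open>The measure is finite and |f| <= 1 + |f|^P, so all coefficients are genuine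
  integrals.\<close>

lemma in_Lp_integrable:
 assumes nu: "nu > -1" and p: "1 < p" and f: "in_Lp (mu_nu nu) p f"
 shows "integrable (mu_nu nu) f"
proof -
 interpret finite_measure "mu_nu nu" by (rule finite_measure_mu_nu[OF nu])
 have m[measurable]: "f : borel_measurable (mu_nu nu)" using f by (simp add: in_Lp_def)
 have "(nni (mu_nu nu) (%x. ennreal (norm (f x)))) < \<infinity>"
 proof (cases "p = \<infinity>")
  case True
  then obtain t where t: "Lp_norm (mu_nu nu) \<infinity> (%x. ennreal \<bar>f x\<bar>) < t" "t < \<infinity>"
   using f dense[of "Lp_norm (mu_nu nu) \<infinity> (%x. ennreal \<bar>f x\<bar>)" \<infinity>] by (auto simp: in_Lp_def)
  have "(nni (mu_nu nu) (%x. ennreal (norm (f x)))) <= (nni (mu_nu nu) (%x. t))"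
   using Lp_norm_infinity_AE[OF t(1)] by (intro nn_integral_mono_AE) simp
  also have "... < \<infinity>" using t(2) emeasure_finite by (simp add: ennreal_mult_eq_top_iff less_top[symmetric])
  finally show ?thesis .
 next
  case False
  define P where "P = enn2real p"
  have P: "P > 1" using enn2real_gt_1[OF p False] by (simp add: P_def)
  have "epow (nni (mu_nu nu) (%x. epow (ennreal \<bar>f x\<bar>) P)) (1/P) < \<infinity>"
   using f False by (simp add: in_Lp_def Lp_norm_finite P_def)
  hence fin: "(nni (mu_nu nu) (%x. epow (ennreal \<bar>f x\<bar>) P)) < \<infinity>" by (auto simp: epow_def less_top split: if_splits)
  have "(nni (mu_nu nu) (%x. ennreal (norm (f x)))) <= (nni (mu_nu nu) (%x. 1 + epow (ennreal \<bar>f x\<bar>) P))"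
  proof (rule nn_integral_mono)
   fix x
   have "\<bar>f x\<bar> <= 1 + \<bar>f x\<bar> powr P"
   proof (cases "\<bar>f x\<bar> <= 1")
    case False
    hence "\<bar>f x\<bar> powr 1 <= \<bar>f x\<bar> powr P" using P by (intro powr_mono) auto
    thus ?thesis using False by simp
   qed (simp add: add_increasing2)
   hence "ennreal \<bar>f x\<bar> <= ennreal (1 + \<bar>f x\<bar> powr P)" by (rule ennreal_leI)
   thus "ennreal (norm (f x)) <= 1 + epow (ennreal \<bar>f x\<bar>) P" by (simp add: epow_ennreal)
  qed
  also have "... = emeasure (mu_nu nu) (space (mu_nu nu)) + (nni (mu_nu nu) (%x. epow (ennreal \<bar>f x\<bar>) P))"
   by (simp add: nn_integral_add)
  also have "... < \<infinity>" using fin emeasure_finite by (simp add: less_top[symmetric])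
  finally show ?thesis .
 qed
 thus ?thesis by (intro integrableI_bounded) auto
qed

context bessel_jost
begin

lemma psi_const: "\<exists>c. \<forall>x>0. psi nu (Suc j) x = c * rE nu (bz (Suc j) * x)"
 by (rule exI[of _ "sqrt 2/\<bar>bz (Suc j) / 2*rE (nu + 1) (bz (Suc j))\<bar>"]) (intro allI impI psi_eq[OF nu bz_pos])

lemma continuous_rE: "continuous_on S (rE nu)"
 using has_real_derivative_rE[OF nu] by (intro continuous_at_imp_continuous_on ballI DERIV_isCont)

lemma integrable_mult_psi:
 assumes u: "integrable (mu_nu nu) u"
 shows "integrable (mu_nu nu) (%x. u x * psi nu (Suc j) x)"
proof -
 obtain c where c: "\<forall>x>0. psi nu (Suc j) x = c * rE nu (bz (Suc j) * x)" using psi_const by blast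
 obtain B where B: "B >= 0" "!!x. x : {0..bz (Suc j)} ==> \<bar>rE nu x\<bar> <= B" using rE_bounded[of "bz (Suc j)"] by blast
 have [measurable]: "u : borel_measurable (mu_nu nu)" using u by auto
 have [measurable]: "rE nu : borel_measurable borel" by (intro borel_measurable_continuous_onI continuous_rE)
 have id[measurable]: "(%x. x) : borel_measurable (mu_nu nu)"
  by (subst borel_measurable_mu_nu_iff) measurable
 have "integrable (mu_nu nu) (%x. u x * (c * rE nu (bz (Suc j) * x)))"
 proof (rule Bochner_Integration.integrable_bound[OF integrable_mult_right[OF u, of "\<bar>c\<bar> * B"]])
  show "AE x in mu_nu nu. norm (u x * (c * rE nu (bz (Suc j) * x))) <= norm (\<bar>c\<bar> * B * u x)"
  proof (rule AE_I2)
   fix x assume "x : space (mu_nu nu)"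
   hence x: "0 < x" "x < 1" by (auto simp: space_mu_nu)
   have "\<bar>rE nu (bz (Suc j) * x)\<bar> <= B" using x bz_pos[of j] by (intro B(2)) auto
   hence "\<bar>u x\<bar> * (\<bar>c\<bar> * \<bar>rE nu (bz (Suc j) * x)\<bar>) <= \<bar>u x\<bar> * (\<bar>c\<bar> * B)" by (intro mult_left_mono) auto
   thus "norm (u x * (c * rE nu (bz (Suc j) * x))) <= norm (\<bar>c\<bar> * B * u x)"
    using B(1) by (simp add: abs_mult mult_ac)
  qed
 qed measurable
 thus ?thesis by (rule Bochner_Integration.integrable_cong[THEN iffD1, rotated 2]) (auto simp: space_mu_nu c)
qed

text \<open>Only finitely many zeros lie below R, and the weight at all others is 0, so the series
  is a finite sum that can be moved under the integral.\<close>

lemma bochner_riesz_Kern: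
 assumes u: "integrable (mu_nu nu) u" and delta: "delta > 0" and R: "R > 0"
 shows "integrable (mu_nu nu) (%y. Kern delta R x y * u y)"
  "bochner_riesz nu delta R u x = (bni (mu_nu nu) (%y. Kern delta R x y * u y))"
proof -
 define J where "J = {j. bz (Suc j) < R}"
 have J: "finite J" "{j. bz (Suc j) < R} <= J" unfolding J_def using finite_bz_below by auto
 define w where "w j = max 0 (1 - (bz (Suc j))\<^sup>2/R\<^sup>2) powr delta" for j
 have K: "Kern delta R x y * u y = (\<Sum>j\<in>J. (w j * psi nu (Suc j) x) * (u y * psi nu (Suc j) y))" for y
  unfolding Kern_eq[OF delta J R] sum_distrib_right w_def by (intro sum.cong refl) (simp only: mult_ac)
 show "integrable (mu_nu nu) (%y. Kern delta R x y * u y)"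
  unfolding K by (intro Bochner_Integration.integrable_sum integrable_mult_right integrable_mult_psi u)
 have w0: "w j = 0" if "j \<notin> J" for j
 proof -
  have "R\<^sup>2 <= (bz (Suc j))\<^sup>2" using that R by (intro power_mono) (auto simp: J_def)
  hence "1 - (bz (Suc j))\<^sup>2/R\<^sup>2 <= 0" using R by (simp add: field_simps)
  thus ?thesis by (simp add: w_def)
 qed
 have "bochner_riesz nu delta R u x = (\<Sum>j\<in>J. w j * coeff_a nu (Suc j) u * psi nu (Suc j) x)"
  unfolding bochner_riesz_def w_def[symmetric] by (rule suminf_finite) (auto simp: J w0)
 also have "... = (\<Sum>j\<in>J. (bni (mu_nu nu) (%y. (w j * psi nu (Suc j) x) * (u y * psi nu (Suc j) y))))"
  unfolding coeff_a_def Bochner_Integration.integral_mult_right_zero by (intro sum.cong refl) (simp only: mult_ac)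
 also have "... = (bni (mu_nu nu) (%y. (\<Sum>j\<in>J. (w j * psi nu (Suc j) x) * (u y * psi nu (Suc j) y))))"
  by (intro Bochner_Integration.integral_sum[symmetric] integrable_mult_right integrable_mult_psi u)
 finally show "bochner_riesz nu delta R u x = (bni (mu_nu nu) (%y. Kern delta R x y * u y))" unfolding K .
qed

lemma bochner_riesz_le_majorant:
 assumes delta: "delta > 0"
 obtains C where "C > 0"
  "!!u R x. integrable (mu_nu nu) u ==> R > 0 ==> 0 < x ==> x < 1 ==>
   ennreal \<bar>bochner_riesz nu delta R u x\<bar> <= (nni (mu_nu nu) (%y. ennreal (majorant a delta R x y) * ennreal (C * \<bar>u y\<bar>)))"
proof (rule kernel_bound[OF delta])
 fix C assume C: "C > 0"
  "!!R x y. R > 0 ==> 0 < x ==> x < 1 ==> 0 < y ==> y < 1 ==> \<bar>Kern delta R x y\<bar> <= C * Maj delta R x y"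
 have M: "Maj delta R x y = majorant a delta R x y" for R x y by (simp add: Maj_def majorant_def)
 show thesis
 proof (rule that[OF C(1)])
  fix u :: "real => real" and R x :: real assume u: "integrable (mu_nu nu) u" and R: "R > 0" and x: "0 < x" "x < 1"
  have "ennreal \<bar>bochner_riesz nu delta R u x\<bar> = ennreal (norm (bni (mu_nu nu) (%y. Kern delta R x y * u y)))"
   by (simp add: bochner_riesz_Kern(2)[OF u delta R])
  also have "... <= (nni (mu_nu nu) (%y. norm (Kern delta R x y * u y)))"
   by (rule integral_norm_bound_ennreal[OF bochner_riesz_Kern(1)[OF u delta R]])
  also have "... <= (nni (mu_nu nu) (%y. ennreal (majorant a delta R x y) * ennreal (C * \<bar>u y\<bar>)))"
  proof (rule nn_integral_mono)
   fix y assume "y : space (mu_nu nu)"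
   hence y: "0 < y" "y < 1" by (auto simp: space_mu_nu)
   have "\<bar>Kern delta R x y\<bar> * \<bar>u y\<bar> <= (C * majorant a delta R x y) * \<bar>u y\<bar>"
    using C(2)[OF R x y] by (intro mult_right_mono) (auto simp: M)
   hence "norm (Kern delta R x y * u y) <= majorant a delta R x y * (C * \<bar>u y\<bar>)"
    by (simp add: abs_mult mult_ac)
   thus "ennreal (norm (Kern delta R x y * u y)) <= ennreal (majorant a delta R x y) * ennreal (C * \<bar>u y\<bar>)"
    using majorant_nonneg[OF R] C(1) by (subst ennreal_mult[symmetric]) (auto intro!: ennreal_leI)
  qed
  finally show "ennreal \<bar>bochner_riesz nu delta R u x\<bar> <= (nni (mu_nu nu) (%y. ennreal (majorant a delta R x y) * ennreal (C * \<bar>u y\<bar>)))" .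
 qed
qed

lemma two_a: "2*nu + 1 = 2*a" by simp

lemma two_a_gt: "2*a > -1" using nu by simp

lemma maximal_bounded_finite:
 assumes delta: "delta > 0" and p: "1 < p" "p ~= \<infinity>" and P: "P = enn2real p"
  and cond: "a - min delta a < (2*a + 1) / P" "(2*a + 1) / P < a + min delta a + 1"
 shows "\<exists>C::real. \<forall>u. in_Lp (mu_nu nu) p u \<longrightarrow>
   Lp_norm (mu_nu nu) p (bochner_riesz_max nu delta u) <= ennreal C * Lp_norm (mu_nu nu) p (%x. ennreal \<bar>u x\<bar>)"
proof (rule bochner_riesz_le_majorant[OF delta])
 fix C assume C: "C > 0"
  "!!u R x. integrable (mu_nu nu) u ==> R > 0 ==> 0 < x ==> x < 1 ==>
   ennreal \<bar>bochner_riesz nu delta R u x\<bar> <= (nni (mu_nu nu) (%y. ennreal (majorant a delta R x y) * ennreal (C * \<bar>u y\<bar>)))"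
 have P1: "P > 1" using enn2real_gt_1[OF p] P by simp
 let ?M = "pmeas (2*a)"
 show ?thesis
 proof (rule maximal_majorant_bounded[OF P1 two_a_gt delta cond])
  fix D assume D: "D >= 0" "!!g h. g : borel_measurable borel ==> (!!y. g y >= 0) ==>
   (!!x. 0 < x ==> x < 1 ==> h x <= (SUP R\<in>{0<..}. \<integral>\<^sup>+y. ennreal (majorant a delta R x y) * ennreal (g y) \<partial>?M)) ==>
   (nni ?M (%x. epow (h x) P)) <= ennreal D * (nni ?M (%y. ennreal (g y powr P)))"
  \<comment> \<open>The summand 1 keeps the constant positive, as \<open>epow_cmult\<close>
    requires.\<close>
  define E where "E = D * C powr P + 1"
  have E: "E > 0" "D * C powr P <= E" using D(1) by (auto simp: E_def intro!: add_nonneg_pos)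
  show ?thesis
  proof (intro exI[of _ "E powr (1/P)"] allI impI)
   fix u assume u: "in_Lp (mu_nu nu) p u"
   have int: "integrable (mu_nu nu) u" by (rule in_Lp_integrable[OF nu p(1) u])
   hence fm[measurable]: "u : borel_measurable (mu_nu nu)" by auto
   \<comment> \<open>The constant times |u|, extended by zero to a Borel function on the line, the
     form demanded by the bound for the majorant.\<close>
   define g where "g y = C * \<bar>indicator {0<..<1} y * u y\<bar>" for y
   have g[measurable]: "g : borel_measurable borel"
    using fm unfolding borel_measurable_mu_nu_iff g_def by measurable
   have g0: "g y >= 0" for y using C(1) by (simp add: g_def)
   have gind: "ennreal (C * \<bar>u y\<bar>) * indicator {0<..<1} y = ennreal (g y)" for y by (simp add: g_def indicator_def)
   have "(nni (mu_nu nu) (%x. epow (bochner_riesz_max nu delta u x) P)) <= (nni (pmeas (2*nu + 1)) (%x. epow (bochner_riesz_max nu delta u x) P))"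
    by (rule nn_integral_mu_nu_le)
   also have "... <= ennreal D * (nni (pmeas (2*nu + 1)) (%y. ennreal (g y powr P)))"
    unfolding two_a
   proof (rule D(2)[OF g g0])
    fix x :: real assume x: "0 < x" "x < 1"
    show "bochner_riesz_max nu delta u x <= (SUP R\<in>{0<..}. \<integral>\<^sup>+y. ennreal (majorant a delta R x y) * ennreal (g y) \<partial>?M)"
     unfolding bochner_riesz_max_def
    proof (rule SUP_mono)
     fix R :: real assume R: "R : {0<..}"
     have "ennreal \<bar>bochner_riesz nu delta R u x\<bar> <= (nni (mu_nu nu) (%y. ennreal (majorant a delta R x y) * ennreal (C * \<bar>u y\<bar>)))"
      using R x by (intro C(2) int) auto
     also have "... = (nni (pmeas (2*nu + 1)) (%y. ennreal (majorant a delta R x y) * ennreal (C * \<bar>u y\<bar>) * indicator {0<..<1} y))"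
     proof (rule nn_integral_mu_nu(2))
      have "(%x. x) : borel_measurable (mu_nu nu)" by (subst borel_measurable_mu_nu_iff) measurable
      thus "(%y. ennreal (majorant a delta R x y) * ennreal (C * \<bar>u y\<bar>)) : borel_measurable (mu_nu nu)" by measurable
     qed
     also have "... = (nni ?M (%y. ennreal (majorant a delta R x y) * ennreal (g y)))"
      unfolding two_a mult.assoc gind ..
     finally show "\<exists>R'\<in>{0<..}. ennreal \<bar>bochner_riesz nu delta R u x\<bar> <= (nni ?M (%y. ennreal (majorant a delta R' x y) * ennreal (g y)))"
      using R by blast
    qed
   qed
   also have "(nni (pmeas (2*nu + 1)) (%y. ennreal (g y powr P))) = (nni (pmeas (2*nu + 1)) (%y. ennreal (C powr P * \<bar>u y\<bar> powr P) * indicator {0<..<1} y))"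
    using P1 by (intro nn_integral_cong) (simp add: g_def indicator_def powr_mult)
   also have "... = (nni (mu_nu nu) (%y. ennreal (C powr P * \<bar>u y\<bar> powr P)))"
    by (rule nn_integral_mu_nu(2)[symmetric]) measurable
   also have "... = (nni (mu_nu nu) (%y. ennreal (C powr P) * epow (ennreal \<bar>u y\<bar>) P))"
    by (intro nn_integral_cong) (simp add: ennreal_mult epow_ennreal)
   also have "... = ennreal (C powr P) * (nni (mu_nu nu) (%y. epow (ennreal \<bar>u y\<bar>) P))" (is "_ = _ * ?N")
    by (rule nn_integral_cmult) measurable
   also have "ennreal D * (ennreal (C powr P) * ?N) = ennreal (D * C powr P) * ?N"
    using D(1) by (simp add: ennreal_mult mult.assoc)
   also have "... <= ennreal E * ?N" using E by (intro mult_right_mono ennreal_leI) auto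
   finally have "epow (nni (mu_nu nu) (%x. epow (bochner_riesz_max nu delta u x) P)) (1/P) <= epow (ennreal E * ?N) (1/P)"
    using P1 by (intro epow_mono) auto
   also have "... = ennreal (E powr (1/P)) * epow ?N (1/P)" using E P1 by (intro epow_cmult) auto
   finally show "Lp_norm (mu_nu nu) p (bochner_riesz_max nu delta u) <= ennreal (E powr (1/P)) * Lp_norm (mu_nu nu) p (%x. ennreal \<bar>u x\<bar>)"
    using p P by (simp add: Lp_norm_finite)
  qed
 qed
qed

lemma maximal_bounded_infinity:
 assumes delta: "delta > 0" "delta > a"
 shows "\<exists>C::real. \<forall>u. in_Lp (mu_nu nu) \<infinity> u \<longrightarrow>
   Lp_norm (mu_nu nu) \<infinity> (bochner_riesz_max nu delta u) <= ennreal C * Lp_norm (mu_nu nu) \<infinity> (%x. ennreal \<bar>u x\<bar>)"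
proof (rule bochner_riesz_le_majorant[OF delta(1)])
 fix C assume C: "C > 0"
  "!!u R x. integrable (mu_nu nu) u ==> R > 0 ==> 0 < x ==> x < 1 ==>
   ennreal \<bar>bochner_riesz nu delta R u x\<bar> <= (nni (mu_nu nu) (%y. ennreal (majorant a delta R x y) * ennreal (C * \<bar>u y\<bar>)))"
 show ?thesis
 proof (rule majorant_integral_bounded[OF two_a_gt delta])
  fix D assume D: "D >= 0" "!!x R. 0 < x ==> R > 0 ==> (nni (pmeas (2*a)) (%y. ennreal (majorant a delta R x y))) <= ennreal D"
  define E where "E = C * D + 1"
  have E: "E > 0" "C * D <= E" using D(1) C(1) by (auto simp: E_def intro!: add_nonneg_pos)
  show ?thesis
  proof (intro exI[of _ E] allI impI)
   fix u assume u: "in_Lp (mu_nu nu) \<infinity> u"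
   have int: "integrable (mu_nu nu) u" by (rule in_Lp_integrable[OF nu _ u]) simp
   let ?N = "Lp_norm (mu_nu nu) \<infinity> (%x. ennreal \<bar>u x\<bar>)"
   obtain n where n: "?N = ennreal n" "n >= 0" using u by (cases ?N) (auto simp: in_Lp_def)
   \<comment> \<open>A function is bounded almost everywhere by each t strictly above its supremum
     norm n; the slack t - n is removed afterwards.\<close>
   have step: "Lp_norm (mu_nu nu) \<infinity> (bochner_riesz_max nu delta u) <= ennreal (E * t)" if t: "t > n" for t
   proof (rule Lp_norm_infinity_le)
    fix x assume "x : space (mu_nu nu)"
    hence x: "0 < x" "x < 1" by (auto simp: space_mu_nu)
    have t0: "t >= 0" using t n by simp
    have AE: "AE y in mu_nu nu. ennreal \<bar>u y\<bar> <= ennreal t"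
     by (rule Lp_norm_infinity_AE) (use t n in "simp add: ennreal_lessI")
    show "bochner_riesz_max nu delta u x <= ennreal (E * t)"
     unfolding bochner_riesz_max_def
    proof (rule SUP_least)
     fix R :: real assume R: "R : {0<..}"
     have idm[measurable]: "(%x. x) : borel_measurable (mu_nu nu)" by (subst borel_measurable_mu_nu_iff) measurable
     have mm[measurable]: "(%y. ennreal (majorant a delta R x y)) : borel_measurable (mu_nu nu)" by measurable
     have "ennreal \<bar>bochner_riesz nu delta R u x\<bar> <= (nni (mu_nu nu) (%y. ennreal (majorant a delta R x y) * ennreal (C * \<bar>u y\<bar>)))"
      using R x by (intro C(2) int) auto
     also have "... <= (nni (mu_nu nu) (%y. ennreal (C * t) * ennreal (majorant a delta R x y)))"
     proof (rule nn_integral_mono_AE, use AE in eventually_elim)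
      fix y assume "ennreal \<bar>u y\<bar> <= ennreal t"
      hence "\<bar>u y\<bar> <= t" using t0 by simp
      hence "ennreal (C * \<bar>u y\<bar>) <= ennreal (C * t)" using C(1) by (intro ennreal_leI mult_left_mono) auto
      thus "ennreal (majorant a delta R x y) * ennreal (C * \<bar>u y\<bar>) <= ennreal (C * t) * ennreal (majorant a delta R x y)"
       by (subst mult.commute) (rule mult_right_mono, auto)
     qed
     also have "... = ennreal (C * t) * (nni (mu_nu nu) (%y. ennreal (majorant a delta R x y)))"
      by (rule nn_integral_cmult) (rule mm)
     also have "... <= ennreal (C * t) * (nni (pmeas (2*nu + 1)) (%y. ennreal (majorant a delta R x y)))"
      by (intro mult_left_mono nn_integral_mu_nu_le) simp
     also have "... <= ennreal (C * t) * ennreal D"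
      unfolding two_a using R x by (intro mult_left_mono D(2)) auto
     also have "... = ennreal (C * D * t)" using C(1) D(1) t0 by (simp add: ennreal_mult[symmetric] mult_ac)
     also have "... <= ennreal (E * t)" using E(2) t0 by (intro ennreal_leI mult_right_mono)
     finally show "ennreal \<bar>bochner_riesz nu delta R u x\<bar> <= ennreal (E * t)" .
    qed
   qed
   have "Lp_norm (mu_nu nu) \<infinity> (bochner_riesz_max nu delta u) <= ennreal (E * n)"
   proof (rule ennreal_le_epsilon)
    fix e :: real assume e: "e > 0"
    have "Lp_norm (mu_nu nu) \<infinity> (bochner_riesz_max nu delta u) <= ennreal (E * (n + e / E))"
     using e E by (intro step) simp
    also have "E * (n + e / E) = E * n + e" using E by (simp add: field_simps)
    finally show "Lp_norm (mu_nu nu) \<infinity> (bochner_riesz_max nu delta u) <= ennreal (E * n) + ennreal e"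
     using e E n by (simp add: ennreal_plus)
   qed
   thus "Lp_norm (mu_nu nu) \<infinity> (bochner_riesz_max nu delta u) <= ennreal E * ?N"
    using E n by (simp add: ennreal_mult)
  qed
 qed
qed

text \<open>With s = 2a + 1 the exponents are p0 = s/(a+delta+1) and p1 = s/(a-delta), so p0 < p <
  p1 is the Schur condition for d = delta. If delta > a, then d = a and the condition reads 0 < s/P
  < s.\<close>

theorem sufficiency:
 assumes delta: "delta > 0" and p: "1 < p"
  and cond: "(nu <= -1/2 \<or> delta > nu + 1/2)
       \<or> (delta <= nu + 1/2 & nu > -1/2 & p0_exp nu delta < p & p < p1_exp nu delta)"
 shows "\<exists>C::real. \<forall>u. in_Lp (mu_nu nu) p u \<longrightarrow>
   Lp_norm (mu_nu nu) p (bochner_riesz_max nu delta u) <= ennreal C * Lp_norm (mu_nu nu) p (%x. ennreal \<bar>u x\<bar>)"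
proof (cases "p = \<infinity>")
 case True
 hence "delta > a" using cond delta by auto
 thus ?thesis using maximal_bounded_infinity[OF delta] True by simp
next
 case False
 define P where "P = enn2real p"
 have P: "P > 1" "p = ennreal P" using enn2real_gt_1[OF p False] False by (auto simp: P_def less_top)
 define s where "s = 2*a + 1"
 have s: "s > 0" using nu by (simp add: s_def)
 show ?thesis
 proof (rule maximal_bounded_finite[OF delta p False P_def])
  have sP: "s / P > 0" "s / P < s" using s P(1) by (auto simp: field_simps)
  have "a - min delta a < s / P & s / P < a + min delta a + 1"
  proof (cases "delta > a")
   case True
   thus ?thesis using sP by (simp add: s_def min_def)
  next
   case F: False
   hence c: "p0_exp nu delta < p" "p < p1_exp nu delta" "delta <= a" using cond delta by auto
   have "2 * s / (2*(a + delta + 1)) < P"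
    using c(1) P s delta c(3) by (simp add: p0_exp_def ennreal_less_iff s_def algebra_simps)
   hence "s / P < a + delta + 1" using P(1) delta c(3) s by (simp add: field_simps)
   moreover have "a - delta < s / P"
   proof (cases "delta = a")
    case True thus ?thesis using sP by simp
   next
    case False
    hence d: "a - delta > 0" using c(3) by simp
    hence "p1_exp nu delta = ennreal (2 * s / (2*(a - delta)))" by (simp add: p1_exp_def s_def algebra_simps)
    hence "P < 2 * s / (2*(a - delta))" using c(2) P by (simp add: ennreal_less_iff)
    thus ?thesis using d P(1) by (simp add: field_simps)
   qed
   ultimately show ?thesis using c(3) by (simp add: min_def)
  qed
  thus "a - min delta a < (2*a + 1) / P" "(2*a + 1) / P < a + min delta a + 1" by (auto simp: s_def)
 qed
qed

end

section \<open>Spacing of the zeros and the scaling limit of spectral sums\<close>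

lemma riemann_sum_increment:
 fixes s :: "nat => real" and Ps :: "real => real"
 assumes S: "S > 0" and mono: "!!j. s j < s (Suc j)" and s0: "s 0 > 0"
  and cont: "continuous_on {0..1} Ps" and n: "s n <= S"
  and osc: "!!j t. Suc j <= n ==> s j / S <= t ==> t <= s (Suc j) / S ==> \<bar>Ps t - Ps (s j / S)\<bar> <= e"
 shows "\<bar>integral {s 0/S..s n / S} Ps - (\<Sum>j<n. Ps (s j / S) * (s (Suc j) - s j) / S)\<bar> <= e * (s n - s 0) / S"
 using n osc
proof (induction n)
 case 0
 show ?case by simp
next
 case (Suc n)
 have le: "s 0 <= s n" by (rule lift_Suc_mono_le[of s]) (use mono in "auto intro: less_imp_le")
 have nS: "s n <= S" using Suc.prems(1) mono[of n] by linarith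
 let ?p = "s n / S" let ?q = "s (Suc n) / S"
 have pq: "s 0/S <= ?p" "?p <= ?q" "0 <= s 0/S" "?q <= 1"
  using le mono[of n] S s0 Suc.prems(1) by (auto simp: divide_right_mono)
 have int: "Ps integrable_on {u..v}" if "0 <= u" "v <= 1" for u v
  by (rule integrable_continuous_real) (rule continuous_on_subset[OF cont], use that in auto)
 have IH: "\<bar>integral {s 0/S..?p} Ps - (\<Sum>j<n. Ps (s j / S) * (s (Suc j) - s j) / S)\<bar> <= e * (s n - s 0) / S"
  by (rule Suc.IH[OF nS]) (use Suc.prems(2) in auto)
 have comb: "integral {s 0/S..?p} Ps + integral {?p..?q} Ps = integral {s 0/S..?q} Ps"
  using pq by (intro Henstock_Kurzweil_Integration.integral_combine int) auto
 have c: "((%t. Ps ?p) has_integral Ps ?p * (?q - ?p)) {?p..?q}"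
  using has_integral_const_real[of "Ps ?p" ?p ?q] pq by (simp add: mult.commute)
 have ip: "Ps integrable_on {?p..?q}" using pq by (intro int) auto
 have "norm (integral {?p..?q} (%t. Ps t - Ps ?p)) <= integral {?p..?q} (%t. e)"
  using Suc.prems(2)[of n] ip has_integral_integrable[OF c]
  by (intro integral_norm_bound_integral integrable_diff) auto
 hence "\<bar>integral {?p..?q} Ps - Ps ?p * (?q - ?p)\<bar> <= e * (?q - ?p)"
  using pq integral_diff[OF ip has_integral_integrable[OF c]] integral_unique[OF c] by (simp add: mult.commute)
 moreover have "Ps ?p * (?q - ?p) = Ps ?p * (s (Suc n) - s n) / S" "e * (?q - ?p) = e * (s (Suc n) - s n) / S"
  by (simp_all only: diff_divide_distrib[symmetric] times_divide_eq_right)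
 moreover have "e * (s n - s 0) / S + e * (s (Suc n) - s n) / S = e * (s (Suc n) - s 0) / S"
  by (simp add: add_divide_distrib[symmetric] algebra_simps)
 ultimately have 1: "\<bar>integral {?p..?q} Ps - Ps ?p * (s (Suc n) - s n) / S\<bar> <= e * (s (Suc n) - s n) / S"
  and 2: "e * (s n - s 0) / S + e * (s (Suc n) - s n) / S = e * (s (Suc n) - s 0) / S" by (simp_all only:)
 have alg: "\<bar>I - (A + B)\<bar> <= E" if "\<bar>I0 - A\<bar> <= E0" "\<bar>I1 - B\<bar> <= E1" "I0 + I1 = I" "E0 + E1 = E"
  for I I0 I1 A B E E0 E1 :: real using that by linarith
 show ?case unfolding sum.lessThan_Suc by (rule alg[OF IH 1 comb 2])
qed

text \<open>The rescaled nodes s_j/s_N have mesh tending to 0, and a weight asymptotic to kpp times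
  the gap acts in the limit like kpp times the length element.\<close>

lemma riemann_sum_weights:
 fixes s e :: "nat => real" and Ps :: "real => real"
 assumes mono: "!!j. s j < s (Suc j)" and s0: "s 0 > 0" and lim: "filterlim s at_top sequentially"
  and gap: "!!j. s (Suc j) - s j <= B"
  and cont: "continuous_on {0..1} Ps"
  and e: "(%j. e j / (s (Suc j) - s j)) \<longlonglongrightarrow> kpp"
 shows "(%N. (\<Sum>j<N. Ps (s j / s N) * e j) / s N) \<longlonglongrightarrow> kpp * integral {0..1} Ps"
proof -
 have sm: "s i <= s j" if "i <= j" for i j
  using that by (rule lift_Suc_mono_le[of s, rotated]) (use mono in "auto intro: less_imp_le")
 have pos: "s j > 0" for j using sm[of 0 j] s0 by simp
 have B: "B > 0" using gap[of 0] mono[of 0] by linarith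
 have "compact (Ps ` {0..1})" by (intro compact_continuous_image cont) auto
 from compact_imp_bounded[OF this] obtain P0 where "\<forall>y\<in>Ps ` {0..1}. norm y <= P0"
  unfolding bounded_iff by (rule exE)
 hence P0: "\<bar>Ps t\<bar> <= P0" if "0 <= t" "t <= 1" for t using that by auto
 define P where "P = max P0 1"
 have P: "P > 0" "\<bar>Ps t\<bar> <= P" if "0 <= t" "t <= 1" for t using P0[OF that] by (auto simp: P_def)
 have P': "P > 0" by (simp add: P_def)
 define Dl where "Dl j = s (Suc j) - s j" for j
 have Dl: "Dl j > 0" for j using mono[of j] by (simp add: Dl_def)
 have teles: "(\<Sum>j<N. Dl j) = s N - s 0" for N unfolding Dl_def by (rule sum_lessThan_telescope)
 have inv: "(%N. C / s N) \<longlonglongrightarrow> 0" for C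
  by (rule tendsto_divide_0[OF tendsto_const]) (rule filterlim_at_top_imp_at_infinity[OF lim])
 have in01: "0 <= s j / s N" "s j / s N <= 1" if "j <= N" for j N using sm[OF that] pos[of j] pos[of N] by auto
 have t1: "(%N. (\<Sum>j<N. Ps (s j / s N) * Dl j / s N)) \<longlonglongrightarrow> integral {0..1} Ps"
 proof (rule LIMSEQ_I)
  fix r :: real assume r: "r > 0"
  have "uniformly_continuous_on {0..1} Ps" by (intro compact_uniformly_continuous cont) auto
  then obtain d where d: "d > 0" "!!x y. x : {0..1} ==> y : {0..1} ==> dist y x < d ==> dist (Ps y) (Ps x) < r / 2"
   using r unfolding uniformly_continuous_on_def by (metis half_gt_zero)
  have ev1: "\<forall>\<^sub>F N in sequentially. B / s N < d" using order_tendstoD(2)[OF inv d(1)] .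
  have "r / (2*P) > 0" using r P' by simp
  hence ev2: "\<forall>\<^sub>F N in sequentially. s 0 / s N < r / (2*P)" using order_tendstoD(2)[OF inv] by blast
  from eventually_conj[OF ev1 ev2] obtain N0 where N0: "!!N. N >= N0 ==> B / s N < d & s 0 / s N < r / (2*P)"
   unfolding eventually_sequentially by blast
  show "\<exists>no. \<forall>N\<ge>no. norm ((\<Sum>j<N. Ps (s j / s N) * Dl j / s N) - integral {0..1} Ps) < r"
  proof (intro exI[of _ N0] allI impI)
   fix N assume N: "N0 <= N"
   let ?S = "s N"
   have S: "?S > 0" by (rule pos)
   have int: "Ps integrable_on {u..v}" if "0 <= u" "v <= 1" for u v
    by (rule integrable_continuous_real) (rule continuous_on_subset[OF cont], use that in auto)
   have 1: "\<bar>integral {s 0/?S..s N / ?S} Ps - (\<Sum>j<N. Ps (s j / ?S) * (s (Suc j) - s j) / ?S)\<bar> <= r / 2*(s N - s 0) / ?S"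
   proof (rule riemann_sum_increment[OF S mono s0 cont order_refl])
    fix j t assume j: "Suc j <= N" and t: "s j / ?S <= t" "t <= s (Suc j) / ?S"
    have "s (Suc j) / ?S - s j / ?S = (s (Suc j) - s j) / ?S" by (simp add: diff_divide_distrib)
    also have "... <= B / ?S" using gap[of j] S by (intro divide_right_mono) auto
    finally have "\<bar>t - s j / ?S\<bar> < d" using N0[OF N] t by auto
    moreover have "s j / ?S : {0..1}" "t : {0..1}" using in01[of j N] in01[of "Suc j" N] j t by auto
    ultimately have "dist (Ps t) (Ps (s j / ?S)) < r / 2" using d(2) by (simp add: dist_real_def)
    thus "\<bar>Ps t - Ps (s j / ?S)\<bar> <= r / 2" by (simp add: dist_real_def)
   qed
   have "r / 2*(s N - s 0) / ?S <= r / 2"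
   proof -
    have "(s N - s 0) / ?S <= 1" using S s0 by simp
    hence "r / 2*((s N - s 0) / ?S) <= r / 2*1" using r by (intro mult_left_mono) auto
    thus ?thesis by simp
   qed
   moreover have "integral {0..s 0/?S} Ps + integral {s 0/?S..1} Ps = integral {0..1} Ps"
    using in01[of 0 N] by (intro Henstock_Kurzweil_Integration.integral_combine int) auto
   moreover have "\<bar>integral {0..s 0/?S} Ps\<bar> < r / 2"
   proof -
    have "norm (integral {0..s 0/?S} Ps) <= integral {0..s 0/?S} (%t. P)"
     using in01[of 0 N] by (intro integral_norm_bound_integral int) (auto intro!: P(2))
    also have "... = P * (s 0/?S)" using in01[of 0 N] by simp
    also have "... < P * (r / (2*P))" using N0[OF N] P' by (intro mult_strict_left_mono) auto
    also have "... = r / 2" using P' by simp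
    finally show ?thesis by simp
   qed
   moreover have "s N / ?S = 1" using S by simp
   ultimately show "norm ((\<Sum>j<N. Ps (s j / ?S) * Dl j / ?S) - integral {0..1} Ps) < r"
    using 1 unfolding Dl_def real_norm_def by (simp only:)
  qed
 qed
 \<comment> \<open>The deviation from the ideal weight is small compared with the gap, so its total
   is small compared with s_N, up to finitely many early terms.\<close>
 define eet where "eet j = e j - kpp * Dl j" for j
 have t2: "(%N. (\<Sum>j<N. Ps (s j / s N) * eet j) / s N) \<longlonglongrightarrow> 0"
 proof (rule LIMSEQ_I)
  fix r :: real assume r: "r > 0"
  define eps where "eps = r / (2*P)"
  have eps: "eps > 0" using r P' by (simp add: eps_def)
  obtain J where J: "!!j. j >= J ==> \<bar>e j / Dl j - kpp\<bar> < eps"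
   using LIMSEQ_D[OF e eps] unfolding Dl_def by auto
  define C where "C = (\<Sum>j<J. \<bar>eet j\<bar>)"
  have le: "\<bar>eet j\<bar> <= (if j < J then \<bar>eet j\<bar> else 0) + eps * Dl j" for j
  proof (cases "j < J")
   case True
   have "0 <= eps * Dl j" using eps Dl[of j] by simp
   thus ?thesis using True by simp
  next
   case False
   have "eet j = (e j / Dl j - kpp) * Dl j" using Dl[of j] by (simp add: eet_def field_simps)
   hence "\<bar>eet j\<bar> = \<bar>e j / Dl j - kpp\<bar> * Dl j" using Dl[of j] by (simp add: abs_mult)
   also have "... <= eps * Dl j" using J[of j] False Dl[of j] by (intro mult_right_mono) auto
   finally show ?thesis using False by simp
  qed
  have sumle: "(\<Sum>j<N. \<bar>eet j\<bar>) <= C + eps * s N" for N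
  proof -
   have "(\<Sum>j<N. \<bar>eet j\<bar>) <= (\<Sum>j<N. (if j < J then \<bar>eet j\<bar> else 0)) + eps * (\<Sum>j<N. Dl j)"
    unfolding sum_distrib_left sum.distrib[symmetric] by (intro sum_mono le)
   also have "(\<Sum>j<N. (if j < J then \<bar>eet j\<bar> else 0)) = (\<Sum>j\<in>{..<N} \<inter> {..<J}. \<bar>eet j\<bar>)"
    by (subst sum.inter_restrict) auto
   also have "... <= C" unfolding C_def by (intro sum_mono2) auto
   also have "eps * (\<Sum>j<N. Dl j) <= eps * s N" unfolding teles using eps s0 by (intro mult_left_mono) auto
   finally show ?thesis by simp
  qed
  have "r / (2*P) > 0" using r P' by simp
  from order_tendstoD(2)[OF inv this, of C] obtain N0 where N0: "!!N. N >= N0 ==> C / s N < r / (2*P)"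
   unfolding eventually_sequentially by blast
  show "\<exists>no. \<forall>N\<ge>no. norm ((\<Sum>j<N. Ps (s j / s N) * eet j) / s N - 0) < r"
  proof (intro exI[of _ N0] allI impI)
   fix N assume N: "N0 <= N"
   have "\<bar>\<Sum>j<N. Ps (s j / s N) * eet j\<bar> <= (\<Sum>j<N. P * \<bar>eet j\<bar>)"
    by (rule order_trans[OF sum_abs sum_mono]) (auto simp: abs_mult intro!: mult_right_mono P(2) in01)
   also have "... <= P * (C + eps * s N)" unfolding sum_distrib_left[symmetric] using P' by (intro mult_left_mono sumle) auto
   finally have "\<bar>\<Sum>j<N. Ps (s j / s N) * eet j\<bar> / s N <= P * (C + eps * s N) / s N"
    using pos[of N] by (intro divide_right_mono) auto
   also have "... = P * (C / s N + eps)" using pos[of N] by (simp add: field_simps)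
   also have "... < P * (r / (2*P) + eps)" using N0[OF N] P' by (intro mult_strict_left_mono) auto
   also have "... = r" using P' by (simp add: eps_def distrib_left)
   finally show "norm ((\<Sum>j<N. Ps (s j / s N) * eet j) / s N - 0) < r" using pos[of N] by simp
  qed
 qed
 have "(%N. kpp * (\<Sum>j<N. Ps (s j / s N) * Dl j / s N) + (\<Sum>j<N. Ps (s j / s N) * eet j) / s N) \<longlonglongrightarrow> kpp * integral {0..1} Ps + 0"
  by (intro tendsto_intros t1 t2)
 moreover have "kpp * (\<Sum>j<N. Ps (s j / s N) * Dl j / s N) + (\<Sum>j<N. Ps (s j / s N) * eet j) / s N = (\<Sum>j<N. Ps (s j / s N) * e j) / s N" for N
  unfolding sum_distrib_left sum_divide_distrib sum.distrib[symmetric]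
  by (intro sum.cong refl) (simp add: eet_def add_divide_distrib[symmetric] algebra_simps)
 ultimately show ?thesis by simp
qed

context bessel_jost
begin

definition rho :: "real => real" where "rho x = (norm (f (of_real x)))\<^sup>2"

lemma fc_of_real: "fc (of_real x) = cnj (f (of_real x))"
 by (simp add: fc_def)

lemma f_of_real_nonzero: "x > 0 ==> f (of_real x) ~= 0"
proof
 assume x: "x > 0" and "f (of_real x) = 0"
 thus False using wronskian_f_fc[of "of_real x"] by (simp add: fc_of_real)
qed

lemma rho_pos: "x > 0 ==> rho x > 0"
 using f_of_real_nonzero[of x] by (simp add: rho_def)

lemma continuous_rho: "S <= {0<..} ==> continuous_on S rho"
proof -
 assume S: "S <= {0<..}"
 have "continuous_on (of_real ` S) f"
  by (intro continuous_at_imp_continuous_on ballI DERIV_isCont[OF f_deriv]) (use S in auto)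
 hence "continuous_on S (%x. f (of_real x))" by (rule continuous_on_compose2) (auto intro!: continuous_intros)
 thus ?thesis unfolding rho_def by (intro continuous_intros)
qed

lemma rho_tendsto: "(rho \<longlongrightarrow> 1) at_top"
proof (rule tendsto_sandwich[where f = "%x. (2 - exp (K / x))\<^sup>2" and h = "%x. (exp (K / x))\<^sup>2"])
 have inv: "((%x. K / x) \<longlongrightarrow> 0) at_top"
  by (rule tendsto_divide_0[OF tendsto_const]) (rule filterlim_at_top_imp_at_infinity[OF filterlim_ident])
 have e: "((%x. exp (K / x)) \<longlongrightarrow> exp 0) at_top" by (rule tendsto_exp[OF inv])
 have "((%x. (exp (K / x))\<^sup>2) \<longlongrightarrow> (exp 0)\<^sup>2) at_top" by (intro tendsto_intros e)
 thus "((%x. (exp (K / x))\<^sup>2) \<longlongrightarrow> 1) at_top" by simp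
 have "((%x. (2 - exp (K / x))\<^sup>2) \<longlongrightarrow> (2 - exp 0)\<^sup>2) at_top" by (intro tendsto_intros e)
 thus "((%x. (2 - exp (K / x))\<^sup>2) \<longlongrightarrow> 1) at_top" by simp
 show "\<forall>\<^sub>F x in at_top. rho x <= (exp (K / x))\<^sup>2"
  using eventually_gt_at_top[of 0]
 proof eventually_elim
  case (elim x)
  have "norm (f (of_real x)) <= exp (K / x)" using norm_f_le[of "of_real x"] elim by simp
  thus ?case unfolding rho_def by (intro power_mono) auto
 qed
 have "\<forall>\<^sub>F x in at_top. exp (K / x) < 2" using order_tendstoD(2)[OF e, of 2] by simp
 thus "\<forall>\<^sub>F x in at_top. (2 - exp (K / x))\<^sup>2 <= rho x"
  using eventually_gt_at_top[of 0]
 proof eventually_elim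
  case (elim x)
  have "2 - exp (K / x) <= norm (f (of_real x))" using norm_f_ge[of "of_real x"] elim by simp
  thus ?case unfolding rho_def using elim by (intro power_mono) auto
 qed
qed

text \<open>By the Wronskian identity the argument of $f$ has derivative $1/|f|^2$ on the real axis,
 and the argument is known modulo $\pi$ at the zeros of $F$.\<close>
lemma phase_between_zeros:
 assumes p: "0 < p" "p < r" "rE nu p = 0" "rE nu r = 0"
  and none: "!!x. p < x ==> x < r ==> rE nu x ~= 0"
 shows "integral {p..r} (%x. 1/rho x) = pi"
proof -
 let ?I = "{p..r}"
 have pos: "x > 0" if "x : ?I" for x using that p by auto
 have c: "continuous_on ?I (%x. 1/rho x)"
  using pos rho_pos by (intro continuous_intros continuous_rho) (auto simp: less_imp_neq[symmetric])
 define tht where "tht x = integral {p..x} (%x. 1/rho x)" for x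
 have d: "(tht has_vector_derivative 1/rho x) (at x within ?I)" if "x : ?I" for x
  unfolding tht_def by (rule integral_has_vector_derivative[OF c that])
 \<comment> \<open>On the axis fc is the conjugate of f, so Q is unimodular with Q'/Q = 2i/rho.
   Hence Q is its value at p times exp(2i tht).\<close>
 define Q where "Q x = f (of_real x) / fc (of_real x)" for x :: real
 have fcn: "fc (of_real x) ~= 0" if "x > 0" for x using f_of_real_nonzero[OF that] by (simp add: fc_of_real)
 have rr: "f (of_real x) * fc (of_real x) = of_real (rho x)" for x :: real
  unfolding fc_of_real rho_def by (rule complex_norm_square[symmetric])
 have dQ: "(Q has_vector_derivative 2*\<i> / of_real (rho x) * Q x) (at x within ?I)" if x: "x : ?I" for x
 proof -
  let ?z = "complex_of_real x"
  have x0: "x > 0" by (rule pos[OF x])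
  have "((%z. f z / fc z) has_field_derivative (f' ?z * fc ?z - f ?z * fc' ?z) / (fc ?z * fc ?z)) (at ?z)"
   using x0 by (intro DERIV_divide f_deriv fc_deriv fcn) auto
  also have "f' ?z * fc ?z - f ?z * fc' ?z = 2*\<i>" using wronskian_f_fc[of ?z] x0 by (simp add: algebra_simps)
  also have "2*\<i> / (fc ?z * fc ?z) = 2*\<i> / of_real (rho x) * Q x"
   unfolding rr[symmetric] Q_def using fcn[OF x0] f_of_real_nonzero[OF x0] by simp
  finally show ?thesis unfolding Q_def by (rule has_vector_derivative_real_field)
 qed
 define G where "G x = exp (- 2*\<i> * of_real (tht x))" for x
 have dG: "(G has_vector_derivative (- 2*\<i> / of_real (rho x)) * G x) (at x within ?I)" if x: "x : ?I" for x
 proof -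
  have "((%x. of_real (tht x) :: complex) has_vector_derivative of_real (1/rho x)) (at x within ?I)"
   by (rule has_vector_derivative_of_real[OF has_real_derivative_iff_has_vector_derivative[THEN iffD2, OF d[OF x]]])
  hence "((%x. (- 2*\<i>) * of_real (tht x)) has_vector_derivative (- 2*\<i>) * of_real (1/rho x)) (at x within ?I)"
   by (rule has_vector_derivative_mult_right)
  moreover have "(exp has_field_derivative exp ((- 2*\<i>) * of_real (tht x))) (at ((- 2*\<i>) * of_real (tht x)) within (%x. (- 2*\<i>) * of_real (tht x)) ` ?I)"
   by (rule has_field_derivative_at_within[OF DERIV_exp])
  ultimately have "(exp \<circ> (%x. (- 2*\<i>) * of_real (tht x)) has_vector_derivative
    ((- 2*\<i>) * of_real (1/rho x)) * exp ((- 2*\<i>) * of_real (tht x))) (at x within ?I)"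
   by (rule field_vector_diff_chain_within)
  thus ?thesis by (simp add: G_def[abs_def] o_def)
 qed
 have dz: "((%x. Q x * G x) has_vector_derivative 0) (at x within ?I)" if x: "x : ?I" for x
  using has_vector_derivative_mult[OF dQ[OF x] dG[OF x]] by (simp add: algebra_simps)
 obtain k where k: "!!x. x : ?I ==> Q x * G x = k"
  using has_vector_derivative_zero_constant[of ?I "%x. Q x * G x", OF _ dz] by auto
 have "G p = 1" by (simp add: G_def tht_def)
 hence const: "Q x * G x = Q p" if "x : ?I" for x
  using k[OF that] k[of p] p by simp
 have Qx: "Q x = Q p * exp (2*\<i> * of_real (tht x))" if "x : ?I" for x
 proof -
  have "Q p * exp (2*\<i> * of_real (tht x)) = Q x * (G x * exp (2*\<i> * of_real (tht x)))" using const[OF that] by simp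
  also have "G x * exp (2*\<i> * of_real (tht x)) = 1" by (simp add: G_def exp_add[symmetric])
  finally show ?thesis by simp
 qed
 \<comment> \<open>By the connection formula F vanishes exactly where f/fc takes one fixed value, so
   a further zero means that \<open>tht\<close> is a multiple of pi.\<close>
 have zero_iff: "rE nu x = 0 \<longleftrightarrow> Q x = - beta / cnj beta" if x: "x > 0" for x
 proof -
  have "rE nu x = 0 \<longleftrightarrow> F (of_real x) = 0" unfolding F_of_real[OF x] using x by simp
  also have "... \<longleftrightarrow> cnj beta * f (of_real x) = - beta * fc (of_real x)"
   using F_eq[of "of_real x"] x by (simp add: eq_neg_iff_add_eq_0)
  also have "... \<longleftrightarrow> Q x = - beta / cnj beta"
   using fcn[OF x] beta_nonzero by (auto simp: Q_def field_simps)
  finally show ?thesis .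
 qed
 have Qnz: "Q p ~= 0" using f_of_real_nonzero[OF p(1)] fcn[OF p(1)] by (simp add: Q_def)
 have zero_theta: "rE nu x = 0 \<longleftrightarrow> exp (2*\<i> * of_real (tht x)) = 1" if x: "x : ?I" for x
 proof -
  have "rE nu x = 0 \<longleftrightarrow> Q x = Q p" using zero_iff[OF pos[OF x]] zero_iff[OF p(1)] p(3) by simp
  thus ?thesis using Qx[OF x] Qnz by simp
 qed
 have ct: "continuous_on ?I tht"
  unfolding tht_def by (rule indefinite_integral_continuous_1[OF integrable_continuous_real[OF c]])
 have thtp: "tht p = 0" by (simp add: tht_def)
 have pi1: "tht x ~= pi" if "p < x" "x < r" for x
 proof
  assume "tht x = pi"
  hence "exp (2*\<i> * of_real (tht x)) = 1" by (simp add: exp_eq_1)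
  thus False using zero_theta[of x] none[OF that] that by simp
 qed
 obtain xi where xi: "xi : {p<..<r}" "tht r - tht p = (r - p) * (1/rho xi)"
  using mvt_simple[OF p(2), of tht "%x h. h * (1/rho x)"] d
  unfolding has_vector_derivative_def by (auto simp: mult.commute)
 have thtq: "tht r > 0" using xi p rho_pos[of xi] thtp by simp
 have "exp (2*\<i> * of_real (tht r)) = 1" using zero_theta[of r] p by simp
 then obtain n :: int where n: "tht r = of_int n * pi" by (auto simp: exp_eq_1)
 have "of_int n * pi > 0" using thtq n by simp
 hence n0: "n >= 1" by (simp add: zero_less_mult_iff)
 have "tht r <= pi"
 proof (rule ccontr)
  assume "\<not> tht r <= pi"
  then obtain x where x: "p <= x" "x <= r" "tht x = pi"
   using IVT'[of tht p pi r] ct p thtp by auto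
  moreover have "x ~= p" "x ~= r" using x \<open>\<not> tht r <= pi\<close> thtp by auto
  ultimately show False using pi1[of x] by simp
 qed
 moreover have "pi * 1 <= pi * of_int n" using n0 by (intro mult_left_mono) auto
 ultimately show ?thesis using n by (simp add: tht_def mult.commute)
qed

text \<open>The mean value theorem applied to the phase integral, whose total over one gap is pi. As
  rho tends to 1, it forces the gaps to tend to pi.\<close>

lemma zero_gap:
 obtains xi where "bz (Suc j) < xi" "xi < bz (Suc (Suc j))" "bz (Suc (Suc j)) - bz (Suc j) = pi * rho xi"
proof -
 let ?p = "bz (Suc j)" let ?q = "bz (Suc (Suc j))"
 have p: "0 < ?p" "?p < ?q" using bz_pos bz_Suc(1) by auto
 have I: "integral {?p..?q} (%x. 1/rho x) = pi"
  by (rule phase_between_zeros[OF p bz_Suc(2) bz_Suc(2) bz_Suc(3)])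
 have c: "continuous_on {?p..?q} (%x. 1/rho x)"
  using p rho_pos by (intro continuous_intros continuous_rho) (auto simp: less_imp_neq[symmetric])
 have "\<exists>x\<in>{?p<..<?q}. integral {?p..?q} (%x. 1/rho x) - integral {?p..?p} (%x. 1/rho x) = (?q - ?p) * (1/rho x)"
  using mvt_simple[OF p(2), of "%u. integral {?p..u} (%x. 1/rho x)" "%x h. h * (1/rho x)"]
   integral_has_vector_derivative[OF c] unfolding has_vector_derivative_def by (auto simp: mult.commute)
 then obtain x where x: "?p < x" "x < ?q" "pi = (?q - ?p) * (1/rho x)" using I by auto
 have "?q - ?p = pi * rho x" using x rho_pos[of x] p by (simp add: field_simps)
 thus thesis by (rule that[OF x(1,2)])
qed

lemma bz_at_top: "filterlim (%j. bz (Suc j)) at_top sequentially"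
proof (rule filterlim_at_top_mono[of "%j. bz j"])
 show "filterlim bz at_top sequentially"
  unfolding filterlim_at_top eventually_sequentially
 proof
  fix Z
  obtain j where "bz j > Z" using bz_unbounded by blast
  thus "\<exists>N. \<forall>n\<ge>N. Z <= bz n"
   using strict_mono_less_eq[OF strict_mono_bz] by (intro exI[of _ j]) (auto intro: order_trans less_imp_le)
 qed
 show "\<forall>\<^sub>F j in sequentially. bz j <= bz (Suc j)" by (intro always_eventually allI less_imp_le bz_Suc(1))
qed

lemma gap_tendsto: "(%j. bz (Suc (Suc j)) - bz (Suc j)) \<longlonglongrightarrow> pi"
proof -
 have "\<exists>xi. \<forall>j. bz (Suc j) < xi j & bz (Suc (Suc j)) - bz (Suc j) = pi * rho (xi j)"
  by (rule choice) (metis zero_gap)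
 then obtain xi where xi: "!!j. bz (Suc j) < xi j" "!!j. bz (Suc (Suc j)) - bz (Suc j) = pi * rho (xi j)" by blast
 have "filterlim xi at_top sequentially"
  by (rule filterlim_at_top_mono[OF bz_at_top]) (intro always_eventually allI less_imp_le xi(1))
 hence "(%j. rho (xi j)) \<longlonglongrightarrow> 1" by (rule filterlim_compose[OF rho_tendsto])
 hence "(%j. pi * rho (xi j)) \<longlonglongrightarrow> pi * 1" by (intro tendsto_intros)
 thus ?thesis using xi(2) by simp
qed

definition cj :: "nat => real" where "cj j = 2/(dj j)\<^sup>2"

text \<open>At a zero the Wronskian of F and f reduces to -F' f = 2i beta, and F' is s^a times the
  norming quantity \<open>dj\<close> up to sign. Taking moduli squared expresses the norming
  constant through rho, hence asymptotically as a power of s.\<close>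

lemma cj_eq: "cj j = bz (Suc j) powr (2*nu + 1) * (rho (bz (Suc j)) / (2*(norm beta)\<^sup>2))"
proof -
 define s where "s = bz (Suc j)"
 have s: "s > 0" "rE nu s = 0" using bz_pos bz_Suc(2) by (auto simp: s_def)
 have F0: "F (of_real s) = 0" unfolding F_of_real[OF s(1)] using s by simp
 have F': "F' (of_real s) = of_real (- (s powr a * dj j))"
  unfolding F'_of_real[OF s(1)] using s by (simp add: dj_def s_def)
 have "- F' (of_real s) * f (of_real s) = 2*\<i> * beta" using wronskian_F_f[of "of_real s"] s F0 by simp
 hence "norm (of_real (s powr a * dj j) * f (of_real s)) = norm (2*\<i> * beta)" unfolding F' by simp
 hence "s powr a * \<bar>dj j\<bar> * norm (f (of_real s)) = 2*norm beta" by (simp add: norm_mult abs_mult)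
 hence "(s powr a * \<bar>dj j\<bar> * norm (f (of_real s)))\<^sup>2 = (2*norm beta)\<^sup>2" by simp
 hence eq: "s powr (2*nu + 1) * (dj j)\<^sup>2*rho s = 4*(norm beta)\<^sup>2"
 proof -
  have sq: "s powr (2*nu + 1) = (s powr a)\<^sup>2" by (simp add: power2_eq_square powr_add[symmetric])
  assume "(s powr a * \<bar>dj j\<bar> * norm (f (of_real s)))\<^sup>2 = (2*norm beta)\<^sup>2"
  thus ?thesis unfolding sq rho_def power_mult_distrib power2_abs by simp
 qed
 have nz: "(dj j)\<^sup>2 > 0" "(norm beta)\<^sup>2 > 0" using dj_nonzero[of j] beta_nonzero by auto
 have "2/D = P * (r / (2*B))" if "P * D * r = 4*B" "D > 0" "B > 0" for D P r B :: real
  using that by (simp add: field_simps)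
 from this[OF eq nz] show ?thesis unfolding cj_def s_def .
qed

text \<open>The squared norming constants behave like s^{2a}/(2 |beta|^2) and the zeros have density
  1/pi. The discrete Fourier-Bessel spectrum therefore scales to the spectral measure t^{2a} dt of
  the Hankel transform.\<close>

theorem spectral_sum_tendsto:
 assumes a0: "a > 0" and Ph: "continuous_on {0..1} Ph"
 shows "(%N. (\<Sum>j<N. Ph (bz (Suc j) / bz (Suc N)) * cj j) / bz (Suc N) powr (2*a + 1))
  \<longlonglongrightarrow> 1/(2*pi * (norm beta)\<^sup>2) * integral {0..1} (%t. Ph t * t powr (2*a))"
proof -
 define s where "s j = bz (Suc j)" for j
 define e where "e j = rho (s j) / (2*(norm beta)\<^sup>2)" for j
 have nb: "(norm beta)\<^sup>2 > 0" using beta_nonzero by simp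
 have mono: "s j < s (Suc j)" and spos: "s j > 0" for j using bz_Suc(1) bz_pos by (auto simp: s_def)
 have lim: "filterlim s at_top sequentially" using bz_at_top by (simp add: s_def[abs_def])
 have gap: "(%j. s (Suc j) - s j) \<longlonglongrightarrow> pi" using gap_tendsto by (simp add: s_def)
 obtain B where B: "!!j. s (Suc j) - s j <= B"
 proof -
  have "Bseq (%j. s (Suc j) - s j)" by (rule convergent_imp_Bseq) (use gap in "auto simp: convergent_def")
  then obtain B where B0: "!!j. norm (s (Suc j) - s j) <= B" by (auto simp: Bseq_def)
  show thesis
  proof (rule that[of B])
   fix j show "s (Suc j) - s j <= B" using B0[of j] unfolding real_norm_def by linarith
  qed
 qed
 have "(%j. rho (s j)) \<longlonglongrightarrow> 1" by (rule filterlim_compose[OF rho_tendsto lim])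
 hence "(%j. e j / (s (Suc j) - s j)) \<longlonglongrightarrow> (1/(2*(norm beta)\<^sup>2)) / pi"
  unfolding e_def by (intro tendsto_divide tendsto_intros gap) (use nb in auto)
 hence e: "(%j. e j / (s (Suc j) - s j)) \<longlonglongrightarrow> 1/(2*pi * (norm beta)\<^sup>2)" by (simp add: mult_ac)
 have c: "continuous_on {0..1} (%t. Ph t * t powr (2*a))"
  using a0 by (intro continuous_on_mult Ph continuous_on_powr' continuous_intros) auto
 have t: "(%N. (\<Sum>j<N. (Ph (s j / s N) * (s j / s N) powr (2*a)) * e j) / s N)
  \<longlonglongrightarrow> 1/(2*pi * (norm beta)\<^sup>2) * integral {0..1} (%t. Ph t * t powr (2*a))"
  by (rule riemann_sum_weights[OF mono spos lim B c e])
 have eq: "(\<Sum>j<N. (Ph (s j / s N) * (s j / s N) powr (2*a)) * e j) / s N = (\<Sum>j<N. Ph (s j / s N) * cj j) / s N powr (2*a + 1)" for N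
 proof -
  have two: "2*nu + 1 = 2*a" by simp
  have c: "cj j = s j powr (2*a) * e j" for j unfolding cj_eq two e_def s_def ..
  have p: "(s j / s N) powr (2*a) = s j powr (2*a) / s N powr (2*a)" for j by (rule powr_divide)
  have q: "s N powr (2*a + 1) = s N powr (2*a) * s N" using spos[of N] by (simp only: powr_add powr_one less_imp_le)
  show ?thesis unfolding q c p sum_divide_distrib by (intro sum.cong refl) simp
 qed
 show ?thesis using t[unfolded eq] unfolding s_def .
qed

end

section \<open>Sonine's integral, decay and oscillation of E_nu\<close>

lemma rE_summable: "nu > -1 ==> summable (%m. \<bar>bcoef nu m\<bar> * r ^ m)" for r :: real
proof -
 assume nu: "nu > -1"
 have "summable (%m. norm (of_real (bcoef nu m) * complex_of_real \<bar>r\<bar> ^ m))" by (rule summable_norm_bP[OF nu])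
 hence s: "summable (%m. \<bar>bcoef nu m\<bar> * \<bar>r\<bar> ^ m)" by (simp add: norm_mult norm_power)
 show ?thesis by (rule summable_comparison_test'[OF s, of 0]) (simp add: abs_mult power_abs)
qed

lemma continuous_on_rE: "nu > -1 ==> continuous_on S (rE nu)"
 using has_real_derivative_rE by (intro continuous_at_imp_continuous_on ballI DERIV_isCont)

lemma integral_even_series:
 fixes w :: "real => real" and h :: "nat => real"
 assumes w: "continuous_on {0..1} w" and h: "summable (%m. \<bar>h m\<bar>)"
 shows "(%m. h m * integral {0..1} (%t. w t * t ^ (2*m))) sums integral {0..1} (%t. w t * (\<Sum>m. h m * t ^ (2*m)))"
proof -
 have "compact (w ` {0..1})" by (intro compact_continuous_image w) auto
 from compact_imp_bounded[OF this] obtain B where "\<forall>y\<in>w ` {0..1}. norm y <= B"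
  unfolding bounded_iff by (rule exE)
 hence B: "\<bar>w t\<bar> <= B" if "t : {0..1}" for t using that by auto
 have bd: "norm (w t * (h m * t ^ (2*m))) <= B * \<bar>h m\<bar>" if t: "t : {0..1}" for t m
 proof -
  have "\<bar>t ^ (2*m)\<bar> <= 1" using t by (simp add: power_le_one)
  hence h1: "\<bar>h m\<bar> * \<bar>t ^ (2*m)\<bar> <= \<bar>h m\<bar> * 1" by (rule mult_left_mono) simp
  have "0 <= B" using B[OF t] by linarith
  hence "\<bar>w t\<bar> * (\<bar>h m\<bar> * \<bar>t ^ (2*m)\<bar>) <= B * (\<bar>h m\<bar> * 1)"
   by (intro mult_mono[OF B[OF t] h1]) auto
  thus ?thesis by (simp add: abs_mult)
 qed
 have unif: "uniform_limit {0..1} (%n t. \<Sum>m<n. w t * (h m * t ^ (2*m))) (%t. \<Sum>m. w t * (h m * t ^ (2*m))) sequentially"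
  by (rule Weierstrass_m_test[OF bd]) (use h in "auto intro: summable_mult")
 have c: "continuous_on {0..1} (%t. \<Sum>m<n. w t * (h m * t ^ (2*m)))" for n
  by (intro continuous_intros w)
 obtain I J where I: "!!n. ((%t. \<Sum>m<n. w t * (h m * t ^ (2*m))) has_integral I n) {0..1}"
  and J: "((%t. \<Sum>m. w t * (h m * t ^ (2*m))) has_integral J) {0..1}" and IJ: "(I \<longlongrightarrow> J) sequentially"
  using uniform_limit_integral[OF unif c] by auto
 have int: "(%t. w t * t ^ (2*m)) integrable_on {0..1}" for m
  by (intro integrable_continuous_real continuous_intros w)
 have "((%t. \<Sum>m<n. h m * (w t * t ^ (2*m))) has_integral (\<Sum>m<n. h m * integral {0..1} (%t. w t * t ^ (2*m)))) {0..1}" for n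
  by (intro has_integral_sum has_integral_mult_right integrable_integral int) auto
 hence "I n = (\<Sum>m<n. h m * integral {0..1} (%t. w t * t ^ (2*m)))" for n
  using I[of n] by (simp add: mult.left_commute has_integral_unique)
 hence IE: "I = (%n. \<Sum>m<n. h m * integral {0..1} (%t. w t * t ^ (2*m)))" by (rule ext)
 have "(%m. h m * integral {0..1} (%t. w t * t ^ (2*m))) sums J" using IJ unfolding IE sums_def .
 moreover have "J = integral {0..1} (%t. w t * (\<Sum>m. h m * t ^ (2*m)))"
 proof -
  have "(\<Sum>m. w t * (h m * t ^ (2*m))) = w t * (\<Sum>m. h m * t ^ (2*m))" if t: "t : {0..1}" for t
  proof (rule suminf_mult)
   have "\<bar>h m * t ^ (2*m)\<bar> <= \<bar>h m\<bar>" for m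
    using mult_left_mono[of "\<bar>t ^ (2*m)\<bar>" 1 "\<bar>h m\<bar>"] t by (simp add: abs_mult power_le_one)
   thus "summable (%m. h m * t ^ (2*m))" by (intro summable_comparison_test'[OF h, of 0]) auto
  qed
  hence "((%t. w t * (\<Sum>m. h m * t ^ (2*m))) has_integral J) {0..1}"
   using J by (rule has_integral_eq)
  thus ?thesis by (simp add: integral_unique)
 qed
 ultimately show ?thesis by simp
qed

text \<open>Half the Beta value B((b+1)/2, sg+1). Only its recurrence in b and crude two-sided
  bounds are used.\<close>

definition bmom :: "real => real => real" where
 "bmom sg b = integral {0..1} (%t. (1 - t\<^sup>2) powr sg * t powr b)"

lemma continuous_weight:
 assumes "sg > 0" "b > 0" shows "continuous_on {0..1} (%t::real. (1 - t\<^sup>2) powr sg * t powr b)"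
proof (intro continuous_on_mult continuous_on_powr' continuous_intros ballI)
 fix t :: real assume "t : {0..1}"
 thus "0 <= 1 - t\<^sup>2 & (1 - t\<^sup>2 = 0 \<longrightarrow> 0 < sg)" using assms by (auto simp: power_le_one)
qed (use assms in auto)

lemma bmom_integral: "sg > 0 ==> b > 0 ==> ((%t. (1 - t\<^sup>2) powr sg * t powr b) has_integral bmom sg b) {0..1}"
 unfolding bmom_def by (intro integrable_integral integrable_continuous_real continuous_weight)

text \<open>The derivative of (1 - t^2)^{sg+1} t^{b+1} integrates to 0 over [0,1].\<close>

lemma bmom_rec:
 assumes s: "sg > 0" "b > 0"
 shows "(b + 2 * sg + 3) * bmom sg (b + 2) = (b + 1) * bmom sg b"
proof -
 let ?G = "%t::real. (1 - t\<^sup>2) powr (sg + 1) * t powr (b + 1)"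
 let ?g = "%t::real. (b + 1) * ((1 - t\<^sup>2) powr sg * t powr b) - (b + 2 * sg + 3) * ((1 - t\<^sup>2) powr sg * t powr (b + 2))"
 have "(?g has_integral (?G 1 - ?G 0)) {0..1}"
 proof (rule fundamental_theorem_of_calculus_interior)
  show "continuous_on {0..1} ?G" by (rule continuous_weight) (use s in auto)
  fix t :: real assume t: "t : {0<..<1}"
  have p: "1 - t\<^sup>2 > 0" using t by (simp add: power_less_one_iff abs_square_less_1)
  have "(?G has_real_derivative ((sg + 1) * (1 - t\<^sup>2) powr sg * (- 2*t)) * t powr (b + 1) + ((b + 1) * t powr b) * (1 - t\<^sup>2) powr (sg + 1)) (at t)"
   using t p by (auto intro!: derivative_eq_intros simp: powr_diff)
  moreover have "((sg + 1) * (1 - t\<^sup>2) powr sg * (- 2*t)) * t powr (b + 1) + ((b + 1) * t powr b) * (1 - t\<^sup>2) powr (sg + 1) = ?g t"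
  proof -
   define P where "P = (1 - t\<^sup>2) powr sg"
   define T where "T = t powr b"
   have e: "(1 - t\<^sup>2) powr (sg + 1) = P * (1 - t\<^sup>2)" "t powr (b + 1) = T * t" "t powr (b + 2) = T * t\<^sup>2"
    using t p by (simp_all add: P_def T_def powr_add)
   show ?thesis unfolding e P_def[symmetric] T_def[symmetric] by (simp add: algebra_simps power2_eq_square)
  qed
  ultimately show "(?G has_vector_derivative ?g t) (at t)"
   by (simp add: has_real_derivative_iff_has_vector_derivative)
 qed simp
 hence "(?g has_integral 0) {0..1}" using s by simp
 moreover have "(?g has_integral (b + 1) * bmom sg b - (b + 2 * sg + 3) * bmom sg (b + 2)) {0..1}"
  using s by (intro has_integral_diff has_integral_mult_right bmom_integral) auto
 ultimately have "(b + 1) * bmom sg b - (b + 2 * sg + 3) * bmom sg (b + 2) = 0"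
  by (rule has_integral_unique[symmetric])
 thus ?thesis by simp
qed

lemma bmom_bounds:
 assumes s: "sg > 0" "b > 0"
 shows "bmom sg b <= 1" "bmom sg b >= (3/4) powr sg * (1/4) powr b / 4"
proof -
 have "bmom sg b <= integral {0..1} (%t::real. 1)"
  unfolding bmom_def
 proof (rule integral_le)
  fix t :: real assume t: "t : {0..1}"
  have "(1 - t\<^sup>2) powr sg <= 1 powr sg" "t powr b <= 1 powr b" using t s by (auto intro!: powr_le1 simp: power_le_one)
  hence "(1 - t\<^sup>2) powr sg * t powr b <= 1*1" by (intro mult_mono) auto
  thus "(1 - t\<^sup>2) powr sg * t powr b <= 1" by simp
 qed (use bmom_integral[OF s] in auto)
 thus "bmom sg b <= 1" by simp
 let ?w = "%t::real. (1 - t\<^sup>2) powr sg * t powr b"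
 have sub: "?w integrable_on {1/4..1/2}"
  by (rule integrable_continuous_real) (rule continuous_on_subset[OF continuous_weight[OF s]], auto)
 have "integral {1/4..1/2} (%t::real. (3/4) powr sg * (1/4) powr b) <= integral {1/4..1/2} ?w"
 proof (rule integral_le[OF _ sub])
  fix t :: real assume t: "t : {1/4..1/2}"
  have "t\<^sup>2 <= (1/2)\<^sup>2" using t by (intro power_mono) auto
  hence "3/4 <= 1 - t\<^sup>2" by (simp add: power2_eq_square)
  hence "(3/4) powr sg <= (1 - t\<^sup>2) powr sg" "(1/4) powr b <= t powr b" using t s by (auto intro!: powr_mono2)
  thus "(3/4) powr sg * (1/4) powr b <= ?w t" by (intro mult_mono) auto
 qed auto
 also have "... <= bmom sg b"
  unfolding bmom_def by (rule integral_subset_le[OF _ sub]) (use bmom_integral[OF s] in auto)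
 finally show "bmom sg b >= (3/4) powr sg * (1/4) powr b / 4" by simp
qed

definition Snu :: "real => nat => real => real => real" where
 "Snu nu m sg x = integral {0..1} (%t. (1 - t\<^sup>2) powr sg * t powr (2*nu + 1) * rE nu (x * t) * t ^ (2*m))"

text \<open>Sonine's first integral, with the value of the Beta integral left implicit.\<close>
lemma Sonine:
 assumes nu: "nu > -1/2" and s: "sg > 0"
 shows "Snu nu 0 sg x = bmom sg (2*nu + 1) * Gamma (nu + sg + 2) / Gamma (nu + 1) * rE (nu + sg + 1) x"
proof -
 define b where "b = 2*nu + 1"
 have b: "b > 0" using nu by (simp add: b_def)
 define w where "w = (%t::real. (1 - t\<^sup>2) powr sg * t powr b)"
 have mom: "integral {0..1} (%t. w t * t ^ (2*m)) = bmom sg (b + 2*real m)" for m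
  unfolding bmom_def
 proof (rule integral_cong)
  fix t :: real assume t: "t : {0..1}"
  show "w t * t ^ (2*m) = (1 - t\<^sup>2) powr sg * t powr (b + 2*real m)"
  proof (cases "t = 0")
   case False
   hence "t powr real (2*m) = t ^ (2*m)" using t by (intro powr_realpow) auto
   thus ?thesis by (simp add: w_def powr_add)
  qed (use b in "simp add: w_def")
 qed
 have gam: "Gamma (real m + nu + 1) > 0" "Gamma (real m + nu + sg + 2) > 0" for m
  using nu s by (auto intro!: Gamma_real_pos)
 have bm: "bmom sg (b + 2*real m) = bmom sg b * (Gamma (nu + sg + 2) / Gamma (nu + 1)) * (Gamma (real m + nu + 1) / Gamma (real m + nu + sg + 2))" for m
 proof (induction m)
  case 0
  show ?case using gam[of 0] by simp
 next
  case (Suc m)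
  have nz: "real m + nu + 1 ~= 0" "real m + nu + sg + 2 ~= 0" using nu s by auto
  have Gp1: "Gamma (z + 1) = z * Gamma z" if "z > 0" for z :: real
   by (rule Gamma_plus1) (use that nonpos_Ints_nonpos[of z] in force)
  have g1: "Gamma (real (Suc m) + nu + 1) = (real m + nu + 1) * Gamma (real m + nu + 1)"
   using Gp1[of "real m + nu + 1"] nu by (simp add: add_ac)
  have g2: "Gamma (real (Suc m) + nu + sg + 2) = (real m + nu + sg + 2) * Gamma (real m + nu + sg + 2)"
   using Gp1[of "real m + nu + sg + 2"] nu s by (simp add: add_ac)
  have "(b + 2*real m + 2 * sg + 3) * bmom sg (b + 2*real m + 2) = (b + 2*real m + 1) * bmom sg (b + 2*real m)"
   using s b by (intro bmom_rec) auto
  hence rec: "(real m + nu + sg + 2) * bmom sg (b + 2*real m + 2) = (real m + nu + 1) * bmom sg (b + 2*real m)"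
   by (simp add: b_def algebra_simps)
  have eq: "b + 2*real (Suc m) = b + 2*real m + 2" by simp
  have alg: "X = M * G * ((n1*A) / (n2*B))" if "n2*X = n1*(M * G * (A / B))" "n2 ~= 0" for X M G n1 n2 A B :: real
  proof -
   have "X = (n2*X) / n2" using that(2) by simp
   also have "... = M * G * ((n1*A) / (n2*B))" unfolding that(1) by (simp add: mult_ac)
   finally show ?thesis .
  qed
  show ?case unfolding eq g1 g2 by (rule alg) (use rec nz Suc.IH in auto)
 qed
 define h where "h m = bcoef nu m * (x / 2) ^ (2*m)" for m
 have hs: "summable (%m. \<bar>h m\<bar>)"
 proof -
  have "\<bar>h m\<bar> = \<bar>bcoef nu m\<bar> * ((x / 2)\<^sup>2) ^ m" for m
   unfolding h_def abs_mult power_mult by (simp only: abs_of_nonneg zero_le_power zero_le_power2)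
  thus ?thesis using rE_summable[of nu "(x / 2)\<^sup>2"] nu by simp
 qed
 have wc: "continuous_on {0..1} w" unfolding w_def by (rule continuous_weight[OF s b])
 have ser: "(\<Sum>m. h m * t ^ (2*m)) = rE nu (x * t)" for t
  using rE_sums[of nu "x * t"] nu by (simp add: sums_iff h_def power_mult_distrib power_divide mult_ac)
 have "Snu nu 0 sg x = integral {0..1} (%t. w t * (\<Sum>m. h m * t ^ (2*m)))"
  unfolding ser by (simp add: Snu_def w_def b_def)
 with integral_even_series[OF wc hs] have "(%m. h m * bmom sg (b + 2*real m)) sums Snu nu 0 sg x" unfolding mom by simp
 moreover have "h m * bmom sg (b + 2*real m) = (bmom sg b * (Gamma (nu + sg + 2) / Gamma (nu + 1))) * (bcoef (nu + sg + 1) m * (x / 2) ^ (2*m))" for m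
 proof -
  have e: "real m + (nu + sg + 1) + 1 = real m + nu + sg + 2" by simp
  show ?thesis unfolding bm h_def bcoef_def e using gam[of m] by (simp add: mult_ac)
 qed
 moreover have "(%m. (bmom sg b * (Gamma (nu + sg + 2) / Gamma (nu + 1))) * (bcoef (nu + sg + 1) m * (x / 2) ^ (2*m))) sums
   ((bmom sg b * (Gamma (nu + sg + 2) / Gamma (nu + 1))) * rE (nu + sg + 1) x)"
  by (intro sums_mult rE_sums) (use nu s in simp)
 ultimately have "Snu nu 0 sg x = (bmom sg b * (Gamma (nu + sg + 2) / Gamma (nu + 1))) * rE (nu + sg + 1) x"
  by (simp add: sums_unique2)
 thus ?thesis by (simp add: b_def)
qed

text \<open>E_nu is bounded near 0 and O(x^{-(nu+1/2)}) at infinity, hence O(x^{-B}) for every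
  intermediate exponent.\<close>

lemma rE_decay:
 assumes nu: "nu > -1/2" and B: "0 <= B" "B <= nu + 1/2"
 obtains C where "C > 0" "!!x. x > 0 ==> \<bar>rE nu x\<bar> <= C * x powr (- B)"
proof -
 have "nu > -1" using nu by simp
 then obtain f f' K where "bessel_jost nu f f' K" by (rule bessel_jost_exists)
 then interpret J: bessel_jost nu f f' K .
 define A where "A = nu + 1/2"
 obtain C where C: "C > 0" "!!w. Re w > 0 ==> Im w >= 0 ==> norm (bF nu w) <= C * min 1 (norm w) powr (nu + 1/2) * exp (Im w)"
  using J.F_upper_bound by blast
 show thesis
 proof (rule that[OF C(1)])
  fix x :: real assume x: "x > 0"
  have "norm (complex_of_real (x powr A * rE nu x)) <= C * min 1 x powr A"
   using C(2)[of "of_real x"] x J.F_of_real[OF x] by (simp add: A_def)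
  hence "x powr A * \<bar>rE nu x\<bar> <= C * min 1 x powr A" unfolding norm_of_real by (simp add: abs_mult)
  hence le: "x powr (- A) * (x powr A * \<bar>rE nu x\<bar>) <= x powr (- A) * (C * min 1 x powr A)"
   by (intro mult_left_mono) auto
  have one: "x powr (- A) * x powr A = 1" using x by (simp add: powr_add[symmetric])
  have 1: "\<bar>rE nu x\<bar> <= C * (x powr (- A) * min 1 x powr A)"
   using le unfolding mult.assoc[symmetric] one mult_1 by (simp only: mult.commute[of "x powr (- A)" C])
  have "x powr (- A) * min 1 x powr A <= x powr (- B)"
  proof (cases "x >= 1")
   case True
   thus ?thesis using B by (simp add: A_def powr_mono)
  next
   case False
   have "x powr (- A) * x powr A = 1" using x by (simp add: powr_add[symmetric])
   moreover have "1 powr (- B) <= x powr (- B)" using False x B by (intro powr_mono2') auto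
   ultimately show ?thesis using False by (simp add: min_def)
  qed
  hence "C * (x powr (- A) * min 1 x powr A) <= C * x powr (- B)" using C(1) by (intro mult_left_mono) auto
  thus "\<bar>rE nu x\<bar> <= C * x powr (- B)" using 1 by linarith
 qed
qed

lemma Snu_integrable:
 assumes "nu > -1/2" "sg > 0"
 shows "(%t. (1 - t\<^sup>2) powr sg * t powr (2*nu + 1) * rE nu (x * t) * t ^ (2*m)) integrable_on {0..1}"
 using assms by (intro integrable_continuous_real continuous_on_mult[OF continuous_on_mult[OF continuous_weight]]
   continuous_on_compose2[OF continuous_on_rE[of nu UNIV]] continuous_intros) auto

lemma Snu_rec:
 assumes nu: "nu > -1/2" and s: "sg > 0"
 shows "Snu nu (Suc m) sg x = Snu nu m sg x - Snu nu m (sg + 1) x"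
proof -
 have "Snu nu m sg x - Snu nu m (sg + 1) x = integral {0..1} (%t.
   (1 - t\<^sup>2) powr sg * t powr (2*nu + 1) * rE nu (x * t) * t ^ (2*m) - (1 - t\<^sup>2) powr (sg + 1) * t powr (2*nu + 1) * rE nu (x * t) * t ^ (2*m))"
  unfolding Snu_def using nu s by (intro integral_diff[symmetric] Snu_integrable) auto
 also have "... = Snu nu (Suc m) sg x"
  unfolding Snu_def
 proof (rule integral_cong)
  fix t :: real assume t: "t : {0..1}"
  have e: "(1 - t\<^sup>2) powr (sg + 1) = (1 - t\<^sup>2) powr sg * (1 - t\<^sup>2)" using t by (simp add: powr_add power_le_one)
  show "(1 - t\<^sup>2) powr sg * t powr (2*nu + 1) * rE nu (x * t) * t ^ (2*m) - (1 - t\<^sup>2) powr (sg + 1) * t powr (2*nu + 1) * rE nu (x * t) * t ^ (2*m)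
   = (1 - t\<^sup>2) powr sg * t powr (2*nu + 1) * rE nu (x * t) * t ^ (2*Suc m)"
   unfolding e by (simp add: algebra_simps power2_eq_square)
 qed
 finally show ?thesis by simp
qed

text \<open>Writing t^2 = 1 - (1 - t^2) expresses the moment of index m through those of index 0
  with dl replaced by dl + k, for k <= m. By Sonine these are multiples of E_{mu+k}(x), all decaying
  like E_mu(x) with constants of order (4/3)^k. The binomial sum gives (1 + 4/3)^m.\<close>

lemma Snu_bound:
 assumes nu: "nu > -1/2" and d: "dl > 0"
 obtains C where "C > 0" "!!m x. x > 0 ==> \<bar>Snu nu m dl x\<bar> <= C * (7/3) ^ m * x powr (- (nu + 3/2 + dl))"
proof -
 define \<mu> where "\<mu> = nu + dl + 1"
 define A where "A = nu + 3/2 + dl"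
 have mu: "\<mu> > -1/2" "A = \<mu> + 1/2" "A > 0" using nu d by (auto simp: \<mu>_def A_def)
 obtain C1 where C1: "C1 > 0" "!!x. x > 0 ==> \<bar>rE \<mu> x\<bar> <= C1*x powr (- A)" using rE_decay[of \<mu> A] mu by auto
 obtain C2 where C2: "C2 > 0" "!!x. x > 0 ==> \<bar>rE (\<mu> + 1) x\<bar> <= C2*x powr (- A)" using rE_decay[of "\<mu> + 1" A] mu by auto
 define G where "G k = bmom (dl + real k) (2*nu + 1) * Gamma (nu + (dl + real k) + 2) / Gamma (nu + 1)" for k :: nat
 have gp: "Gamma (nu + 1) > 0" "Gamma (\<mu> + 1) > 0" using nu mu by (auto intro!: Gamma_real_pos)
 have gk: "Gamma (nu + (dl + real k) + 2) > 0" for k using nu d by (intro Gamma_real_pos) auto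
 have b0: "bmom (dl + real k) (2*nu + 1) > 0" "bmom (dl + real k) (2*nu + 1) <= 1" for k
 proof -
  have "0 < (3/4) powr (dl + real k) * (1/4) powr (2*nu + 1) / (4::real)" by simp
  also have "... <= bmom (dl + real k) (2*nu + 1)" using nu d by (intro bmom_bounds) auto
  finally show "bmom (dl + real k) (2*nu + 1) > 0" .
  show "bmom (dl + real k) (2*nu + 1) <= 1" using nu d by (intro bmom_bounds) auto
 qed
 have G0: "G k > 0" for k using b0 gk gp by (simp add: G_def)
 have S0: "Snu nu 0 (dl + real k) x = G k * rE (\<mu> + real k) x" for k x
  using Sonine[of nu "dl + real k" x] nu d by (simp add: G_def \<mu>_def add_ac)
 \<comment> \<open>Inverts the factor (1/4)^{2mu+1}/4 in the lower bound of
   \<open>bmom_bounds\<close>.\<close>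
 define q where "q = 4*4 powr (2*\<mu> + 1)"
 define C3 where "C3 = q * Gamma (\<mu> + 1) / Gamma (nu + 1) * C1"
 \<comment> \<open>For k >= 2 the function E_{mu+k} is itself a Sonine integral of E_mu with
   parameter k - 1 > 0, so the decay of E_mu carries over. The ratio of the two Beta values is at
   most q (4/3)^k. The values k = 0 and k = 1 are treated directly.\<close>
 have base2: "\<bar>Snu nu 0 (dl + real k) x\<bar> <= C3*(4/3) ^ k * x powr (- A)" if k: "k >= 2" and x: "x > 0" for k x
 proof -
  define sg where "sg = real k - 1"
  have s: "sg > 0" using k by (simp add: sg_def)
  define M where "M = bmom sg (2*\<mu> + 1)"
  have "4 powr (2*\<mu> + 1) * (1/4) powr (2*\<mu> + 1) = (1::real)" by (simp add: powr_divide)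
  moreover have "M >= (3/4) powr sg * (1/4) powr (2*\<mu> + 1) / 4" unfolding M_def using s mu by (intro bmom_bounds) auto
  hence "q * M >= q * ((3/4) powr sg * (1/4) powr (2*\<mu> + 1) / 4)" by (intro mult_left_mono) (auto simp: q_def)
  ultimately have "q * M >= (3/4) powr sg" by (simp add: q_def mult_ac)
  also have "(3/4) powr sg >= (3/4) ^ k" using powr_mono'[of sg "real k" "3/4"] by (simp add: sg_def powr_realpow)
  finally have qM: "q * M >= (3/4) ^ k" by simp
  have "(4/3) ^ k * (3/4) ^ k = (1::real)" by (simp add: power_mult_distrib[symmetric])
  hence qM2: "1 <= q * M * (4/3) ^ k" using mult_left_mono[OF qM, of "(4/3) ^ k"] by (simp add: mult_ac)
  have "0 < q * M" by (rule less_le_trans[OF _ qM]) simp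
  hence M0: "M > 0" by (rule zero_less_mult_pos) (simp add: q_def)
  have Sm: "Snu \<mu> 0 sg x = M * Gamma (nu + (dl + real k) + 2) / Gamma (\<mu> + 1) * rE (\<mu> + real k) x"
  proof -
   have e: "\<mu> + sg + 2 = nu + (dl + real k) + 2" "\<mu> + sg + 1 = \<mu> + real k" by (simp_all add: \<mu>_def sg_def)
   show ?thesis using Sonine[OF mu(1) s, of x] unfolding e M_def .
  qed
  have "norm (Snu \<mu> 0 sg x) <= integral {0..1} (%t::real. C1*x powr (- A))"
   unfolding Snu_def
  proof (rule integral_norm_bound_integral[OF Snu_integrable[OF mu(1) s, of x 0] integrable_const_ivl])
   fix t :: real assume t: "t : {0..1}"
   show "norm ((1 - t\<^sup>2) powr sg * t powr (2*\<mu> + 1) * rE \<mu> (x * t) * t ^ (2*0)) <= C1*x powr (- A)"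
   proof (cases "t = 0")
    case False
    hence t0: "t > 0" using t by simp
    have "(1 - t\<^sup>2) powr sg <= 1 powr sg" using t s by (intro powr_mono2) (auto simp: power_le_one)
    hence p: "(1 - t\<^sup>2) powr sg <= 1" by simp
    have "t powr (2*\<mu> + 1) * \<bar>rE \<mu> (x * t)\<bar> <= t powr (2*\<mu> + 1) * (C1*(x * t) powr (- A))"
     using C1(2)[of "x * t"] x t0 by (intro mult_left_mono) auto
    also have "... = C1*x powr (- A) * (t powr (2*\<mu> + 1) * t powr (- A))" by (simp add: powr_mult)
    also have "t powr (2*\<mu> + 1) * t powr (- A) = t powr A" by (simp add: powr_add[symmetric] mu(2))
    also have "C1*x powr (- A) * t powr A <= C1*x powr (- A) * 1"
     using powr_mono2[of A t 1] t mu C1(1) by (intro mult_left_mono) auto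
    finally have r: "t powr (2*\<mu> + 1) * \<bar>rE \<mu> (x * t)\<bar> <= C1*x powr (- A)" by simp
    have "(1 - t\<^sup>2) powr sg * (t powr (2*\<mu> + 1) * \<bar>rE \<mu> (x * t)\<bar>) <= 1*(C1*x powr (- A))"
     by (intro mult_mono p r) auto
    thus ?thesis by (simp add: abs_mult mult.assoc)
   qed (use C1 in simp)
  qed
  hence Sb: "\<bar>Snu \<mu> 0 sg x\<bar> <= C1*x powr (- A)" by simp
  have "Snu nu 0 (dl + real k) x = (bmom (dl + real k) (2*nu + 1) / M * (Gamma (\<mu> + 1) / Gamma (nu + 1))) * Snu \<mu> 0 sg x"
   unfolding S0 Sm G_def using M0 gp by simp
  hence "\<bar>Snu nu 0 (dl + real k) x\<bar> = (bmom (dl + real k) (2*nu + 1) / M * (Gamma (\<mu> + 1) / Gamma (nu + 1))) * \<bar>Snu \<mu> 0 sg x\<bar>"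
   using b0[of k] M0 gp by (simp add: abs_mult)
  also have "... <= (q * (4/3) ^ k * (Gamma (\<mu> + 1) / Gamma (nu + 1))) * (C1*x powr (- A))"
  proof (intro mult_mono Sb mult_right_mono)
   have "bmom (dl + real k) (2*nu + 1) / M <= 1/M" using b0[of k] M0 by (intro divide_right_mono) auto
   also have "... <= q * (4/3) ^ k" using qM2 M0 by (simp add: pos_divide_le_eq mult_ac)
   finally show "bmom (dl + real k) (2*nu + 1) / M <= q * (4/3) ^ k" .
  qed (use gp in "auto simp: q_def")
  also have "... = C3*(4/3) ^ k * x powr (- A)" by (simp add: C3_def)
  finally show ?thesis .
 qed
 define C where "C = G 0*C1 + G 1*C2 + C3"
 have C30: "C3 >= 0" using gp C1(1) by (simp add: C3_def q_def)
 have C: "C > 0" "G 0*C1 <= C" "G 1*C2 <= C" "C3 <= C"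
 proof -
  have "G 0*C1 > 0" "G 1*C2 > 0" using G0 C1(1) C2(1) by (simp_all only: mult_pos_pos)
  thus "C > 0" "G 0*C1 <= C" "G 1*C2 <= C" "C3 <= C" using C30 unfolding C_def by linarith+
 qed
 have base: "\<bar>Snu nu 0 (dl + real k) x\<bar> <= C * (4/3) ^ k * x powr (- A)" if x: "x > 0" for k x
 proof -
  consider "k = 0" | "k = 1" | "k >= 2" by linarith
  thus ?thesis
  proof cases
   case 1
   have "\<bar>Snu nu 0 (dl + real k) x\<bar> = G 0*\<bar>rE \<mu> x\<bar>" unfolding S0 using 1 G0[of 0] by (simp add: abs_mult)
   also have "... <= G 0*(C1*x powr (- A))" using C1(2)[OF x] G0[of 0] by (intro mult_left_mono) auto
   also have "... <= C * x powr (- A)" unfolding mult.assoc[symmetric] using C by (intro mult_right_mono) auto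
   finally show ?thesis using 1 by simp
  next
   case 2
   have "\<bar>Snu nu 0 (dl + real k) x\<bar> = G 1*\<bar>rE (\<mu> + 1) x\<bar>" unfolding S0 using 2 G0[of 1] by (simp add: abs_mult)
   also have "... <= G 1*(C2*x powr (- A))" using C2(2)[OF x] G0[of 1] by (intro mult_left_mono) auto
   also have "... <= C * x powr (- A)" unfolding mult.assoc[symmetric] using C by (intro mult_right_mono) auto
   also have "... <= C * (4/3) ^ k * x powr (- A)" using C(1) 2 by (intro mult_right_mono) auto
   finally show ?thesis .
  next
   case 3
   have "\<bar>Snu nu 0 (dl + real k) x\<bar> <= C3*(4/3) ^ k * x powr (- A)" by (rule base2[OF 3 x])
   also have "... <= C * (4/3) ^ k * x powr (- A)" using C by (intro mult_right_mono) auto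
   finally show ?thesis .
  qed
 qed
 have main: "\<bar>Snu nu m (dl + real k) x\<bar> <= C * (4/3) ^ k * (7/3) ^ m * x powr (- A)" if x: "x > 0" for m k x
 proof (induction m arbitrary: k)
  case 0
  show ?case using base[OF x] by simp
 next
  case (Suc m)
  have "Snu nu (Suc m) (dl + real k) x = Snu nu m (dl + real k) x - Snu nu m (dl + real (Suc k)) x"
   using Snu_rec[of nu "dl + real k" m x] nu d by (simp add: add_ac)
  hence "\<bar>Snu nu (Suc m) (dl + real k) x\<bar> <= \<bar>Snu nu m (dl + real k) x\<bar> + \<bar>Snu nu m (dl + real (Suc k)) x\<bar>" by simp
  also have "... <= C * (4/3) ^ k * (7/3) ^ m * x powr (- A) + C * (4/3) ^ Suc k * (7/3) ^ m * x powr (- A)"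
   by (intro add_mono Suc.IH)
  also have "... = C * (4/3) ^ k * (7/3) ^ Suc m * x powr (- A)" by (simp add: algebra_simps)
  finally show ?case .
 qed
 show thesis
  by (rule that[OF C(1)]) (use main[of _ _ 0] in "simp add: A_def")
qed

text \<open>The contributions at x and x + h together are at least c/(x+h). Both shifted integrals
  are dominated by the full one, whence the factor 1/2.\<close>

lemma log_lower_bound:
 fixes W :: "real => real"
 assumes c: "continuous_on {1..} W" and M: "M >= 1" and h: "h > 0" and c0: "c >= 0"
  and W: "!!x. x >= M ==> (W x)\<^sup>2 + (W (x + h))\<^sup>2 >= c" and X: "X >= M + h"
 shows "integral {1..X} (%x. (W x)\<^sup>2/x) >= c / 2*(ln X - ln (M + h))"
proof -
 let ?g = "%x. (W x)\<^sup>2/x"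
 have gc: "continuous_on S ?g" if "S <= {1..}" for S
  using that by (intro continuous_intros continuous_on_subset[OF c]) auto
 have int: "?g integrable_on {u..v}" if "u >= 1" for u v using that by (intro integrable_continuous_real gc) auto
 have pos: "?g x >= 0" if "x >= 1" for x using that by simp
 have 1: "integral {M..X - h} ?g <= integral {1..X} ?g"
  using M h by (intro integral_subset_le int) (auto intro!: pos)
 have 2: "integral {M + h..X} ?g <= integral {1..X} ?g"
  using M h by (intro integral_subset_le int) (auto intro!: pos)
 have sh: "integral {M..X - h} (?g \<circ> (%x. x + h)) = integral {M + h..X} ?g"
  using integral_shift[of M h "X - h" ?g] gc[of "{M + h..X}"] M h by auto
 have ish: "(?g \<circ> (%x. x + h)) integrable_on {M..X - h}"
  by (intro integrable_continuous_real continuous_on_compose continuous_intros gc) (use M h in auto)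
 have "((%x. 1/(x + h)) has_integral (ln (X - h + h) - ln (M + h))) {M..X - h}"
  by (intro fundamental_theorem_of_calculus)
   (use X M h in "auto intro!: derivative_eq_intros simp: has_real_derivative_iff_has_vector_derivative[symmetric]")
 hence base: "((%x. 1/(x + h)) has_integral (ln X - ln (M + h))) {M..X - h}" by simp
 have L: "((%x. c * (1/(x + h))) has_integral (c * (ln X - ln (M + h)))) {M..X - h}"
  by (rule has_integral_mult_right[OF base])
 have "c * (ln X - ln (M + h)) <= integral {M..X - h} (%x. ?g x + (?g \<circ> (%x. x + h)) x)"
 proof (subst integral_unique[OF L, symmetric], rule integral_le)
  fix x assume x: "x : {M..X - h}"
  have "c / (x + h) <= ((W x)\<^sup>2 + (W (x + h))\<^sup>2) / (x + h)" using W[of x] x M h by (intro divide_right_mono) auto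
  also have "... <= (W x)\<^sup>2/x + (W (x + h))\<^sup>2/(x + h)"
   using x M h by (auto simp: add_divide_distrib intro!: divide_left_mono)
  finally show "c * (1/(x + h)) <= ?g x + (?g \<circ> (%x. x + h)) x" by simp
 next
  show "(%x. c * (1/(x + h))) integrable_on {M..X - h}" by (rule has_integral_integrable[OF L])
  show "(%x. ?g x + (?g \<circ> (%x. x + h)) x) integrable_on {M..X - h}" by (rule integrable_add[OF int[OF M] ish])
 qed
 also have "... = integral {M..X - h} ?g + integral {M..X - h} (?g \<circ> (%x. x + h))"
  using M by (intro integral_add int ish) auto
 finally show ?thesis using 1 2 sh by simp
qed

text \<open>Asymptotically the function is 2 Re(cnj beta e^{ix}), and a shift by pi/2 replaces the
  real part by minus the imaginary part. The squares then add up to about 4 |beta|^2, of which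
  |beta|^2 survives the error.\<close>

lemma rE_oscillation:
 assumes nu: "nu > -1"
 obtains c M where "c > 0" "M >= 1"
  "!!x. x >= M ==> (x powr (nu + 1/2) * rE nu x)\<^sup>2 + ((x + pi / 2) powr (nu + 1/2) * rE nu (x + pi / 2))\<^sup>2 >= c"
proof -
 obtain f f' K where "bessel_jost nu f f' K" using bessel_jost_exists[OF nu] by metis
 then interpret J: bessel_jost nu f f' K .
 obtain M where M: "M >= 1" "!!r. r >= M ==> exp (K / r) <= 13/12" using J.small_exp_bound by blast
 define b where "b = norm J.beta"
 have b: "b > 0" using J.beta_nonzero by (simp add: b_def)
 have app: "\<bar>x powr (nu + 1/2) * rE nu x - 2*Re (cnj J.beta * cis x)\<bar> <= b / 6" if x: "x >= M" for x
 proof -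
  have x0: "x > 0" using x M by linarith
  define g where "g = exp (- \<i> * of_real x) * f (of_real x)"
  have "norm (g - 1) <= exp (K / x) - 1" using J.f_bound[of "of_real x"] x0 by (simp add: g_def)
  hence g: "norm (g - 1) <= 1/12" using M(2)[OF x] by simp
  have fx: "f (of_real x) = cis x * g"
   using J.f_eq[of "of_real x"] by (simp add: g_def cis_conv_exp)
  have "J.beta * J.fc (of_real x) = cnj (cnj J.beta * f (of_real x))" by (simp add: J.fc_of_real)
  hence "bF nu (of_real x) = of_real (2*Re (cnj J.beta * f (of_real x)))"
   using J.F_eq[of "of_real x"] x0 by (simp only: complex_add_cnj) (simp add: complex_add_cnj)
  hence "x powr (nu + 1/2) * rE nu x = 2*Re (cnj J.beta * f (of_real x))"
   unfolding J.F_of_real[OF x0] by (simp only: of_real_eq_iff)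
  also have "cnj J.beta * f (of_real x) = cnj J.beta * cis x + cnj J.beta * cis x * (g - 1)"
   unfolding fx by (simp add: algebra_simps)
  finally have e: "x powr (nu + 1/2) * rE nu x - 2*Re (cnj J.beta * cis x) = 2*Re (cnj J.beta * cis x * (g - 1))" by simp
  have m: "\<bar>Re (cnj J.beta * cis x * (g - 1))\<bar> <= b * (1/12)"
  proof (rule order_trans[OF abs_Re_le_cmod])
   show "norm (cnj J.beta * cis x * (g - 1)) <= b * (1/12)"
    unfolding norm_mult complex_mod_cnj norm_cis b_def mult_1_right by (intro mult_left_mono g) simp
  qed
  have "\<bar>2*Z\<bar> <= b / 6" if "\<bar>Z\<bar> <= b * (1/12)" for Z :: real using that by simp
  from this[OF m] show ?thesis unfolding e .
 qed
 show thesis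
 proof (rule that[of "b\<^sup>2" M])
  show "b\<^sup>2 > 0" "M >= 1" using b M by auto
  fix x assume x: "x >= M"
  define z where "z = cnj J.beta * cis x"
  have "cis (x + pi / 2) = \<i> * cis x" by (simp add: complex_eq_iff cos_add sin_add)
  hence "Re (cnj J.beta * cis (x + pi / 2)) = - Im z" by (simp add: z_def)
  hence 2: "\<bar>(x + pi / 2) powr (nu + 1/2) * rE nu (x + pi / 2) - 2*(- Im z)\<bar> <= b / 6"
   using app[of "x + pi / 2"] x pi_gt_zero by simp
  have 1: "\<bar>x powr (nu + 1/2) * rE nu x - 2*Re z\<bar> <= b / 6" using app[OF x] by (simp add: z_def)
  have "norm z = b" by (simp add: z_def norm_mult b_def)
  hence z: "(Re z)\<^sup>2 + (Im z)\<^sup>2 = b\<^sup>2" by (simp add: cmod_power2[symmetric])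
  have sq: "p\<^sup>2 >= 2*r\<^sup>2 - b\<^sup>2/36" if "\<bar>p - 2*r\<bar> <= b / 6" for p r :: real
  proof -
   have "(p - 2*r)\<^sup>2 <= (b / 6)\<^sup>2" using power_mono[OF that, of 2] by simp
   hence "(p - 2*r)\<^sup>2 <= b\<^sup>2/36" by (simp add: power_divide)
   moreover have "0 <= 2*(p - r)\<^sup>2" by simp
   ultimately show ?thesis by (simp add: power2_diff power_mult_distrib algebra_simps)
  qed
  show "b\<^sup>2 <= (x powr (nu + 1/2) * rE nu x)\<^sup>2 + ((x + pi / 2) powr (nu + 1/2) * rE nu (x + pi / 2))\<^sup>2"
  proof -
   have "(- Im z)\<^sup>2 = (Im z)\<^sup>2" by simp
   thus ?thesis using sq[OF 1] sq[OF 2] z zero_le_power2[of b] by linarith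
  qed
 qed
qed

lemma integral_scale:
 fixes g :: "real => real"
 assumes R: "R > 0" and g: "continuous_on {p..q} g"
 shows "integral {p / R..q / R} (%x. g (R * x)) = integral {p..q} g / R"
proof -
 have "(g has_integral integral {p..q} g) {p..q}" by (intro integrable_integral integrable_continuous_real g)
 from has_integral_stretch_real[OF this, of R]
 have "((%x. g (R * x)) has_integral (1/\<bar>R\<bar>) *\<^sub>R integral {p..q} g) ((%x. x / R) ` {p..q})" using R by simp
 moreover have "(%x. x / R) ` {p..q} = {p / R..q / R}" using R by simp
 ultimately show ?thesis using R by (simp add: integral_unique)
qed

section \<open>Test functions at scale 1/R and the limiting bilinear form\<close>

context bessel_jost
begin

text \<open>The measure x^{2a} dx scales by R^{-(2a+1)}, and q' < R keeps the support inside (0,1)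
  except possibly for the point 0.\<close>

lemma mu_nu_scaled:
 assumes a0: "a > 0" and R: "R > 0" and p: "0 <= p" "q' < R" and ph: "continuous_on {p..q'} ph"
 shows "integrable (mu_nu nu) (%x. ph (R * x) * indicator {p..q'} (R * x))"
  "(bni (mu_nu nu) (%x. ph (R * x) * indicator {p..q'} (R * x))) = R powr (- (2*a + 1)) * integral {p..q'} (%x. x powr (2*a) * ph x)"
proof -
 let ?I = "{p / R..q' / R}"
 let ?u = "%x. ph (R * x) * indicator {p..q'} (R * x)"
 let ?k = "%x. x powr (2*a) * ph (R * x)"
 have ind: "indicator {p..q'} (R * x) = (indicator ?I x :: real)" for x
  using R by (auto simp: indicator_def field_simps)
 have cph: "continuous_on ?I (%x. ph (R * x))"
  by (rule continuous_on_compose2[OF ph]) (use R in "auto intro!: continuous_intros simp: field_simps")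
 have "0 <= p / R" "q' / R < 1" using p R by simp_all
 hence I01: "0 <= x" "x < 1" if "x : ?I" for x using that by auto
 have ck: "continuous_on ?I ?k"
  using a0 I01 by (intro continuous_on_mult cph continuous_on_powr' continuous_intros) auto
 have m0: "?u : borel_measurable borel"
  unfolding ind using borel_measurable_continuous_on_indicator[OF _ cph] by (simp add: mult.commute)
 have m: "?u : borel_measurable (restrict_space lborel {0<..<1})" by (rule measurable_restrict_space1) (use m0 in simp)
 have w: "(%x. x powr (2*nu + 1)) : borel_measurable (restrict_space lborel {0<..<1::real})"
  by (rule measurable_restrict_space1) simp
 have two: "2*nu + 1 = 2*a" by simp
 have eq: "indicator {0<..<1} x *\<^sub>R (x powr (2*nu + 1) *\<^sub>R ?u x) = indicator ?I x *\<^sub>R ?k x" for x :: real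
 proof (cases "x : {0<..<1}")
  case True
  thus ?thesis unfolding ind two by (simp add: mult_ac)
 next
  case False
  have "x = 0" if "x : ?I"
   using I01[OF that] False by simp
  thus ?thesis using False by (auto simp: indicator_def)
 qed
 have si: "set_integrable lborel ?I ?k" by (rule borel_integrable_atLeastAtMost'[OF ck])
 have "integrable (restrict_space lborel {0<..<1}) (%x. x powr (2*nu + 1) *\<^sub>R ?u x)"
  by (subst integrable_restrict_space) (simp, unfold eq, rule si[unfolded set_integrable_def])
 thus "integrable (mu_nu nu) ?u"
  unfolding mu_nu_def by (intro integrable_density[OF m w, THEN iffD2] AE_I2) auto
 have "(bni (mu_nu nu) (%x. ?u x)) = (bni (restrict_space lborel {0<..<1}) (%x. x powr (2*nu + 1) *\<^sub>R ?u x))"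
  unfolding mu_nu_def by (rule integral_density[OF m w]) simp
 also have "... = (bni lborel (%x. indicator {0<..<1} x *\<^sub>R (x powr (2*nu + 1) *\<^sub>R ?u x)))"
  by (rule integral_restrict_space) simp
 also have "... = (bni lborel (%x. indicator ?I x *\<^sub>R ?k x))" unfolding eq ..
 also have "... = integral ?I ?k" using set_borel_integral_eq_integral(2)[OF si] by (simp add: set_lebesgue_integral_def)
 also have "... = integral ?I (%x. R powr (- (2*a)) * ((R * x) powr (2*a) * ph (R * x)))"
 proof (rule integral_cong)
  fix x assume "x : ?I"
  have "R powr (- (2*a)) * R powr (2*a) = 1" using R by (simp add: powr_add[symmetric])
  thus "?k x = R powr (- (2*a)) * ((R * x) powr (2*a) * ph (R * x))" by (simp add: powr_mult mult.assoc[symmetric])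
 qed
 also have "... = R powr (- (2*a)) * (integral {p..q'} (%x. x powr (2*a) * ph x) / R)"
 proof -
  have "continuous_on {p..q'} (%x. x powr (2*a) * ph x)"
   using a0 p by (intro continuous_on_mult ph continuous_on_powr' continuous_intros) auto
  from integral_scale[OF R this] show ?thesis by simp
 qed
 also have "... = R powr (- (2*a + 1)) * integral {p..q'} (%x. x powr (2*a) * ph x)"
 proof -
  have "R powr (- (2*a) - 1) = R powr (- (2*a)) / R powr 1" by (rule powr_diff)
  moreover have "- (2*a + 1) = - (2*a) - 1" by simp
  ultimately have "R powr (- (2*a + 1)) = R powr (- (2*a)) / R" using R by (simp only:) simp
  thus ?thesis by simp
 qed
 finally show "(bni (mu_nu nu) (%x. ?u x)) = R powr (- (2*a + 1)) * integral {p..q'} (%x. x powr (2*a) * ph x)" .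
qed

text \<open>The Hankel transform, with E_nu as kernel, of the function cut off to [p, q'].\<close>

definition tr :: "(real => real) => real => real => real => real" where
 "tr ph p q' t = integral {p..q'} (%x. x powr (2*a) * (ph x * rE nu (t * x)))"

lemma continuous_tr:
 assumes a0: "a > 0" and p: "0 <= p" and ph: "continuous_on {p..q'} ph"
 shows "continuous_on S (tr ph p q')"
proof -
 have "continuous_on (S \<times> cbox p q') (%(t, x). x powr (2*a) * (ph x * rE nu (t * x)))"
  unfolding split_beta
  using a0 p
  by (intro continuous_on_mult continuous_on_powr' continuous_on_compose2[OF ph] continuous_on_compose2[OF continuous_rE[of UNIV]] continuous_intros) auto
 from integral_continuous_on_param[OF this] show ?thesis by (simp add: tr_def[abs_def])
qed

definition pc :: "nat => real" where "pc j = sqrt 2/\<bar>dj j\<bar>"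

lemma psi_pc: "x > 0 ==> psi nu (Suc j) x = pc j * rE nu (bz (Suc j) * x)"
 unfolding pc_def dj_def by (rule psi_eq[OF nu bz_pos])

lemma pc_square: "pc j * pc j = cj j"
 by (simp add: pc_def cj_def power2_eq_square)

lemma coeff_scaled:
 assumes a0: "a > 0" and R: "R > 0" and p: "0 <= p" "q' < R" and ph: "continuous_on {p..q'} ph"
 shows "coeff_a nu (Suc j) (%x. ph (R * x) * indicator {p..q'} (R * x))
  = pc j * (R powr (- (2*a + 1)) * tr ph p q' (bz (Suc j) / R))"
proof -
 let ?t = "bz (Suc j) / R"
 have "coeff_a nu (Suc j) (%x. ph (R * x) * indicator {p..q'} (R * x))
  = (bni (mu_nu nu) (%x. pc j * ((ph (R * x) * rE nu (?t * (R * x))) * indicator {p..q'} (R * x))))"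
  unfolding coeff_a_def
  by (rule Bochner_Integration.integral_cong) (use R in "auto simp: space_mu_nu psi_pc")
 also have "... = pc j * (R powr (- (2*a + 1)) * tr ph p q' ?t)"
 proof -
  have "continuous_on {p..q'} (%x. ph x * rE nu (?t * x))"
   by (intro continuous_on_mult ph continuous_on_compose2[OF continuous_rE[of UNIV]] continuous_intros) auto
  from mu_nu_scaled(2)[OF a0 R p this] show ?thesis unfolding tr_def by simp
 qed
 finally show ?thesis .
qed

text \<open>Linearity alone. R is the zero with index N + 1, so exactly the zeros with indices 1 to
  N contribute; the weight at R itself is 0.\<close>

lemma bilinear_form:
 fixes N :: nat
 assumes delta: "delta > 0" and u: "integrable (mu_nu nu) u" and v: "integrable (mu_nu nu) v"
 defines "R \<equiv> bz (Suc N)"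
 shows "integrable (mu_nu nu) (%x. bochner_riesz nu delta R u x * v x)"
  "(bni (mu_nu nu) (%x. bochner_riesz nu delta R u x * v x))
   = (\<Sum>j<N. (1 - (bz (Suc j) / R)\<^sup>2) powr delta * coeff_a nu (Suc j) u * coeff_a nu (Suc j) v)"
proof -
 have R: "R > 0" using bz_pos by (simp add: R_def)
 define w where "w j = max 0 (1 - (bz (Suc j))\<^sup>2/R\<^sup>2) powr delta" for j
 have w0: "w j = 0" if "\<not> j < N" for j
 proof -
  have "R <= bz (Suc j)" unfolding R_def using that strict_mono_less_eq[OF strict_mono_bz, of "Suc N" "Suc j"] by simp
  hence "R\<^sup>2 <= (bz (Suc j))\<^sup>2" using R by (intro power_mono) auto
  hence "1 - (bz (Suc j))\<^sup>2/R\<^sup>2 <= 0" using R by (simp add: field_simps)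
  thus ?thesis by (simp add: w_def)
 qed
 have w1: "w j = (1 - (bz (Suc j) / R)\<^sup>2) powr delta" if "j < N" for j
 proof -
  have "bz (Suc j) <= R" unfolding R_def using that strict_mono_less_eq[OF strict_mono_bz, of "Suc j" "Suc N"] by simp
  hence "(bz (Suc j))\<^sup>2 <= R\<^sup>2" using bz_pos[of j] by (intro power_mono) auto
  hence "0 <= 1 - (bz (Suc j))\<^sup>2/R\<^sup>2" using R by (simp add: field_simps)
  thus ?thesis by (simp add: w_def power_divide)
 qed
 have B: "bochner_riesz nu delta R u x * v x = (\<Sum>j<N. (w j * coeff_a nu (Suc j) u) * (v x * psi nu (Suc j) x))" for x
 proof -
  have eq: "bochner_riesz nu delta R u x = (\<Sum>j<N. w j * coeff_a nu (Suc j) u * psi nu (Suc j) x)"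
   unfolding bochner_riesz_def w_def[symmetric] by (rule suminf_finite) (auto simp: w0)
  show ?thesis unfolding eq sum_distrib_right by (intro sum.cong refl) (simp only: mult_ac)
 qed
 show "integrable (mu_nu nu) (%x. bochner_riesz nu delta R u x * v x)"
  unfolding B by (intro Bochner_Integration.integrable_sum integrable_mult_right integrable_mult_psi v)
 have "(bni (mu_nu nu) (%x. bochner_riesz nu delta R u x * v x)) = (\<Sum>j<N. (bni (mu_nu nu) (%x. (w j * coeff_a nu (Suc j) u) * (v x * psi nu (Suc j) x))))"
  unfolding B by (intro Bochner_Integration.integral_sum integrable_mult_right integrable_mult_psi v)
 also have "... = (\<Sum>j<N. w j * coeff_a nu (Suc j) u * coeff_a nu (Suc j) v)"
  unfolding Bochner_Integration.integral_mult_right_zero coeff_a_def ..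
 also have "... = (\<Sum>j<N. (1 - (bz (Suc j) / R)\<^sup>2) powr delta * coeff_a nu (Suc j) u * coeff_a nu (Suc j) v)"
  by (intro sum.cong refl) (simp add: w1)
 finally show "(bni (mu_nu nu) (%x. bochner_riesz nu delta R u x * v x))
   = (\<Sum>j<N. (1 - (bz (Suc j) / R)\<^sup>2) powr delta * coeff_a nu (Suc j) u * coeff_a nu (Suc j) v)" .
qed

definition bil :: "real => real => real => (real => real) => real => real" where
 "bil delta eps X g t = (1 - t\<^sup>2) powr delta * tr g 1 X t * tr (%_. 1) 0 eps t"

text \<open>Each coefficient is R^{-(2a+1)} times a transform evaluated at s_j/R times
  \<open>pc j\<close>, and the square of \<open>pc j\<close> is the spectral weight. After
  multiplication by R^{2a+1} this is the sum treated by \<open>spectral_sum_tendsto\<close>.\<close>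

lemma bilinear_tendsto:
 assumes a0: "a > 0" and delta: "delta > 0" and g: "continuous_on {1..X} g"
 shows "(%N. bz (Suc N) powr (2*a + 1) * (\<Sum>j<N. (1 - (bz (Suc j) / bz (Suc N))\<^sup>2) powr delta
    * coeff_a nu (Suc j) (%x. g (bz (Suc N) * x) * indicator {1..X} (bz (Suc N) * x))
    * coeff_a nu (Suc j) (%x. 1*indicator {0..eps} (bz (Suc N) * x))))
  \<longlonglongrightarrow> 1/(2*pi * (norm beta)\<^sup>2) * integral {0..1} (%t. bil delta eps X g t * t powr (2*a))"
proof -
 have c: "continuous_on {0..1} (bil delta eps X g)"
  unfolding bil_def[abs_def]
 proof (intro continuous_on_mult continuous_tr a0 g continuous_on_powr' continuous_intros ballI)
  fix t :: real assume "t : {0..1}"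
  thus "0 <= 1 - t\<^sup>2 & (1 - t\<^sup>2 = 0 \<longrightarrow> 0 < delta)" using delta by (auto simp: power_le_one)
 qed auto
 note lim = spectral_sum_tendsto[OF a0 c]
 have "\<forall>\<^sub>F N in sequentially. bz (Suc N) > max X eps"
  using bz_at_top unfolding filterlim_at_top_dense by blast
 hence "\<forall>\<^sub>F N in sequentially. (\<Sum>j<N. bil delta eps X g (bz (Suc j) / bz (Suc N)) * cj j) / bz (Suc N) powr (2*a + 1)
  = bz (Suc N) powr (2*a + 1) * (\<Sum>j<N. (1 - (bz (Suc j) / bz (Suc N))\<^sup>2) powr delta
    * coeff_a nu (Suc j) (%x. g (bz (Suc N) * x) * indicator {1..X} (bz (Suc N) * x))
    * coeff_a nu (Suc j) (%x. 1*indicator {0..eps} (bz (Suc N) * x)))"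
 proof eventually_elim
  case (elim N)
  define R where "R = bz (Suc N)"
  have R: "R > 0" "X < R" "eps < R" using elim bz_pos[of N] by (auto simp: R_def)
  define P where "P = R powr (2*a + 1)"
  have P: "P > 0" "R powr (- (2*a + 1)) = 1/P" using R by (simp_all only: P_def powr_minus_divide) auto
  have 1: "coeff_a nu (Suc j) (%x. g (R * x) * indicator {1..X} (R * x)) = pc j * (1/P * tr g 1 X (bz (Suc j) / R))" for j
   unfolding P(2)[symmetric] by (rule coeff_scaled[OF a0 R(1) _ R(2) g]) simp
  have 2: "coeff_a nu (Suc j) (%x. 1*indicator {0..eps} (R * x)) = pc j * (1/P * tr (%_. 1) 0 eps (bz (Suc j) / R))" for j
   unfolding P(2)[symmetric] by (rule coeff_scaled[OF a0 R(1) _ R(3), of 0 "%_. 1"]) auto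
  have alg: "P * (d * (c * (1/P * x)) * (c * (1/P * y))) = (d * x * y) * (c * c) / P" for c d x y :: real
   using P by (simp add: field_simps)
  show ?case unfolding R_def[symmetric] 1 2 sum_distrib_left P_def[symmetric] sum_divide_distrib alg pc_square bil_def ..
 qed
 from Lim_transform_eventually[OF lim this] show ?thesis .
qed

text \<open>Power series of the transform of the indicator of [0, eps]: each Taylor coefficient of
  E_nu is integrated against x^{2a}. The powers of eps make all but the constant term small.\<close>

lemma source_transform:
 assumes a0: "a > 0" and eps: "eps > 0"
 shows "(%m. eps powr (2*a + 1) * (bcoef nu m * (eps / 2) ^ (2*m) / (2*a + 1 + 2*real m)) * t ^ (2*m)) sums tr (%_. 1) 0 eps t"
proof -
 define h where "h m = bcoef nu m * (t * eps / 2) ^ (2*m)" for m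
 have hs: "summable (%m. \<bar>h m\<bar>)"
 proof -
  have "\<bar>h m\<bar> = \<bar>bcoef nu m\<bar> * ((t * eps / 2)\<^sup>2) ^ m" for m
   unfolding h_def abs_mult power_mult by (simp only: abs_of_nonneg zero_le_power zero_le_power2)
  thus ?thesis using rE_summable[OF nu, of "(t * eps / 2)\<^sup>2"] by simp
 qed
 have w: "continuous_on {0..1} (%r::real. r powr (2*a))" using a0 by (intro continuous_on_powr' continuous_intros) auto
 have mom: "integral {0..1} (%r::real. r powr (2*a) * r ^ (2*m)) = 1/(2*a + 1 + 2*real m)" for m
 proof -
  have base: "((%r::real. r powr (2*a + 2*real m)) has_integral (1 powr (2*a + 2*real m + 1) / (2*a + 2*real m + 1))) {0..1}"
   using a0 by (intro has_integral_powr_from_0) auto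
  have eq: "r powr (2*a) * r ^ (2*m) = r powr (2*a + 2*real m)" if "r : {0..1}" for r :: real
  proof (cases "r = 0")
   case False
   hence "r powr real (2*m) = r ^ (2*m)" using that by (intro powr_realpow) auto
   thus ?thesis by (simp add: powr_add)
  qed (use a0 in simp)
  have "((%r::real. r powr (2*a) * r ^ (2*m)) has_integral (1 powr (2*a + 2*real m + 1) / (2*a + 2*real m + 1))) {0..1}"
   by (rule has_integral_eq[OF _ base]) (rule eq[symmetric])
  thus ?thesis by (simp add: integral_unique add_ac)
 qed
 have ser: "(\<Sum>m. h m * r ^ (2*m)) = rE nu (t * eps * r)" for r
  using rE_sums[OF nu, of "t * eps * r"] by (simp add: sums_iff h_def power_mult_distrib power_divide mult_ac)
 have s: "(%m. h m * (1/(2*a + 1 + 2*real m))) sums integral {0..1} (%r. r powr (2*a) * rE nu (t * eps * r))"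
  using integral_even_series[OF w hs] unfolding mom ser .
 have R: "1/eps > 0" using eps by simp
 have cg: "continuous_on {0..1} (%r. r powr (2*a) * rE nu (t * eps * r))"
  by (intro continuous_on_mult w continuous_on_compose2[OF continuous_rE[of UNIV]] continuous_intros) auto
 have "tr (%_. 1) 0 eps t = integral {0..eps} (%x. eps powr (2*a) * ((1/eps * x) powr (2*a) * rE nu (t * eps * (1/eps * x))))"
  unfolding tr_def using eps by (intro integral_cong) (simp add: powr_divide)
 also have "... = eps powr (2*a) * (integral {0..1} (%r. r powr (2*a) * rE nu (t * eps * r)) * eps)"
  using integral_scale[OF R cg] eps by simp
 also have "... = eps powr (2*a + 1) * integral {0..1} (%r. r powr (2*a) * rE nu (t * eps * r))"
 proof -
  have q: "eps powr (2*a + 1) = eps powr (2*a) * eps" using eps by (simp only: powr_add powr_one less_imp_le)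
  show ?thesis unfolding q by (simp only: mult_ac)
 qed
 finally have T: "tr (%_. 1) 0 eps t = eps powr (2*a + 1) * integral {0..1} (%r. r powr (2*a) * rE nu (t * eps * r))" .
 have eqm: "eps powr (2*a + 1) * (bcoef nu m * (eps / 2) ^ (2*m) / (2*a + 1 + 2*real m)) * t ^ (2*m)
  = eps powr (2*a + 1) * (h m * (1/(2*a + 1 + 2*real m)))" for m
  by (simp add: h_def power_mult_distrib power_divide)
 show ?thesis unfolding T eqm by (rule sums_mult[OF s])
qed

end

section \<open>Logarithmic growth of the limiting form\<close>

lemma ln_not_bounded:
 fixes k D X0 :: real
 assumes k: "k > 0" and h: "!!X. X >= X0 ==> X >= 1 ==> k * ln X <= D"
 shows False
proof -
 define X where "X = max (max X0 1) (exp (D / k + 1))"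
 have "X >= X0" "X >= 1" "X > 0" by (auto simp: X_def)
 moreover have "ln (exp (D / k + 1)) <= ln X" using \<open>X > 0\<close> by (subst ln_le_cancel_iff) (auto simp: X_def)
 ultimately have "k * (D / k + 1) <= k * ln X" "k * ln X <= D" using k h[of X] by (auto intro!: mult_left_mono)
 hence "k * (D / k + 1) <= D" by (rule order_trans)
 thus False using k by (simp add: distrib_left)
qed

lemma weighted_Young:
 fixes u v tt P :: real
 assumes P: "P > 1" and tt: "tt > 0" and Q: "Q = P / (P - 1)"
 shows "\<bar>u * v\<bar> <= tt powr P * \<bar>u\<bar> powr P + tt powr (- Q) * \<bar>v\<bar> powr Q"
proof -
 have q1: "Q > 1" "1/P + 1/Q = 1" using P by (auto simp: Q field_simps)
 have "\<bar>u * v\<bar> = (tt * \<bar>u\<bar>) * (\<bar>v\<bar> / tt)" using tt by (simp add: abs_mult)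
 also have "... <= (tt * \<bar>u\<bar>) powr P / P + (\<bar>v\<bar> / tt) powr Q / Q"
  by (rule Youngs_inequality) (use P q1 tt in auto)
 also have "... <= (tt * \<bar>u\<bar>) powr P + (\<bar>v\<bar> / tt) powr Q"
 proof -
  have le: "z / r <= z" if "z >= 0" "r >= 1" for z r :: real
   using mult_left_mono[of 1 r z] that by (simp add: pos_divide_le_eq)
  show ?thesis using P q1 by (intro add_mono le) auto
 qed
 also have "... = tt powr P * \<bar>u\<bar> powr P + tt powr (- Q) * \<bar>v\<bar> powr Q"
  by (simp add: powr_mult powr_divide powr_minus_divide)
 finally show ?thesis .
qed

lemma epow_inverse: "r > 0 ==> epow (epow v (1/r)) r = v"
proof (cases v)
 case (real t)
 assume "r > 0"
 thus ?thesis using real by (simp add: epow_ennreal powr_powr)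
qed (simp add: epow_def)

context bessel_jost
begin

text \<open>By Sonine, E_{nu+delta+1}(x) is a multiple of the response of the multiplier (1 -
  t^2)^delta to a point source at 0. The power x^{2delta+1} brings the size to x^{delta-a}. At p =
  p1 its p-th power times x^{2a} is of order 1/x, and so is its product with the response times
  x^{2a}.\<close>

definition dual_source :: "real => real => real" where
 "dual_source delta x = x powr (2*delta + 1) * rE (nu + delta + 1) x"

lemma continuous_dual_source:
 assumes "a > 0" "delta > 0" "0 < p" shows "continuous_on {p..q'} (dual_source delta)"
 unfolding dual_source_def[abs_def] using assms nu
 by (intro continuous_on_mult continuous_on_powr' continuous_on_rE continuous_intros) auto

lemma dual_source_bound:
 assumes a0: "a > 0" and delta: "delta > 0"
 obtains C where "C > 0" "!!x. x > 0 ==> \<bar>rE (nu + delta + 1) x\<bar> <= C * x powr (- (a + delta + 1))"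
  "!!x. x > 0 ==> \<bar>dual_source delta x\<bar> <= C * x powr (delta - a)"
proof -
 have "nu + delta + 1 > -1/2" "0 <= a + delta + 1" "a + delta + 1 <= (nu + delta + 1) + 1/2" using a0 delta by auto
 from rE_decay[OF this] obtain C where C: "C > 0" "!!x. x > 0 ==> \<bar>rE (nu + delta + 1) x\<bar> <= C * x powr (- (a + delta + 1))" by blast
 show thesis
 proof (rule that[OF C])
  fix x :: real assume x: "x > 0"
  have "\<bar>dual_source delta x\<bar> <= x powr (2*delta + 1) * (C * x powr (- (a + delta + 1)))"
   unfolding dual_source_def using C(2)[OF x] by (simp add: abs_mult mult_left_mono)
  also have "... = C * (x powr (2*delta + 1) * x powr (- (a + delta + 1)))" by simp
  also have "x powr (2*delta + 1) * x powr (- (a + delta + 1)) = x powr (delta - a)"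
  proof -
   have e: "delta - a = (2*delta + 1) + (- (a + delta + 1))" by simp
   show ?thesis unfolding e by (rule powr_add[symmetric])
  qed
  finally show "\<bar>dual_source delta x\<bar> <= C * x powr (delta - a)" .
 qed
qed

text \<open>Fubini on a compact rectangle, and expansion of the transformed bump in even powers of
  t. Each power produces one of the moments \<open>Snu\<close>.\<close>

lemma bil_integral_swap:
 assumes a0: "a > 0" and delta: "delta > 0" and eps: "eps > 0" and X: "X >= 1"
  and kK: "!!t. (%m. eps powr (2*a + 1) * k m * t ^ (2*m)) sums tr (%_. 1) 0 eps t"
  and k: "summable (%m. \<bar>k m\<bar>)"
 shows "integral {0..1} (%t. bil delta eps X (dual_source delta) t * t powr (2*a))
  = eps powr (2*a + 1) * integral {1..X} (%x. x powr (2*a) * dual_source delta x * (\<Sum>m. k m * Snu nu m delta x))"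
proof -
 let ?g = "dual_source delta" let ?T = "tr (%_. 1) 0 eps" let ?E = "eps powr (2*a + 1)"
 have E: "?E > 0" using eps by simp
 have two: "2*nu + 1 = 2*a" by simp
 have nu2: "nu > -1/2" using a0 by simp
 define Ph where "Ph t x = x powr (2*a) * (?g x * rE nu (t * x)) * ((1 - t\<^sup>2) powr delta * ?T t * t powr (2*a))" for t x
 have gc: "continuous_on {1..X} ?g" by (rule continuous_dual_source[OF a0 delta]) simp
 have "integral {0..1} (%t. bil delta eps X ?g t * t powr (2*a)) = integral {0..1} (%t. integral {1..X} (Ph t))"
 proof (rule integral_cong)
  fix t
  have "bil delta eps X ?g t * t powr (2*a) = tr ?g 1 X t * ((1 - t\<^sup>2) powr delta * ?T t * t powr (2*a))"
   unfolding bil_def by (simp only: mult_ac)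
  thus "bil delta eps X ?g t * t powr (2*a) = integral {1..X} (Ph t)"
   unfolding Ph_def tr_def[of ?g] by (simp only: integral_mult_left)
 qed
 also have "... = integral {1..X} (%x. integral {0..1} (%t. Ph t x))"
 proof -
  have "continuous_on (cbox (0::real, 1::real) (1, X)) (%(t, x). Ph t x)"
   unfolding Ph_def split_beta
  proof (intro continuous_on_mult continuous_on_powr' continuous_on_compose2[OF gc] continuous_on_compose2[OF continuous_rE[of UNIV]]
    continuous_on_compose2[OF continuous_tr[OF a0 order_refl continuous_on_const, of UNIV]] continuous_intros ballI)
   fix z :: "real \<times> real" assume "z : cbox (0, 1) (1, X)"
   hence "0 <= fst z" "fst z <= 1" by (auto simp: cbox_Pair_eq)
   thus "0 <= 1 - (fst z)\<^sup>2 & (1 - (fst z)\<^sup>2 = 0 \<longrightarrow> 0 < delta)" using delta by (auto simp: power_le_one)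
  qed (use a0 in "auto simp: cbox_Pair_eq")
  from integral_swap_continuous[OF this] show ?thesis by simp
 qed
 also have "... = integral {1..X} (%x. ?E * (x powr (2*a) * ?g x * (\<Sum>m. k m * Snu nu m delta x)))"
 proof (rule integral_cong)
  fix x assume x: "x : {1..X}"
  define w where "w = (%t::real. (1 - t\<^sup>2) powr delta * t powr (2*nu + 1) * rE nu (x * t))"
  have wc: "continuous_on {0..1} w"
   unfolding w_def using nu2 delta
   by (intro continuous_on_mult[OF continuous_weight] continuous_on_compose2[OF continuous_rE[of UNIV]] continuous_intros) auto
  have S: "(%m. k m * Snu nu m delta x) sums integral {0..1} (%t. w t * (\<Sum>m. k m * t ^ (2*m)))"
   using integral_even_series[OF wc k] unfolding w_def Snu_def .
  have K: "?T t = ?E * (\<Sum>m. k m * t ^ (2*m))" for t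
  proof -
   have "(%m. (1/?E) * (?E * k m * t ^ (2*m))) sums ((1/?E) * ?T t)" by (rule sums_mult[OF kK])
   moreover have "(1/?E) * (?E * k m * t ^ (2*m)) = k m * t ^ (2*m)" for m using eps by simp
   ultimately have "(\<Sum>m. k m * t ^ (2*m)) = (1/?E) * ?T t" by (simp only: sums_iff)
   thus ?thesis using E by simp
  qed
  have "integral {0..1} (%t. Ph t x) = integral {0..1} (%t. (?E * (x powr (2*a) * ?g x)) * (w t * (\<Sum>m. k m * t ^ (2*m))))"
   unfolding Ph_def K w_def two by (intro integral_cong) (simp add: mult_ac)
  also have "... = (?E * (x powr (2*a) * ?g x)) * (\<Sum>m. k m * Snu nu m delta x)"
   using S by (simp add: sums_iff)
  finally show "integral {0..1} (%t. Ph t x) = ?E * (x powr (2*a) * ?g x * (\<Sum>m. k m * Snu nu m delta x))" by simp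
 qed
 also have "... = ?E * integral {1..X} (%x. x powr (2*a) * ?g x * (\<Sum>m. k m * Snu nu m delta x))" by (rule integral_mult_right)
 finally show ?thesis .
qed

text \<open>The zeroth moment gives the main term, a positive multiple of W(x)^2/x with W bounded
  and not small at both x and x + pi/2. The remaining moments carry a factor eps^2 and are absorbed
  by choosing eps small, leaving half of the logarithm.\<close>

lemma form_lower_bound:
 assumes a0: "a > 0" and delta: "delta > 0"
 obtains eps k0 k1 X0 where "0 < eps" "eps <= 1" "k0 > 0"
  "!!X. X >= X0 ==> X >= 1 ==> integral {0..1} (%t. bil delta eps X (dual_source delta) t * t powr (2*a)) >= k0*ln X - k1"
proof -
 define s where "s = 2*a + 1"
 define A where "A = a + delta + 1"
 define \<mu> where "\<mu> = nu + delta + 1"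
 have s: "s > 0" and A0: "A > 0" using a0 delta by (auto simp: s_def A_def)
 have nu2: "nu > -1/2" using a0 by simp
 have mu: "\<mu> > -1" "\<mu> + 1/2 = A" using nu delta by (auto simp: \<mu>_def A_def)
 obtain CW where CW: "CW > 0" "!!x. x > 0 ==> \<bar>rE \<mu> x\<bar> <= CW * x powr (- A)"
  using dual_source_bound[OF a0 delta] unfolding \<mu>_def A_def by metis
 define W where "W x = x powr A * rE \<mu> x" for x
 have rW: "rE \<mu> x = x powr (- A) * W x" if "x > 0" for x
 proof -
  have "x powr (- A) * x powr A = 1" using that by (simp add: powr_add[symmetric])
  thus ?thesis unfolding W_def mult.assoc[symmetric] by simp
 qed
 have Wb: "\<bar>W x\<bar> <= CW" if x: "x > 0" for x
 proof -
  have "\<bar>W x\<bar> <= x powr A * (CW * x powr (- A))" unfolding W_def using CW(2)[OF x] by (simp add: abs_mult mult_left_mono)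
  also have "... = CW * (x powr A * x powr (- A))" by simp
  also have "x powr A * x powr (- A) = 1" using x by (simp add: powr_add[symmetric])
  finally show ?thesis by simp
 qed
 obtain c M where c: "c > 0" "M >= 1" "!!x. x >= M ==> (W x)\<^sup>2 + (W (x + pi / 2))\<^sup>2 >= c"
  using rE_oscillation[OF mu(1)] unfolding mu(2) W_def by metis
 obtain CS where CS: "CS > 0" "!!m x. x > 0 ==> \<bar>Snu nu m delta x\<bar> <= CS * (7/3) ^ m * x powr (- A)"
 proof (rule Snu_bound[OF nu2 delta])
  fix C assume C: "C > 0" "!!m x. x > 0 ==> \<bar>Snu nu m delta x\<bar> <= C * (7/3) ^ m * x powr (- (nu + 3/2 + delta))"
  have e: "A = nu + 3/2 + delta" by (simp add: A_def)
  show thesis by (rule that[OF C(1)]) (unfold e, rule C(2))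
 qed
 define G0 where "G0 = bmom delta (2*nu + 1) * Gamma (nu + delta + 2) / Gamma (nu + 1)"
 have S0: "Snu nu 0 delta x = G0*rE \<mu> x" for x unfolding G0_def \<mu>_def by (rule Sonine[OF nu2 delta])
 have gam: "Gamma (nu + 1) > 0" "Gamma (nu + delta + 2) > 0" using nu delta by (auto intro!: Gamma_real_pos)
 have G0: "G0 > 0"
 proof -
  have "0 < (3/4) powr delta * (1/4) powr (2*nu + 1) / (4::real)" by simp
  also have "... <= bmom delta (2*nu + 1)" using a0 delta by (intro bmom_bounds) auto
  finally show ?thesis using gam by (simp add: G0_def)
 qed
 define b0 where "b0 = bcoef nu 0 / s"
 have b0: "b0 > 0" using gam s by (simp add: b0_def bcoef_def)
 define Sg where "Sg = (\<Sum>m. \<bar>bcoef nu m\<bar> * (7/12) ^ m)"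
 have sm: "summable (%m. \<bar>bcoef nu m\<bar> * (7/12) ^ m)" by (rule rE_summable[OF nu])
 have Sg: "Sg >= 0" unfolding Sg_def by (rule suminf_nonneg[OF sm]) simp
 define E where "E = CS / s * Sg"
 have E: "E >= 0" using CS(1) s Sg by (simp add: E_def)
 define g0 where "g0 = b0*G0"
 have g0: "g0 > 0" using b0 G0 by (simp add: g0_def)
 \<comment> \<open>Chosen so that the error eps^2 E CW is at most g0 c/4, half the coefficient g0
   c/2 that \<open>log_lower_bound\<close> yields.\<close>
 define eps where "eps = min 1 (sqrt (g0*c / (4*(E * CW + 1))))"
 have den: "E * CW + 1 > 0" using E CW by (simp add: add_nonneg_pos)
 have arg: "g0*c / (4*(E * CW + 1)) > 0" using g0 c(1) den by simp
 have eps: "0 < eps" "eps <= 1" using arg by (auto simp: eps_def)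
 have eps2: "eps\<^sup>2*(E * CW) <= g0*c / 4"
 proof -
  have "eps\<^sup>2 <= (sqrt (g0*c / (4*(E * CW + 1))))\<^sup>2" using eps by (intro power_mono) (auto simp: eps_def)
  hence "eps\<^sup>2 <= g0*c / (4*(E * CW + 1))" using arg by simp
  hence "eps\<^sup>2*(E * CW + 1) <= g0*c / (4*(E * CW + 1)) * (E * CW + 1)" using den by (intro mult_right_mono) auto
  also have "z / (4*d) * d = z / 4" if "d > 0" for z d :: real using that by simp
  note this[OF den]
  finally have "eps\<^sup>2*(E * CW + 1) <= g0*c / 4" .
  moreover have "eps\<^sup>2*(E * CW) <= eps\<^sup>2*(E * CW + 1)" by (intro mult_left_mono) auto
  ultimately show ?thesis by linarith
 qed
 define k where "k m = bcoef nu m * (eps / 2) ^ (2*m) / (s + 2*real m)" for m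
 \<comment> \<open>The growth (7/3)^m of the moments meets (eps/2)^{2m}, giving (7/12)^m eps^{2m};
   for m >= 1 one factor eps^2 is kept.\<close>
 have kb: "\<bar>k m\<bar> * (7/3) ^ m <= (if m = 0 then 1 else eps\<^sup>2) / s * (\<bar>bcoef nu m\<bar> * (7/12) ^ m)" for m
 proof -
  have q2: "(eps / 2)\<^sup>2*(7/3) = eps\<^sup>2*(7/12)" by (simp add: power_divide)
  have "(eps / 2) ^ (2*m) * (7/3) ^ m = (eps\<^sup>2*(7/12)) ^ m"
   unfolding q2[symmetric] power_mult by (rule power_mult_distrib[symmetric])
  also have "... = (eps\<^sup>2) ^ m * (7/12) ^ m" by (rule power_mult_distrib)
  also have "... <= (if m = 0 then 1 else eps\<^sup>2) * (7/12) ^ m"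
  proof (intro mult_right_mono)
   have "(eps\<^sup>2) ^ m <= (eps\<^sup>2) ^ 1" if "m ~= 0" using that eps by (intro power_decreasing) (auto simp: power_le_one)
   thus "(eps\<^sup>2) ^ m <= (if m = 0 then 1 else eps\<^sup>2)" by simp
  qed simp
  finally have 1: "(eps / 2) ^ (2*m) * (7/3) ^ m <= (if m = 0 then 1 else eps\<^sup>2) * (7/12) ^ m" .
  have ab: "\<bar>k m\<bar> = \<bar>bcoef nu m\<bar> * (eps / 2) ^ (2*m) / (s + 2*real m)"
   using s eps by (simp add: k_def abs_mult)
  have "\<bar>k m\<bar> * (7/3) ^ m <= \<bar>bcoef nu m\<bar> * (eps / 2) ^ (2*m) / s * (7/3) ^ m"
   unfolding ab using s eps by (intro mult_right_mono divide_left_mono) auto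
  also have "... = \<bar>bcoef nu m\<bar> / s * ((eps / 2) ^ (2*m) * (7/3) ^ m)" by simp
  also have "... <= \<bar>bcoef nu m\<bar> / s * ((if m = 0 then 1 else eps\<^sup>2) * (7/12) ^ m)" using s by (intro mult_left_mono 1) auto
  finally show ?thesis by (simp add: mult_ac)
 qed
 have ksum: "summable (%m. \<bar>k m\<bar>)"
 proof (rule summable_comparison_test'[OF summable_mult[OF sm, of "1 / s"], of 0])
  fix m
  have "\<bar>k m\<bar> * 1 <= \<bar>k m\<bar> * (7/3) ^ m" by (intro mult_left_mono) auto
  also have "... <= (if m = 0 then 1 else eps\<^sup>2) / s * (\<bar>bcoef nu m\<bar> * (7/12) ^ m)" by (rule kb)
  also have "... <= 1 / s * (\<bar>bcoef nu m\<bar> * (7/12) ^ m)"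
   using s eps by (intro mult_right_mono divide_right_mono) (auto simp: power_le_one)
  finally show "norm \<bar>k m\<bar> <= 1 / s * (\<bar>bcoef nu m\<bar> * (7/12) ^ m)" by simp
 qed
 define H where "H x = (\<Sum>m. k m * Snu nu m delta x)" for x
 have Hs: "summable (%m. k m * Snu nu m delta x)" and Herr: "\<bar>H x - g0*rE \<mu> x\<bar> <= eps\<^sup>2*E * x powr (- A)" if x: "x > 0" for x
 proof -
  have tb: "\<bar>k m * Snu nu m delta x\<bar> <= (if m = 0 then 1 else eps\<^sup>2) * (CS / s * x powr (- A)) * (\<bar>bcoef nu m\<bar> * (7/12) ^ m)" for m
  proof -
   have "\<bar>k m * Snu nu m delta x\<bar> <= \<bar>k m\<bar> * (CS * (7/3) ^ m * x powr (- A))"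
    unfolding abs_mult by (intro mult_left_mono CS(2)[OF x]) simp
   also have "... = (CS * x powr (- A)) * (\<bar>k m\<bar> * (7/3) ^ m)" by simp
   also have "... <= (CS * x powr (- A)) * ((if m = 0 then 1 else eps\<^sup>2) / s * (\<bar>bcoef nu m\<bar> * (7/12) ^ m))"
    using CS(1) by (intro mult_left_mono kb) auto
   finally show ?thesis by (simp add: mult_ac)
  qed
  let ?d = "%m. k m * Snu nu m delta x - (if m = 0 then k m * Snu nu m delta x else 0)"
  have gs: "summable (%m. eps\<^sup>2*(CS / s * x powr (- A)) * (\<bar>bcoef nu m\<bar> * (7/12) ^ m))" by (rule summable_mult[OF sm])
  have db: "norm (?d m) <= eps\<^sup>2*(CS / s * x powr (- A)) * (\<bar>bcoef nu m\<bar> * (7/12) ^ m)" for m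
   using tb[of m] CS(1) s by (cases "m = 0") auto
  have ds: "summable ?d" by (rule summable_comparison_test'[OF gs, of 0]) (rule db)
  have single: "(%m. if m = 0 then k m * Snu nu m delta x else 0) sums (k 0*Snu nu 0 delta x)"
   using sums_single[of 0 "%m. k m * Snu nu m delta x"] by simp
  from sums_add[OF summable_sums[OF ds] single]
  have tot: "(%m. k m * Snu nu m delta x) sums (suminf ?d + k 0*Snu nu 0 delta x)" by simp
  thus "summable (%m. k m * Snu nu m delta x)" by (rule sums_summable)
  have "k 0*Snu nu 0 delta x = g0*rE \<mu> x" by (simp add: S0 k_def g0_def b0_def)
  hence "H x - g0*rE \<mu> x = suminf ?d" using tot by (simp add: H_def sums_iff)
  also have "norm (suminf ?d) <= (\<Sum>m. eps\<^sup>2*(CS / s * x powr (- A)) * (\<bar>bcoef nu m\<bar> * (7/12) ^ m))"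
   by (rule norm_suminf_le[OF db gs])
  also have "... = eps\<^sup>2*(CS / s * x powr (- A)) * Sg" unfolding Sg_def by (rule suminf_mult[OF sm])
  finally show "\<bar>H x - g0*rE \<mu> x\<bar> <= eps\<^sup>2*E * x powr (- A)" by (simp add: E_def mult_ac)
 qed
 define X0 where "X0 = M + pi / 2"
 have kK: "(%m. eps powr (2*a + 1) * k m * t ^ (2*m)) sums tr (%_. 1) 0 eps t" for t
  using source_transform[OF a0 eps(1), of t] unfolding k_def s_def .
 show thesis
 proof (rule that[OF eps])
  show "eps powr (2*a + 1) * (g0*c / 4) > 0" using eps g0 c(1) by simp
  fix X assume X: "X0 <= X" "X >= 1"
  have sw: "integral {0..1} (%t. bil delta eps X (dual_source delta) t * t powr (2*a))
   = eps powr (2*a + 1) * integral {1..X} (%x. x powr (2*a) * dual_source delta x * H x)"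
   unfolding H_def by (rule bil_integral_swap[OF a0 delta eps(1) X(2) kK ksum])
  let ?h = "%x. x powr (2*a) * dual_source delta x * H x"
  \<comment> \<open>Source and response contain the same Bessel function, so their product is a
    square; the powers of x combine to exactly 1/x.\<close>
  have pt: "g0*((W x)\<^sup>2/x) - (g0*c / 4) * (1/x) <= ?h x" if x: "x >= 1" for x
  proof -
   have x0: "x > 0" using x by simp
   have "x powr (2*a) * dual_source delta x = (x powr (2*a) * x powr (2*delta + 1)) * (x powr (- A) * W x)"
    unfolding dual_source_def \<mu>_def[symmetric] rW[OF x0] by simp
   also have "x powr (2*a) * x powr (2*delta + 1) = x powr (A + (A - 1))"
   proof -
    have e: "A + (A - 1) = 2*a + (2*delta + 1)" by (simp add: A_def)
    show ?thesis unfolding e by (rule powr_add[symmetric])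
   qed
   also have "x powr (A + (A - 1)) * (x powr (- A) * W x) = x powr (A - 1) * W x"
   proof -
    have one: "x powr A * x powr (- A) = 1" using x0 by (simp add: powr_add[symmetric])
    have "x powr (A + (A - 1)) = x powr A * x powr (A - 1)" by (rule powr_add)
    hence "x powr (A + (A - 1)) * (x powr (- A) * W x) = (x powr A * x powr (- A)) * (x powr (A - 1) * W x)"
     by (simp only: mult_ac)
    thus ?thesis unfolding one by simp
   qed
   finally have d: "x powr (2*a) * dual_source delta x = x powr (A - 1) * W x" .
   have pA: "x powr (A - 1) * x powr (- A) = 1/x"
   proof -
    have "x powr (A - 1) * x powr (- A) = x powr ((A - 1) + (- A))" by (rule powr_add[symmetric])
    also have "(A - 1) + (- A) = -1" by simp
    finally show ?thesis using x0 by (simp add: powr_minus_divide)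
   qed
   define e where "e = H x - g0*rE \<mu> x"
   have "?h x = x powr (A - 1) * W x * (g0*(x powr (- A) * W x) + e)" unfolding d e_def rW[OF x0] by simp
   also have "... = g0*((x powr (A - 1) * x powr (- A)) * (W x)\<^sup>2) + x powr (A - 1) * W x * e"
    by (simp add: algebra_simps power2_eq_square)
   finally have hx: "?h x = g0*((W x)\<^sup>2/x) + x powr (A - 1) * W x * e" unfolding pA by simp
   have "\<bar>x powr (A - 1) * W x * e\<bar> = x powr (A - 1) * (\<bar>W x\<bar> * \<bar>e\<bar>)" by (simp add: abs_mult)
   also have "... <= x powr (A - 1) * (CW * (eps\<^sup>2*E * x powr (- A)))"
    using Herr[OF x0] Wb[OF x0] CW(1) unfolding e_def by (intro mult_left_mono mult_mono) auto
   also have "... = eps\<^sup>2*(E * CW) * (x powr (A - 1) * x powr (- A))" by simp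
   also have "... <= (g0*c / 4) * (1/x)" unfolding pA using x0 by (intro mult_right_mono eps2) auto
   finally have "\<bar>x powr (A - 1) * W x * e\<bar> <= (g0*c / 4) * (1/x)" .
   thus ?thesis unfolding hx by linarith
  qed
  have Wc: "continuous_on {1..} W" unfolding W_def[abs_def] using mu(1)
   by (intro continuous_on_mult continuous_on_powr' continuous_on_rE continuous_intros) auto
  have i1: "(%x. (W x)\<^sup>2/x) integrable_on {1..X}"
   by (intro integrable_continuous_real continuous_intros continuous_on_subset[OF Wc]) auto
  have "((%x. 1/x) has_integral (ln X - ln 1)) {1..X}"
   by (intro fundamental_theorem_of_calculus)
    (use X in "auto intro!: derivative_eq_intros simp: has_real_derivative_iff_has_vector_derivative[symmetric]")
  hence i2: "((%x. 1/x) has_integral ln X) {1..X}" by simp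
  have low: "((%x. g0*((W x)\<^sup>2/x) - (g0*c / 4) * (1/x)) has_integral
    (g0*integral {1..X} (%x. (W x)\<^sup>2/x) - (g0*c / 4) * ln X)) {1..X}"
   by (intro has_integral_diff has_integral_mult_right i2 integrable_integral[OF i1])
  have ih: "?h integrable_on {1..X}"
  proof (rule integrable_continuous_real)
   have "continuous_on {1..X} H"
   proof -
    have unif: "uniform_limit {1..X} (%n x. \<Sum>m<n. k m * Snu nu m delta x) (%x. \<Sum>m. k m * Snu nu m delta x) sequentially"
    proof (rule Weierstrass_m_test)
     fix m x assume "x : {1..X}"
     hence x: "x >= 1" "x > 0" by auto
     have p1: "x powr (- A) <= 1" using x A0 powr_mono[of "- A" 0 x] by simp
     have "\<bar>k m\<bar> * \<bar>Snu nu m delta x\<bar> <= \<bar>k m\<bar> * (CS * (7/3) ^ m * 1)"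
      using CS(1) p1 by (intro mult_left_mono order_trans[OF CS(2)[OF x(2)]]) auto
     also have "... = CS * (\<bar>k m\<bar> * (7/3) ^ m)" by simp
     also have "... <= CS * (1 / s * (\<bar>bcoef nu m\<bar> * (7/12) ^ m))"
     proof -
      have "(if m = 0 then 1 else eps\<^sup>2) / s * (\<bar>bcoef nu m\<bar> * (7/12) ^ m) <= 1 / s * (\<bar>bcoef nu m\<bar> * (7/12) ^ m)"
       using s eps by (intro mult_right_mono divide_right_mono) (auto simp: power_le_one)
      thus ?thesis using CS(1) kb[of m] by (intro mult_left_mono) auto
     qed
     finally show "norm (k m * Snu nu m delta x) <= CS * (1 / s * (\<bar>bcoef nu m\<bar> * (7/12) ^ m))" by (simp add: abs_mult)
    qed (intro summable_mult sm)
    have "continuous_on {1..X} (%x. \<Sum>m<n. k m * Snu nu m delta x)" for n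
    proof (intro continuous_intros)
     fix m
     have "continuous_on ({1..X} \<times> cbox 0 1) (%(x, t::real). (1 - t\<^sup>2) powr delta * t powr (2*nu + 1) * rE nu (x * t) * t ^ (2*m))"
      unfolding split_beta
      by (intro continuous_on_mult continuous_on_compose2[OF continuous_weight[OF delta, of "2*nu + 1"], of _ snd, simplified]
        continuous_on_compose2[OF continuous_rE[of UNIV]] continuous_intros) (use a0 in auto)
     from integral_continuous_on_param[OF this] show "continuous_on {1..X} (Snu nu m delta)"
      by (simp add: Snu_def[abs_def])
    qed
    from uniform_limit_theorem[OF _ unif] this show ?thesis unfolding H_def[abs_def] by simp
   qed
   thus "continuous_on {1..X} ?h"
    using a0 by (intro continuous_on_mult continuous_on_powr' continuous_dual_source[OF a0 delta] continuous_intros) auto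
  qed
  have "g0*integral {1..X} (%x. (W x)\<^sup>2/x) - (g0*c / 4) * ln X <= integral {1..X} ?h"
   by (rule has_integral_le[OF low integrable_integral[OF ih]]) (use pt in auto)
  moreover have "c / 2*(ln X - ln X0) <= integral {1..X} (%x. (W x)\<^sup>2/x)"
   unfolding X0_def by (rule log_lower_bound[OF Wc c(2)]) (use c X in "auto simp: X0_def")
  hence "g0*(c / 2*(ln X - ln X0)) <= g0*integral {1..X} (%x. (W x)\<^sup>2/x)" using g0 by (intro mult_left_mono) auto
  moreover have "g0*(c / 2*(ln X - ln X0)) - (g0*c / 4) * ln X = g0*c / 4*ln X - g0*c / 2*ln X0"
   by (simp add: field_simps)
  ultimately have "g0*c / 4*ln X - g0*c / 2*ln X0 <= integral {1..X} ?h" by linarith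
  hence "eps powr (2*a + 1) * (g0*c / 4*ln X - g0*c / 2*ln X0) <= eps powr (2*a + 1) * integral {1..X} ?h"
   by (rule mult_left_mono) simp
  thus "eps powr (2*a + 1) * (g0*c / 4) * ln X - eps powr (2*a + 1) * (g0*c / 2*ln X0)
   <= integral {0..1} (%t. bil delta eps X (dual_source delta) t * t powr (2*a))"
   unfolding sw by (simp add: right_diff_distrib mult.assoc)
 qed
qed

end

section \<open>Failure of the inequality outside the stated range\<close>

context bessel_jost
begin

text \<open>The pointwise Young inequality, the value at one R being below the maximal function. The
  parameter \<open>tt\<close> stays free, so that either of the two terms can be made small at the
  expense of the other.\<close>

lemma finite_pairing:
 assumes delta: "delta > 0" and p: "1 < p" "p ~= \<infinity>" and P: "P = enn2real p" and Q: "Q = P / (P - 1)"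
  and C: "C > 0" "!!u. in_Lp (mu_nu nu) p u ==>
   Lp_norm (mu_nu nu) p (bochner_riesz_max nu delta u) <= ennreal C * Lp_norm (mu_nu nu) p (%x. ennreal \<bar>u x\<bar>)"
  and u: "u : borel_measurable (mu_nu nu)" "(nni (mu_nu nu) (%x. ennreal (\<bar>u x\<bar> powr P))) <= ennreal U" "U >= 0"
  and v: "integrable (mu_nu nu) v" "(nni (mu_nu nu) (%x. ennreal (\<bar>v x\<bar> powr Q))) <= ennreal V" "V >= 0"
  and tt: "tt > 0"
 shows "(bni (mu_nu nu) (%x. bochner_riesz nu delta (bz (Suc N)) u x * v x)) <= tt powr P * C powr P * U + tt powr (- Q) * V"
proof -
 let ?R = "bz (Suc N)"
 have R: "?R > 0" by (rule bz_pos)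
 have P1: "P > 1" using enn2real_gt_1[OF p] P by simp
 interpret fm: finite_measure "mu_nu nu" by (rule finite_measure_mu_nu[OF nu])
 have um[measurable]: "u : borel_measurable (mu_nu nu)" by (rule u(1))
 have vm[measurable]: "v : borel_measurable (mu_nu nu)" using v(1) by auto
 have eu: "(nni (mu_nu nu) (%x. epow (ennreal \<bar>u x\<bar>) P)) = (nni (mu_nu nu) (%x. ennreal (\<bar>u x\<bar> powr P)))"
  by (simp add: epow_ennreal)
 have uL: "in_Lp (mu_nu nu) p u"
 proof -
  have "(nni (mu_nu nu) (%x. ennreal (\<bar>u x\<bar> powr P))) < \<infinity>" using u(2) by (rule le_less_trans) simp
  hence "epow (nni (mu_nu nu) (%x. epow (ennreal \<bar>u x\<bar>) P)) (1/P) < \<infinity>" unfolding eu by (simp add: epow_def)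
  thus ?thesis using p P by (simp add: in_Lp_def Lp_norm_finite)
 qed
 have iu: "integrable (mu_nu nu) u" by (rule in_Lp_integrable[OF nu p(1) uL])
 have one: "integrable (mu_nu nu) (%x. 1::real)" by simp
 have Bm[measurable]: "bochner_riesz nu delta ?R u : borel_measurable (mu_nu nu)"
  using bilinear_form(1)[OF delta iu one, of N] by (auto dest: borel_measurable_integrable)
 let ?B = "bochner_riesz nu delta ?R u"
 have "epow (epow (nni (mu_nu nu) (%x. epow (bochner_riesz_max nu delta u x) P)) (1/P)) P
   <= epow (ennreal C * epow (nni (mu_nu nu) (%x. ennreal (\<bar>u x\<bar> powr P))) (1/P)) P"
  using C(2)[OF uL] p P P1 eu by (intro epow_mono) (auto simp: Lp_norm_finite)
 also have "... = ennreal (C powr P) * (nni (mu_nu nu) (%x. ennreal (\<bar>u x\<bar> powr P)))"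
  using C(1) P1 by (subst epow_cmult) (auto simp: epow_inverse)
 also have "... <= ennreal (C powr P) * ennreal U" by (intro mult_left_mono u(2)) simp
 finally have max_le: "(nni (mu_nu nu) (%x. epow (bochner_riesz_max nu delta u x) P)) <= ennreal (C powr P) * ennreal U"
  using P1 by (simp add: epow_inverse)
 have "(nni (mu_nu nu) (%x. ennreal (\<bar>?B x\<bar> powr P))) <= (nni (mu_nu nu) (%x. epow (bochner_riesz_max nu delta u x) P))"
 proof (rule nn_integral_mono)
  fix x
  have "ennreal \<bar>?B x\<bar> <= bochner_riesz_max nu delta u x"
   unfolding bochner_riesz_max_def using R by (intro SUP_upper2[of ?R]) auto
  hence "epow (ennreal \<bar>?B x\<bar>) P <= epow (bochner_riesz_max nu delta u x) P" using P1 by (intro epow_mono) auto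
  thus "ennreal (\<bar>?B x\<bar> powr P) <= epow (bochner_riesz_max nu delta u x) P" by (simp add: epow_ennreal)
 qed
 hence BP: "(nni (mu_nu nu) (%x. ennreal (\<bar>?B x\<bar> powr P))) <= ennreal (C powr P * U)"
  using max_le u(3) by (simp add: ennreal_mult order_trans)
 have "ennreal \<bar>\<integral>x. ?B x * v x \<partial>mu_nu nu\<bar> <= (nni (mu_nu nu) (%x. ennreal (norm (?B x * v x))))"
  using integral_norm_bound_ennreal[OF bilinear_form(1)[OF delta iu v(1), of N]] by simp
 also have "... <= (nni (mu_nu nu) (%x. ennreal (tt powr P) * ennreal (\<bar>?B x\<bar> powr P) + ennreal (tt powr (- Q)) * ennreal (\<bar>v x\<bar> powr Q)))"
 proof (rule nn_integral_mono)
  fix x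
  have "ennreal \<bar>?B x * v x\<bar> <= ennreal (tt powr P * \<bar>?B x\<bar> powr P + tt powr (- Q) * \<bar>v x\<bar> powr Q)"
   by (intro ennreal_leI weighted_Young[OF P1 tt Q])
  thus "ennreal (norm (?B x * v x)) <= ennreal (tt powr P) * ennreal (\<bar>?B x\<bar> powr P) + ennreal (tt powr (- Q)) * ennreal (\<bar>v x\<bar> powr Q)"
   by (simp add: ennreal_mult ennreal_plus)
 qed
 also have "... = ennreal (tt powr P) * (nni (mu_nu nu) (%x. ennreal (\<bar>?B x\<bar> powr P))) + ennreal (tt powr (- Q)) * (nni (mu_nu nu) (%x. ennreal (\<bar>v x\<bar> powr Q)))"
  by (rule nn_integral_linear) measurable
 also have "... <= ennreal (tt powr P) * ennreal (C powr P * U) + ennreal (tt powr (- Q)) * ennreal V"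
  by (intro add_mono mult_left_mono BP v(2)) auto
 also have "... = ennreal (tt powr P * (C powr P * U) + tt powr (- Q) * V)"
  using u(3) v(3) by (simp add: ennreal_mult ennreal_plus)
 finally have "\<bar>\<integral>x. ?B x * v x \<partial>mu_nu nu\<bar> <= tt powr P * (C powr P * U) + tt powr (- Q) * V"
  using u(3) v(3) by (subst (asm) ennreal_le_iff) auto
 thus ?thesis by (simp add: mult.assoc)
qed

lemma scaled_power_integral:
 assumes a0: "a > 0" and R: "R > 0" and p: "0 <= p" "q' < R" and ph: "continuous_on {p..q'} ph" and Q: "Q > 0"
 shows "(nni (mu_nu nu) (%x. ennreal (\<bar>ph (R * x) * indicator {p..q'} (R * x)\<bar> powr Q)))
  = ennreal (R powr (- (2*a + 1)) * integral {p..q'} (%x. x powr (2*a) * \<bar>ph x\<bar> powr Q))"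
proof -
 have c: "continuous_on {p..q'} (%x. \<bar>ph x\<bar> powr Q)"
  using Q by (intro continuous_on_powr' continuous_intros ph) auto
 have e: "\<bar>ph (R * x) * indicator {p..q'} (R * x)\<bar> powr Q = \<bar>ph (R * x)\<bar> powr Q * indicator {p..q'} (R * x)" for x
  using Q by (simp add: indicator_def)
 show ?thesis unfolding e mu_nu_scaled(2)[OF a0 R p c, symmetric]
  by (rule nn_integral_eq_integral[OF mu_nu_scaled(1)[OF a0 R p c]]) simp
qed

text \<open>The form pairs the long oscillating function g with the short bump h, and its kernel is
  symmetric. For p >= p1 the operator acts on g and for p <= p0 on h. In both cases the norm of g
  enters only through a power integral bounded by a multiple of ln X, whose coefficient is made
  smaller than in the lower bound.\<close>

theorem necessity:
 assumes delta: "delta > 0" and p: "1 < p" and a0: "a > 0" and da: "delta <= a"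
  and bd: "!!u. in_Lp (mu_nu nu) p u ==>
   Lp_norm (mu_nu nu) p (bochner_riesz_max nu delta u) <= ennreal C0*Lp_norm (mu_nu nu) p (%x. ennreal \<bar>u x\<bar>)"
  and out: "p <= p0_exp nu delta \<or> p1_exp nu delta <= p"
 shows False
proof -
 \<comment> \<open>The given constant may be negative, in which case \<open>ennreal\<close> turns it
   into 0; it is replaced by one that is at least 1.\<close>
 define C where "C = max C0 1"
 have C: "C > 0" "C >= 1" by (auto simp: C_def)
 have bd: "Lp_norm (mu_nu nu) p (bochner_riesz_max nu delta u) <= ennreal C * Lp_norm (mu_nu nu) p (%x. ennreal \<bar>u x\<bar>)"
  if "in_Lp (mu_nu nu) p u" for u
  by (rule order_trans[OF bd[OF that]]) (intro mult_right_mono ennreal_leI, auto simp: C_def)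
 define s where "s = 2*a + 1"
 have s: "s > 0" using a0 by (simp add: s_def)
 obtain CW where CW: "CW > 0" "!!x. x > 0 ==> \<bar>dual_source delta x\<bar> <= CW * x powr (delta - a)"
  using dual_source_bound[OF a0 delta] by metis
 obtain eps k0 k1 X0 where e: "0 < eps" "eps <= 1" "k0 > 0"
  and low: "!!X. X >= X0 ==> X >= 1 ==> integral {0..1} (%t. bil delta eps X (dual_source delta) t * t powr (2*a)) >= k0*ln X - k1"
  using form_lower_bound[OF a0 delta] by metis
 define kpp where "kpp = 1/(2*pi * (norm beta)\<^sup>2)"
 have kpp: "kpp > 0" using beta_nonzero by (simp add: kpp_def)
 define g where "g X R x = dual_source delta (R * x) * indicator {1..X} (R * x)" for X R x
 define h :: "real => real => real" where "h R x = 1*indicator {0..eps} (R * x)" for R x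
 define I where "I X N = (\<Sum>j<N. (1 - (bz (Suc j) / bz (Suc N))\<^sup>2) powr delta
   * coeff_a nu (Suc j) (g X (bz (Suc N))) * coeff_a nu (Suc j) (h (bz (Suc N))))" for X N
 have gc: "continuous_on {1..X} (dual_source delta)" for X by (rule continuous_dual_source[OF a0 delta]) simp
 text \<open>Any bound for the bilinear form that grows more slowly than the logarithm is contradictory.\<close>
 have contra: False
  if UB: "!!X N. X >= 1 ==> bz (Suc N) > max X eps ==> bz (Suc N) powr s * I X N <= D + kpp * k0/2*ln X" for D
 proof (rule ln_not_bounded[of "kpp * k0/2" X0 "D + kpp * k1"])
  show "kpp * k0/2 > 0" using kpp e by simp
  fix X :: real assume X: "X >= X0" "X >= 1"
  have lim: "(%N. bz (Suc N) powr s * I X N) \<longlonglongrightarrow> kpp * integral {0..1} (%t. bil delta eps X (dual_source delta) t * t powr (2*a))"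
   unfolding I_def g_def[abs_def] h_def[abs_def] s_def kpp_def by (rule bilinear_tendsto[OF a0 delta gc])
  have "\<forall>\<^sub>F N in sequentially. bz (Suc N) > max X eps"
   using bz_at_top unfolding filterlim_at_top_dense by blast
  hence "\<forall>\<^sub>F N in sequentially. bz (Suc N) powr s * I X N <= D + kpp * k0/2*ln X"
   by eventually_elim (rule UB[OF X(2)])
  hence "kpp * integral {0..1} (%t. bil delta eps X (dual_source delta) t * t powr (2*a)) <= D + kpp * k0/2*ln X"
   by (rule tendsto_upperbound[OF lim]) simp
  moreover have "kpp * (k0*ln X - k1) <= kpp * integral {0..1} (%t. bil delta eps X (dual_source delta) t * t powr (2*a))"
   using kpp low[OF X] by (intro mult_left_mono) auto
  moreover have "kpp * (k0*ln X - k1) = kpp * k0/2*ln X + kpp * k0/2*ln X - kpp * k1" by (simp add: algebra_simps)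
  ultimately show "kpp * k0/2*ln X <= D + kpp * k1" by linarith
 qed
 have gi: "integrable (mu_nu nu) (g X R)" if "R > 0" "X < R" for X R
  unfolding g_def[abs_def] by (rule mu_nu_scaled(1)[OF a0 that(1) _ that(2) gc]) simp
 have hi: "integrable (mu_nu nu) (h R)" if "R > 0" "eps < R" for R
  unfolding h_def[abs_def] by (rule mu_nu_scaled(1)[OF a0 that(1) order_refl that(2) continuous_on_const])
 have Igh: "(bni (mu_nu nu) (%x. bochner_riesz nu delta (bz (Suc N)) (g X (bz (Suc N))) x * h (bz (Suc N)) x)) = I X N"
  and Ihg: "(bni (mu_nu nu) (%x. bochner_riesz nu delta (bz (Suc N)) (h (bz (Suc N))) x * g X (bz (Suc N)) x)) = I X N"
  if "bz (Suc N) > max X eps" for X N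
 proof -
  have i: "integrable (mu_nu nu) (g X (bz (Suc N)))" "integrable (mu_nu nu) (h (bz (Suc N)))"
   using that bz_pos[of N] by (auto intro!: gi hi)
  show "(bni (mu_nu nu) (%x. bochner_riesz nu delta (bz (Suc N)) (g X (bz (Suc N))) x * h (bz (Suc N)) x)) = I X N"
   unfolding I_def by (rule bilinear_form(2)[OF delta i])
  show "(bni (mu_nu nu) (%x. bochner_riesz nu delta (bz (Suc N)) (h (bz (Suc N))) x * g X (bz (Suc N)) x)) = I X N"
   unfolding I_def bilinear_form(2)[OF delta i(2) i(1)] by (intro sum.cong refl) (simp only: mult_ac)
 qed
 have e1: "integral {0..eps} (%x. x powr (2*a)) <= 1"
 proof -
  have "integral {0..eps} (%x. x powr (2*a)) <= integral {0..eps} (%x. 1)"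
   using a0 e by (intro integral_le integrable_continuous_real continuous_on_powr' continuous_intros) (auto intro!: powr_le1)
  thus ?thesis using e by simp
 qed
 have hQ: "(nni (mu_nu nu) (%x. ennreal (\<bar>h R x\<bar> powr Q))) <= ennreal (R powr (- s))" if "R > 0" "eps < R" "Q > 0" for R Q
 proof -
  have "(nni (mu_nu nu) (%x. ennreal (\<bar>h R x\<bar> powr Q))) = ennreal (R powr (- s) * integral {0..eps} (%x. x powr (2*a) * \<bar>1\<bar> powr Q))"
   unfolding h_def s_def by (rule scaled_power_integral[OF a0 that(1) order_refl that(2) continuous_on_const that(3)])
  also have "... <= ennreal (R powr (- s) * 1)" using e1 by (intro ennreal_leI mult_left_mono) auto
  finally show ?thesis by simp
 qed
 \<comment> \<open>The condition s <= (a - delta) Q says precisely that x^{2a} times the Q-th power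
   of x^{delta-a} is at most 1/x for x >= 1.\<close>
 have gQ: "(nni (mu_nu nu) (%x. ennreal (\<bar>g X R x\<bar> powr Q))) <= ennreal (R powr (- s) * (CW powr Q * ln X))"
  if R: "R > 0" "X < R" and Q: "Q > 0" "s <= (a - delta) * Q" and X: "X >= 1" for X R Q
 proof -
  have "integral {1..X} (%x. x powr (2*a) * \<bar>dual_source delta x\<bar> powr Q) <= CW powr Q * ln X"
  proof (rule has_integral_le)
   have c: "continuous_on {1..X} (%x. x powr (2*a) * \<bar>dual_source delta x\<bar> powr Q)"
    using Q a0 by (intro continuous_on_mult continuous_on_powr' continuous_intros gc) auto
   show "((%x. x powr (2*a) * \<bar>dual_source delta x\<bar> powr Q) has_integral integral {1..X} (%x. x powr (2*a) * \<bar>dual_source delta x\<bar> powr Q)) {1..X}"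
    by (intro integrable_integral integrable_continuous_real c)
   have "((%x. 1/x) has_integral (ln X - ln 1)) {1..X}"
    by (intro fundamental_theorem_of_calculus)
     (use X in "auto intro!: derivative_eq_intros simp: has_real_derivative_iff_has_vector_derivative[symmetric]")
   hence "((%x. 1/x) has_integral ln X) {1..X}" by simp
   thus "((%x. CW powr Q * (1/x)) has_integral (CW powr Q * ln X)) {1..X}" by (rule has_integral_mult_right)
   fix x assume "x : {1..X}"
   hence x: "x >= 1" "x > 0" by auto
   have "\<bar>dual_source delta x\<bar> powr Q <= (CW * x powr (delta - a)) powr Q" using CW(2)[OF x(2)] Q by (intro powr_mono2) auto
   also have "... = CW powr Q * x powr ((delta - a) * Q)" by (simp add: powr_mult powr_powr)
   finally have "x powr (2*a) * \<bar>dual_source delta x\<bar> powr Q <= x powr (2*a) * (CW powr Q * x powr ((delta - a) * Q))"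
    by (rule mult_left_mono) simp
   also have "... = CW powr Q * (x powr (2*a) * x powr ((delta - a) * Q))" by simp
   also have "x powr (2*a) * x powr ((delta - a) * Q) = x powr (2*a + (delta - a) * Q)" by (rule powr_add[symmetric])
   also have "CW powr Q * x powr (2*a + (delta - a) * Q) <= CW powr Q * x powr (- 1)"
   proof (intro mult_left_mono powr_mono)
    have "(delta - a) * Q = - ((a - delta) * Q)" by (simp add: algebra_simps)
    thus "2*a + (delta - a) * Q <= - 1" using Q(2) by (simp add: s_def)
   qed (use x in auto)
   also have "x powr (- 1) = 1/x" using x by (simp add: powr_minus_divide)
   finally show "x powr (2*a) * \<bar>dual_source delta x\<bar> powr Q <= CW powr Q * (1/x)" .
  qed
  hence "R powr (- s) * integral {1..X} (%x. x powr (2*a) * \<bar>dual_source delta x\<bar> powr Q) <= R powr (- s) * (CW powr Q * ln X)"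
   by (rule mult_left_mono) simp
  moreover have "(nni (mu_nu nu) (%x. ennreal (\<bar>g X R x\<bar> powr Q))) = ennreal (R powr (- s) * integral {1..X} (%x. x powr (2*a) * \<bar>dual_source delta x\<bar> powr Q))"
   unfolding g_def s_def by (rule scaled_power_integral[OF a0 R(1) _ R(2) gc Q(1)]) simp
  ultimately show ?thesis by (simp add: ennreal_leI)
 qed
 have Rs: "R powr s * R powr (- s) = 1" if "R > 0" for R using that by (simp add: powr_add[symmetric])
 show False
 proof (cases "p = \<infinity>")
  case True
  \<comment> \<open>The added 1 gives the strict inequality needed to pass from the supremum norm to
    an almost everywhere bound. For p = infinity, g is bounded because delta <= a.\<close>
  define t where "t = C * CW + 1"
  have t: "t > 0" using C CW by (simp add: t_def add_pos_pos)
  show False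
  proof (rule contra[of t])
   fix X N assume X: "X >= 1" and N: "bz (Suc N) > max X eps"
   let ?R = "bz (Suc N)"
   have R: "?R > 0" "X < ?R" "eps < ?R" using N bz_pos[of N] by auto
   have gb: "\<bar>g X ?R x\<bar> <= CW" for x
   proof (cases "?R * x : {1..X}")
    case True
    have "\<bar>dual_source delta (?R * x)\<bar> <= CW * (?R * x) powr (delta - a)" using True by (intro CW(2)) auto
    also have "... <= CW * (?R * x) powr 0" using True da CW(1) by (intro mult_left_mono powr_mono) auto
    also have "... = CW" by (subst powr_zero_eq_one) (use True in auto)
    finally show ?thesis using True by (simp add: g_def)
   qed (use CW in "simp add: g_def")
   have gm: "g X ?R : borel_measurable (mu_nu nu)" using gi[OF R(1,2)] by auto
   have gn: "Lp_norm (mu_nu nu) \<infinity> (%x. ennreal \<bar>g X ?R x\<bar>) <= ennreal CW"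
    by (rule Lp_norm_infinity_le) (use gb in "auto intro: ennreal_leI")
   hence "in_Lp (mu_nu nu) \<infinity> (g X ?R)" using gm by (simp add: in_Lp_def le_less_trans)
   hence "Lp_norm (mu_nu nu) \<infinity> (bochner_riesz_max nu delta (g X ?R)) <= ennreal C * Lp_norm (mu_nu nu) \<infinity> (%x. ennreal \<bar>g X ?R x\<bar>)"
    using bd True by simp
   also have "... <= ennreal C * ennreal CW" by (intro mult_left_mono gn) simp
   also have "... < ennreal t" using C CW by (simp add: t_def ennreal_mult[symmetric] ennreal_less_iff)
   finally have "AE x in mu_nu nu. bochner_riesz_max nu delta (g X ?R) x <= ennreal t" by (rule Lp_norm_infinity_AE)
   hence AE: "AE x in mu_nu nu. bochner_riesz nu delta ?R (g X ?R) x * h ?R x <= t * h ?R x"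
   proof eventually_elim
    case (elim x)
    have "ennreal \<bar>bochner_riesz nu delta ?R (g X ?R) x\<bar> <= bochner_riesz_max nu delta (g X ?R) x"
     unfolding bochner_riesz_max_def using R by (intro SUP_upper2[of ?R]) auto
    hence "ennreal \<bar>bochner_riesz nu delta ?R (g X ?R) x\<bar> <= ennreal t" using elim by (rule order_trans)
    hence "bochner_riesz nu delta ?R (g X ?R) x <= t" using t by simp
    thus ?case by (intro mult_right_mono) (auto simp: h_def)
   qed
   have "I X N <= (bni (mu_nu nu) (%x. t * h ?R x))"
    unfolding Igh[OF N, symmetric]
    by (rule integral_mono_AE[OF bilinear_form(1)[OF delta gi[OF R(1,2)] hi[OF R(1,3)]] _ AE]) (intro integrable_mult_right hi R)
   also have "... = t * (bni (mu_nu nu) (%x. h ?R x))" by simp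
   also have "(bni (mu_nu nu) (%x. h ?R x)) = ?R powr (- s) * integral {0..eps} (%x. x powr (2*a) * 1)"
    unfolding h_def s_def by (rule mu_nu_scaled(2)[OF a0 R(1) order_refl R(3) continuous_on_const])
   also have "t * (?R powr (- s) * integral {0..eps} (%x. x powr (2*a) * 1)) <= t * (?R powr (- s) * 1)"
    using e1 t by (intro mult_left_mono) auto
   finally have "?R powr s * I X N <= ?R powr s * (t * (?R powr (- s) * 1))" by (rule mult_left_mono) simp
   also have "... = t * (?R powr s * ?R powr (- s))" by simp
   finally have "?R powr s * I X N <= t" using Rs[OF R(1)] by simp
   moreover have "0 <= kpp * k0/2*ln X" using kpp e X by simp
   ultimately show "?R powr s * I X N <= t + kpp * k0/2*ln X" by linarith
  qed
 next
  case False
  define P where "P = enn2real p"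
  define Q where "Q = P / (P - 1)"
  have P: "P > 1" "p = ennreal P" using enn2real_gt_1[OF p False] False by (auto simp: P_def less_top)
  have Q: "Q > 0" using P by (simp add: Q_def)
  note pair = finite_pairing[OF delta p False P_def Q_def C(1) bd]
  define y where "y = kpp * k0/2"
  have y: "y > 0" using kpp e by (simp add: y_def)
  from out show False
  proof
   assume "p <= p0_exp nu delta"
   hence "P <= 4*(nu + 1) / (2*nu + 3 + 2*delta)" using P delta a0 by (simp add: p0_exp_def)
   also have "4*(nu + 1) / (2*nu + 3 + 2*delta) = (2 * s) / (2*(a + delta + 1))"
    by (simp add: s_def algebra_simps)
   finally have le: "P <= (2 * s) / (2*(a + delta + 1))" .
   have "P * B <= s" if "P <= (2 * s) / (2*B)" "B > 0" for B using that by (simp add: pos_le_divide_eq)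
   from this[OF le] have "P * (a + delta + 1) <= s" using a0 delta by simp
   \<comment> \<open>This identity turns P <= p0 into s <= (a - delta) Q for the conjugate exponent
     Q: the endpoint p0 is dual to p1.\<close>
   moreover have "(a - delta) * P - s * (P - 1) = s - P * (a + delta + 1)" by (simp add: s_def algebra_simps)
   ultimately have "s * (P - 1) <= (a - delta) * P" by linarith
   hence "s <= (a - delta) * P / (P - 1)" using P(1) by (simp add: pos_le_divide_eq)
   hence cond: "s <= (a - delta) * Q" by (simp add: Q_def)
   \<comment> \<open>Makes the coefficient of ln X equal to y, half of the coefficient in the lower
     bound; the other term becomes a constant.\<close>
   define tt where "tt = CW / y powr (1/Q)"
   have tt: "tt > 0" using CW y by (simp add: tt_def)
   have ttQ: "tt powr (- Q) * CW powr Q = y"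
    using CW(1) y Q by (simp add: tt_def powr_divide powr_minus_divide powr_powr)
   show False
   proof (rule contra[of "tt powr P * C powr P"])
    fix X N assume X: "X >= 1" and N: "bz (Suc N) > max X eps"
    let ?R = "bz (Suc N)"
    have R: "?R > 0" "X < ?R" "eps < ?R" using N bz_pos[of N] by auto
    have V0: "0 <= ?R powr (- s) * (CW powr Q * ln X)" using X by simp
    have "I X N <= tt powr P * C powr P * ?R powr (- s) + tt powr (- Q) * (?R powr (- s) * (CW powr Q * ln X))"
     unfolding Ihg[OF N, symmetric]
     by (rule pair[OF _ borel_measurable_integrable[OF hi[OF R(1,3)]] hQ[OF R(1,3)] _ gi[OF R(1,2)] gQ[OF R(1,2) Q cond X] V0 tt]) (use P in auto)
    hence "?R powr s * I X N <= ?R powr s * (tt powr P * C powr P * ?R powr (- s) + tt powr (- Q) * (?R powr (- s) * (CW powr Q * ln X)))"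
     by (rule mult_left_mono) simp
    also have "... = (?R powr s * ?R powr (- s)) * (tt powr P * C powr P + (tt powr (- Q) * CW powr Q) * ln X)"
     by (simp add: algebra_simps)
    finally show "?R powr s * I X N <= tt powr P * C powr P + kpp * k0/2*ln X"
     unfolding ttQ Rs[OF R(1)] y_def by simp
   qed
  next
   assume p1: "p1_exp nu delta <= p"
   have "a - delta ~= 0" using p1 False by (auto simp: p1_exp_def top_unique)
   hence d: "a - delta > 0" using da by simp
   hence "p1_exp nu delta = ennreal ((2 * s) / (2*(a - delta)))" by (simp add: p1_exp_def s_def algebra_simps)
   hence "ennreal ((2 * s) / (2*(a - delta))) <= ennreal P" using p1 P(2) by (simp only:)
   hence le: "(2 * s) / (2*(a - delta)) <= P" using P(1) by (subst (asm) ennreal_le_iff) auto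
   have "s <= B * P" if "(2 * s) / (2*B) <= P" "B > 0" for B using that by (simp add: pos_divide_le_eq mult.commute)
   from this[OF le d] have cond: "s <= (a - delta) * P" .
   \<comment> \<open>As in the dual case, but now the oscillating function is the argument of the
     operator, so the constant C enters the coefficient to be normalized to y.\<close>
   define tt where "tt = y powr (1/P) / (C * CW)"
   have tt: "tt > 0" using CW C y by (simp add: tt_def)
   have ttP: "tt powr P * C powr P * CW powr P = y"
   proof -
    have "tt powr P * C powr P * CW powr P = (tt * (C * CW)) powr P" by (simp add: powr_mult)
    also have "tt * (C * CW) = y powr (1/P)" using C CW by (simp add: tt_def)
    finally show ?thesis using y P by (simp add: powr_powr)
   qed
   show False
   proof (rule contra[of "tt powr (- Q)"])
    fix X N assume X: "X >= 1" and N: "bz (Suc N) > max X eps"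
    let ?R = "bz (Suc N)"
    have R: "?R > 0" "X < ?R" "eps < ?R" using N bz_pos[of N] by auto
    have P0: "P > 0" using P by simp
    have U0: "0 <= ?R powr (- s) * (CW powr P * ln X)" using X by simp
    have "I X N <= tt powr P * C powr P * (?R powr (- s) * (CW powr P * ln X)) + tt powr (- Q) * ?R powr (- s)"
     unfolding Igh[OF N, symmetric]
     by (rule pair[OF _ borel_measurable_integrable[OF gi[OF R(1,2)]] gQ[OF R(1,2) P0 cond X] U0 hi[OF R(1,3)] hQ[OF R(1,3) Q] _ tt]) auto
    hence "?R powr s * I X N <= ?R powr s * (tt powr P * C powr P * (?R powr (- s) * (CW powr P * ln X)) + tt powr (- Q) * ?R powr (- s))"
     by (rule mult_left_mono) simp
    also have "... = (?R powr s * ?R powr (- s)) * (tt powr (- Q) + (tt powr P * C powr P * CW powr P) * ln X)"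
     by (simp add: algebra_simps)
    finally show "?R powr s * I X N <= tt powr (- Q) + kpp * k0/2*ln X"
     unfolding ttP Rs[OF R(1)] y_def by simp
   qed
  qed
 qed
qed

end

theorem theorem2:
  fixes nu delta :: real and p :: ennreal
  assumes "nu > -1" and "delta > 0" and "1 < p"
  shows "(\<exists>C::real. \<forall>f. in_Lp (mu_nu nu) p f \<longrightarrow>
            Lp_norm (mu_nu nu) p (bochner_riesz_max nu delta f)
              \<le> ennreal C * Lp_norm (mu_nu nu) p (\<lambda>x. ennreal \<bar>f x\<bar>))
         \<longleftrightarrow> ((nu \<le> -1/2 \<or> delta > nu + 1/2)
              \<or> (delta \<le> nu + 1/2 \<and> nu > -1/2 \<and> p0_exp nu delta < p \<and> p < p1_exp nu delta))"
proof -
  obtain f f' K where "bessel_jost nu f f' K" using bessel_jost_exists[OF assms(1)] by metis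
  then interpret bessel_jost nu f f' K .
  show ?thesis (is "?B \<longleftrightarrow> ?C")
  proof
    assume ?B
    then obtain C where C: "\<And>u. in_Lp (mu_nu nu) p u \<Longrightarrow>
      Lp_norm (mu_nu nu) p (bochner_riesz_max nu delta u) \<le> ennreal C * Lp_norm (mu_nu nu) p (\<lambda>x. ennreal \<bar>u x\<bar>)" by blast
    show ?C
    proof (rule ccontr)
      assume n: "\<not> ?C"
      hence "nu + 1/2 > 0" "delta \<le> nu + 1/2" "p \<le> p0_exp nu delta \<or> p1_exp nu delta \<le> p" by (auto simp: not_less)
      thus False using necessity[OF assms(2,3) _ _ C] by blast
    qed
  next
    assume ?C
    thus ?B by (rule sufficiency[OF assms(2,3)])
  qed
qed

end
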